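(* Let $1\le p,q\le\infty$ and $s>1$. If $f,g\in\mathcal{GM}^{2p,q}_{s}(\mathbb{R}^n)$, then $f\cdot g\in\mathcal{GM}^{p,q}_{s}(\mathbb{R}^n)$ and $$\|fg\|_{\mathcal{GM}^{p,q}_{s}(\mathbb{R}^n)}\le C\,\|f\|_{\mathcal{GM}^{2p,q}_{s}(\mathbb{R}^n)}\,\|g\|_{\mathcal{GM}^{2p,q}_{s}(\mathbb{R}^n)}$$ with a constant $C>0$ which depends only on the choice of the frequency-uniform decomposition, the dimension $n$ and the parameters $s,p,q$ (in particular not on $f,g$). In particular, the Gevrey-modulation space $\mathcal{GM}^{p,q}_{s}(\mathbb{R}^n)$ is an algebra under multiplication.
   Context: Fourier transform: $\mathcal{F}f(\xi)=\hat f(\xi)=(2\pi)^{-n/2}\int_{\mathbb{R}^n}f(x)e^{-ix\cdot\xi}\,dx$, extended to distributions by duality. Gelfand-Shilov spaces: $\mathcal{S}_{s,h}(\mathbb{R}^n)$ is the Banach space of $f\in C^\infty(\mathbb{R}^n)$ with $\|f\|_{\mathcal{S}_{s,h}}=\sup_{x,\alpha,\beta}\frac{|x^\alpha\partial^\beta f(x)|}{h^{|\alpha|+|\beta|}(\alpha!\beta!)^s}<\infty$; $\mathcal{S}_s=\bigcup_{h>0}\mathcal{S}_{s,h}$ (inductive limit) and $\mathcal{S}_s'=\bigcap_{h>0}\mathcal{S}_{s,h}'$ (projective limit). Frequency-uniform decomposition: fix $\rho\in\mathcal{S}_s(\mathbb{R}^n)$, $\rho:\mathbb{R}^n\to[0,1]$,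 supported in $[-1,1]^n$, with $\rho(\xi)=1$ for $|\xi|\le\frac12$ and $\sum_{l\in\mathbb{Z}^n}\rho(\xi-l)>0$ for all $\xi$. Put $\sigma_k(\xi)=\rho(\xi-k)\big(\sum_{l\in\mathbb{Z}^n}\rho(\xi-l)\big)^{-1}$ and $\Box_k f=\mathcal{F}^{-1}(\sigma_k\mathcal{F}f)$ for $k\in\mathbb{Z}^n$. Gevrey-modulation space: for $s>1$, $1\le p,q\le\infty$, $\mathcal{GM}^{p,q}_s(\mathbb{R}^n)$ is the set of all $f\in\mathcal{S}_s'(\mathbb{R}^n)$ with $$\|f\|_{\mathcal{GM}^{p,q}_s(\mathbb{R}^n)}=\Big(\sum_{k\in\mathbb{Z}^n}e^{q|k|^{1/s}}\|\Box_kf\|_{L^p}^q\Big)^{1/q}<\infty,$$ with the obvious (supremum) modification if $q=\infty$. Convention: $2p=\infty$ if $p=\infty$. Elements of these spaces are bounded functions, and $f\cdot g$ is the pointwise product. *)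

theory Defs
  imports "HOL-Analysis.Analysis" "HOL-Probability.Essential_Supremum"
begin

section \<open>Partial derivatives with respect to multi-indices\<close>

definition pdiff :: "'n::finite \<Rightarrow> (real^'n \<Rightarrow> complex) \<Rightarrow> (real^'n \<Rightarrow> complex)" where
  "pdiff i f = (\<lambda>x. frechet_derivative f (at x) (axis i 1))"

definition iter_pdiff :: "'n::finite list \<Rightarrow> (real^'n \<Rightarrow> complex) \<Rightarrow> (real^'n \<Rightarrow> complex)" where
  "iter_pdiff is f = foldr pdiff is f"

text \<open>\<open>f \<in> C\<^sup>\<infinity>\<close>: all iterated partial derivatives, taken in any order, exist and are
  differentiable (hence continuous).\<close>

definition smooth_fun :: "(real^'n::finite \<Rightarrow> complex) \<Rightarrow> bool" where
  "smooth_fun f \<longleftrightarrow> (\<forall>is x. iter_pdiff is f differentiable (at x))"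

text \<open>The index type carries no order, so \<open>\<partial>\<^sup>\<beta>\<close> is computed along an arbitrary fixed
  enumeration of the coordinates. For smooth functions the order is immaterial.\<close>

definition coord_list :: "'n::finite list" where
  "coord_list = (SOME is. distinct is \<and> set is = UNIV)"

definition mderiv :: "('n::finite \<Rightarrow> nat) \<Rightarrow> (real^'n \<Rightarrow> complex) \<Rightarrow> (real^'n \<Rightarrow> complex)" where
  "mderiv \<beta> f = iter_pdiff (concat (map (\<lambda>i. replicate (\<beta> i) i) coord_list)) f"

definition mi_abs :: "('n::finite \<Rightarrow> nat) \<Rightarrow> nat" where
  "mi_abs \<alpha> = (\<Sum>i\<in>UNIV. \<alpha> i)"

definition mi_fact :: "('n::finite \<Rightarrow> nat) \<Rightarrow> real" where
  "mi_fact \<alpha> = (\<Prod>i\<in>UNIV. fact (\<alpha> i))"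

definition mi_power :: "real^'n::finite \<Rightarrow> ('n \<Rightarrow> nat) \<Rightarrow> real" where
  "mi_power x \<alpha> = (\<Prod>i\<in>UNIV. (x $ i) ^ \<alpha> i)"

section \<open>Gelfand--Shilov spaces and their duals\<close>

definition gs_norm :: "real \<Rightarrow> real \<Rightarrow> (real^'n::finite \<Rightarrow> complex) \<Rightarrow> ennreal" where
  "gs_norm s h f = (SUP (x, \<alpha>, \<beta>) \<in> UNIV.
     ennreal (norm (mi_power x \<alpha> * mderiv \<beta> f x)
              / (h ^ (mi_abs \<alpha> + mi_abs \<beta>) * (mi_fact \<alpha> * mi_fact \<beta>) powr s)))"

definition gs_space_h :: "real \<Rightarrow> real \<Rightarrow> (real^'n::finite \<Rightarrow> complex) set" where
  "gs_space_h s h = {f. smooth_fun f \<and> gs_norm s h f < \<infinity>}"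

definition gs_space :: "real \<Rightarrow> (real^'n::finite \<Rightarrow> complex) set" where
  "gs_space s = (\<Union>h\<in>{0<..}. gs_space_h s h)"

text \<open>Functionals are total HOL functions on all functions; only their values on
  \<^term>\<open>gs_space s\<close> are meaningful, and every notion below depends on these values only.\<close>

type_synonym 'n functional = "(real^'n \<Rightarrow> complex) \<Rightarrow> complex"

definition gs_dual_h :: "real \<Rightarrow> real \<Rightarrow> 'n::finite functional set" where
  "gs_dual_h s h = {u.
     (\<forall>\<phi>\<in>gs_space_h s h. \<forall>\<psi>\<in>gs_space_h s h. u (\<lambda>x. \<phi> x + \<psi> x) = u \<phi> + u \<psi>) \<and>
     (\<forall>c. \<forall>\<phi>\<in>gs_space_h s h. u (\<lambda>x. c * \<phi> x) = c * u \<phi>) \<and>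
     (\<exists>C::real. \<forall>\<phi>\<in>gs_space_h s h. ennreal (norm (u \<phi>)) \<le> ennreal C * gs_norm s h \<phi>)}"

definition gs_dual :: "real \<Rightarrow> 'n::finite functional set" where
  "gs_dual s = (\<Inter>h\<in>{0<..}. gs_dual_h s h)"

section \<open>Fourier transform\<close>

definition fourier :: "(real^'n::finite \<Rightarrow> complex) \<Rightarrow> (real^'n \<Rightarrow> complex)" where
  "fourier f = (\<lambda>\<xi>. complex_of_real ((2 * pi) powr (- real CARD('n) / 2)) *
     (\<integral>x. f x * exp (- \<i> * complex_of_real (x \<bullet> \<xi>)) \<partial>lborel))"

definition inv_fourier :: "(real^'n::finite \<Rightarrow> complex) \<Rightarrow> (real^'n \<Rightarrow> complex)" where
  "inv_fourier f = (\<lambda>x. complex_of_real ((2 * pi) powr (- real CARD('n) / 2)) *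
     (\<integral>\<xi>. f \<xi> * exp (\<i> * complex_of_real (x \<bullet> \<xi>)) \<partial>lborel))"

definition dual_fourier :: "'n::finite functional \<Rightarrow> 'n functional" where
  "dual_fourier u = (\<lambda>\<phi>. u (fourier \<phi>))"

definition dual_inv_fourier :: "'n::finite functional \<Rightarrow> 'n functional" where
  "dual_inv_fourier u = (\<lambda>\<phi>. u (inv_fourier \<phi>))"

definition dual_times :: "(real^'n::finite \<Rightarrow> complex) \<Rightarrow> 'n functional \<Rightarrow> 'n functional" where
  "dual_times m u = (\<lambda>\<phi>. u (\<lambda>x. m x * \<phi> x))"

section \<open>Frequency-uniform decomposition\<close>

definition lattice_point :: "int^'n::finite \<Rightarrow> real^'n" where
  "lattice_point k = (\<chi> i. real_of_int (k $ i))"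

definition freq_uniform :: "real \<Rightarrow> (real^'n::finite \<Rightarrow> real) \<Rightarrow> bool" where
  "freq_uniform s \<rho> \<longleftrightarrow>
     (\<lambda>\<xi>. complex_of_real (\<rho> \<xi>)) \<in> gs_space s \<and>
     (\<forall>\<xi>. 0 \<le> \<rho> \<xi> \<and> \<rho> \<xi> \<le> 1) \<and>
     closure {\<xi>. \<rho> \<xi> \<noteq> 0} \<subseteq> {\<xi>. \<forall>i. -1 \<le> \<xi> $ i \<and> \<xi> $ i \<le> 1} \<and>
     (\<forall>\<xi>. norm \<xi> \<le> 1 / 2 \<longrightarrow> \<rho> \<xi> = 1) \<and>
     (\<forall>\<xi>. (\<Sum>\<^sub>\<infinity>l. \<rho> (\<xi> - lattice_point l)) > 0)"

definition sigma_fun :: "(real^'n::finite \<Rightarrow> real) \<Rightarrow> int^'n \<Rightarrow> real^'n \<Rightarrow> complex" where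
  "sigma_fun \<rho> k = (\<lambda>\<xi>. complex_of_real
     (\<rho> (\<xi> - lattice_point k) * inverse (\<Sum>\<^sub>\<infinity>l. \<rho> (\<xi> - lattice_point l))))"

definition freq_box :: "(real^'n::finite \<Rightarrow> real) \<Rightarrow> int^'n \<Rightarrow> 'n functional \<Rightarrow> 'n functional" where
  "freq_box \<rho> k u = dual_inv_fourier (dual_times (sigma_fun \<rho> k) (dual_fourier u))"

section \<open>Regular functionals and Lebesgue norms\<close>

definition regular_functional :: "(real^'n::finite \<Rightarrow> complex) \<Rightarrow> 'n functional" where
  "regular_functional F = (\<lambda>\<phi>. \<integral>x. F x * \<phi> x \<partial>lborel)"

definition represents ::
    "real \<Rightarrow> (real^'n::finite \<Rightarrow> complex) \<Rightarrow> 'n functional \<Rightarrow> bool" where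
  "represents s F u \<longleftrightarrow> F \<in> borel_measurable lborel \<and>
     (\<forall>\<phi>\<in>gs_space s. integrable lborel (\<lambda>x. F x * \<phi> x) \<and> u \<phi> = regular_functional F \<phi>)"

definition ennreal_powr :: "ennreal \<Rightarrow> real \<Rightarrow> ennreal" where
  "ennreal_powr x a = (if x = \<infinity> then \<infinity> else ennreal (enn2real x powr a))"

definition fun_Lp_norm :: "ennreal \<Rightarrow> (real^'n::finite \<Rightarrow> complex) \<Rightarrow> ennreal" where
  "fun_Lp_norm p F =
     (if p = \<infinity> then esssup lborel (\<lambda>x. ennreal (norm (F x)))
      else ennreal_powr (\<integral>\<^sup>+x. ennreal (norm (F x) powr enn2real p) \<partial>lborel) (1 / enn2real p))"

text \<open>The representing function is unique almost everywhere, so the infimum just selects its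
  norm; it is \<open>\<infinity>\<close> (infimum of the empty set) for a functional that is not a function.\<close>

definition Lp_norm :: "real \<Rightarrow> ennreal \<Rightarrow> 'n::finite functional \<Rightarrow> ennreal" where
  "Lp_norm s p u = (INF F \<in> {F. represents s F u}. fun_Lp_norm p F)"

section \<open>Gevrey-modulation spaces\<close>

definition gm_norm ::
    "(real^'n::finite \<Rightarrow> real) \<Rightarrow> real \<Rightarrow> ennreal \<Rightarrow> ennreal \<Rightarrow> 'n functional \<Rightarrow> ennreal" where
  "gm_norm \<rho> s p q u =
     (if q = \<infinity> then
        (SUP k. ennreal (exp (norm (lattice_point k) powr (1 / s))) * Lp_norm s p (freq_box \<rho> k u))
      else
        ennreal_powr
          (\<Sum>\<^sub>\<infinity>k. ennreal (exp (enn2real q * norm (lattice_point k) powr (1 / s)))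
                  * ennreal_powr (Lp_norm s p (freq_box \<rho> k u)) (enn2real q))
          (1 / enn2real q))"

definition gm_space ::
    "(real^'n::finite \<Rightarrow> real) \<Rightarrow> real \<Rightarrow> ennreal \<Rightarrow> ennreal \<Rightarrow> 'n functional set" where
  "gm_space \<rho> s p q = {u \<in> gs_dual s. gm_norm \<rho> s p q u < \<infinity>}"

text \<open>Multiplication is pointwise multiplication of the bounded functions representing the two
  functionals; these are unique almost everywhere, so the choice does not affect the result.\<close>

definition density_fun :: "real \<Rightarrow> 'n::finite functional \<Rightarrow> (real^'n \<Rightarrow> complex)" where
  "density_fun s u = (SOME F. bounded (range F) \<and> represents s F u)"

definition pointwise_prod ::
    "real \<Rightarrow> 'n::finite functional \<Rightarrow> 'n functional \<Rightarrow> 'n functional" where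
  "pointwise_prod s u v = regular_functional (\<lambda>x. density_fun s u x * density_fun s v x)"

end

(* The product is analysed through the frequency pieces F_l representing Box_l f. Each F_l equals its
   convolution with a kernel whose Fourier transform is 1 on the support of sigma_l, which gives both the
   Bernstein bound |F_l| <= C ||F_l||_r and, by continuity of f on the Gelfand-Shilov space, the absolutely
   convergent expansion f = sum F_l. In Box_k (f g) = sum_{l,m} Box_k (F_l G_m) only the terms with
   |k - l - m| <= 3 in every coordinate survive, so Young's and the Cauchy-Schwarz inequality bound the L^p
   norm by a discrete convolution. It is closed in the weighted l^q norm by the gain
   |l + m|^a <= |l|^a + |m|^a - (1 - a) min(|l|, |m|)^a for a = 1/s < 1, which turns one of the two
   sequences into a summable one.

   Derivatives are indexed by lists of directions instead of multi-indices. No symmetry of mixed derivatives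
   is needed: the Fourier transform only uses bounds on pure derivatives and yields bounds on all
   of them, so inversion upgrades the former to the latter. *)

theory Submission
  imports Defs "HOL-Probability.Probability"
begin

section \<open>Iterated derivatives and Gevrey estimates for them\<close>

section \<open>Iterated partial derivatives\<close>

text \<open>Representing functions are unique only almost everywhere, and \<open>Lp_norm\<close> and
  \<open>pointwise_prod\<close> are defined through them. Uniqueness, obtained from indicators of
  boxes as limits of test functions, allows a frequency piece to be exchanged for a better
  representative: a kernel convolution that is bounded at every point for the Bernstein estimate,
  and a convolution of the bounded density for the support argument. The latter never takes the
  Fourier transform of a merely bounded function; it tests plane waves against kernels and
  superposes them. The sum of the pieces converges absolutely for every q alike: each weighted
  component is at most the full norm, and the reciprocal weights are summable. All norms take values
  in [0, \<infinity>], over \<open>lborel\<close> or a counting measure, so that infinite exponents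
  and infinite values need few separate cases. The algebra property reduces to the product estimate
  by embedding exponent p into exponent 2 p: the Bernstein bound M of a piece F gives |F|^(2p) \<le>
  M^p |F|^p.\<close>

lemma pdiff_eqI: "(f has_derivative f') (at x) \<Longrightarrow> pdiff i f x = f' (axis i 1)"
  unfolding pdiff_def using frechet_derivative_at by metis

lemma differentiable_has_derivative:
  "f differentiable at x \<Longrightarrow> (f has_derivative frechet_derivative f (at x)) (at x)"
  by (simp add: frechet_derivative_works)

lemma iter_pdiff_Nil [simp]: "iter_pdiff [] f = f"
  by (simp add: iter_pdiff_def)

lemma iter_pdiff_Cons: "iter_pdiff (i # is) f = pdiff i (iter_pdiff is f)"
  by (simp add: iter_pdiff_def)

lemma iter_pdiff_append: "iter_pdiff (is @ js) f = iter_pdiff is (iter_pdiff js f)"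
  by (simp add: iter_pdiff_def)

lemma iter_pdiff_snoc: "iter_pdiff (is @ [i]) f = iter_pdiff is (pdiff i f)"
  by (simp add: iter_pdiff_def)

text \<open>The derivative of a product or of a reciprocal contains the original functions again, so
  closure under these operations needs induction on the order, which \<open>smooth_fun\<close>
  itself does not offer.\<close>

primrec smooth_upto :: "nat \<Rightarrow> (real^'n::finite \<Rightarrow> complex) \<Rightarrow> bool" where
  "smooth_upto 0 f \<longleftrightarrow> (\<forall>x. f differentiable at x)"
| "smooth_upto (Suc m) f \<longleftrightarrow> (\<forall>x. f differentiable at x) \<and> (\<forall>i. smooth_upto m (pdiff i f))"

lemma smooth_upto_iff:
  "smooth_upto m f \<longleftrightarrow> (\<forall>is. length is \<le> m \<longrightarrow> (\<forall>x. iter_pdiff is f differentiable at x))"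
proof (induction m arbitrary: f)
  case 0
  then show ?case by simp
next
  case (Suc m)
  show ?case
  proof
    assume L: "smooth_upto (Suc m) f"
    show "\<forall>is. length is \<le> Suc m \<longrightarrow> (\<forall>x. iter_pdiff is f differentiable at x)"
    proof (intro allI impI)
      fix "is" :: "'a list" and x
      assume len: "length is \<le> Suc m"
      show "iter_pdiff is f differentiable at x"
      proof (cases "is" rule: rev_cases)
        case Nil
        then show ?thesis using L by simp
      next
        case (snoc js i)
        then have "length js \<le> m" using len by simp
        moreover have "smooth_upto m (pdiff i f)" using L by simp
        ultimately show ?thesis using Suc.IH snoc by (simp add: iter_pdiff_snoc)
      qed
    qed
  next
    assume R: "\<forall>is. length is \<le> Suc m \<longrightarrow> (\<forall>x. iter_pdiff is f differentiable at x)"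
    have "f differentiable at x" for x using R[rule_format, of "[]"] by simp
    moreover have "smooth_upto m (pdiff i f)" for i
      unfolding Suc.IH
    proof (intro allI impI)
      fix "is" :: "'a list" and x
      assume "length is \<le> m"
      then show "iter_pdiff is (pdiff i f) differentiable at x"
        using R[rule_format, of "is @ [i]" x] by (simp add: iter_pdiff_snoc)
    qed
    ultimately show "smooth_upto (Suc m) f" by simp
  qed
qed

lemma smooth_fun_iff: "smooth_fun f \<longleftrightarrow> (\<forall>m. smooth_upto m f)"
  unfolding smooth_upto_iff smooth_fun_def by blast

lemma smooth_upto_Suc_D: "smooth_upto (Suc m) f \<Longrightarrow> smooth_upto m f"
  unfolding smooth_upto_iff by simp

lemma smooth_upto_differentiable: "smooth_upto m f \<Longrightarrow> f differentiable at x"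
  by (cases m) auto

lemma smooth_fun_iter: "smooth_fun f \<Longrightarrow> iter_pdiff is f differentiable at x"
  by (simp add: smooth_fun_def)

lemma smooth_fun_differentiable: "smooth_fun f \<Longrightarrow> f differentiable at x"
  using smooth_fun_iter[of f "[]"] by simp

lemma smooth_fun_pdiff: "smooth_fun f \<Longrightarrow> smooth_fun (pdiff i f)"
  unfolding smooth_fun_def by (metis iter_pdiff_snoc)

lemma smooth_fun_iter_pdiff: "smooth_fun f \<Longrightarrow> smooth_fun (iter_pdiff is f)"
  unfolding smooth_fun_def by (metis iter_pdiff_append)

lemma smooth_fun_continuous: "smooth_fun f \<Longrightarrow> continuous_on A f"
  by (meson smooth_fun_differentiable differentiable_imp_continuous_within
      continuous_at_imp_continuous_on)

lemma pdiff_add: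
  assumes "\<And>x. f differentiable at x" "\<And>x. g differentiable at x"
  shows "pdiff i (\<lambda>x. f x + g x) = (\<lambda>x. pdiff i f x + pdiff i g x)"
  by (rule ext, rule pdiff_eqI[THEN trans, rotated], unfold pdiff_def, rule refl)
     (intro has_derivative_add differentiable_has_derivative assms)

lemma pdiff_mult:
  assumes "\<And>x. f differentiable at x" "\<And>x. g differentiable at x"
  shows "pdiff i (\<lambda>x. f x * g x) = (\<lambda>x. pdiff i f x * g x + f x * pdiff i g x)"
proof
  fix x
  have "((\<lambda>x. f x * g x) has_derivative
      (\<lambda>h. f x * frechet_derivative g (at x) h + frechet_derivative f (at x) h * g x)) (at x)"
    by (intro has_derivative_mult differentiable_has_derivative assms)
  from pdiff_eqI[OF this]
  show "pdiff i (\<lambda>x. f x * g x) x = pdiff i f x * g x + f x * pdiff i g x"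
    by (simp add: pdiff_def)
qed

lemma pdiff_const: "pdiff i (\<lambda>x. c) = (\<lambda>x. 0)"
  by (rule ext) (rule pdiff_eqI[OF has_derivative_const])

lemma pdiff_inverse:
  assumes "\<And>x. g differentiable at x" "\<And>x. g x \<noteq> 0"
  shows "pdiff i (\<lambda>x. inverse (g x)) =
    (\<lambda>x. (- 1) * (pdiff i g x * (inverse (g x) * inverse (g x))))"
proof
  fix x
  have "((\<lambda>x. inverse (g x)) has_derivative
      (\<lambda>h. - (inverse (g x) * frechet_derivative g (at x) h * inverse (g x)))) (at x)"
    by (rule Deriv.has_derivative_inverse[OF assms(2) differentiable_has_derivative[OF assms(1)]])
  from pdiff_eqI[OF this]
  show "pdiff i (\<lambda>x. inverse (g x)) x =
      (- 1) * (pdiff i g x * (inverse (g x) * inverse (g x)))"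
    by (simp add: pdiff_def)
qed

lemma smooth_upto_const: "smooth_upto m (\<lambda>x. c)"
  by (induction m arbitrary: c) (simp_all add: pdiff_const)

lemma smooth_upto_add:
  "smooth_upto m f \<Longrightarrow> smooth_upto m g \<Longrightarrow> smooth_upto m (\<lambda>x. f x + g x)"
  by (induction m arbitrary: f g) (auto simp: pdiff_add)

lemma smooth_upto_mult:
  "smooth_upto m f \<Longrightarrow> smooth_upto m g \<Longrightarrow> smooth_upto m (\<lambda>x. f x * g x)"
proof (induction m arbitrary: f g)
  case 0
  then show ?case by auto
next
  case (Suc m)
  have 1: "smooth_upto m f" "smooth_upto m g" using Suc.prems smooth_upto_Suc_D by blast+
  show ?case
    using Suc.prems
    by (simp add: pdiff_mult smooth_upto_add Suc.IH 1)
qed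

text \<open>The derivative -g'/g^2 contains 1/g again, but order m for 1/g is already known by
  induction when order m + 1 is wanted.\<close>

lemma smooth_upto_inverse:
  assumes "\<And>x. g x \<noteq> 0"
  shows "smooth_upto m g \<Longrightarrow> smooth_upto m (\<lambda>x. inverse (g x))"
proof (induction m)
  case 0
  then show ?case using assms by auto
next
  case (Suc m)
  have 1: "smooth_upto m (\<lambda>x. inverse (g x))" using Suc smooth_upto_Suc_D by blast
  show ?case
    unfolding smooth_upto.simps
  proof (intro conjI allI)
    show "(\<lambda>x. inverse (g x)) differentiable at x" for x
      by (rule smooth_upto_differentiable[OF 1])
    show "smooth_upto m (pdiff i (\<lambda>x. inverse (g x)))" for i
      unfolding pdiff_inverse[OF smooth_upto_differentiable[OF Suc.prems] assms]
      using Suc.prems by (intro smooth_upto_mult smooth_upto_const 1) simp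
  qed
qed

lemma smooth_fun_const: "smooth_fun (\<lambda>x. c)"
  by (simp add: smooth_fun_iff smooth_upto_const)

lemma smooth_fun_add: "smooth_fun f \<Longrightarrow> smooth_fun g \<Longrightarrow> smooth_fun (\<lambda>x. f x + g x)"
  by (simp add: smooth_fun_iff smooth_upto_add)

lemma smooth_fun_mult: "smooth_fun f \<Longrightarrow> smooth_fun g \<Longrightarrow> smooth_fun (\<lambda>x. f x * g x)"
  by (simp add: smooth_fun_iff smooth_upto_mult)

lemma smooth_fun_inverse:
  "(\<And>x. g x \<noteq> 0) \<Longrightarrow> smooth_fun g \<Longrightarrow> smooth_fun (\<lambda>x. inverse (g x))"
  by (simp add: smooth_fun_iff smooth_upto_inverse)

lemma smooth_fun_sum:
  "(\<And>j. j \<in> J \<Longrightarrow> smooth_fun (f j)) \<Longrightarrow> smooth_fun (\<lambda>x. \<Sum>j\<in>J. f j x)"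
  by (induction J rule: infinite_finite_induct) (auto simp: smooth_fun_const smooth_fun_add)

lemma iter_pdiff_add:
  assumes "smooth_fun f" "smooth_fun g"
  shows "iter_pdiff is (\<lambda>x. f x + g x) = (\<lambda>x. iter_pdiff is f x + iter_pdiff is g x)"
  by (induction "is")
     (simp_all add: iter_pdiff_Cons pdiff_add assms[THEN smooth_fun_iter])

lemma iter_pdiff_cmult:
  assumes "smooth_fun f"
  shows "iter_pdiff is (\<lambda>x. c * f x) = (\<lambda>x. c * iter_pdiff is f x)"
  by (induction "is")
     (simp_all add: iter_pdiff_Cons pdiff_mult pdiff_const assms[THEN smooth_fun_iter])

lemma iter_pdiff_const: "iter_pdiff is (\<lambda>x. c) = (\<lambda>x. if is = [] then c else 0)"
  by (induction "is") (auto simp: iter_pdiff_Cons pdiff_const)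

lemma iter_pdiff_sum:
  assumes "\<And>j. j \<in> J \<Longrightarrow> smooth_fun (f j)"
  shows "iter_pdiff is (\<lambda>x. \<Sum>j\<in>J. f j x) = (\<lambda>x. \<Sum>j\<in>J. iter_pdiff is (f j) x)"
  using assms
proof (induction J rule: infinite_finite_induct)
  case (insert a J)
  have "iter_pdiff is (\<lambda>x. f a x + (\<Sum>j\<in>J. f j x))
      = (\<lambda>x. iter_pdiff is (f a) x + iter_pdiff is (\<lambda>x. \<Sum>j\<in>J. f j x) x)"
    using insert.prems by (intro iter_pdiff_add smooth_fun_sum) auto
  then show ?case using insert by auto
qed (auto simp: iter_pdiff_const)

lemma has_derivative_affine_arg:
  fixes f :: "real^'n::finite \<Rightarrow> complex"
  assumes "(f has_derivative f') (at (c *\<^sub>R x + a))"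
  shows "((\<lambda>x. f (c *\<^sub>R x + a)) has_derivative (\<lambda>h. f' (c *\<^sub>R h))) (at x)"
proof (rule has_derivative_compose[where g = f and f = "\<lambda>x. c *\<^sub>R x + a"])
  show "((\<lambda>x. c *\<^sub>R x + a) has_derivative (\<lambda>h. c *\<^sub>R h)) (at x)"
    by (auto intro!: derivative_eq_intros)
qed (rule assms)

lemma pdiff_affine:
  assumes "\<And>x. f differentiable at x"
  shows "pdiff i (\<lambda>x. f (c *\<^sub>R x + a)) = (\<lambda>x. of_real c * pdiff i f (c *\<^sub>R x + a))"
proof
  fix x
  have D: "(f has_derivative frechet_derivative f (at (c *\<^sub>R x + a))) (at (c *\<^sub>R x + a))"
    by (rule differentiable_has_derivative[OF assms])
  interpret bounded_linear "frechet_derivative f (at (c *\<^sub>R x + a))"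
    using D by (rule has_derivative_bounded_linear)
  show "pdiff i (\<lambda>x. f (c *\<^sub>R x + a)) x = of_real c * pdiff i f (c *\<^sub>R x + a)"
    unfolding pdiff_eqI[OF has_derivative_affine_arg[OF D]] scaleR
    by (simp add: pdiff_def scaleR_conv_of_real)
qed

lemma differentiable_affine_arg:
  fixes f :: "real^'n::finite \<Rightarrow> complex"
  assumes "\<And>x. f differentiable at x"
  shows "(\<lambda>x. f (c *\<^sub>R x + a)) differentiable at x"
  using has_derivative_affine_arg[OF differentiable_has_derivative[OF assms]]
  by (rule differentiableI)

lemma iter_pdiff_affine:
  assumes "smooth_fun f"
  shows "iter_pdiff is (\<lambda>x. f (c *\<^sub>R x + a)) =
    (\<lambda>x. of_real c ^ length is * iter_pdiff is f (c *\<^sub>R x + a))"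
  by (induction "is")
     (simp_all add: iter_pdiff_Cons pdiff_mult pdiff_const pdiff_affine differentiable_affine_arg
        assms[THEN smooth_fun_iter] mult_ac)

lemma smooth_fun_affine:
  assumes "smooth_fun f"
  shows "smooth_fun (\<lambda>x. f (c *\<^sub>R x + a))"
  unfolding smooth_fun_def iter_pdiff_affine[OF assms]
  by (intro allI derivative_intros differentiable_affine_arg differentiable_const
      smooth_fun_iter[OF assms] differentiable_mult)

lemma has_derivative_cong_open:
  assumes "open U" "x \<in> U" "\<And>y. y \<in> U \<Longrightarrow> f y = g y"
  shows "(f has_derivative f') (at x) \<longleftrightarrow> (g has_derivative f') (at x)"
  using assms by (metis has_derivative_transform_within_open)

lemma iter_pdiff_cong_open:
  assumes "open U" "\<And>y. y \<in> U \<Longrightarrow> f y = g y" "x \<in> U"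
  shows "iter_pdiff is f x = iter_pdiff is g x"
  using assms(3)
proof (induction "is" arbitrary: x)
  case Nil
  then show ?case using assms by simp
next
  case (Cons i "is")
  have "frechet_derivative (iter_pdiff is f) (at x) = frechet_derivative (iter_pdiff is g) (at x)"
    unfolding frechet_derivative_def
    using has_derivative_cong_open[OF assms(1) Cons.prems Cons.IH] by simp
  then show ?case by (simp add: iter_pdiff_Cons pdiff_def)
qed

text \<open>Serves sums that are finite only near each point, such as the lattice sum of translates
  of \<rho>.\<close>

lemma smooth_fun_local:
  assumes "\<And>x. \<exists>U g. open U \<and> x \<in> U \<and> smooth_fun g \<and> (\<forall>y\<in>U. f y = g y)"
  shows "smooth_fun f"
  unfolding smooth_fun_def
proof (intro allI)
  fix "is" x
  obtain U g where U: "open U" "x \<in> U" "smooth_fun g" "\<And>y. y \<in> U \<Longrightarrow> f y = g y"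
    using assms by metis
  have "(iter_pdiff is f has_derivative f') (at x) \<longleftrightarrow> (iter_pdiff is g has_derivative f') (at x)" for f'
    by (rule has_derivative_cong_open[OF U(1,2)]) (rule iter_pdiff_cong_open[OF U(1,4)])
  then show "iter_pdiff is f differentiable at x"
    using smooth_fun_iter[OF U(3), of "is" x] by (simp add: differentiable_def)
qed

section \<open>Leibniz estimates\<close>

text \<open>The right-hand side of the Leibniz rule when the bounds on the factors depend on the
  order alone: the binomial coefficient counts the ways of distributing m derivatives over two
  factors.\<close>

definition binom_conv :: "nat \<Rightarrow> (nat \<Rightarrow> real) \<Rightarrow> (nat \<Rightarrow> real) \<Rightarrow> real" where
  "binom_conv m P Q = (\<Sum>j\<le>m. real (m choose j) * P j * Q (m - j))"

text \<open>Pascal's rule. The two summands belong to one further derivative falling on the first or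
  on the second factor.\<close>

lemma binom_conv_Suc:
  "binom_conv (Suc m) P Q = binom_conv m (\<lambda>j. P (Suc j)) Q + binom_conv m P (\<lambda>j. Q (Suc j))"
proof -
  have "binom_conv (Suc m) P Q =
      P 0 * Q (Suc m) + (\<Sum>j\<le>m. real (Suc m choose Suc j) * P (Suc j) * Q (m - j))"
    unfolding binom_conv_def by (subst sum.atMost_Suc_shift) simp
  also have "\<dots> = (\<Sum>j\<le>m. real (m choose j) * P (Suc j) * Q (m - j)) +
      (P 0 * Q (Suc m) + (\<Sum>j\<le>m. real (m choose Suc j) * P (Suc j) * Q (m - j)))"
    by (simp add: ring_distribs sum.distrib)
  also have "P 0 * Q (Suc m) + (\<Sum>j\<le>m. real (m choose Suc j) * P (Suc j) * Q (m - j))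
      = (\<Sum>j\<le>Suc m. real (m choose j) * P j * Q (Suc m - j))"
    by (subst sum.atMost_Suc_shift) simp
  also have "\<dots> = (\<Sum>j\<le>m. real (m choose j) * P j * Q (Suc (m - j)))"
    by (simp add: Suc_diff_le)
  finally show ?thesis by (simp add: binom_conv_def)
qed

text \<open>Induction removes the last entry of the list because that derivative is applied first;
  the product rule then replaces f or g by a derivative and shifts its bound. The set
  \<open>I\<close> allows a single direction, where only pure derivatives are controlled.\<close>

lemma leibniz_bound:
  fixes f g :: "real^'n::finite \<Rightarrow> complex"
  assumes "smooth_fun f" "smooth_fun g" "set is \<subseteq> I"
    and "\<And>js. set js \<subseteq> I \<Longrightarrow> length js \<le> length is \<Longrightarrow> norm (iter_pdiff js f x) \<le> P (length js)"
    and "\<And>js. set js \<subseteq> I \<Longrightarrow> length js \<le> length is \<Longrightarrow> norm (iter_pdiff js g x) \<le> Q (length js)"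
  shows "norm (iter_pdiff is (\<lambda>x. f x * g x) x) \<le> binom_conv (length is) P Q"
  using assms
proof (induction "is" arbitrary: f g P Q rule: rev_induct)
  case Nil
  have "norm (f x) \<le> P 0" "norm (g x) \<le> Q 0" using Nil(4)[of "[]"] Nil(5)[of "[]"] by auto
  then show ?case
    using order.trans[OF norm_ge_zero[of "f x"]] by (simp add: binom_conv_def norm_mult mult_mono)
next
  case (snoc i "is")
  note sm = snoc.prems(1,2)
  have eq: "iter_pdiff (is @ [i]) (\<lambda>x. f x * g x) x =
      iter_pdiff is (\<lambda>x. pdiff i f x * g x) x + iter_pdiff is (\<lambda>x. f x * pdiff i g x) x"
    unfolding iter_pdiff_snoc pdiff_mult[OF sm[THEN smooth_fun_differentiable]]
    by (subst iter_pdiff_add) (auto intro!: smooth_fun_mult smooth_fun_pdiff sm)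
  have i: "i \<in> I" using snoc.prems(3) by simp
  have "norm (iter_pdiff is (\<lambda>x. pdiff i f x * g x) x) \<le> binom_conv (length is) (\<lambda>j. P (Suc j)) Q"
  proof (rule snoc.IH)
    fix js :: "'n list" assume "set js \<subseteq> I" "length js \<le> length is"
    then show "norm (iter_pdiff js (pdiff i f) x) \<le> P (Suc (length js))"
      using snoc.prems(4)[of "js @ [i]"] i by (simp add: iter_pdiff_snoc)
  qed (use snoc.prems smooth_fun_pdiff in auto)
  moreover
  have "norm (iter_pdiff is (\<lambda>x. f x * pdiff i g x) x) \<le> binom_conv (length is) P (\<lambda>j. Q (Suc j))"
  proof (rule snoc.IH)
    fix js :: "'n list" assume "set js \<subseteq> I" "length js \<le> length is"
    then show "norm (iter_pdiff js (pdiff i g) x) \<le> Q (Suc (length js))"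
      using snoc.prems(5)[of "js @ [i]"] i by (simp add: iter_pdiff_snoc)
  qed (use snoc.prems smooth_fun_pdiff in auto)
  ultimately show ?case
    unfolding eq by (simp add: binom_conv_Suc) (meson add_mono norm_triangle_le)
qed

text \<open>In the next estimate the bound on \<open>g\<close> is only needed below the top order, which makes it a
  recursion for the derivatives of a reciprocal.\<close>

lemma leibniz_bound_diff:
  fixes f g :: "real^'n::finite \<Rightarrow> complex"
  assumes "smooth_fun f" "smooth_fun g"
    and "\<And>js. length js \<le> length is \<Longrightarrow> norm (iter_pdiff js f x) \<le> P (length js)"
    and "\<And>js. length js < length is \<Longrightarrow> norm (iter_pdiff js g x) \<le> Q (length js)"
  shows "norm (iter_pdiff is (\<lambda>x. f x * g x) x - f x * iter_pdiff is g x)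
    \<le> binom_conv (length is) (\<lambda>j. if j = 0 then 0 else P j) Q"
  using assms
proof (induction "is" arbitrary: f g P Q rule: rev_induct)
  case Nil
  then show ?case by (simp add: binom_conv_def)
next
  case (snoc i "is")
  note sm = snoc.prems(1,2)
  have eq: "iter_pdiff (is @ [i]) (\<lambda>x. f x * g x) x =
      iter_pdiff is (\<lambda>x. pdiff i f x * g x) x + iter_pdiff is (\<lambda>x. f x * pdiff i g x) x"
    unfolding iter_pdiff_snoc pdiff_mult[OF sm[THEN smooth_fun_differentiable]]
    by (subst iter_pdiff_add) (auto intro!: smooth_fun_mult smooth_fun_pdiff sm)
  have "norm (iter_pdiff is (\<lambda>x. pdiff i f x * g x) x) \<le> binom_conv (length is) (\<lambda>j. P (Suc j)) Q"
  proof (rule leibniz_bound[where I=UNIV])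
    fix js :: "'n list" assume "length js \<le> length is"
    then show "norm (iter_pdiff js (pdiff i f) x) \<le> P (Suc (length js))"
      using snoc.prems(3)[of "js @ [i]"] by (simp add: iter_pdiff_snoc)
  qed (use snoc.prems smooth_fun_pdiff in auto)
  moreover
  have "norm (iter_pdiff is (\<lambda>x. f x * pdiff i g x) x - f x * iter_pdiff is (pdiff i g) x)
      \<le> binom_conv (length is) (\<lambda>j. if j = 0 then 0 else P j) (\<lambda>j. Q (Suc j))"
  proof (rule snoc.IH)
    fix js :: "'n list" assume "length js < length is"
    then show "norm (iter_pdiff js (pdiff i g) x) \<le> Q (Suc (length js))"
      using snoc.prems(4)[of "js @ [i]"] by (simp add: iter_pdiff_snoc)
  qed (use snoc.prems smooth_fun_pdiff in auto)
  ultimately have "norm (iter_pdiff is (\<lambda>x. pdiff i f x * g x) x +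
      (iter_pdiff is (\<lambda>x. f x * pdiff i g x) x - f x * iter_pdiff is (pdiff i g) x))
      \<le> binom_conv (length is) (\<lambda>j. P (Suc j)) Q +
        binom_conv (length is) (\<lambda>j. if j = 0 then 0 else P j) (\<lambda>j. Q (Suc j))"
    by (meson add_mono norm_triangle_le)
  then show ?case
    unfolding eq by (simp add: binom_conv_Suc iter_pdiff_snoc algebra_simps)
qed

section \<open>Gelfand--Shilov bounds over lists of directions\<close>

definition gfact :: "real \<Rightarrow> nat \<Rightarrow> real" where
  "gfact s m = fact m powr s"

lemma gfact_0 [simp]: "gfact s 0 = 1" and gfact_1 [simp]: "gfact s (Suc 0) = 1"
  by (simp_all add: gfact_def)

lemma gfact_pos [simp]: "gfact s m > 0"
  by (simp add: gfact_def)

lemma gfact_nonneg [simp]: "gfact s m \<ge> 0"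
  by (simp add: gfact_def)

lemma gfact_ge_1: "0 \<le> s \<Longrightarrow> 1 \<le> gfact s m"
  unfolding gfact_def by (rule ge_one_powr_ge_zero) (auto simp: fact_ge_1)

lemma gfact_mono: "0 \<le> s \<Longrightarrow> k \<le> m \<Longrightarrow> gfact s k \<le> gfact s m"
  unfolding gfact_def by (rule powr_mono2) (auto intro: fact_mono)

text \<open>For s >= 1 a binomial coefficient is at most its own s-th power, after which the
  factorials recombine. This is what closes Gevrey bounds under products.\<close>

lemma gfact_binomial:
  assumes "1 \<le> s" "j \<le> m"
  shows "real (m choose j) * gfact s j * gfact s (m - j) \<le> gfact s m"
proof -
  have "real (m choose j) \<ge> 1" using assms(2) by (simp add: Suc_le_eq zero_less_binomial)
  then have "real (m choose j) powr 1 \<le> real (m choose j) powr s"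
    using assms(1) by (intro powr_mono) auto
  then have "real (m choose j) * (gfact s j * gfact s (m - j))
      \<le> real (m choose j) powr s * (gfact s j * gfact s (m - j))"
    using \<open>real (m choose j) \<ge> 1\<close> by (intro mult_right_mono) auto
  also have "\<dots> = (real (m choose j) * fact j * fact (m - j)) powr s"
    by (simp add: gfact_def powr_mult)
  also have "real (m choose j) * fact j * fact (m - j) = fact m"
    using binomial_fact_lemma[OF assms(2)]
    by (metis (no_types, lifting) mult.commute mult.assoc of_nat_fact of_nat_mult)
  finally show ?thesis by (simp add: gfact_def mult.assoc)
qed

lemma fact_add_choose: "(fact (k + m) :: real) = real ((k + m) choose k) * fact k * fact m"
  by (simp add: binomial_fact)

lemma binomial_le_pow2_real: "real (n choose k) \<le> 2 ^ n"
  using binomial_le_pow2[of n k] by (metis of_nat_le_iff of_nat_numeral of_nat_power)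

text \<open>The binomial coefficient is at most 2^(k + m), so splitting a factorial costs only a
  geometric factor, which can be absorbed into \<open>h\<close>.\<close>

lemma gfact_add_le:
  assumes "0 \<le> s"
  shows "gfact s (k + m) \<le> (2 powr s) ^ (k + m) * gfact s k * gfact s m"
proof -
  have "fact (k + m) = real ((k + m) choose k) * fact k * fact m"
    by (rule fact_add_choose)
  also have "\<dots> \<le> 2 ^ (k + m) * fact k * fact m"
    by (intro mult_right_mono binomial_le_pow2_real) auto
  finally have "gfact s (k + m) \<le> (2 ^ (k + m) * fact k * fact m) powr s"
    unfolding gfact_def using assms by (intro powr_mono2) auto
  also have "\<dots> = (2 powr s) ^ (k + m) * gfact s k * gfact s m"
    by (simp add: gfact_def powr_mult powr_power powr_realpow[symmetric] powr_powr mult.commute)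
  finally show ?thesis .
qed

text \<open>Powers of the norm and factorials of the order replace monomials and multi-index factorials;
  this changes \<open>h\<close> by a factor depending on the dimension and \<open>s\<close> only. On \<open>pure_lists\<close> only
  derivatives in a single direction are controlled.\<close>

definition gsb :: "'n::finite list set \<Rightarrow> real \<Rightarrow> real \<Rightarrow> real \<Rightarrow> (real^'n \<Rightarrow> complex) \<Rightarrow> bool" where
  "gsb L s A h f \<longleftrightarrow> smooth_fun f \<and> (\<forall>k x. \<forall>is\<in>L. norm x ^ k * norm (iter_pdiff is f x)
     \<le> A * h ^ (k + length is) * (gfact s k * gfact s (length is)))"

definition mbound :: "real \<Rightarrow> real \<Rightarrow> real \<Rightarrow> (real^'n::finite \<Rightarrow> complex) \<Rightarrow> bool" where
  "mbound s B b f \<longleftrightarrow> smooth_fun f \<and>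
     (\<forall>is x. norm (iter_pdiff is f x) \<le> B * b ^ length is * gfact s (length is))"

definition pure_lists :: "'n list set" where
  "pure_lists = {replicate m i |m i. True}"

lemma gsbD:
  "gsb L s A h f \<Longrightarrow> is \<in> L \<Longrightarrow>
    norm x ^ k * norm (iter_pdiff is f x) \<le> A * h ^ (k + length is) * (gfact s k * gfact s (length is))"
  by (simp add: gsb_def)

lemma gsb_smooth: "gsb L s A h f \<Longrightarrow> smooth_fun f"
  by (simp add: gsb_def)

lemma gsb_subset: "gsb L s A h f \<Longrightarrow> L' \<subseteq> L \<Longrightarrow> gsb L' s A h f"
  unfolding gsb_def by blast

lemma gsb_mono:
  assumes "gsb L s A h f" "0 \<le> A" "A \<le> A'" "0 \<le> h" "h \<le> h'"
  shows "gsb L s A' h' f"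
  unfolding gsb_def
proof (intro conjI allI ballI)
  fix k x "is" assume "is \<in> L"
  from gsbD[OF assms(1) this, of x k]
  show "norm x ^ k * norm (iter_pdiff is f x) \<le> A' * h' ^ (k + length is) * (gfact s k * gfact s (length is))"
    by (rule order_trans) (use assms in \<open>intro mult_mono power_mono; simp\<close>)
qed (rule gsb_smooth[OF assms(1)])

lemma gsb_imp_mbound: "gsb UNIV s A h f \<Longrightarrow> mbound s A h f"
  unfolding gsb_def mbound_def
proof (intro conjI allI; elim conjE)
  fix "is" x
  assume "\<forall>k x. \<forall>is\<in>UNIV. norm x ^ k * norm (iter_pdiff is f x)
     \<le> A * h ^ (k + length is) * (gfact s k * gfact s (length is))"
  from this[rule_format, of "is" x 0]
  show "norm (iter_pdiff is f x) \<le> A * h ^ length is * gfact s (length is)" by simp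
qed

lemma gsb_add:
  assumes "gsb L s A h f" "gsb L s B h g"
  shows "gsb L s (A + B) h (\<lambda>x. f x + g x)"
  unfolding gsb_def
proof (intro conjI allI ballI)
  fix k x "is" assume "is \<in> L"
  then have "norm x ^ k * norm (iter_pdiff is f x) + norm x ^ k * norm (iter_pdiff is g x)
     \<le> A * h ^ (k + length is) * (gfact s k * gfact s (length is))
       + B * h ^ (k + length is) * (gfact s k * gfact s (length is))"
    by (intro add_mono gsbD[OF assms(1)] gsbD[OF assms(2)])
  moreover have "norm x ^ k * norm (iter_pdiff is (\<lambda>x. f x + g x) x)
     \<le> norm x ^ k * norm (iter_pdiff is f x) + norm x ^ k * norm (iter_pdiff is g x)"
    unfolding iter_pdiff_add[OF assms[THEN gsb_smooth]] distrib_left[symmetric]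
    by (intro mult_left_mono norm_triangle_ineq) auto
  ultimately show "norm x ^ k * norm (iter_pdiff is (\<lambda>x. f x + g x) x)
     \<le> (A + B) * h ^ (k + length is) * (gfact s k * gfact s (length is))"
    by (simp add: algebra_simps)
qed (intro smooth_fun_add assms[THEN gsb_smooth])

lemma gsb_cmult:
  assumes "gsb L s A h f"
  shows "gsb L s (norm c * A) h (\<lambda>x. c * f x)"
  unfolding gsb_def
proof (intro conjI allI ballI)
  fix k x "is" assume "is \<in> L"
  then show "norm x ^ k * norm (iter_pdiff is (\<lambda>x. c * f x) x)
     \<le> norm c * A * h ^ (k + length is) * (gfact s k * gfact s (length is))"
    using mult_left_mono[OF gsbD[OF assms, of "is" x k], of "norm c"]
    by (simp add: iter_pdiff_cmult[OF gsb_smooth[OF assms]] norm_mult mult_ac)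
qed (intro smooth_fun_mult smooth_fun_const assms[THEN gsb_smooth])

text \<open>After \<open>gfact_binomial\<close> every Leibniz term has the same bound, and their
  number m + 1 is at most 2^m. The extra power k is carried along so that weighted derivatives are
  covered too.\<close>

lemma gfact_conv_bound:
  assumes s: "1 \<le> s" and b: "1 \<le> b" "1 \<le> h" and AB: "0 \<le> A" "0 \<le> B"
  shows "binom_conv m (\<lambda>j. B * b ^ j * gfact s j) (\<lambda>j. A * h ^ (k + j) * gfact s j)
    \<le> A * B * (2 * b * h) ^ (k + m) * gfact s m"
proof -
  have "binom_conv m (\<lambda>j. B * b ^ j * gfact s j) (\<lambda>j. A * h ^ (k + j) * gfact s j)
     = (\<Sum>j\<le>m. A * B * (b ^ j * h ^ (k + (m - j))) * (real (m choose j) * gfact s j * gfact s (m - j)))"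
    unfolding binom_conv_def by (intro sum.cong) (auto simp: mult_ac)
  also have "\<dots> \<le> (\<Sum>j\<le>m. A * B * (b ^ (k + m) * h ^ (k + m)) * gfact s m)"
  proof (intro sum_mono mult_mono)
    fix j assume j: "j \<in> {..m}"
    show "b ^ j \<le> b ^ (k + m)" "h ^ (k + (m - j)) \<le> h ^ (k + m)"
      using b j by (auto intro!: power_increasing)
    show "real (m choose j) * gfact s j * gfact s (m - j) \<le> gfact s m"
      using gfact_binomial[OF s] j by auto
  qed (use AB b in auto)
  also have "\<dots> = real (Suc m) * (A * B * (b ^ (k + m) * h ^ (k + m)) * gfact s m)" by simp
  also have "\<dots> \<le> 2 ^ (k + m) * (A * B * (b ^ (k + m) * h ^ (k + m)) * gfact s m)"
  proof (intro mult_right_mono)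
    have "Suc m \<le> 2 ^ m" by (simp add: Suc_le_eq)
    then have "real (Suc m) \<le> 2 ^ m" by (metis of_nat_le_iff of_nat_numeral of_nat_power)
    also have "(2::real) ^ m \<le> 2 ^ (k + m)" by (intro power_increasing) auto
    finally show "real (Suc m) \<le> 2 ^ (k + m)" .
  qed (use AB b in auto)
  finally show ?thesis by (simp add: power_mult_distrib mult_ac)
qed

lemma gsb_mult:
  assumes "mbound s B b f" "gsb UNIV s A h g" "1 \<le> s" "1 \<le> b" "1 \<le> h" "0 \<le> A" "0 \<le> B"
  shows "gsb UNIV s (A * B) (2 * b * h) (\<lambda>x. f x * g x)"
  unfolding gsb_def
proof (intro conjI allI ballI)
  note sm = assms(1)[unfolded mbound_def, THEN conjunct1] gsb_smooth[OF assms(2)]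
  then show "smooth_fun (\<lambda>x. f x * g x)" by (rule smooth_fun_mult)
  fix k and x :: "real^'a" and "is" :: "'a list"
  \<comment> \<open>The weight at the fixed point x enters as a constant factor of g, so that the
    unweighted Leibniz bound applies.\<close>
  define c :: complex where "c = of_real (norm x ^ k)"
  have c: "norm c = norm x ^ k" by (simp add: c_def norm_power)
  have "norm (iter_pdiff is (\<lambda>x. f x * (c * g x)) x)
      \<le> binom_conv (length is) (\<lambda>j. B * b ^ j * gfact s j) (\<lambda>j. (A * gfact s k) * h ^ (k + j) * gfact s j)"
  proof (rule leibniz_bound[where I = UNIV])
    show "smooth_fun (\<lambda>x. c * g x)" by (intro smooth_fun_mult smooth_fun_const sm)
    fix js :: "'a list"
    show "norm (iter_pdiff js f x) \<le> B * b ^ length js * gfact s (length js)"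
      using assms(1) by (simp add: mbound_def)
    show "norm (iter_pdiff js (\<lambda>x. c * g x) x) \<le> (A * gfact s k) * h ^ (k + length js) * gfact s (length js)"
      using gsbD[OF assms(2) UNIV_I, of x k js]
      unfolding iter_pdiff_cmult[OF sm(2)] norm_mult c by (simp add: mult_ac)
  qed (use sm in auto)
  also have "\<dots> \<le> (A * gfact s k) * B * (2 * b * h) ^ (k + length is) * gfact s (length is)"
    by (rule gfact_conv_bound) (use assms in auto)
  also have "(\<lambda>x. f x * (c * g x)) = (\<lambda>x. c * (f x * g x))" by (simp add: mult_ac)
  finally show "norm x ^ k * norm (iter_pdiff is (\<lambda>x. f x * g x) x)
       \<le> A * B * (2 * b * h) ^ (k + length is) * (gfact s k * gfact s (length is))"
    unfolding iter_pdiff_cmult[OF smooth_fun_mult[OF sm]] norm_mult c by (simp add: mult_ac)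
qed

lemma mbound_mult:
  assumes "mbound s B b f" "mbound s A h g" "1 \<le> s" "1 \<le> b" "1 \<le> h" "0 \<le> A" "0 \<le> B"
  shows "mbound s (A * B) (2 * b * h) (\<lambda>x. f x * g x)"
  unfolding mbound_def
proof (intro conjI allI)
  have sm: "smooth_fun f" "smooth_fun g" using assms by (auto simp: mbound_def)
  then show "smooth_fun (\<lambda>x. f x * g x)" by (rule smooth_fun_mult)
  fix x :: "real^'a" and "is" :: "'a list"
  have "norm (iter_pdiff is (\<lambda>x. f x * g x) x)
      \<le> binom_conv (length is) (\<lambda>j. B * b ^ j * gfact s j) (\<lambda>j. A * h ^ (0 + j) * gfact s j)"
    by (rule leibniz_bound[where I = UNIV]) (use sm assms in \<open>auto simp: mbound_def\<close>)
  also have "\<dots> \<le> A * B * (2 * b * h) ^ (0 + length is) * gfact s (length is)"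
    by (rule gfact_conv_bound) (use assms in auto)
  finally show "norm (iter_pdiff is (\<lambda>x. f x * g x) x)
       \<le> A * B * (2 * b * h) ^ length is * gfact s (length is)" by simp
qed

text \<open>With y = c x + a, |x| is at most 2 max(|y|, |a|) / |c|: powers of |y| are controlled by
  f, powers of |a| go into \<open>h + norm a\<close>, and each derivative contributes a factor
  |c|.\<close>

lemma gsb_affine:
  fixes f :: "real^'n::finite \<Rightarrow> complex"
  assumes f: "gsb UNIV s A h f" and "0 \<le> s" "c \<noteq> 0" "1 \<le> h" "0 \<le> A"
  shows "gsb UNIV s (2 * A) (2 * (1 + 1 / \<bar>c\<bar>) * (1 + \<bar>c\<bar>) * (h + norm a)) (\<lambda>x. f (c *\<^sub>R x + a))"
  unfolding gsb_def
proof (intro conjI allI ballI)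
  show "smooth_fun (\<lambda>x. f (c *\<^sub>R x + a))" by (rule smooth_fun_affine[OF gsb_smooth[OF f]])
  fix k x and "is" :: "'n list"
  define y where "y = c *\<^sub>R x + a"
  define m where "m = length is"
  define N where "N = norm (iter_pdiff is f y)"
  define q where "q = 1 / \<bar>c\<bar>"
  have q: "q > 0" using assms by (simp add: q_def)
  have "x = (1 / c) *\<^sub>R (y - a)" using assms by (simp add: y_def)
  then have "norm x = q * norm (y - a)" by (simp add: q_def)
  also have "\<dots> \<le> q * (2 * max (norm y) (norm a))"
    using q norm_triangle_ineq4[of y a] by (intro mult_left_mono) auto
  finally have "norm x ^ k \<le> (q * (2 * max (norm y) (norm a))) ^ k"
    by (intro power_mono) auto
  also have "\<dots> = (2 * q) ^ k * max (norm y) (norm a) ^ k"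
    by (simp add: power_mult_distrib)
  also have "max (norm y) (norm a) ^ k \<le> norm y ^ k + norm a ^ k"
    by (simp add: max_def)
  finally have "norm x ^ k \<le> (2 * q) ^ k * (norm y ^ k + norm a ^ k)" using q by simp
  then have "norm x ^ k * N \<le> (2 * q) ^ k * (norm y ^ k + norm a ^ k) * N"
    by (rule mult_right_mono) (simp add: N_def)
  also have "\<dots> = (2 * q) ^ k * (norm y ^ k * N + norm a ^ k * N)" by (simp add: algebra_simps)
  also have "norm y ^ k * N \<le> A * h ^ (k + m) * (gfact s k * gfact s m)"
    using gsbD[OF f UNIV_I, of y k "is"] by (simp add: N_def m_def)
  also have "norm a ^ k * N \<le> norm a ^ k * (A * h ^ m * gfact s m)"
    using gsbD[OF f UNIV_I, of y 0 "is"] by (intro mult_left_mono) (auto simp: N_def m_def)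
  also have "\<dots> \<le> norm a ^ k * (A * h ^ m * (gfact s k * gfact s m))"
    using gfact_ge_1[OF \<open>0 \<le> s\<close>, of k] mult_right_mono[of 1 "gfact s k" "gfact s m"] assms
    by (intro mult_left_mono) auto
  also have "A * h ^ (k + m) * (gfact s k * gfact s m) + norm a ^ k * (A * h ^ m * (gfact s k * gfact s m))
     = A * (h ^ k * h ^ m + norm a ^ k * h ^ m) * (gfact s k * gfact s m)"
    by (simp add: power_add algebra_simps)
  also have "\<dots> \<le> A * (2 * (h + norm a) ^ (k + m)) * (gfact s k * gfact s m)"
  proof (intro mult_right_mono mult_left_mono)
    have "h ^ k * h ^ m \<le> (h + norm a) ^ k * (h + norm a) ^ m"
         "norm a ^ k * h ^ m \<le> (h + norm a) ^ k * (h + norm a) ^ m"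
      using assms by (intro mult_mono power_mono; simp)+
    then show "h ^ k * h ^ m + norm a ^ k * h ^ m \<le> 2 * (h + norm a) ^ (k + m)"
      by (simp add: power_add)
  qed (use assms in auto)
  finally have 1: "norm x ^ k * N \<le> (2 * q) ^ k * (A * (2 * (h + norm a) ^ (k + m)) * (gfact s k * gfact s m))"
    using q by simp
  have "\<bar>c\<bar> ^ m * (2 * q) ^ k \<le> (1 + \<bar>c\<bar>) ^ (k + m) * (2 * (1 + q)) ^ (k + m)"
  proof (intro mult_mono)
    have "\<bar>c\<bar> ^ m \<le> (1 + \<bar>c\<bar>) ^ m" by (intro power_mono) auto
    also have "\<dots> \<le> (1 + \<bar>c\<bar>) ^ (k + m)" by (intro power_increasing) auto
    finally show "\<bar>c\<bar> ^ m \<le> (1 + \<bar>c\<bar>) ^ (k + m)" .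
    have "(2 * q) ^ k \<le> (2 * (1 + q)) ^ k" using q by (intro power_mono) auto
    also have "\<dots> \<le> (2 * (1 + q)) ^ (k + m)" using q by (intro power_increasing) auto
    finally show "(2 * q) ^ k \<le> (2 * (1 + q)) ^ (k + m)" .
  qed (use q in auto)
  then have 2: "\<bar>c\<bar> ^ m * (2 * q) ^ k \<le> (2 * (1 + q) * (1 + \<bar>c\<bar>)) ^ (k + m)"
    by (simp add: power_mult_distrib mult_ac)
  have "norm x ^ k * norm (iter_pdiff is (\<lambda>x. f (c *\<^sub>R x + a)) x) = \<bar>c\<bar> ^ m * (norm x ^ k * N)"
    by (simp add: iter_pdiff_affine[OF gsb_smooth[OF f]] norm_mult norm_power m_def N_def y_def)
  also have "\<dots> \<le> \<bar>c\<bar> ^ m * ((2 * q) ^ k * (A * (2 * (h + norm a) ^ (k + m)) * (gfact s k * gfact s m)))"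
    by (intro mult_left_mono 1) auto
  also have "\<dots> = (\<bar>c\<bar> ^ m * (2 * q) ^ k) * (A * (2 * (h + norm a) ^ (k + m)) * (gfact s k * gfact s m))"
    by (simp add: mult_ac)
  also have "\<dots> \<le> (2 * (1 + q) * (1 + \<bar>c\<bar>)) ^ (k + m) * (A * (2 * (h + norm a) ^ (k + m)) * (gfact s k * gfact s m))"
    using assms by (intro mult_right_mono 2) auto
  finally show "norm x ^ k * norm (iter_pdiff is (\<lambda>x. f (c *\<^sub>R x + a)) x)
     \<le> 2 * A * (2 * (1 + 1 / \<bar>c\<bar>) * (1 + \<bar>c\<bar>) * (h + norm a)) ^ (k + length is) * (gfact s k * gfact s (length is))"
    by (simp add: power_mult_distrib q_def m_def mult_ac)
qed

section \<open>Comparison with the multi-index norms\<close>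

text \<open>Reduces a power of the norm to a power of one coordinate, hence to a monomial whose
  exponent has a single nonzero entry.\<close>

lemma norm_le_card_max_coord:
  fixes x :: "real^'n::finite"
  obtains i where "norm x \<le> real CARD('n) * \<bar>x $ i\<bar>"
proof -
  have "finite (range (\<lambda>i. \<bar>x $ i\<bar>))" "range (\<lambda>i. \<bar>x $ i\<bar>) \<noteq> {}" by auto
  then have "Max (range (\<lambda>i. \<bar>x $ i\<bar>)) \<in> range (\<lambda>i. \<bar>x $ i\<bar>)" by (rule Max_in)
  then obtain i where i: "Max (range (\<lambda>i. \<bar>x $ i\<bar>)) = \<bar>x $ i\<bar>" by (rule rangeE)
  have "\<bar>x $ j\<bar> \<le> \<bar>x $ i\<bar>" for j unfolding i[symmetric] by (rule Max_ge) auto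
  then have "(\<Sum>j\<in>UNIV. \<bar>x $ j\<bar>) \<le> (\<Sum>j\<in>(UNIV::'n set). \<bar>x $ i\<bar>)" by (intro sum_mono)
  then have "norm x \<le> real CARD('n) * \<bar>x $ i\<bar>" using norm_le_l1_cart[of x] by simp
  then show ?thesis by (rule that)
qed

lemma coord_list: "distinct (coord_list :: 'n::finite list)" "set (coord_list :: 'n::finite list) = UNIV"
proof -
  have "\<exists>is :: 'n list. distinct is \<and> set is = UNIV"
    using finite_distinct_list[OF finite[of "UNIV :: 'n set"]] by auto
  from someI_ex[OF this] show "distinct (coord_list :: 'n list)" "set (coord_list :: 'n list) = UNIV"
    by (auto simp: coord_list_def)
qed

lemma mderiv_single: "mderiv (\<lambda>j. if j = i then m else 0) f = iter_pdiff (replicate m i) f"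
proof -
  have "concat (map (\<lambda>j. replicate (if j = i then m else 0) j) l) = replicate m i"
    if "distinct l" "i \<in> set l" for l
  proof -
    have "concat (map (\<lambda>j. replicate (if j = i then m else 0) j) l) = []" if "i \<notin> set l" for l
      using that by (induction l) auto
    then show ?thesis using that by (induction l) auto
  qed
  then show ?thesis by (simp add: mderiv_def coord_list)
qed

lemma mi_single:
  fixes i :: "'n::finite"
  shows "mi_abs (\<lambda>j. if j = i then m else 0) = m"
    "mi_fact (\<lambda>j. if j = i then m else 0) = fact m"
    "mi_power x (\<lambda>j. if j = i then m else 0) = (x $ i) ^ m"
proof -
  show "mi_abs (\<lambda>j. if j = i then m else 0) = m" by (simp add: mi_abs_def)
  have "mi_fact (\<lambda>j. if j = i then m else 0) = (\<Prod>j\<in>UNIV. if j = i then fact m else 1)"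
    unfolding mi_fact_def by (intro prod.cong) auto
  then show "mi_fact (\<lambda>j. if j = i then m else 0) = fact m" by simp
  have "mi_power x (\<lambda>j. if j = i then m else 0) = (\<Prod>j\<in>UNIV. if j = i then (x $ i) ^ m else 1)"
    unfolding mi_power_def by (intro prod.cong) auto
  then show "mi_power x (\<lambda>j. if j = i then m else 0) = (x $ i) ^ m" by simp
qed

text \<open>Multi-indices with a single nonzero entry suffice: a dominating coordinate handles the
  weight, and their derivatives do not depend on the enumeration in \<open>coord_list\<close>. For
  mixed derivatives the norm sees only the order of that enumeration, hence the restriction to
  \<open>pure_lists\<close>.\<close>

lemma gs_norm_imp_gsb:
  fixes f :: "real^'n::finite \<Rightarrow> complex"
  assumes sm: "smooth_fun f" and fin: "gs_norm s h f < \<infinity>" and h: "0 < h"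
  shows "gsb pure_lists s (enn2real (gs_norm s h f)) (real CARD('n) * h) f"
  unfolding gsb_def
proof (intro conjI allI ballI sm)
  fix k :: nat and x :: "real^'n" and "is" :: "'n list"
  assume "is \<in> pure_lists"
  then obtain m i where is_eq: "is = replicate m i" by (auto simp: pure_lists_def)
  define A where "A = enn2real (gs_norm s h f)"
  have A: "ennreal A = gs_norm s h f" using fin by (simp add: A_def ennreal_enn2real_if)
  obtain j where j: "norm x \<le> real CARD('n) * \<bar>x $ j\<bar>" using norm_le_card_max_coord .
  let ?\<alpha> = "\<lambda>j'. if j' = j then k else 0" and ?\<beta> = "\<lambda>i'. if i' = i then m else 0"
  have "ennreal (norm (mi_power x ?\<alpha> * mderiv ?\<beta> f x)
        / (h ^ (mi_abs ?\<alpha> + mi_abs ?\<beta>) * (mi_fact ?\<alpha> * mi_fact ?\<beta>) powr s)) \<le> gs_norm s h f"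
    unfolding gs_norm_def by (rule SUP_upper2[of "(x, ?\<alpha>, ?\<beta>)"]) auto
  then have "ennreal (norm ((x $ j) ^ k * iter_pdiff is f x) / (h ^ (k + m) * (fact k * fact m) powr s)) \<le> ennreal A"
    unfolding A mi_single mderiv_single is_eq .
  then have "norm ((x $ j) ^ k * iter_pdiff is f x) / (h ^ (k + m) * (fact k * fact m) powr s) \<le> A"
    by (subst (asm) ennreal_le_iff) (auto simp: A_def)
  then have 1: "\<bar>x $ j\<bar> ^ k * norm (iter_pdiff is f x) \<le> A * (h ^ (k + m) * (gfact s k * gfact s m))"
    using h by (subst (asm) pos_divide_le_eq) (auto simp: norm_mult norm_power power_abs gfact_def powr_mult)
  have "norm x ^ k * norm (iter_pdiff is f x) \<le> (real CARD('n) * \<bar>x $ j\<bar>) ^ k * norm (iter_pdiff is f x)"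
    using j by (intro mult_right_mono power_mono) auto
  also have "\<dots> = real CARD('n) ^ k * (\<bar>x $ j\<bar> ^ k * norm (iter_pdiff is f x))"
    by (simp add: power_mult_distrib)
  also have "\<dots> \<le> real CARD('n) ^ (k + m) * (A * (h ^ (k + m) * (gfact s k * gfact s m)))"
  proof (rule mult_mono[OF _ 1])
    have "1 \<le> real CARD('n)" by (simp add: Suc_le_eq)
    then show "real CARD('n) ^ k \<le> real CARD('n) ^ (k + m)" by (intro power_increasing) auto
  qed auto
  finally show "norm x ^ k * norm (iter_pdiff is f x)
       \<le> enn2real (gs_norm s h f) * (real CARD('n) * h) ^ (k + length is) * (gfact s k * gfact s (length is))"
    by (simp add: A_def[symmetric] is_eq power_mult_distrib mult_ac)
qed

text \<open>The quotient of the factorials is a multinomial coefficient, a product of binomial ones,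
  so each coordinate costs a power of 2.\<close>

lemma fact_mi_abs_le:
  fixes \<alpha> :: "'n::finite \<Rightarrow> nat"
  shows "fact (mi_abs \<alpha>) \<le> (2 ^ CARD('n)) ^ mi_abs \<alpha> * mi_fact \<alpha>"
proof -
  have "fact (\<Sum>i\<in>S. \<alpha> i) \<le> (2 ^ card S) ^ (\<Sum>i\<in>S. \<alpha> i) * (\<Prod>i\<in>S. fact (\<alpha> i) :: real)"
    if "finite S" for S using that
  proof induction
    case (insert i S)
    let ?a = "\<alpha> i" and ?b = "\<Sum>i\<in>S. \<alpha> i"
    have "fact (?a + ?b) = real ((?a + ?b) choose ?a) * fact ?a * fact ?b"
      by (rule fact_add_choose)
    also have "\<dots> \<le> 2 ^ (?a + ?b) * fact ?a * ((2 ^ card S) ^ ?b * (\<Prod>i\<in>S. fact (\<alpha> i)))"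
      using insert.IH by (intro mult_mono binomial_le_pow2_real) auto
    also have "\<dots> \<le> 2 ^ (?a + ?b) * fact ?a * ((2 ^ card S) ^ (?a + ?b) * (\<Prod>i\<in>S. fact (\<alpha> i)))"
      by (intro mult_left_mono mult_right_mono power_increasing) (auto intro: prod_nonneg)
    finally show ?case using insert by (simp add: power_mult_distrib mult_ac)
  qed simp
  from this[OF finite[of UNIV]] show ?thesis by (simp add: mi_abs_def mi_fact_def)
qed

lemma mi_power_le: "\<bar>mi_power x \<alpha>\<bar> \<le> norm x ^ mi_abs \<alpha>"
proof -
  have "\<bar>mi_power x \<alpha>\<bar> = (\<Prod>i\<in>UNIV. \<bar>x $ i\<bar> ^ \<alpha> i)"
    by (simp add: mi_power_def abs_prod power_abs)
  also have "\<dots> \<le> (\<Prod>i\<in>UNIV. norm x ^ \<alpha> i)"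
    by (intro prod_mono conjI power_mono component_le_norm_cart) auto
  finally show ?thesis by (simp add: mi_abs_def power_sum)
qed

lemma length_mderiv_list:
  fixes \<beta> :: "'n::finite \<Rightarrow> nat"
  shows "length (concat (map (\<lambda>i. replicate (\<beta> i) i) coord_list)) = mi_abs \<beta>"
  by (simp add: length_concat comp_def mi_abs_def sum_list_distinct_conv_sum_set coord_list)

text \<open>The factor (2^n)^s in \<open>h\<close> pays for replacing factorials of the total order
  by multi-index factorials.\<close>

lemma gsb_imp_gs_norm:
  fixes f :: "real^'n::finite \<Rightarrow> complex"
  assumes f: "gsb UNIV s A h f" and s: "0 \<le> s" and h: "0 < h" and A: "0 \<le> A"
  shows "gs_norm s (h * (2 ^ CARD('n)) powr s) f \<le> ennreal A"
  unfolding gs_norm_def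
proof (rule SUP_least, clarify)
  fix x :: "real^'n" and \<alpha> \<beta> :: "'n \<Rightarrow> nat"
  let ?k = "mi_abs \<alpha>" and ?m = "mi_abs \<beta>"
  let ?c = "2 ^ CARD('n) :: real"
  define D where "D = h * ?c powr s"
  have D: "D > 0" using h by (simp add: D_def)
  have pos: "mi_fact \<alpha> > 0" "mi_fact \<beta> > 0" by (auto simp: mi_fact_def intro!: prod_pos)
  have g: "gfact s (mi_abs \<gamma>) \<le> (?c powr s) ^ mi_abs \<gamma> * mi_fact \<gamma> powr s" for \<gamma> :: "'n \<Rightarrow> nat"
  proof -
    have "gfact s (mi_abs \<gamma>) \<le> (?c ^ mi_abs \<gamma> * mi_fact \<gamma>) powr s"
      unfolding gfact_def by (intro powr_mono2 s fact_mi_abs_le) auto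
    also have "\<dots> = (?c powr s) ^ mi_abs \<gamma> * mi_fact \<gamma> powr s"
      by (subst powr_mult)
         (auto simp: mi_fact_def powr_power powr_realpow[symmetric] powr_powr mult_ac intro!: prod_nonneg)
    finally show ?thesis .
  qed
  have "norm (mi_power x \<alpha> * mderiv \<beta> f x) \<le> norm x ^ ?k * norm (mderiv \<beta> f x)"
    by (simp add: norm_mult mult_right_mono mi_power_le)
  also have "\<dots> \<le> A * h ^ (?k + ?m) * (gfact s ?k * gfact s ?m)"
    using gsbD[OF f UNIV_I, of x ?k "concat (map (\<lambda>i. replicate (\<beta> i) i) coord_list)"]
    unfolding length_mderiv_list mderiv_def .
  also have "\<dots> \<le> A * h ^ (?k + ?m) *
      (((?c powr s) ^ ?k * mi_fact \<alpha> powr s) * ((?c powr s) ^ ?m * mi_fact \<beta> powr s))"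
    using A h by (intro mult_left_mono mult_mono g) auto
  also have "\<dots> = A * (D ^ (?k + ?m) * (mi_fact \<alpha> * mi_fact \<beta>) powr s)"
    using pos by (simp add: D_def powr_mult power_mult_distrib power_add mult_ac)
  finally have "norm (mi_power x \<alpha> * mderiv \<beta> f x) / (D ^ (?k + ?m) * (mi_fact \<alpha> * mi_fact \<beta>) powr s) \<le> A"
    using D pos by (subst pos_divide_le_eq) auto
  then show "ennreal (norm (mi_power x \<alpha> * mderiv \<beta> f x)
      / ((h * ?c powr s) ^ (?k + ?m) * (mi_fact \<alpha> * mi_fact \<beta>) powr s)) \<le> ennreal A"
    by (intro ennreal_leI) (simp add: D_def)
qed

section \<open>Fourier transform and inversion\<close>

section \<open>Integration tools\<close>

lemma fubini_swap:
  fixes f :: "'a::euclidean_space \<Rightarrow> 'b::euclidean_space \<Rightarrow> complex"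
  assumes m: "(\<lambda>(x, y). f x y) \<in> borel_measurable (lborel \<Otimes>\<^sub>M lborel)"
    and fin: "(\<integral>\<^sup>+x. (\<integral>\<^sup>+y. ennreal (norm (f x y)) \<partial>lborel) \<partial>lborel) < \<infinity>"
  shows "(\<integral>x. (\<integral>y. f x y \<partial>lborel) \<partial>lborel) = (\<integral>y. (\<integral>x. f x y \<partial>lborel) \<partial>lborel)"
    and "integrable lborel (\<lambda>x. \<integral>y. f x y \<partial>lborel)"
    and "integrable lborel (\<lambda>y. \<integral>x. f x y \<partial>lborel)"
proof -
  have [measurable]: "(\<lambda>p. f (fst p) (snd p)) \<in> borel_measurable (lborel \<Otimes>\<^sub>M lborel)"
    using m by (simp add: case_prod_beta')
  have "integrable (lborel \<Otimes>\<^sub>M lborel) (\<lambda>p. f (fst p) (snd p))"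
  proof (rule integrableI_bounded)
    have "(\<integral>\<^sup>+p. ennreal (norm (f (fst p) (snd p))) \<partial>(lborel \<Otimes>\<^sub>M lborel)) =
        (\<integral>\<^sup>+x. (\<integral>\<^sup>+y. ennreal (norm (f x y)) \<partial>lborel) \<partial>lborel)"
      by (subst lborel.nn_integral_fst[symmetric]) auto
    then show "(\<integral>\<^sup>+p. ennreal (norm (f (fst p) (snd p))) \<partial>(lborel \<Otimes>\<^sub>M lborel)) < \<infinity>"
      using fin by simp
  qed measurable
  then have int: "integrable (lborel \<Otimes>\<^sub>M lborel) (case_prod f)"
    by (simp add: case_prod_beta')
  show "(\<integral>x. (\<integral>y. f x y \<partial>lborel) \<partial>lborel) = (\<integral>y. (\<integral>x. f x y \<partial>lborel) \<partial>lborel)"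
    using lborel_pair.Fubini_integral[OF int] by simp
  show "integrable lborel (\<lambda>x. \<integral>y. f x y \<partial>lborel)" "integrable lborel (\<lambda>y. \<integral>x. f x y \<partial>lborel)"
    using lborel_pair.integrable_fst[OF int] lborel_pair.integrable_snd[OF int] by simp_all
qed

lemma
  fixes c :: real and t :: "'a::euclidean_space"
  assumes c: "c \<noteq> 0"
  shows nn_integral_lborel_affine: "f \<in> borel_measurable borel \<Longrightarrow>
      (\<integral>\<^sup>+x. f x \<partial>lborel) = ennreal (\<bar>c\<bar> ^ DIM('a)) * (\<integral>\<^sup>+x. f (t + c *\<^sub>R x) \<partial>lborel)"
    and integral_lborel_affine: "(g :: 'a \<Rightarrow> complex) \<in> borel_measurable borel \<Longrightarrow>
      (\<integral>x. g x \<partial>lborel) = of_real (\<bar>c\<bar> ^ DIM('a)) * (\<integral>x. g (t + c *\<^sub>R x) \<partial>lborel)"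
proof -
  show "f \<in> borel_measurable borel \<Longrightarrow>
      (\<integral>\<^sup>+x. f x \<partial>lborel) = ennreal (\<bar>c\<bar> ^ DIM('a)) * (\<integral>\<^sup>+x. f (t + c *\<^sub>R x) \<partial>lborel)"
    by (subst lborel_affine[OF c, of t])
       (simp add: nn_integral_density nn_integral_distr nn_integral_cmult ennreal_power)
  show "g \<in> borel_measurable borel \<Longrightarrow>
      (\<integral>x. g x \<partial>lborel) = of_real (\<bar>c\<bar> ^ DIM('a)) * (\<integral>x. g (t + c *\<^sub>R x) \<partial>lborel)"
    by (subst lborel_affine[OF c, of t])
       (simp add: integral_density integral_distr ennreal_power scaleR_conv_of_real)
qed

lemma integrable_lborel_affine:
  fixes f :: "'a::euclidean_space \<Rightarrow> complex"
  assumes f: "integrable lborel f" and c: "c \<noteq> 0"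
  shows "integrable lborel (\<lambda>x. f (t + c *\<^sub>R x))"
proof -
  have [measurable]: "f \<in> borel_measurable borel" using f by auto
  have "(\<integral>\<^sup>+x. ennreal (norm (f x)) \<partial>lborel)
      = ennreal (\<bar>c\<bar> ^ DIM('a)) * (\<integral>\<^sup>+x. ennreal (norm (f (t + c *\<^sub>R x))) \<partial>lborel)"
    by (rule nn_integral_lborel_affine[OF c]) measurable
  moreover have "(\<integral>\<^sup>+x. ennreal (norm (f x)) \<partial>lborel) < \<infinity>"
    using f by (simp add: integrable_iff_bounded)
  moreover have "ennreal (\<bar>c\<bar> ^ DIM('a)) \<noteq> 0" using c by (simp add: ennreal_eq_0_iff not_le)
  ultimately have "(\<integral>\<^sup>+x. ennreal (norm (f (t + c *\<^sub>R x))) \<partial>lborel) < \<infinity>"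
    by (auto simp: ennreal_mult_less_top)
  then show ?thesis by (intro integrableI_bounded) auto
qed

lemma nn_integral_lborel_shift:
  fixes t :: "'a::euclidean_space"
  assumes "f \<in> borel_measurable borel"
  shows "(\<integral>\<^sup>+x. f (t + x) \<partial>lborel) = (\<integral>\<^sup>+x. f x \<partial>lborel)"
    and "(\<integral>\<^sup>+x. f (x + t) \<partial>lborel) = (\<integral>\<^sup>+x. f x \<partial>lborel)"
    and "(\<integral>\<^sup>+x. f (x - t) \<partial>lborel) = (\<integral>\<^sup>+x. f x \<partial>lborel)"
    and "(\<integral>\<^sup>+x. f (t - x) \<partial>lborel) = (\<integral>\<^sup>+x. f x \<partial>lborel)"
  using nn_integral_lborel_affine[OF _ assms, of 1 t]
    nn_integral_lborel_affine[OF _ assms, of 1 "- t"]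
    nn_integral_lborel_affine[OF _ assms, of "- 1" t]
  by (simp_all add: add.commute)

lemma integral_lborel_shift:
  fixes t :: "'a::euclidean_space" and f :: "'a \<Rightarrow> complex"
  assumes "f \<in> borel_measurable borel"
  shows "(\<integral>x. f (t + x) \<partial>lborel) = (\<integral>x. f x \<partial>lborel)"
    and "(\<integral>x. f (x + t) \<partial>lborel) = (\<integral>x. f x \<partial>lborel)"
    and "(\<integral>x. f (x - t) \<partial>lborel) = (\<integral>x. f x \<partial>lborel)"
    and "(\<integral>x. f (t - x) \<partial>lborel) = (\<integral>x. f x \<partial>lborel)"
    and "(\<integral>x. f (- x) \<partial>lborel) = (\<integral>x. f x \<partial>lborel)"
  using integral_lborel_affine[OF _ assms, of 1 t]
    integral_lborel_affine[OF _ assms, of 1 "- t"]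
    integral_lborel_affine[OF _ assms, of "- 1" t]
    integral_lborel_affine[OF _ assms, of "- 1" 0]
  by (simp_all add: add.commute)

lemma integrable_lborel_shift:
  fixes t :: "'a::euclidean_space" and f :: "'a \<Rightarrow> complex"
  assumes "integrable lborel f"
  shows "integrable lborel (\<lambda>x. f (t + x))" "integrable lborel (\<lambda>x. f (x + t))"
    "integrable lborel (\<lambda>x. f (x - t))" "integrable lborel (\<lambda>x. f (t - x))"
    "integrable lborel (\<lambda>x. f (- x))"
  using integrable_lborel_affine[OF assms, of 1 t]
    integrable_lborel_affine[OF assms, of 1 "- t"]
    integrable_lborel_affine[OF assms, of "- 1" t]
    integrable_lborel_affine[OF assms, of "- 1" 0]
  by (simp_all add: add.commute)

lemma prod_Basis_vec: "(\<Prod>b\<in>(Basis :: (real^'n::finite) set). g b) = (\<Prod>i\<in>UNIV. g (axis i 1))"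
proof -
  have B: "(Basis :: (real^'n) set) = (\<lambda>i. axis i 1) ` UNIV" by (auto simp: Basis_vec_def)
  show ?thesis unfolding B by (subst prod.reindex) (auto simp: inj_on_def axis_eq_axis)
qed

lemma integral_lborel_prod:
  fixes f :: "real \<Rightarrow> 'n::finite \<Rightarrow> complex"
  assumes int: "\<And>i. integrable lborel (\<lambda>t. f t i)"
  shows "(\<integral>x. (\<Prod>i\<in>UNIV. f (x $ i) i) \<partial>(lborel :: (real^'n) measure)) = (\<Prod>i\<in>UNIV. \<integral>t. f t i \<partial>lborel)"
proof -
  interpret product_sigma_finite "\<lambda>_ :: real^'n. lborel :: real measure" ..
  have [measurable]: "(\<lambda>t. f t i) \<in> borel_measurable borel" for i
    using borel_measurable_integrable[OF int, of i] by simp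
  \<comment> \<open>The product measure behind \<open>lborel\<close> is indexed by
    \<open>Basis\<close>; \<open>j\<close> recovers the coordinate index of a basis vector.\<close>
  define j :: "real^'n \<Rightarrow> 'n" where "j b = (THE i. b = axis i 1)" for b
  have j [simp]: "j (axis i 1) = i" for i
    unfolding j_def by (rule the_equality) (auto simp: axis_eq_axis)
  have "(\<integral>x. (\<Prod>i\<in>UNIV. f (x $ i) i) \<partial>(lborel :: (real^'n) measure))
      = (\<integral>x. (\<Prod>b\<in>Basis. f (x \<bullet> b) (j b)) \<partial>lborel)"
    by (simp add: prod_Basis_vec inner_axis)
  also have "\<dots> = (\<integral>y. (\<Prod>b\<in>Basis. f ((\<Sum>b\<in>Basis. y b *\<^sub>R b) \<bullet> b) (j b)) \<partial>(\<Pi>\<^sub>M b\<in>(Basis :: (real^'n) set). lborel))"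
    by (subst lborel_eq, subst integral_distr) measurable
  also have "\<dots> = (\<integral>y. (\<Prod>b\<in>Basis. f (y b) (j b)) \<partial>(\<Pi>\<^sub>M b\<in>(Basis :: (real^'n) set). lborel))"
    by (intro Bochner_Integration.integral_cong prod.cong refl) simp
  also have "\<dots> = (\<Prod>b\<in>(Basis :: (real^'n) set). \<integral>t. f t (j b) \<partial>lborel)"
    by (rule product_integral_prod) (auto intro: int)
  finally show ?thesis by (simp add: prod_Basis_vec)
qed

text \<open>A product weight, so that its integrability over R^n reduces to that of 1 / (1 + t^2) on
  the line.\<close>

definition omega :: "real^'n::finite \<Rightarrow> real" where
  "omega x = (\<Prod>i\<in>UNIV. inverse (1 + (x $ i)\<^sup>2))"

lemma omega_pos [simp]: "omega x > 0" and omega_nonneg [simp]: "omega x \<ge> 0"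
proof -
  show "omega x > 0"
    unfolding omega_def by (intro prod_pos) (auto simp: add_pos_nonneg)
  then show "omega x \<ge> 0" by simp
qed

lemma omega_measurable [measurable]: "omega \<in> borel_measurable borel"
  unfolding omega_def [abs_def] by measurable

lemma integrable_omega: "integrable lborel (omega :: real^'n::finite \<Rightarrow> real)"
proof (rule integrableI_nonneg)
  have "integrable lborel (\<lambda>t::real. inverse (1 + t\<^sup>2))"
    using integrable_inverse_1_plus_square by (simp add: set_integrable_def)
  then have fin: "(\<integral>\<^sup>+t. ennreal (inverse (1 + t\<^sup>2)) \<partial>(lborel :: real measure)) < \<infinity>"
    by (subst (asm) integrable_iff_bounded) (simp add: add_nonneg_nonneg)
  have "(\<integral>\<^sup>+x. ennreal (omega x) \<partial>(lborel :: (real^'n) measure))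
     = (\<integral>\<^sup>+x. (\<Prod>b\<in>(Basis :: (real^'n) set). ennreal (inverse (1 + (x \<bullet> b)\<^sup>2))) \<partial>lborel)"
    by (simp add: prod_Basis_vec omega_def inner_axis prod_ennreal add_nonneg_nonneg)
  also have "\<dots> = (\<Prod>b\<in>(Basis :: (real^'n) set). \<integral>\<^sup>+t. ennreal (inverse (1 + t\<^sup>2)) \<partial>lborel)"
    by (rule nn_integral_lborel_prod) auto
  also have "\<dots> < \<infinity>" using fin by (simp add: power_less_top_ennreal)
  finally show "(\<integral>\<^sup>+x. ennreal (omega x) \<partial>(lborel :: (real^'n) measure)) < \<infinity>" .
qed auto

text \<open>The reciprocal of \<open>omega x\<close> is at most (1 + |x|^2)^n, hence at most 2^n (1
  + |x|^(2n)). Two bounds, one without weight and one with exponent 2 n, therefore give an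
  integrable majorant.\<close>

lemma weight_bound:
  fixes x :: "real^'n::finite"
  assumes "y \<ge> 0" "y \<le> N" "norm x ^ (2 * CARD('n)) * y \<le> N"
  shows "y \<le> 2 ^ (CARD('n) + 1) * N * omega x"
proof -
  let ?n = "CARD('n)"
  have "inverse (omega x) = (\<Prod>i\<in>UNIV. 1 + (x $ i)\<^sup>2)"
    by (simp add: omega_def prod_inversef[symmetric] comp_def)
  also have "\<dots> \<le> (\<Prod>i\<in>(UNIV::'n set). 1 + (norm x)\<^sup>2)"
    by (intro prod_mono conjI add_left_mono abs_le_square_iff[THEN iffD1])
       (auto simp: component_le_norm_cart add_nonneg_nonneg)
  also have "\<dots> = (1 + (norm x)\<^sup>2) ^ ?n" by simp
  also have "\<dots> \<le> (2 * max 1 ((norm x)\<^sup>2)) ^ ?n" by (intro power_mono) auto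
  also have "\<dots> = 2 ^ ?n * max 1 ((norm x)\<^sup>2) ^ ?n" by (rule power_mult_distrib)
  also have "max 1 ((norm x)\<^sup>2) ^ ?n \<le> 1 + norm x ^ (2 * ?n)"
    by (simp add: max_def power_mult)
  finally have "inverse (omega x) \<le> 2 ^ ?n * (1 + norm x ^ (2 * ?n))" by simp
  then have "y * inverse (omega x) \<le> y * (2 ^ ?n * (1 + norm x ^ (2 * ?n)))"
    using assms by (intro mult_left_mono)
  also have "\<dots> = 2 ^ ?n * (y + norm x ^ (2 * ?n) * y)" by (simp add: algebra_simps)
  also have "\<dots> \<le> 2 ^ ?n * (N + N)" using assms by (intro mult_left_mono add_mono) auto
  finally have "y * inverse (omega x) \<le> 2 ^ (?n + 1) * N" by simp
  then have "y * inverse (omega x) * omega x \<le> 2 ^ (?n + 1) * N * omega x"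
    by (intro mult_right_mono) auto
  then show ?thesis using omega_pos[of x] by (simp add: mult.assoc less_imp_neq[symmetric])
qed

lemma
  fixes f :: "real^'n::finite \<Rightarrow> complex"
  assumes m: "f \<in> borel_measurable borel" and b: "\<And>x. norm (f x) \<le> C * omega x"
  shows integrable_omega_bound: "integrable lborel f"
    and integral_omega_bound: "(\<integral>x. norm (f x) \<partial>lborel) \<le> C * (\<integral>x. omega x \<partial>(lborel :: (real^'n) measure))"
proof -
  have i: "integrable lborel (\<lambda>x :: real^'n. C * omega x)"
    by (intro integrable_mult_right integrable_omega)
  show 1: "integrable lborel f"
  proof (rule Bochner_Integration.integrable_bound[OF i])
    show "AE x in lborel. norm (f x) \<le> norm (C * omega x)"
      using b by (intro AE_I2) (metis abs_ge_self order.trans real_norm_def)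
  qed (use m in auto)
  have "(\<integral>x. norm (f x) \<partial>lborel) \<le> (\<integral>x. C * omega x \<partial>(lborel :: (real^'n) measure))"
    by (rule integral_mono) (use 1 i b in auto)
  then show "(\<integral>x. norm (f x) \<partial>lborel) \<le> C * (\<integral>x. omega x \<partial>(lborel :: (real^'n) measure))" by simp
qed

text \<open>Decay of the function alone. It already makes the Fourier transform smooth, because each
  derivative there only multiplies by a coordinate here.\<close>

definition rapid :: "(real^'n::finite \<Rightarrow> complex) \<Rightarrow> bool" where
  "rapid f \<longleftrightarrow> f \<in> borel_measurable borel \<and> (\<forall>k. \<exists>N. \<forall>x. norm x ^ k * norm (f x) \<le> N)"

lemma rapid_omega:
  fixes f :: "real^'n::finite \<Rightarrow> complex"
  assumes "rapid f"
  obtains C where "\<And>x. norm (f x) \<le> C * omega x"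
proof -
  obtain N0 where N0: "\<And>x. norm x ^ 0 * norm (f x) \<le> N0" using assms unfolding rapid_def by blast
  obtain N1 where N1: "\<And>x. norm x ^ (2 * CARD('n)) * norm (f x) \<le> N1" using assms unfolding rapid_def by blast
  have "norm (f x) \<le> 2 ^ (CARD('n) + 1) * max N0 N1 * omega x" for x
    by (rule weight_bound) (use N0[of x] N1[of x] in auto)
  then show ?thesis by (rule that)
qed

lemma rapid_integrable: "rapid f \<Longrightarrow> integrable lborel f"
  by (metis rapid_omega integrable_omega_bound rapid_def)

lemma rapid_measurable: "rapid f \<Longrightarrow> f \<in> borel_measurable borel"
  by (simp add: rapid_def)

lemma rapid_mult:
  assumes "rapid f" "g \<in> borel_measurable borel" "\<And>x. norm (g x) \<le> C * norm x ^ m"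
  shows "rapid (\<lambda>x. g x * f x)"
  unfolding rapid_def
proof (intro conjI allI)
  have [measurable]: "f \<in> borel_measurable borel" "g \<in> borel_measurable borel"
    using assms by (auto simp: rapid_def)
  show "(\<lambda>x. g x * f x) \<in> borel_measurable borel" by measurable
  fix k
  obtain N where N: "\<And>x. norm x ^ (k + m) * norm (f x) \<le> N" using assms unfolding rapid_def by blast
  have "norm x ^ k * norm (g x * f x) \<le> \<bar>C\<bar> * N" for x
  proof -
    have "norm (g x) \<le> \<bar>C\<bar> * norm x ^ m"
      using assms(3)[of x] by (rule order_trans) (auto intro: mult_right_mono)
    then have "norm x ^ k * norm (g x * f x) \<le> norm x ^ k * ((\<bar>C\<bar> * norm x ^ m) * norm (f x))"
      unfolding norm_mult by (intro mult_left_mono mult_right_mono) auto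
    also have "\<dots> = \<bar>C\<bar> * (norm x ^ (k + m) * norm (f x))" by (simp add: power_add mult_ac)
    also have "\<dots> \<le> \<bar>C\<bar> * N" by (intro mult_left_mono N) auto
    finally show ?thesis .
  qed
  then show "\<exists>N. \<forall>x. norm x ^ k * norm (g x * f x) \<le> N" by blast
qed

lemma gsb_measurable: "gsb L s A h f \<Longrightarrow> f \<in> borel_measurable borel"
  by (intro borel_measurable_continuous_onI smooth_fun_continuous gsb_smooth)

lemma Nil_pure: "[] \<in> pure_lists"
  by (auto simp: pure_lists_def intro: exI[of _ 0])

lemma gsb_rapid:
  assumes "gsb L s A h f" "[] \<in> L"
  shows "rapid f"
  unfolding rapid_def using gsbD[OF assms] gsb_measurable[OF assms(1)] by fastforce

section \<open>The Fourier transform on rapidly decreasing functions\<close>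

definition ftc :: "'n::finite itself \<Rightarrow> real" where
  "ftc _ = (2 * pi) powr (- real CARD('n) / 2)"

lemma ftc_pos: "ftc t > 0"
  by (simp add: ftc_def)

lemma fourier_eq:
  "fourier f \<xi> = of_real (ftc TYPE('n)) * (\<integral>x. f x * exp (- \<i> * complex_of_real (x \<bullet> \<xi>)) \<partial>lborel)"
  for f :: "real^'n::finite \<Rightarrow> complex"
  by (simp add: fourier_def ftc_def)

lemma inv_fourier_eq:
  "inv_fourier f \<xi> = of_real (ftc TYPE('n)) * (\<integral>x. f x * exp (\<i> * complex_of_real (\<xi> \<bullet> x)) \<partial>lborel)"
  for f :: "real^'n::finite \<Rightarrow> complex"
  by (simp add: inv_fourier_def ftc_def)

lemma inv_fourier_conv_fourier: "inv_fourier f \<xi> = fourier f (- \<xi>)"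
  by (simp add: inv_fourier_eq fourier_eq inner_commute)

lemma integrable_mult_unimodular:
  fixes f g :: "'a::euclidean_space \<Rightarrow> complex"
  assumes "integrable lborel f" "g \<in> borel_measurable borel" "\<And>x. norm (g x) \<le> 1"
  shows "integrable lborel (\<lambda>x. f x * g x)"
proof (rule Bochner_Integration.integrable_bound[OF assms(1)])
  show "AE x in lborel. norm (f x * g x) \<le> norm (f x)"
    unfolding norm_mult by (intro AE_I2 mult_left_le assms(3)) auto
qed (use assms in auto)

lemma iexp_measurable [measurable]:
  "(\<lambda>x :: real^'n::finite. exp (\<i> * complex_of_real (x \<bullet> \<xi>))) \<in> borel_measurable borel"
  "(\<lambda>x :: real^'n::finite. exp (- \<i> * complex_of_real (x \<bullet> \<xi>))) \<in> borel_measurable borel"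
  by (intro borel_measurable_continuous_onI continuous_intros)+

lemma norm_iexp: "norm (exp (\<i> * complex_of_real t)) = 1" "norm (exp (- \<i> * complex_of_real t)) = 1"
  "norm (exp (- (\<i> * complex_of_real t))) = 1"
  by (simp_all add: norm_exp_eq_Re)

lemma norm_fourier_le:
  fixes f :: "real^'n::finite \<Rightarrow> complex"
  assumes "integrable lborel f"
  shows "norm (fourier f \<xi>) \<le> ftc TYPE('n) * (\<integral>x. norm (f x) \<partial>lborel)"
proof -
  have "norm (\<integral>x. f x * exp (- \<i> * complex_of_real (x \<bullet> \<xi>)) \<partial>lborel)
     \<le> (\<integral>x. norm (f x * exp (- \<i> * complex_of_real (x \<bullet> \<xi>))) \<partial>lborel)"
    by (rule integral_norm_bound)
  also have "\<dots> = (\<integral>x. norm (f x) \<partial>lborel)" by (simp add: norm_mult norm_iexp)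
  finally show ?thesis
    unfolding fourier_eq norm_mult using ftc_pos[of "TYPE('n)"] by (simp add: mult_left_mono)
qed

lemma has_derivative_quadratic_bound:
  assumes "bounded_linear D" "\<And>h. norm (f (x + h) - f x - D h) \<le> M * (norm h)\<^sup>2"
  shows "(f has_derivative D) (at x)"
  unfolding has_derivative_at
proof (intro conjI assms(1))
  show "(\<lambda>h. norm (f (x + h) - f x - D h) / norm h) \<midarrow>0\<rightarrow> 0"
  proof (rule Lim_null_comparison)
    show "\<forall>\<^sub>F h in at 0. norm (norm (f (x + h) - f x - D h) / norm h) \<le> M * norm h"
    proof (rule eventuallyI)
      fix h
      show "norm (norm (f (x + h) - f x - D h) / norm h) \<le> M * norm h"
      proof (cases "h = 0")
        case False
        then show ?thesis using assms(2)[of h] by (simp add: pos_divide_le_eq power2_eq_square mult.assoc)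
      qed simp
    qed
    show "((\<lambda>h. M * norm h) \<longlongrightarrow> 0) (at 0)" by (auto intro!: tendsto_eq_intros)
  qed
qed

lemma norm_exp_remainder:
  "norm (exp (- \<i> * complex_of_real t) - 1 + \<i> * complex_of_real t) \<le> t\<^sup>2 / 2"
  using iexp_approx1[of "- t" 1] by (simp add: algebra_simps power2_eq_square numeral_2_eq_2)

lemma rapid_coord: "rapid f \<Longrightarrow> rapid (\<lambda>x. (- \<i> * complex_of_real (x $ i)) * f x)"
  by (rule rapid_mult[where m = 1 and C = 1])
     (auto simp: norm_mult component_le_norm_cart)

text \<open>The second-order remainder of the exponential bounds the error by |h|^2 times the
  integral of |x|^2 |f| / 2, so that no limit is interchanged with an integral.\<close>

lemma fourier_has_derivative:
  fixes f :: "real^'n::finite \<Rightarrow> complex"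
  assumes f: "rapid f"
  shows "(fourier f has_derivative
    (\<lambda>h. \<Sum>i\<in>UNIV. of_real (h $ i) * fourier (\<lambda>x. (- \<i> * complex_of_real (x $ i)) * f x) \<xi>)) (at \<xi>)"
proof (rule has_derivative_quadratic_bound)
  let ?e = "\<lambda>x \<eta>. exp (- \<i> * complex_of_real (x \<bullet> \<eta>))"
  have [measurable]: "f \<in> borel_measurable borel" by (rule rapid_measurable[OF f])
  show "bounded_linear (\<lambda>h. \<Sum>i\<in>UNIV. of_real (h $ i) * fourier (\<lambda>x. (- \<i> * complex_of_real (x $ i)) * f x) \<xi>)"
    by (intro bounded_linear_sum bounded_linear_mult_left[THEN bounded_linear_compose]
        bounded_linear_of_real[THEN bounded_linear_compose] bounded_linear_vec_nth)
  have r2: "rapid (\<lambda>x. of_real ((norm x)\<^sup>2 / 2) * f x)"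
    by (rule rapid_mult[OF f, where m = 2 and C = 1]) (auto simp: norm_power norm_divide)
  fix h
  have i0: "integrable lborel (\<lambda>x. f x * ?e x \<eta>)" for \<eta>
    by (rule integrable_mult_unimodular[OF rapid_integrable[OF f]]) (auto simp: norm_iexp)
  have i1: "integrable lborel (\<lambda>x. ((- \<i> * complex_of_real (x $ i)) * f x) * ?e x \<xi>)" for i
    by (rule integrable_mult_unimodular[OF rapid_integrable[OF rapid_coord[OF f]]]) (auto simp: norm_iexp)
  have inner: "x \<bullet> h = (\<Sum>i\<in>UNIV. x $ i * h $ i)" for x :: "real^'n" by (simp add: inner_vec_def)
  have S: "(\<Sum>i\<in>UNIV. of_real (h $ i) * (((- \<i> * complex_of_real (x $ i)) * f x) * ?e x \<xi>))
      = (- \<i> * of_real (x \<bullet> h)) * f x * ?e x \<xi>" for x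
    unfolding inner by (simp add: sum_distrib_left sum_distrib_right sum_negf mult_ac)
  have "(\<Sum>i\<in>UNIV. of_real (h $ i) * fourier (\<lambda>x. (- \<i> * complex_of_real (x $ i)) * f x) \<xi>)
     = of_real (ftc TYPE('n)) * (\<integral>x. (\<Sum>i\<in>UNIV. of_real (h $ i) * (((- \<i> * complex_of_real (x $ i)) * f x) * ?e x \<xi>)) \<partial>lborel)"
  proof -
    have "(\<integral>x. (\<Sum>i\<in>UNIV. of_real (h $ i) * (((- \<i> * complex_of_real (x $ i)) * f x) * ?e x \<xi>)) \<partial>lborel)
       = (\<Sum>i\<in>UNIV. (\<integral>x. of_real (h $ i) * (((- \<i> * complex_of_real (x $ i)) * f x) * ?e x \<xi>) \<partial>lborel))"
      by (intro Bochner_Integration.integral_sum integrable_mult_right i1)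
    also have "\<dots> = (\<Sum>i\<in>UNIV. of_real (h $ i) * (\<integral>x. ((- \<i> * complex_of_real (x $ i)) * f x) * ?e x \<xi> \<partial>lborel))"
      by (simp only: integral_mult_right_zero)
    finally show ?thesis
      unfolding fourier_eq by (simp only: sum_distrib_left mult.left_commute)
  qed
  also have "\<dots> = of_real (ftc TYPE('n)) * (\<integral>x. (- \<i> * of_real (x \<bullet> h)) * f x * ?e x \<xi> \<partial>lborel)"
    by (simp only: S)
  finally have D: "(\<Sum>i\<in>UNIV. of_real (h $ i) * fourier (\<lambda>x. (- \<i> * complex_of_real (x $ i)) * f x) \<xi>)
     = of_real (ftc TYPE('n)) * (\<integral>x. (- \<i> * of_real (x \<bullet> h)) * f x * ?e x \<xi> \<partial>lborel)" .
  have i2: "integrable lborel (\<lambda>x. (- \<i> * of_real (x \<bullet> h)) * f x * ?e x \<xi>)"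
  proof -
    have "integrable lborel (\<lambda>x. \<Sum>i\<in>UNIV. of_real (h $ i) * (((- \<i> * complex_of_real (x $ i)) * f x) * ?e x \<xi>))"
      by (intro Bochner_Integration.integrable_sum integrable_mult_right i1)
    then show ?thesis by (simp only: S)
  qed
  have eq: "f x * ?e x (\<xi> + h) - f x * ?e x \<xi> - (- \<i> * of_real (x \<bullet> h)) * f x * ?e x \<xi>
     = f x * ?e x \<xi> * (exp (- \<i> * of_real (x \<bullet> h)) - 1 + \<i> * of_real (x \<bullet> h))" for x
    by (simp add: inner_add_right exp_add[symmetric] algebra_simps)
  have "fourier f (\<xi> + h) - fourier f \<xi>
      - (\<Sum>i\<in>UNIV. of_real (h $ i) * fourier (\<lambda>x. (- \<i> * complex_of_real (x $ i)) * f x) \<xi>)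
     = of_real (ftc TYPE('n)) * ((\<integral>x. f x * ?e x (\<xi> + h) \<partial>lborel) - (\<integral>x. f x * ?e x \<xi> \<partial>lborel)
       - (\<integral>x. (- \<i> * of_real (x \<bullet> h)) * f x * ?e x \<xi> \<partial>lborel))"
    by (subst D) (simp only: fourier_eq right_diff_distrib)
  also have "(\<integral>x. f x * ?e x (\<xi> + h) \<partial>lborel) - (\<integral>x. f x * ?e x \<xi> \<partial>lborel)
       - (\<integral>x. (- \<i> * of_real (x \<bullet> h)) * f x * ?e x \<xi> \<partial>lborel)
     = (\<integral>x. f x * ?e x (\<xi> + h) - f x * ?e x \<xi> - (- \<i> * of_real (x \<bullet> h)) * f x * ?e x \<xi> \<partial>lborel)"
    by (simp only: Bochner_Integration.integral_diff Bochner_Integration.integrable_diff i0 i2)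
  also have "norm (of_real (ftc TYPE('n)) * \<dots>) \<le> ftc TYPE('n) * (\<integral>x. norm (of_real ((norm x)\<^sup>2 / 2) * f x) * (norm h)\<^sup>2 \<partial>lborel)"
  proof -
    have "norm (\<integral>x. f x * ?e x (\<xi> + h) - f x * ?e x \<xi> - (- \<i> * of_real (x \<bullet> h)) * f x * ?e x \<xi> \<partial>lborel)
       \<le> (\<integral>x. norm (of_real ((norm x)\<^sup>2 / 2) * f x) * (norm h)\<^sup>2 \<partial>lborel)"
    proof (rule Bochner_Integration.integral_norm_bound_integral)
      show "integrable lborel (\<lambda>x. f x * ?e x (\<xi> + h) - f x * ?e x \<xi> - (- \<i> * of_real (x \<bullet> h)) * f x * ?e x \<xi>)"
        by (intro Bochner_Integration.integrable_diff i0 i2)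
      show "integrable lborel (\<lambda>x. norm (of_real ((norm x)\<^sup>2 / 2) * f x) * (norm h)\<^sup>2)"
        by (intro integrable_mult_left integrable_norm rapid_integrable r2)
      fix x :: "real^'n"
      have "norm (f x * ?e x \<xi> * (exp (- \<i> * of_real (x \<bullet> h)) - 1 + \<i> * of_real (x \<bullet> h)))
         \<le> norm (f x) * ((x \<bullet> h)\<^sup>2 / 2)"
        unfolding norm_mult[of "f x * _"] norm_mult[of "f x"] norm_iexp mult_1_right
        by (intro mult_left_mono norm_exp_remainder norm_ge_zero)
      also have "\<dots> \<le> norm (f x) * ((norm x * norm h)\<^sup>2 / 2)"
        using Cauchy_Schwarz_ineq2[of x h]
        by (intro mult_left_mono divide_right_mono) (auto simp: abs_le_square_iff[symmetric])
      also have "\<dots> = norm (of_real ((norm x)\<^sup>2 / 2) * f x) * (norm h)\<^sup>2"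
        by (simp add: norm_mult norm_divide norm_power power_mult_distrib mult_ac)
      finally show "norm (f x * ?e x (\<xi> + h) - f x * ?e x \<xi> - (- \<i> * of_real (x \<bullet> h)) * f x * ?e x \<xi>)
         \<le> norm (of_real ((norm x)\<^sup>2 / 2) * f x) * (norm h)\<^sup>2"
        unfolding eq .
    qed
    then show ?thesis unfolding norm_mult using ftc_pos[of "TYPE('n)"] by (simp add: mult_left_mono)
  qed
  also have "\<dots> = (ftc TYPE('n) * (\<integral>x. norm (of_real ((norm x)\<^sup>2 / 2) * f x) \<partial>lborel)) * (norm h)\<^sup>2"
    by simp
  finally show "norm (fourier f (\<xi> + h) - fourier f \<xi>
      - (\<Sum>i\<in>UNIV. of_real (h $ i) * fourier (\<lambda>x. (- \<i> * complex_of_real (x $ i)) * f x) \<xi>))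
     \<le> (ftc TYPE('n) * (\<integral>x. norm (of_real ((norm x)\<^sup>2 / 2) * f x) \<partial>lborel)) * (norm h)\<^sup>2" .
qed

primrec xmon :: "'n list \<Rightarrow> real^'n::finite \<Rightarrow> complex" where
  "xmon [] x = 1"
| "xmon (i # is) x = of_real (x $ i) * xmon is x"

lemma norm_xmon_le: "norm (xmon is x) \<le> norm x ^ length is"
proof (induction "is")
  case (Cons i "is")
  then show ?case by (simp add: norm_mult) (intro mult_mono component_le_norm_cart; simp)
qed simp

lemma xmon_measurable [measurable]: "xmon is \<in> borel_measurable borel"
  by (induction "is") (simp_all add: fun_eq_iff)

lemma rapid_xmon: "rapid f \<Longrightarrow> rapid (\<lambda>x. c * xmon is x * f x)"
  by (rule rapid_mult[where m = "length is" and C = "norm c"])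
     (auto simp: norm_mult norm_xmon_le mult_left_mono)

lemma pdiff_fourier:
  assumes "rapid f"
  shows "pdiff i (fourier f) = fourier (\<lambda>x. (- \<i> * complex_of_real (x $ i)) * f x)"
proof
  fix \<xi>
  have "(\<Sum>j\<in>UNIV. of_real ((axis i 1 :: real^'a) $ j) * fourier (\<lambda>x. (- \<i> * complex_of_real (x $ j)) * f x) \<xi>)
     = (\<Sum>j\<in>UNIV. if j = i then fourier (\<lambda>x. (- \<i> * complex_of_real (x $ j)) * f x) \<xi> else 0)"
    by (intro sum.cong) (auto simp: axis_def)
  then show "pdiff i (fourier f) \<xi> = fourier (\<lambda>x. (- \<i> * complex_of_real (x $ i)) * f x) \<xi>"
    using pdiff_eqI[OF fourier_has_derivative[OF assms]] by simp
qed

lemma iter_pdiff_fourier: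
  assumes "rapid f"
  shows "iter_pdiff is (fourier f) = fourier (\<lambda>x. (- \<i>) ^ length is * xmon is x * f x)"
proof (induction "is")
  case (Cons i "is")
  have "pdiff i (fourier (\<lambda>x. (- \<i>) ^ length is * xmon is x * f x))
     = fourier (\<lambda>x. (- \<i> * complex_of_real (x $ i)) * ((- \<i>) ^ length is * xmon is x * f x))"
    by (rule pdiff_fourier[OF rapid_xmon[OF assms]])
  also have "(\<lambda>x. (- \<i> * complex_of_real (x $ i)) * ((- \<i>) ^ length is * xmon is x * f x))
     = (\<lambda>x. (- \<i>) ^ length (i # is) * xmon (i # is) x * f x)"
    by (simp add: fun_eq_iff mult_ac)
  finally show ?case by (simp add: iter_pdiff_Cons Cons.IH)
qed simp

lemma smooth_fourier: "rapid f \<Longrightarrow> smooth_fun (fourier f)"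
  unfolding smooth_fun_def iter_pdiff_fourier
  by (intro allI differentiableI[OF fourier_has_derivative] rapid_xmon)

text \<open>The integral of f(x + e) - f(x) vanishes by translation invariance. By the fundamental
  theorem it is also the mean over t in [0, 1] of the integrals of the derivative shifted by t e,
  which are all equal.\<close>

lemma integral_pdiff_eq_0:
  fixes f :: "real^'n::finite \<Rightarrow> complex"
  assumes d: "\<And>x. f differentiable at x" and c: "continuous_on UNIV (pdiff i f)"
    and int: "integrable lborel f" "integrable lborel (pdiff i f)"
  shows "(\<integral>x. pdiff i f x \<partial>lborel) = 0"
proof -
  define e :: "real^'n" where "e = axis i 1"
  define g where "g = pdiff i f"
  have cg: "continuous_on UNIV g" using c by (simp add: g_def)
  have mg [measurable]: "g \<in> borel_measurable borel"
    by (intro borel_measurable_continuous_onI cg)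
  have mf: "f \<in> borel_measurable borel" using int(1) by auto
  have D: "((\<lambda>t. f (x + t *\<^sub>R e)) has_vector_derivative g (x + t *\<^sub>R e)) (at t within {0..1})" for x t
  proof -
    have "(f has_derivative frechet_derivative f (at (x + t *\<^sub>R e))) (at (x + t *\<^sub>R e))"
      by (rule differentiable_has_derivative[OF d])
    moreover have "((\<lambda>t. x + t *\<^sub>R e) has_derivative (\<lambda>t. t *\<^sub>R e)) (at t within {0..1})"
      by (auto intro!: derivative_eq_intros)
    ultimately have "((\<lambda>t. f (x + t *\<^sub>R e)) has_derivative
        (\<lambda>s. frechet_derivative f (at (x + t *\<^sub>R e)) (s *\<^sub>R e))) (at t within {0..1})"
      by (rule has_derivative_compose[rotated])
    moreover have "frechet_derivative f (at (x + t *\<^sub>R e)) (s *\<^sub>R e) = s *\<^sub>R g (x + t *\<^sub>R e)" for s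
      using linear_cmul[OF linear_frechet_derivative[OF d]] by (simp add: g_def pdiff_def e_def)
    ultimately show ?thesis by (simp add: has_vector_derivative_def)
  qed
  have F: "(\<integral>t. indicator {0..1} t *\<^sub>R g (x + t *\<^sub>R e) \<partial>lborel) = f (x + e) - f x" for x
    using integral_FTC_Icc[OF zero_le_one D[of x]] 
      continuous_on_compose2[OF cg, of "{0..1}" "\<lambda>t. x + t *\<^sub>R e"]
    by (simp add: continuous_intros)
  have m2: "(\<lambda>(x, t). indicator {0..1::real} t *\<^sub>R g (x + t *\<^sub>R e)) \<in> borel_measurable (lborel \<Otimes>\<^sub>M lborel)"
    by measurable
  have N: "(\<integral>\<^sup>+x. ennreal (norm (g x)) \<partial>lborel) < \<infinity>"
    using int(2) by (simp add: g_def integrable_iff_bounded)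
  have "(\<integral>\<^sup>+x. (\<integral>\<^sup>+t. ennreal (norm (indicator {0..1::real} t *\<^sub>R g (x + t *\<^sub>R e))) \<partial>lborel) \<partial>lborel)
     = (\<integral>\<^sup>+t. (\<integral>\<^sup>+x. ennreal (norm (indicator {0..1::real} t *\<^sub>R g (x + t *\<^sub>R e))) \<partial>lborel) \<partial>lborel)"
    by (rule lborel_pair.Fubini') measurable
  also have "\<dots> = (\<integral>\<^sup>+t. indicator {0..1::real} t * (\<integral>\<^sup>+x. ennreal (norm (g x)) \<partial>lborel) \<partial>lborel)"
  proof (intro nn_integral_cong)
    fix t :: real
    have "(\<integral>\<^sup>+x. ennreal (norm (indicator {0..1::real} t *\<^sub>R g (x + t *\<^sub>R e))) \<partial>lborel)
      = (\<integral>\<^sup>+x. indicator {0..1::real} t * ennreal (norm (g (x + t *\<^sub>R e))) \<partial>lborel)"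
      by (intro nn_integral_cong) (auto split: split_indicator)
    also have "\<dots> = indicator {0..1::real} t * (\<integral>\<^sup>+x. ennreal (norm (g (x + t *\<^sub>R e))) \<partial>lborel)"
      by (rule nn_integral_cmult) measurable
    also have "(\<integral>\<^sup>+x. ennreal (norm (g (x + t *\<^sub>R e))) \<partial>lborel) = (\<integral>\<^sup>+x. ennreal (norm (g x)) \<partial>lborel)"
      by (rule nn_integral_lborel_shift(2)[of "\<lambda>x. ennreal (norm (g x))"]) measurable
    finally show "(\<integral>\<^sup>+x. ennreal (norm (indicator {0..1::real} t *\<^sub>R g (x + t *\<^sub>R e))) \<partial>lborel)
       = indicator {0..1::real} t * (\<integral>\<^sup>+x. ennreal (norm (g x)) \<partial>lborel)" .
  qed
  also have "\<dots> = (\<integral>\<^sup>+x. ennreal (norm (g x)) \<partial>lborel)"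
    by (subst nn_integral_multc) auto
  finally have fin: "(\<integral>\<^sup>+x. (\<integral>\<^sup>+t. ennreal (norm (indicator {0..1::real} t *\<^sub>R g (x + t *\<^sub>R e))) \<partial>lborel) \<partial>lborel) < \<infinity>"
    using N by simp
  have "0 = (\<integral>x. f (x + e) \<partial>lborel) - (\<integral>x. f x \<partial>lborel)"
    using integral_lborel_shift(2)[OF mf] by simp
  also have "\<dots> = (\<integral>x. f (x + e) - f x \<partial>lborel)"
    by (rule Bochner_Integration.integral_diff[symmetric]) (intro int integrable_lborel_shift)+
  also have "\<dots> = (\<integral>x. (\<integral>t. indicator {0..1::real} t *\<^sub>R g (x + t *\<^sub>R e) \<partial>lborel) \<partial>lborel)"
    by (simp only: F)
  also have "\<dots> = (\<integral>t. (\<integral>x. indicator {0..1::real} t *\<^sub>R g (x + t *\<^sub>R e) \<partial>lborel) \<partial>lborel)"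
    by (rule fubini_swap(1)[OF m2 fin])
  also have "\<dots> = (\<integral>t. indicator {0..1::real} t *\<^sub>R (\<integral>x. g x \<partial>lborel) \<partial>lborel)"
    by (simp add: integral_lborel_shift(2)[OF mg])
  also have "\<dots> = (\<integral>x. g x \<partial>lborel)" by simp
  finally show ?thesis by (simp add: g_def)
qed

text \<open>Integration by parts: \<open>integral_pdiff_eq_0\<close> applied to the product of f
  with the character of frequency \<xi>.\<close>

lemma fourier_pdiff:
  fixes f :: "real^'n::finite \<Rightarrow> complex"
  assumes sm: "smooth_fun f" and int: "integrable lborel f" "integrable lborel (pdiff i f)"
  shows "fourier (pdiff i f) \<xi> = \<i> * of_real (\<xi> $ i) * fourier f \<xi>"
proof -
  define e where "e x = exp (- \<i> * complex_of_real (x \<bullet> \<xi>))" for x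
  have De: "(e has_derivative (\<lambda>h. - \<i> * of_real (h \<bullet> \<xi>) * e x)) (at x)" for x
  proof -
    have "((\<lambda>x. - \<i> * complex_of_real (x \<bullet> \<xi>)) has_derivative (\<lambda>h. - \<i> * complex_of_real (h \<bullet> \<xi>))) (at x)"
      by (intro bounded_linear_imp_has_derivative bounded_linear_mult_right[THEN bounded_linear_compose]
          bounded_linear_of_real[THEN bounded_linear_compose] bounded_linear_inner_left)
    from has_derivative_compose[OF this DERIV_exp[unfolded has_field_derivative_def]]
    show ?thesis unfolding e_def [abs_def] by (simp add: mult_ac)
  qed
  have de: "e differentiable at x" for x using De by (rule differentiableI)
  have pe: "pdiff i e = (\<lambda>x. - \<i> * of_real (\<xi> $ i) * e x)"
    using pdiff_eqI[OF De] by (auto simp: inner_axis')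
  have ce: "continuous_on UNIV e" unfolding e_def [abs_def] by (intro continuous_intros)
  have me: "e \<in> borel_measurable borel" by (rule borel_measurable_continuous_onI[OF ce])
  have ne: "norm (e x) \<le> 1" for x by (simp add: e_def norm_iexp)
  note df = smooth_fun_differentiable[OF sm]
  have P: "pdiff i (\<lambda>x. f x * e x) = (\<lambda>x. pdiff i f x * e x + (- \<i> * of_real (\<xi> $ i)) * (f x * e x))"
    unfolding pdiff_mult[OF df de] pe by (simp add: algebra_simps)
  have i1: "integrable lborel (\<lambda>x. f x * e x)" and i2: "integrable lborel (\<lambda>x. pdiff i f x * e x)"
    by (intro integrable_mult_unimodular int me ne)+
  have "(\<integral>x. pdiff i (\<lambda>x. f x * e x) x \<partial>lborel) = 0"
  proof (rule integral_pdiff_eq_0)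
    show "continuous_on UNIV (pdiff i (\<lambda>x. f x * e x))"
      unfolding P by (intro continuous_intros ce smooth_fun_continuous smooth_fun_pdiff sm)
    show "integrable lborel (pdiff i (\<lambda>x. f x * e x))"
      unfolding P by (intro Bochner_Integration.integrable_add integrable_mult_right i1 i2)
    show "(\<lambda>x. f x * e x) differentiable at x" for x by (intro differentiable_mult df de)
  qed (rule i1)
  then have "(\<integral>x. pdiff i f x * e x \<partial>lborel) + (- \<i> * of_real (\<xi> $ i)) * (\<integral>x. f x * e x \<partial>lborel) = 0"
    unfolding P using i1 i2 by (subst (asm) Bochner_Integration.integral_add) auto
  then have "(\<integral>x. pdiff i f x * e x \<partial>lborel) = \<i> * of_real (\<xi> $ i) * (\<integral>x. f x * e x \<partial>lborel)"
    by (simp add: algebra_simps)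
  then show ?thesis unfolding fourier_eq e_def by simp
qed

lemma norm_fourier_iter_pdiff:
  fixes f :: "real^'n::finite \<Rightarrow> complex"
  assumes sm: "smooth_fun f" and "\<And>m. integrable lborel (iter_pdiff (replicate m i) f)"
  shows "norm (fourier (iter_pdiff (replicate k i) f) \<xi>) = \<bar>\<xi> $ i\<bar> ^ k * norm (fourier f \<xi>)"
proof (induction k)
  case (Suc k)
  have "fourier (pdiff i (iter_pdiff (replicate k i) f)) \<xi>
      = \<i> * of_real (\<xi> $ i) * fourier (iter_pdiff (replicate k i) f) \<xi>"
    using assms(2)[of "Suc k"]
    by (intro fourier_pdiff smooth_fun_iter_pdiff sm assms(2)) (simp add: iter_pdiff_Cons)
  then show ?case by (simp add: iter_pdiff_Cons norm_mult Suc.IH)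
qed simp

lemma pdiff_coord:
  "pdiff j (\<lambda>x :: real^'n::finite. complex_of_real (x $ i)) = (\<lambda>x. if i = j then 1 else 0)"
proof
  fix x :: "real^'n"
  have "((\<lambda>x :: real^'n. complex_of_real (x $ i)) has_derivative (\<lambda>h. complex_of_real (h $ i))) (at x)"
    by (intro bounded_linear_imp_has_derivative bounded_linear_of_real[THEN bounded_linear_compose]
        bounded_linear_vec_nth)
  from pdiff_eqI[OF this] show "pdiff j (\<lambda>x :: real^'n. complex_of_real (x $ i)) x = (if i = j then 1 else 0)"
    by (simp add: axis_def)
qed

lemma differentiable_coord: "(\<lambda>x :: real^'n::finite. complex_of_real (x $ i)) differentiable at x"
  by (intro differentiableI[where f' = "\<lambda>h. complex_of_real (h $ i)"] bounded_linear_imp_has_derivative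
      bounded_linear_of_real[THEN bounded_linear_compose] bounded_linear_vec_nth)

lemma smooth_coord: "smooth_fun (\<lambda>x :: real^'n::finite. complex_of_real (x $ i))"
  unfolding smooth_fun_iff
proof
  fix m show "smooth_upto m (\<lambda>x :: real^'n. complex_of_real (x $ i))"
    by (cases m) (simp_all add: differentiable_coord pdiff_coord smooth_upto_const)
qed

lemma norm_iter_pdiff_coord:
  "norm (iter_pdiff js (\<lambda>x :: real^'n::finite. complex_of_real (x $ i)) x)
    \<le> (if length js = 0 then norm x else if length js = 1 then 1 else 0)"
proof (cases js rule: rev_cases)
  case Nil
  then show ?thesis by (simp add: component_le_norm_cart)
next
  case (snoc ks j)
  then show ?thesis by (simp add: iter_pdiff_snoc pdiff_coord iter_pdiff_const)
qed

lemma smooth_xmon: "smooth_fun (xmon is)"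
proof -
  have "smooth_fun (\<lambda>x. xmon is x)"
    by (induction "is") (auto intro!: smooth_fun_const smooth_fun_mult smooth_coord)
  then show ?thesis by simp
qed

text \<open>The j-th derivative of a one-variable monomial of degree r at X. It dominates every
  derivative of order j of a monomial of total degree r at a point of norm X.\<close>

definition monb :: "nat \<Rightarrow> real \<Rightarrow> nat \<Rightarrow> real" where
  "monb r X j = (if j \<le> r then fact r / fact (r - j) * X ^ (r - j) else 0)"

text \<open>One more coordinate factor has only a value and a first derivative, so two Leibniz terms
  remain; they combine through r + 1 = (r + 1 - m) + m.\<close>

lemma monb_rec:
  assumes "X \<ge> 0"
  shows "binom_conv m (\<lambda>j. if j = 0 then X else if j = 1 then 1 else 0) (monb r X) \<le> monb (Suc r) X m"
proof -
  let ?P = "\<lambda>j::nat. if j = 0 then X else if j = 1 then 1 else 0"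
  show ?thesis
  proof (cases m)
    case 0
    then show ?thesis by (simp add: binom_conv_def monb_def)
  next
    case (Suc m')
    have "binom_conv m ?P (monb r X) = (\<Sum>j\<in>{0, 1}. real (m choose j) * ?P j * monb r X (m - j))"
      unfolding binom_conv_def by (rule sum.mono_neutral_right) (auto simp: Suc)
    also have "\<dots> = X * monb r X m + real m * monb r X (m - 1)" by simp
    also have "\<dots> = monb (Suc r) X m"
    proof -
      consider "m \<le> r" | "m = Suc r" | "m > Suc r" by linarith
      then show ?thesis
      proof cases
        case 1
        define d where "d = r - m"
        have r: "r = m + d" using 1 by (simp add: d_def)
        have "real (fact (m + d)) / fact d * X ^ d * X + real m * (fact (m + d) / fact (Suc d) * X ^ Suc d)
           = fact (Suc (m + d)) / fact (Suc d) * X ^ Suc d"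
        proof -
          have gen: "a / b * X ^ d * X + real m * (a / (y * b) * X ^ Suc d) = (real m + y) * a / (y * b) * X ^ Suc d"
            if "b \<noteq> 0" "y \<noteq> 0" for a b y :: real
            using that by (simp add: field_simps)
          show ?thesis
            using gen[of "fact d" "real (Suc d)" "fact (m + d)"] by (simp add: add_ac)
        qed
        then show ?thesis
          using Suc by (simp add: monb_def r Suc_diff_le algebra_simps)
      qed (use Suc in \<open>auto simp: monb_def\<close>)
    qed
    finally show ?thesis by simp
  qed
qed

lemma norm_iter_pdiff_xmon: "norm (iter_pdiff js (xmon is) x) \<le> monb (length is) (norm x) (length js)"
proof (induction "is" arbitrary: js)
  case Nil
  have "xmon [] = (\<lambda>x. 1 :: complex)" by (rule ext) simp
  then show ?case by (auto simp: iter_pdiff_const monb_def)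
next
  case (Cons i "is")
  have "xmon (i # is) = (\<lambda>x. complex_of_real (x $ i) * xmon is x)" by (rule ext) simp
  then have "norm (iter_pdiff js (xmon (i # is)) x)
      \<le> binom_conv (length js) (\<lambda>j. if j = 0 then norm x else if j = 1 then 1 else 0) (monb (length is) (norm x))"
    by (simp only:, intro leibniz_bound[where I = UNIV] smooth_coord smooth_xmon norm_iter_pdiff_coord
        Cons.IH subset_UNIV)
  also have "\<dots> \<le> monb (Suc (length is)) (norm x) (length js)" by (rule monb_rec) simp
  finally show ?case by (simp only: list.size add_0_right add_Suc_right)
qed

text \<open>The quotient of factorials is at least 1 and hence at most its own s-th power.\<close>

lemma gfact_ratio:
  assumes "1 \<le> s" "j \<le> r"
  shows "fact r / fact (r - j) * gfact s (r - j) \<le> gfact s r"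
proof -
  have "(fact (r - j) :: real) \<le> fact r" by (intro fact_mono) auto
  then have 1: "1 \<le> (fact r / fact (r - j) :: real)" by simp
  have "fact r / fact (r - j) * gfact s (r - j) \<le> (fact r / fact (r - j)) powr s * gfact s (r - j)"
    using powr_mono[OF assms(1) 1] by (intro mult_right_mono) auto
  also have "\<dots> = gfact s r" by (simp add: gfact_def powr_divide)
  finally show ?thesis .
qed

text \<open>All derivatives go in one direction \<open>i\<close>, so that only pure derivatives of f
  occur, while the monomial is arbitrary. The weight of exponent at most \<open>K\<close> is a fixed
  extra decay for integrability; its cost stays in a factor depending on \<open>K\<close>, and the
  new scale carries only the exponent r + m.\<close>

lemma xmon_mult_bound:
  fixes f :: "real^'n::finite \<Rightarrow> complex" and "is" :: "'n list"
  assumes f: "gsb pure_lists s A h f" and s: "1 \<le> s" and h: "1 \<le> h" and A: "0 \<le> A" and k: "k \<le> K"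
  defines "r \<equiv> length is"
  shows "norm x ^ k * norm (iter_pdiff (replicate m i) (\<lambda>x. xmon is x * f x) x)
    \<le> A * (h ^ K * (2 powr s) ^ K * gfact s K) * (2 * h * 2 powr s) ^ (r + m) * (gfact s r * gfact s m)"
proof -
  define X where "X = norm x"
  define N where "N j = norm (iter_pdiff (replicate j i) f x)" for j
  define z where "z = h * 2 powr s"
  define T where "T = A * (z ^ (K + (r + m)) * gfact s K) * (gfact s r * gfact s m)"
  have X: "X \<ge> 0" by (simp add: X_def)
  have ps: "1 \<le> 2 powr s" using s by (intro ge_one_powr_ge_zero) auto
  have T: "T \<ge> 0" using A h by (simp add: T_def z_def)
  have fb: "X ^ k * N j \<le> A * h ^ (k + j) * (gfact s k * gfact s j)" for k j
    using gsbD[OF f, of "replicate j i" x k] by (auto simp: X_def N_def pure_lists_def)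
  have "norm (iter_pdiff (replicate m i) (\<lambda>x. xmon is x * f x) x) \<le> binom_conv (length (replicate m i)) (monb r X) N"
  proof (rule leibniz_bound[where I = "{i}"])
    fix js :: "'n list" assume "set js \<subseteq> {i}"
    then have "js = replicate (length js) i" by (metis replicate_eqI singletonD subset_iff)
    then show "norm (iter_pdiff js f x) \<le> N (length js)" unfolding N_def by (metis order_refl)
    show "norm (iter_pdiff js (xmon is) x) \<le> monb r X (length js)"
      unfolding r_def X_def by (rule norm_iter_pdiff_xmon)
  qed (auto intro: smooth_xmon gsb_smooth[OF f])
  then have "X ^ k * norm (iter_pdiff (replicate m i) (\<lambda>x. xmon is x * f x) x) \<le> X ^ k * binom_conv m (monb r X) N"
    using X by (intro mult_left_mono) auto
  also have "\<dots> = (\<Sum>j\<le>m. X ^ k * (real (m choose j) * monb r X j * N (m - j)))"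
    by (simp add: binom_conv_def sum_distrib_left)
  also have "\<dots> \<le> (\<Sum>j\<le>m. T)"
  proof (rule sum_mono)
    fix j assume "j \<in> {..m}"
    then have jm: "j \<le> m" by simp
    show "X ^ k * (real (m choose j) * monb r X j * N (m - j)) \<le> T"
    proof (cases "j \<le> r")
      case False
      then show ?thesis using T by (simp add: monb_def)
    next
      case True
      have "X ^ k * (real (m choose j) * monb r X j * N (m - j))
        = real (m choose j) * (fact r / fact (r - j)) * (X ^ (k + (r - j)) * N (m - j))"
        using True unfolding monb_def power_add by simp
      also have "\<dots> \<le> real (m choose j) * (fact r / fact (r - j)) *
          (A * h ^ (k + (r - j) + (m - j)) * (gfact s (k + (r - j)) * gfact s (m - j)))"
        by (intro mult_left_mono fb) auto
      also have "\<dots> \<le> real (m choose j) * (fact r / fact (r - j)) *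
          (A * h ^ (K + (r + m)) * (((2 powr s) ^ (K + (r + m)) * gfact s K * gfact s (r - j)) * gfact s (m - j)))"
      proof (intro mult_left_mono mult_mono)
        show "h ^ (k + (r - j) + (m - j)) \<le> h ^ (K + (r + m))"
          using h k by (intro power_increasing) auto
        have "gfact s (k + (r - j)) \<le> (2 powr s) ^ (k + (r - j)) * gfact s k * gfact s (r - j)"
          using s by (intro gfact_add_le) auto
        also have "\<dots> \<le> (2 powr s) ^ (K + (r + m)) * gfact s K * gfact s (r - j)"
          using ps k s by (intro mult_right_mono mult_mono power_increasing gfact_mono) auto
        finally show "gfact s (k + (r - j)) \<le> (2 powr s) ^ (K + (r + m)) * gfact s K * gfact s (r - j)" .
      qed (use A h in auto)
      also have "\<dots> = A * (z ^ (K + (r + m)) * gfact s K) *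
          ((fact r / fact (r - j) * gfact s (r - j)) * (real (m choose j) * 1 * gfact s (m - j)))"
        by (simp add: z_def power_mult_distrib mult_ac)
      also have "\<dots> \<le> T"
        unfolding T_def
      proof (intro mult_left_mono mult_mono)
        show "fact r / fact (r - j) * gfact s (r - j) \<le> gfact s r"
          by (rule gfact_ratio[OF s True])
        have "real (m choose j) * 1 * gfact s (m - j) \<le> real (m choose j) * gfact s j * gfact s (m - j)"
          using s by (intro mult_right_mono mult_left_mono gfact_ge_1) auto
        also have "\<dots> \<le> gfact s m" by (rule gfact_binomial[OF s jm])
        finally show "real (m choose j) * 1 * gfact s (m - j) \<le> gfact s m" .
      qed (use A h in \<open>auto simp: z_def\<close>)
      finally show ?thesis .
    qed
  qed
  also have "\<dots> = real (Suc m) * T" by simp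
  also have "\<dots> \<le> 2 ^ (r + m) * T"
  proof (intro mult_right_mono T)
    have "Suc m \<le> 2 ^ m" by (simp add: Suc_le_eq)
    then have "real (Suc m) \<le> 2 ^ m" by (metis of_nat_le_iff of_nat_numeral of_nat_power)
    also have "(2::real) ^ m \<le> 2 ^ (r + m)" by (intro power_increasing) auto
    finally show "real (Suc m) \<le> 2 ^ (r + m)" .
  qed
  also have "\<dots> = A * (h ^ K * (2 powr s) ^ K * gfact s K) * (2 * h * 2 powr s) ^ (r + m) * (gfact s r * gfact s m)"
    unfolding T_def z_def by (simp only: power_mult_distrib power_add mult_ac)
  finally show ?thesis by (simp add: X_def)
qed

lemma fourier_cmult: "fourier (\<lambda>x. c * f x) \<xi> = c * fourier f \<xi>"
  by (simp add: fourier_eq mult.assoc)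

text \<open>Derivatives of the transform become the monomial \<open>xmon is\<close>; a power of
  |\<xi>| is reduced to a power of a dominating coordinate and becomes a pure derivative of
  \<open>xmon is x * f x\<close>. The constants do not depend on A or f, so that a small A gives a
  small transform.\<close>

lemma fourier_gsb:
  assumes s: "1 \<le> s" and h: "1 \<le> h"
  shows "\<exists>C h'. 0 \<le> C \<and> 1 \<le> h' \<and> (\<forall>A f. 0 \<le> A \<longrightarrow> gsb pure_lists s A h f \<longrightarrow>
    gsb UNIV s (C * A) h' (fourier (f :: real^'n::finite \<Rightarrow> complex)))"
proof -
  let ?n = "CARD('n)"
  define \<Omega> where "\<Omega> = (\<integral>x. omega x \<partial>(lborel :: (real^'n) measure))"
  have \<Omega>: "\<Omega> \<ge> 0" unfolding \<Omega>_def by (rule Bochner_Integration.integral_nonneg) simp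
  define K where "K = 2 * ?n"
  define E where "E = h ^ K * (2 powr s) ^ K * gfact s K"
  have E: "E \<ge> 0" using h by (simp add: E_def)
  define z where "z = 2 * h * 2 powr s"
  have ps: "1 \<le> 2 powr s" using s by (intro ge_one_powr_ge_zero) auto
  have n1: "1 \<le> real ?n" by (simp add: Suc_le_eq)
  have z: "1 \<le> z" using mult_mono[OF h ps] h by (simp add: z_def)
  define C where "C = ftc TYPE('n) * 2 ^ (?n + 1) * E * \<Omega>"
  define h' where "h' = real ?n * z"
  have C: "C \<ge> 0" using E \<Omega> ftc_pos[of "TYPE('n)"] by (simp add: C_def)
  have h': "1 \<le> h'" using mult_mono[OF n1 z] by (simp add: h'_def)
  have "gsb UNIV s (C * A) h' (fourier f)" if A: "0 \<le> A" and f: "gsb pure_lists s A h f" for A and f :: "real^'n \<Rightarrow> complex"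
    unfolding gsb_def
  proof (intro conjI allI ballI)
    note rf = gsb_rapid[OF f Nil_pure]
    show "smooth_fun (fourier f)" by (rule smooth_fourier[OF rf])
    fix m and \<xi> :: "real^'n" and "is" :: "'n list"
    define r where "r = length is"
    define D where "D = A * E * z ^ (r + m) * (gfact s r * gfact s m)"
    define g where "g = (\<lambda>x. xmon is x * f x)"
    have sg: "smooth_fun g" unfolding g_def by (intro smooth_fun_mult smooth_xmon gsb_smooth[OF f])
    obtain i where i: "norm \<xi> \<le> real ?n * \<bar>\<xi> $ i\<bar>" using norm_le_card_max_coord .
    have gb: "norm (iter_pdiff (replicate j i) g x) \<le>
        2 ^ (?n + 1) * (A * E * z ^ (r + j) * (gfact s r * gfact s j)) * omega x" for j x
    proof (rule weight_bound)
      show "norm (iter_pdiff (replicate j i) g x) \<le> A * E * z ^ (r + j) * (gfact s r * gfact s j)"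
        using xmon_mult_bound[OF f s h A, of 0 K x j i "is"] by (simp add: E_def z_def r_def g_def)
      show "norm x ^ (2 * ?n) * norm (iter_pdiff (replicate j i) g x) \<le> A * E * z ^ (r + j) * (gfact s r * gfact s j)"
        using xmon_mult_bound[OF f s h A, of "2 * ?n" K x j i "is"] by (simp add: E_def z_def r_def g_def K_def)
    qed simp
    have mg: "iter_pdiff (replicate j i) g \<in> borel_measurable borel" for j
      by (intro borel_measurable_continuous_onI smooth_fun_continuous smooth_fun_iter_pdiff sg)
    have ig: "integrable lborel (iter_pdiff (replicate j i) g)" for j
      by (rule integrable_omega_bound[OF mg gb])
    have "(\<lambda>x. (- \<i>) ^ r * xmon is x * f x) = (\<lambda>x. (- \<i>) ^ r * g x)" by (simp add: g_def mult_ac)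
    then have "norm (iter_pdiff is (fourier f) \<xi>) = norm (fourier g \<xi>)"
      unfolding iter_pdiff_fourier[OF rf] r_def[symmetric] by (simp add: fourier_cmult norm_mult norm_power)
    then have "norm \<xi> ^ m * norm (iter_pdiff is (fourier f) \<xi>) \<le> (real ?n * \<bar>\<xi> $ i\<bar>) ^ m * norm (fourier g \<xi>)"
      using i by (simp add: mult_right_mono power_mono)
    also have "\<dots> = real ?n ^ m * norm (fourier (iter_pdiff (replicate m i) g) \<xi>)"
      by (simp add: norm_fourier_iter_pdiff[OF sg ig] power_mult_distrib)
    also have "\<dots> \<le> real ?n ^ (m + r) * (ftc TYPE('n) * (\<integral>x. norm (iter_pdiff (replicate m i) g x) \<partial>lborel))"
      using n1 by (intro mult_mono norm_fourier_le ig power_increasing) auto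
    also have "\<dots> \<le> real ?n ^ (m + r) * (ftc TYPE('n) * (2 ^ (?n + 1) * D * \<Omega>))"
      using integral_omega_bound[OF mg gb, of m] ftc_pos[of "TYPE('n)"]
      by (intro mult_left_mono) (auto simp: D_def \<Omega>_def)
    also have "\<dots> = C * A * h' ^ (m + length is) * (gfact s m * gfact s (length is))"
      unfolding C_def D_def h'_def r_def by (simp add: power_add power_mult_distrib mult_ac)
    finally show "norm \<xi> ^ m * norm (iter_pdiff is (fourier f) \<xi>)
      \<le> C * A * h' ^ (m + length is) * (gfact s m * gfact s (length is))" .
  qed
  then show ?thesis using C h' by blast
qed

lemma inv_fourier_gsb:
  assumes s: "1 \<le> s" and h: "1 \<le> h"
  shows "\<exists>C h'. 0 \<le> C \<and> 1 \<le> h' \<and> (\<forall>A f. 0 \<le> A \<longrightarrow> gsb pure_lists s A h f \<longrightarrow>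
    gsb UNIV s (C * A) h' (inv_fourier (f :: real^'n::finite \<Rightarrow> complex)))"
proof -
  obtain C h' where C: "0 \<le> C" "1 \<le> h'"
    and F: "\<And>A f. 0 \<le> A \<Longrightarrow> gsb pure_lists s A h f \<Longrightarrow> gsb UNIV s (C * A) h' (fourier (f :: real^'n \<Rightarrow> complex))"
    using fourier_gsb[OF s h, where 'n = 'n] by blast
  have "gsb UNIV s (2 * C * A) (8 * h') (inv_fourier f)" if "0 \<le> A" "gsb pure_lists s A h f" for A and f :: "real^'n \<Rightarrow> complex"
  proof -
    \<comment> \<open>Reflection is the affine map with c = -1 and a = 0; it costs 2 in the constant
      and 2 * 2 * 2 = 8 in the scale.\<close>
    have "gsb UNIV s (2 * (C * A)) (2 * (1 + 1 / \<bar>- 1\<bar>) * (1 + \<bar>- 1\<bar>) * (h' + norm (0 :: real^'n)))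
        (\<lambda>x. fourier f (- 1 *\<^sub>R x + 0))"
      by (rule gsb_affine[OF F[OF that]]) (use s C that in auto)
    moreover have "(\<lambda>x. fourier f (- 1 *\<^sub>R x + 0)) = inv_fourier f"
      by (simp add: inv_fourier_conv_fourier fun_eq_iff)
    ultimately show ?thesis by (simp add: mult.assoc)
  qed
  then show ?thesis using C by (intro exI[of _ "2 * C"] exI[of _ "8 * h'"]) auto
qed

section \<open>Fourier inversion\<close>

text \<open>The characteristic function of the standard normal distribution, with the normalisation
  removed.\<close>

lemma gauss_fourier_1:
  "(\<integral>t. exp (\<i> * complex_of_real (t * y)) * complex_of_real (exp (- t\<^sup>2 / 2)) \<partial>lborel)
    = complex_of_real (sqrt (2 * pi) * exp (- y\<^sup>2 / 2))"
proof -
  have "char std_normal_distribution y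
     = (\<integral>t. std_normal_density t *\<^sub>R exp (\<i> * complex_of_real (y * t)) \<partial>lborel)"
    unfolding char_def by (subst integral_density) (auto simp: normal_density_nonneg)
  also have "\<dots> = (\<integral>t. complex_of_real (1 / sqrt (2 * pi)) *
      (exp (\<i> * complex_of_real (t * y)) * complex_of_real (exp (- t\<^sup>2 / 2))) \<partial>lborel)"
    by (intro Bochner_Integration.integral_cong) (auto simp: std_normal_density_def scaleR_conv_of_real mult_ac)
  also have "\<dots> = complex_of_real (1 / sqrt (2 * pi)) *
      (\<integral>t. exp (\<i> * complex_of_real (t * y)) * complex_of_real (exp (- t\<^sup>2 / 2)) \<partial>lborel)"
    by (rule integral_mult_right_zero)
  finally have "complex_of_real (exp (- y\<^sup>2 / 2)) = complex_of_real (1 / sqrt (2 * pi)) *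
      (\<integral>t. exp (\<i> * complex_of_real (t * y)) * complex_of_real (exp (- t\<^sup>2 / 2)) \<partial>lborel)"
    by (simp add: char_std_normal_distribution)
  then have "complex_of_real (sqrt (2 * pi)) * complex_of_real (exp (- y\<^sup>2 / 2)) = 
     complex_of_real (sqrt (2 * pi) * (1 / sqrt (2 * pi))) *
      (\<integral>t. exp (\<i> * complex_of_real (t * y)) * complex_of_real (exp (- t\<^sup>2 / 2)) \<partial>lborel)"
    by simp
  also have "sqrt (2 * pi) * (1 / sqrt (2 * pi)) = 1" by simp
  finally show ?thesis by simp
qed

lemma integrable_gauss_1: "integrable lborel (\<lambda>t. exp (\<i> * complex_of_real (t * y)) * complex_of_real (exp (- t\<^sup>2 / 2)))"
proof -
  have "integrable lborel (\<lambda>t. complex_of_real (sqrt (2 * pi) * std_normal_density t))"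
    by (intro integrable_of_real integrable_mult_right integrable_normal_density) auto
  then have "integrable lborel (\<lambda>t. complex_of_real (exp (- t\<^sup>2 / 2)))"
    by (simp add: std_normal_density_def)
  from integrable_mult_unimodular[OF this, of "\<lambda>t. exp (\<i> * complex_of_real (t * y))"]
  show ?thesis by (simp add: norm_iexp mult.commute)
qed

lemma exp_norm_prod:
  fixes x :: "real^'n::finite"
  shows "exp (\<i> * complex_of_real (x \<bullet> \<xi>)) * complex_of_real (exp (- (norm x)\<^sup>2 / 2))
    = (\<Prod>i\<in>UNIV. exp (\<i> * complex_of_real (x $ i * \<xi> $ i)) * complex_of_real (exp (- (x $ i)\<^sup>2 / 2)))"
proof -
  have "(norm x)\<^sup>2 = (\<Sum>i\<in>UNIV. (x $ i)\<^sup>2)"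
    unfolding power2_norm_eq_inner inner_vec_def by (simp add: power2_eq_square)
  then have "exp (- (norm x)\<^sup>2 / 2) = (\<Prod>i\<in>UNIV. exp (- (x $ i)\<^sup>2 / 2))"
    by (simp add: exp_sum[symmetric] sum_negf sum_divide_distrib)
  moreover have "exp (\<i> * complex_of_real (x \<bullet> \<xi>)) = (\<Prod>i\<in>UNIV. exp (\<i> * complex_of_real (x $ i * \<xi> $ i)))"
    by (simp add: exp_sum[symmetric] inner_vec_def sum_distrib_left)
  ultimately show ?thesis by (simp only: of_real_prod prod.distrib)
qed

lemma gauss_fourier:
  "(\<integral>x. exp (\<i> * complex_of_real (x \<bullet> \<xi>)) * complex_of_real (exp (- (norm x)\<^sup>2 / 2)) \<partial>(lborel :: (real^'n::finite) measure))
    = complex_of_real (sqrt (2 * pi) ^ CARD('n) * exp (- (norm \<xi>)\<^sup>2 / 2))"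
proof -
  have "(norm \<xi>)\<^sup>2 = (\<Sum>i\<in>UNIV. (\<xi> $ i)\<^sup>2)"
    unfolding power2_norm_eq_inner inner_vec_def by (simp add: power2_eq_square)
  then have "exp (- (norm \<xi>)\<^sup>2 / 2) = (\<Prod>i\<in>UNIV. exp (- (\<xi> $ i)\<^sup>2 / 2))"
    by (simp add: exp_sum[symmetric] sum_negf sum_divide_distrib)
  then show ?thesis
    unfolding exp_norm_prod integral_lborel_prod[where f = "\<lambda>t i. exp (\<i> * complex_of_real (t * \<xi> $ i)) * complex_of_real (exp (- t\<^sup>2 / 2))", OF integrable_gauss_1]
    by (simp only: gauss_fourier_1 of_real_prod[symmetric] prod.distrib prod_constant)
qed

text \<open>The Bochner integral of a non-integrable function is 0, whereas
  \<open>gauss_fourier\<close> at 0 gives a positive value.\<close>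

lemma integrable_gauss: "integrable (lborel :: (real^'n::finite) measure) (\<lambda>x. complex_of_real (exp (- (norm x)\<^sup>2 / 2)))"
proof (rule ccontr)
  assume "\<not> ?thesis"
  then have "(\<integral>x. complex_of_real (exp (- (norm x)\<^sup>2 / 2)) \<partial>(lborel :: (real^'n) measure)) = 0"
    by (rule not_integrable_integral_eq)
  with gauss_fourier[of "0 :: real^'n"] show False by simp
qed

lemma ftc_sqrt: "ftc TYPE('n::finite) * sqrt (2 * pi) ^ CARD('n) = 1"
proof -
  have "sqrt (2 * pi) ^ CARD('n) = (2 * pi) powr (real CARD('n) / 2)"
    by (simp add: powr_half_sqrt[symmetric] powr_power)
  then show ?thesis by (simp add: ftc_def powr_add[symmetric])
qed

text \<open>Gaussian regularisation: the factor \<open>g (\<epsilon> N *\<^sub>R \<xi>)\<close>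
  makes Fubini applicable and turns the double integral into a Gaussian average of f around x. Both
  sides converge by dominated convergence as the parameter tends to 0.\<close>

lemma fourier_inv_fourier:
  fixes f :: "real^'n::finite \<Rightarrow> complex"
  assumes cf: "continuous_on UNIV f" and bf: "\<And>x. norm (f x) \<le> B" and int: "integrable lborel f"
    and intF: "integrable lborel (inv_fourier f)"
  shows "fourier (inv_fourier f) x = f x"
proof -
  define c :: complex where "c = of_real (ftc TYPE('n))"
  define Q :: complex where "Q = of_real (sqrt (2 * pi) ^ CARD('n))"
  have cQ: "c * Q = 1" unfolding c_def Q_def using ftc_sqrt[where 'n = 'n] by (metis of_real_1 of_real_mult)
  define g :: "real^'n \<Rightarrow> complex" where "g \<xi> = of_real (exp (- (norm \<xi>)\<^sup>2 / 2))" for \<xi>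
  define \<epsilon> where "\<epsilon> N = 1 / real (Suc N)" for N :: nat
  have \<epsilon>: "\<epsilon> N > 0" for N by (simp add: \<epsilon>_def)
  have \<epsilon>0: "\<epsilon> \<longlonglongrightarrow> 0" unfolding \<epsilon>_def by (rule LIMSEQ_Suc[OF lim_1_over_n])
  have mf [measurable]: "f \<in> borel_measurable borel" by (rule borel_measurable_continuous_onI[OF cf])
  have mF [measurable]: "inv_fourier f \<in> borel_measurable borel" using intF by auto
  have cg: "continuous_on UNIV g" unfolding g_def [abs_def] by (intro continuous_intros) auto
  have mg [measurable]: "g \<in> borel_measurable borel" by (rule borel_measurable_continuous_onI[OF cg])
  have ig: "integrable lborel g" unfolding g_def by (rule integrable_gauss)
  have g1: "norm (g \<xi>) \<le> 1" for \<xi> by (simp add: g_def)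
  have ge: "(\<integral>\<zeta>. exp (\<i> * of_real (\<zeta> \<bullet> z)) * g \<zeta> \<partial>lborel) = Q * g z" for z
    unfolding g_def Q_def using gauss_fourier[of z] by simp
  define h where "h N \<xi> = inv_fourier f \<xi> * exp (- \<i> * of_real (\<xi> \<bullet> x)) * g (\<epsilon> N *\<^sub>R \<xi>)" for N \<xi>
  have eq: "(\<integral>\<xi>. h N \<xi> \<partial>lborel) = (\<integral>z. f (x + \<epsilon> N *\<^sub>R z) * g z \<partial>lborel)" for N
  proof -
    define e where "e = \<epsilon> N"
    have e: "e > 0" using \<epsilon> by (simp add: e_def)
    define G where "G \<xi> y = f y * exp (\<i> * of_real ((y - x) \<bullet> \<xi>)) * g (e *\<^sub>R \<xi>)" for \<xi> y
    have mG: "(\<lambda>(\<xi>, y). G \<xi> y) \<in> borel_measurable (lborel \<Otimes>\<^sub>M lborel)"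
    proof -
      have [measurable]: "(\<lambda>p :: (real^'n) \<times> (real^'n). exp (\<i> * of_real ((snd p - x) \<bullet> fst p))) \<in> borel_measurable borel"
        by (intro borel_measurable_continuous_onI continuous_intros)
      have [measurable]: "(\<lambda>p :: (real^'n) \<times> (real^'n). exp (\<i> * of_real ((snd p - x) \<bullet> fst p))) \<in> borel_measurable (lborel \<Otimes>\<^sub>M lborel)"
        by (simp add: lborel_prod)
      show ?thesis unfolding G_def case_prod_beta' by measurable
    qed
    have "integrable lborel (\<lambda>\<xi>. g (0 + e *\<^sub>R \<xi>))" by (rule integrable_lborel_affine[OF ig]) (use e in auto)
    then have fg: "(\<integral>\<^sup>+\<xi>. ennreal (norm (g (e *\<^sub>R \<xi>))) \<partial>lborel) < \<infinity>" by (simp add: integrable_iff_bounded)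
    have ff: "(\<integral>\<^sup>+y. ennreal (norm (f y)) \<partial>lborel) < \<infinity>" using int by (simp add: integrable_iff_bounded)
    have "(\<integral>\<^sup>+\<xi>. (\<integral>\<^sup>+y. ennreal (norm (G \<xi> y)) \<partial>lborel) \<partial>lborel)
       = (\<integral>\<^sup>+\<xi>. (\<integral>\<^sup>+y. ennreal (norm (f y)) * ennreal (norm (g (e *\<^sub>R \<xi>))) \<partial>lborel) \<partial>lborel)"
      by (simp add: G_def norm_mult norm_iexp ennreal_mult)
    also have "\<dots> = (\<integral>\<^sup>+y. ennreal (norm (f y)) \<partial>lborel) * (\<integral>\<^sup>+\<xi>. ennreal (norm (g (e *\<^sub>R \<xi>))) \<partial>lborel)"
      by (simp add: nn_integral_multc nn_integral_cmult)
    also have "\<dots> < \<infinity>" using ff fg by (simp add: ennreal_mult_less_top)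
    finally have finG: "(\<integral>\<^sup>+\<xi>. (\<integral>\<^sup>+y. ennreal (norm (G \<xi> y)) \<partial>lborel) \<partial>lborel) < \<infinity>" .
    have 1: "h N \<xi> = c * (\<integral>y. G \<xi> y \<partial>lborel)" for \<xi>
    proof -
      have "exp (\<i> * of_real ((y - x) \<bullet> \<xi>)) = exp (\<i> * of_real (\<xi> \<bullet> y)) * exp (- \<i> * of_real (\<xi> \<bullet> x))" for y
        by (simp add: exp_add[symmetric] inner_diff_left inner_commute algebra_simps)
      then
      have "(\<integral>y. G \<xi> y \<partial>lborel) = (\<integral>y. (f y * exp (\<i> * of_real (\<xi> \<bullet> y))) * (exp (- \<i> * of_real (\<xi> \<bullet> x)) * g (e *\<^sub>R \<xi>)) \<partial>lborel)"
        by (simp only: G_def mult.assoc)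
      then show ?thesis by (simp add: h_def inv_fourier_eq c_def e_def)
    qed
    have "(\<integral>\<xi>. h N \<xi> \<partial>lborel) = c * (\<integral>\<xi>. (\<integral>y. G \<xi> y \<partial>lborel) \<partial>lborel)"
      unfolding 1 by simp
    also have "\<dots> = c * (\<integral>y. (\<integral>\<xi>. G \<xi> y \<partial>lborel) \<partial>lborel)"
      by (simp only: fubini_swap(1)[OF mG finG])
    \<comment> \<open>Substitution y = x + e z. Its Jacobian e^n is used up below by the
      substitution \<zeta> = e \<xi> in the Gaussian integral.\<close>
    also have "(\<integral>y. (\<integral>\<xi>. G \<xi> y \<partial>lborel) \<partial>lborel) = of_real (\<bar>e\<bar> ^ DIM(real^'n)) * (\<integral>z. (\<integral>\<xi>. G \<xi> (x + e *\<^sub>R z) \<partial>lborel) \<partial>lborel)"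
      by (rule integral_lborel_affine) (use e fubini_swap(3)[OF mG finG] in auto)
    also have "\<dots> = (\<integral>z. of_real (\<bar>e\<bar> ^ DIM(real^'n)) * (\<integral>\<xi>. G \<xi> (x + e *\<^sub>R z) \<partial>lborel) \<partial>lborel)"
      by simp
    also have "\<dots> = (\<integral>z. Q * (f (x + e *\<^sub>R z) * g z) \<partial>lborel)"
    proof (intro Bochner_Integration.integral_cong refl)
      fix z
      have "of_real (\<bar>e\<bar> ^ DIM(real^'n)) * (\<integral>\<xi>. G \<xi> (x + e *\<^sub>R z) \<partial>lborel)
         = f (x + e *\<^sub>R z) * (of_real (\<bar>e\<bar> ^ DIM(real^'n)) * (\<integral>\<xi>. exp (\<i> * of_real ((0 + e *\<^sub>R \<xi>) \<bullet> z)) * g (0 + e *\<^sub>R \<xi>) \<partial>lborel))"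
        by (simp add: G_def inner_commute mult.assoc)
      also have "of_real (\<bar>e\<bar> ^ DIM(real^'n)) * (\<integral>\<xi>. exp (\<i> * of_real ((0 + e *\<^sub>R \<xi>) \<bullet> z)) * g (0 + e *\<^sub>R \<xi>) \<partial>lborel)
         = (\<integral>\<zeta>. exp (\<i> * of_real (\<zeta> \<bullet> z)) * g \<zeta> \<partial>lborel)"
        by (rule integral_lborel_affine[OF less_imp_neq[OF e, symmetric], symmetric]) measurable
      finally show "of_real (\<bar>e\<bar> ^ DIM(real^'n)) * (\<integral>\<xi>. G \<xi> (x + e *\<^sub>R z) \<partial>lborel) = Q * (f (x + e *\<^sub>R z) * g z)"
        unfolding ge by (simp add: mult_ac)
    qed
    also have "c * \<dots> = (c * Q) * (\<integral>z. f (x + e *\<^sub>R z) * g z \<partial>lborel)" by simp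
    finally show ?thesis by (simp add: cQ e_def)
  qed
  have "(\<lambda>N. \<integral>\<xi>. h N \<xi> \<partial>lborel) \<longlonglongrightarrow> (\<integral>\<xi>. inv_fourier f \<xi> * exp (- \<i> * of_real (\<xi> \<bullet> x)) \<partial>lborel)"
  proof (rule integral_dominated_convergence[where w = "\<lambda>\<xi>. norm (inv_fourier f \<xi>)"])
    show "AE \<xi> in lborel. (\<lambda>N. h N \<xi>) \<longlonglongrightarrow> inv_fourier f \<xi> * exp (- \<i> * of_real (\<xi> \<bullet> x))"
    proof (rule AE_I2)
      fix \<xi> :: "real^'n"
      have "(\<lambda>N. \<epsilon> N *\<^sub>R \<xi>) \<longlonglongrightarrow> 0 *\<^sub>R \<xi>" by (intro tendsto_intros \<epsilon>0)
      then have "(\<lambda>N. g (\<epsilon> N *\<^sub>R \<xi>)) \<longlonglongrightarrow> g 0"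
        using cg by (auto intro!: continuous_on_tendsto_compose[OF cg])
      then have "(\<lambda>N. h N \<xi>) \<longlonglongrightarrow> inv_fourier f \<xi> * exp (- \<i> * of_real (\<xi> \<bullet> x)) * g 0"
        unfolding h_def by (intro tendsto_intros)
      then show "(\<lambda>N. h N \<xi>) \<longlonglongrightarrow> inv_fourier f \<xi> * exp (- \<i> * of_real (\<xi> \<bullet> x))"
        by (simp add: g_def)
    qed
    show "AE \<xi> in lborel. norm (h N \<xi>) \<le> norm (inv_fourier f \<xi>)" for N
      unfolding h_def norm_mult norm_iexp using g1 by (intro AE_I2) (simp add: mult_left_le)
    show "h N \<in> borel_measurable lborel" for N unfolding h_def [abs_def] by measurable
  qed (use intF in auto)
  moreover have "(\<lambda>N. \<integral>z. f (x + \<epsilon> N *\<^sub>R z) * g z \<partial>lborel) \<longlonglongrightarrow> (\<integral>z. f x * g z \<partial>lborel)"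
  proof (rule integral_dominated_convergence[where w = "\<lambda>z. B * norm (g z)"])
    show "AE z in lborel. (\<lambda>N. f (x + \<epsilon> N *\<^sub>R z) * g z) \<longlonglongrightarrow> f x * g z"
    proof (rule AE_I2)
      fix z :: "real^'n"
      have "(\<lambda>N. x + \<epsilon> N *\<^sub>R z) \<longlonglongrightarrow> x + 0 *\<^sub>R z" by (intro tendsto_intros \<epsilon>0)
      then have "(\<lambda>N. f (x + \<epsilon> N *\<^sub>R z)) \<longlonglongrightarrow> f x"
        by (auto intro!: continuous_on_tendsto_compose[OF cf])
      then show "(\<lambda>N. f (x + \<epsilon> N *\<^sub>R z) * g z) \<longlonglongrightarrow> f x * g z" by (intro tendsto_intros)
    qed
    show "AE z in lborel. norm (f (x + \<epsilon> N *\<^sub>R z) * g z) \<le> B * norm (g z)" for N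
      unfolding norm_mult by (intro AE_I2 mult_right_mono bf) auto
  qed (use ig in auto)
  ultimately have "(\<integral>\<xi>. inv_fourier f \<xi> * exp (- \<i> * of_real (\<xi> \<bullet> x)) \<partial>lborel) = (\<integral>z. f x * g z \<partial>lborel)"
    unfolding eq by (rule LIMSEQ_unique)
  also have "\<dots> = f x * Q" using ge[of 0] by (simp add: g_def)
  finally show ?thesis using cQ by (simp add: fourier_eq c_def[symmetric] mult_ac)
qed

section \<open>Test functions, functionals and Fourier multipliers\<close>

section \<open>The Gelfand--Shilov space and its dual\<close>

lemma gsb_in_gs_space_h:
  fixes f :: "real^'n::finite \<Rightarrow> complex"
  assumes "gsb UNIV s A h f" "0 \<le> s" "0 < h" "0 \<le> A"
  shows "f \<in> gs_space_h s (h * (2 ^ CARD('n)) powr s)"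
  using gsb_imp_gs_norm[OF assms] gsb_smooth[OF assms(1)]
  by (auto simp: gs_space_h_def intro: le_less_trans)

lemma gs_space_h_gsb:
  fixes f :: "real^'n::finite \<Rightarrow> complex"
  assumes "f \<in> gs_space_h s h" "0 < h"
  shows "gsb pure_lists s (enn2real (gs_norm s h f)) (max 1 (real CARD('n) * h)) f"
  by (rule gsb_mono[OF gs_norm_imp_gsb]) (use assms in \<open>auto simp: gs_space_h_def\<close>)

lemma gsb_inversion:
  fixes f :: "real^'n::finite \<Rightarrow> complex"
  assumes f: "gsb pure_lists s A h f" and s: "1 \<le> s" and h: "1 \<le> h" and A: "0 \<le> A"
  shows "fourier (inv_fourier f) = f"
proof
  fix x
  obtain C h' where "gsb UNIV s (C * A) h' (inv_fourier f)"
    using inv_fourier_gsb[OF s h, where 'n = 'n] f A by blast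
  then have "integrable lborel (inv_fourier f)" by (rule rapid_integrable[OF gsb_rapid]) simp
  moreover have "norm (f x) \<le> A" for x using gsbD[OF f Nil_pure, of x 0] by simp
  ultimately show "fourier (inv_fourier f) x = f x"
    by (intro fourier_inv_fourier smooth_fun_continuous gsb_smooth[OF f] rapid_integrable[OF gsb_rapid[OF f Nil_pure]])
qed

text \<open>Forwards, the inverse transform followed by the transform returns f itself, now with
  bounds on all lists. The closure properties below are proved through this
  characterisation.\<close>

lemma gs_space_iff:
  fixes f :: "real^'n::finite \<Rightarrow> complex"
  assumes s: "1 \<le> s"
  shows "f \<in> gs_space s \<longleftrightarrow> (\<exists>A h. 0 \<le> A \<and> 1 \<le> h \<and> gsb UNIV s A h f)"
proof
  assume "f \<in> gs_space s"
  then obtain h where h: "h > 0" "f \<in> gs_space_h s h" by (auto simp: gs_space_def)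
  obtain A h where A: "A \<ge> 0" and h: "1 \<le> h" and f: "gsb pure_lists s A h f"
    using gs_space_h_gsb[OF h(2,1)] by (meson enn2real_nonneg max.cobounded1)
  obtain C h' where C: "0 \<le> C" "1 \<le> h'" "gsb UNIV s (C * A) h' (inv_fourier f)"
    using inv_fourier_gsb[OF s h, where 'n = 'n] f A by blast
  obtain C2 h2 where C2: "0 \<le> C2" "1 \<le> h2" "gsb UNIV s (C2 * (C * A)) h2 (fourier (inv_fourier f))"
    using fourier_gsb[OF s C(2), where 'n = 'n] gsb_subset[OF C(3) subset_UNIV] A C(1)
    by (meson mult_nonneg_nonneg)
  then show "\<exists>A h. 0 \<le> A \<and> 1 \<le> h \<and> gsb UNIV s A h f"
    unfolding gsb_inversion[OF f s h A] using A C by (meson mult_nonneg_nonneg)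
next
  assume "\<exists>A h. 0 \<le> A \<and> 1 \<le> h \<and> gsb UNIV s A h f"
  then obtain A h where A: "0 \<le> A" "1 \<le> h" "gsb UNIV s A h f" by blast
  have "f \<in> gs_space_h s (h * (2 ^ CARD('n)) powr s)"
    by (rule gsb_in_gs_space_h[OF A(3)]) (use A s in auto)
  then show "f \<in> gs_space s" using A by (auto simp: gs_space_def)
qed

lemma gs_spaceE:
  assumes "f \<in> gs_space s" "1 \<le> s"
  obtains A h where "0 \<le> A" "1 \<le> h" "gsb UNIV s A h f"
  using assms gs_space_iff by blast

lemma gs_spaceI: "gsb UNIV s A h f \<Longrightarrow> 0 \<le> A \<Longrightarrow> 1 \<le> h \<Longrightarrow> 1 \<le> s \<Longrightarrow> f \<in> gs_space s"
  using gs_space_iff by blast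

lemma gs_space_rapid: "f \<in> gs_space s \<Longrightarrow> 1 \<le> s \<Longrightarrow> rapid f"
  by (metis gs_spaceE gsb_rapid UNIV_I)

lemma gs_space_measurable: "f \<in> gs_space s \<Longrightarrow> 1 \<le> s \<Longrightarrow> f \<in> borel_measurable borel"
  by (rule rapid_measurable[OF gs_space_rapid])

lemma gs_space_integrable: "f \<in> gs_space s \<Longrightarrow> 1 \<le> s \<Longrightarrow> integrable lborel f"
  by (rule rapid_integrable[OF gs_space_rapid])

lemma gs_space_bounded:
  assumes "f \<in> gs_space s" "1 \<le> s"
  obtains B where "0 \<le> B" "\<And>x. norm (f x) \<le> B"
proof -
  obtain A h where "0 \<le> A" "1 \<le> h" and f: "gsb UNIV s A h f" using gs_spaceE[OF assms] .
  moreover have "norm (f x) \<le> A" for x using gsbD[OF f UNIV_I, of x 0 "[]"] by simp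
  ultimately show ?thesis using that by blast
qed

lemma gs_space_fourier:
  fixes f :: "real^'n::finite \<Rightarrow> complex"
  assumes "f \<in> gs_space s" "1 \<le> s"
  shows "fourier f \<in> gs_space s" "inv_fourier f \<in> gs_space s"
    "fourier (inv_fourier f) = f" "inv_fourier (fourier f) = f"
proof -
  obtain A h where A: "0 \<le> A" "1 \<le> h" and f: "gsb UNIV s A h f" using gs_spaceE[OF assms] .
  have fp: "gsb pure_lists s A h f" by (rule gsb_subset[OF f]) simp
  obtain C h' where C: "0 \<le> C" "1 \<le> h'" "gsb UNIV s (C * A) h' (inv_fourier f)"
    using inv_fourier_gsb[OF assms(2) A(2), where 'n = 'n] fp A by blast
  obtain C2 h2 where C2: "0 \<le> C2" "1 \<le> h2" "gsb UNIV s (C2 * A) h2 (fourier f)"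
    using fourier_gsb[OF assms(2) A(2), where 'n = 'n] fp A by blast
  show "inv_fourier f \<in> gs_space s" by (rule gs_spaceI[OF C(3)]) (use A C assms in auto)
  show F: "fourier f \<in> gs_space s" by (rule gs_spaceI[OF C2(3)]) (use A C2 assms in auto)
  show 1: "fourier (inv_fourier f) = f" by (rule gsb_inversion[OF fp assms(2) A(2,1)])
  \<comment> \<open>\<open>inv_fourier\<close> is \<open>fourier\<close> at the reflected point, so
    reflecting the integration variable exchanges the order of the two transforms.\<close>
  have "inv_fourier (fourier f) x = fourier (inv_fourier f) x" for x
  proof -
    have m: "fourier f \<in> borel_measurable borel" by (rule gs_space_measurable[OF F assms(2)])
    have [measurable]: "(\<lambda>\<xi>. fourier f \<xi> * exp (\<i> * complex_of_real (x \<bullet> \<xi>))) \<in> borel_measurable borel"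
      using m by (intro borel_measurable_times) (auto simp: inner_commute[of x])
    have "(\<integral>\<xi>. fourier f \<xi> * exp (\<i> * complex_of_real (x \<bullet> \<xi>)) \<partial>lborel)
       = (\<integral>\<xi>. fourier f (- \<xi>) * exp (\<i> * complex_of_real (x \<bullet> (- \<xi>))) \<partial>lborel)"
      by (rule integral_lborel_shift(5)[symmetric]) measurable
    then show ?thesis
      by (simp add: inv_fourier_eq[of "fourier f"] fourier_eq[of "inv_fourier f"] inv_fourier_conv_fourier[of f]
         inner_commute)
  qed
  then show "inv_fourier (fourier f) = f" using 1 by (metis ext)
qed

lemma gs_space_add:
  assumes "f \<in> gs_space s" "g \<in> gs_space s" "1 \<le> s"
  shows "(\<lambda>x. f x + g x) \<in> gs_space s"
proof -
  obtain A h where A: "0 \<le> A" "1 \<le> h" and f: "gsb UNIV s A h f" using gs_spaceE[OF assms(1,3)] .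
  obtain B k where B: "0 \<le> B" "1 \<le> k" and g: "gsb UNIV s B k g" using gs_spaceE[OF assms(2,3)] .
  have "gsb UNIV s A (max h k) f" "gsb UNIV s B (max h k) g"
    by (rule gsb_mono[OF f] gsb_mono[OF g]; use A B in simp)+
  from gsb_add[OF this] show ?thesis by (rule gs_spaceI) (use A B assms in auto)
qed

lemma gs_space_cmult:
  assumes "f \<in> gs_space s" "1 \<le> s"
  shows "(\<lambda>x. c * f x) \<in> gs_space s"
proof -
  obtain A h where A: "0 \<le> A" "1 \<le> h" and f: "gsb UNIV s A h f" using gs_spaceE[OF assms] .
  show ?thesis by (rule gs_spaceI[OF gsb_cmult[OF f, of c]]) (use A assms in auto)
qed

lemma gs_space_zero: "1 \<le> s \<Longrightarrow> (\<lambda>x. 0) \<in> gs_space s"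
  by (rule gs_spaceI[of s 0 1]) (auto simp: gsb_def smooth_fun_const iter_pdiff_const)

lemma gs_space_sum:
  assumes "\<And>j. j \<in> J \<Longrightarrow> f j \<in> gs_space s" "1 \<le> s"
  shows "(\<lambda>x. \<Sum>j\<in>J. f j x) \<in> gs_space s"
  using assms by (induction J rule: infinite_finite_induct) (auto intro: gs_space_zero gs_space_add)

lemma gs_space_mult:
  assumes m: "mbound s B b m" "0 \<le> B" and f: "f \<in> gs_space s" "1 \<le> s"
  shows "(\<lambda>x. m x * f x) \<in> gs_space s"
proof -
  obtain A h where A: "0 \<le> A" "1 \<le> h" and g: "gsb UNIV s A h f" using gs_spaceE[OF f] .
  \<comment> \<open>\<open>gsb_mult\<close> asks for a scale of at least 1, while \<open>b\<close>
    is an arbitrary real here.\<close>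
  have m': "mbound s B (max 1 \<bar>b\<bar>) m"
    unfolding mbound_def
  proof (intro conjI allI)
    fix "is" x
    have "norm (iter_pdiff is m x) \<le> B * b ^ length is * gfact s (length is)"
      using m by (simp add: mbound_def)
    also have "\<dots> \<le> B * max 1 \<bar>b\<bar> ^ length is * gfact s (length is)"
      using m(2) power_mono[of "\<bar>b\<bar>" "max 1 \<bar>b\<bar>" "length is"]
      by (intro mult_right_mono mult_left_mono) (auto simp: power_abs[symmetric] intro: order_trans[OF abs_ge_self])
    finally show "norm (iter_pdiff is m x) \<le> B * max 1 \<bar>b\<bar> ^ length is * gfact s (length is)" .
  qed (use m in \<open>auto simp: mbound_def\<close>)
  have "1 \<le> max 1 \<bar>b\<bar> * h" using mult_mono[of 1 "max 1 \<bar>b\<bar>" 1 h] A by simp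
  then show ?thesis
    by (intro gs_spaceI[OF gsb_mult[OF m' g]]) (use A m f in auto)
qed

lemma gs_space_affine:
  assumes f: "f \<in> gs_space s" "1 \<le> s" and c: "c \<noteq> 0"
  shows "(\<lambda>x. f (c *\<^sub>R x + a)) \<in> gs_space s"
proof -
  obtain A h where A: "0 \<le> A" "1 \<le> h" and g: "gsb UNIV s A h f" using gs_spaceE[OF f] .
  have "1 \<le> (2 * (1 + 1 / \<bar>c\<bar>)) * ((1 + \<bar>c\<bar>) * (h + norm a))"
  proof -
    have "1 \<le> (1 + \<bar>c\<bar>) * (h + norm a)"
      using mult_mono[of 1 "1 + \<bar>c\<bar>" 1 "h + norm a"] A norm_ge_zero[of a] by linarith
    moreover have "1 \<le> 2 * (1 + 1 / \<bar>c\<bar>)" by simp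
    ultimately show ?thesis
      using mult_mono[of 1 "2 * (1 + 1 / \<bar>c\<bar>)" 1 "(1 + \<bar>c\<bar>) * (h + norm a)"] by simp
  qed
  then show ?thesis
    by (intro gs_spaceI[OF gsb_affine[OF g _ c]]) (use A f in \<open>auto simp: mult.assoc\<close>)
qed

text \<open>Additivity of a functional is available only inside one Banach space
  \<open>gs_space_h s h\<close>.\<close>

lemma gs_space_common_h:
  fixes f g :: "real^'n::finite \<Rightarrow> complex"
  assumes "f \<in> gs_space s" "g \<in> gs_space s" "1 \<le> s"
  obtains h where "0 < h" "f \<in> gs_space_h s h" "g \<in> gs_space_h s h"
proof -
  obtain A h where A: "0 \<le> A" "1 \<le> h" and f: "gsb UNIV s A h f" using gs_spaceE[OF assms(1,3)] .
  obtain B k where B: "0 \<le> B" "1 \<le> k" and g: "gsb UNIV s B k g" using gs_spaceE[OF assms(2,3)] .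
  have fg: "gsb UNIV s A (max h k) f" "gsb UNIV s B (max h k) g"
    by (rule gsb_mono[OF f] gsb_mono[OF g]; use A B in simp)+
  have 1: "0 \<le> s" "0 < max h k" using A assms by auto
  show ?thesis
    by (rule that[OF _ gsb_in_gs_space_h[OF fg(1) 1 A(1)] gsb_in_gs_space_h[OF fg(2) 1 B(1)]]) (use A in auto)
qed

lemma gs_dual_add:
  assumes "u \<in> gs_dual s" "f \<in> gs_space s" "g \<in> gs_space s" "1 \<le> s"
  shows "u (\<lambda>x. f x + g x) = u f + u g"
proof -
  obtain h where "0 < h" "f \<in> gs_space_h s h" "g \<in> gs_space_h s h"
    using gs_space_common_h[OF assms(2-4)] .
  then show ?thesis using assms(1) by (auto simp: gs_dual_def gs_dual_h_def)
qed

lemma gs_dual_cmult: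
  assumes "u \<in> gs_dual s" "f \<in> gs_space s" "1 \<le> s"
  shows "u (\<lambda>x. c * f x) = c * u f"
proof -
  obtain h where "0 < h" "f \<in> gs_space_h s h" 
    using gs_space_common_h[OF assms(2,2,3)] .
  then show ?thesis using assms(1) by (auto simp: gs_dual_def gs_dual_h_def)
qed

lemma gs_dual_sum:
  assumes "u \<in> gs_dual s" "\<And>j. j \<in> J \<Longrightarrow> f j \<in> gs_space s" "1 \<le> s"
  shows "u (\<lambda>x. \<Sum>j\<in>J. f j x) = (\<Sum>j\<in>J. u (f j))"
  using assms(2)
proof (induction J rule: infinite_finite_induct)
  case (insert j J)
  then have "u (\<lambda>x. f j x + (\<Sum>j\<in>J. f j x)) = u (f j) + u (\<lambda>x. \<Sum>j\<in>J. f j x)"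
    by (intro gs_dual_add gs_space_sum) (use assms(1,3) in auto)
  then show ?case using insert by simp
qed (use gs_dual_cmult[OF assms(1) gs_space_zero assms(3), of 0] assms in auto)

text \<open>Continuity with one constant for all functions of a given scale; it is applied to
  remainders whose A tends to 0 at a fixed scale.\<close>

lemma gs_dual_continuous:
  fixes u :: "'n::finite functional"
  assumes u: "u \<in> gs_dual s" and s: "1 \<le> s" and h: "1 \<le> h"
  obtains C where "0 \<le> C" "\<And>A f. 0 \<le> A \<Longrightarrow> gsb UNIV s A h f \<Longrightarrow> norm (u f) \<le> C * A"
proof -
  define k where "k = h * (2 ^ CARD('n)) powr s"
  have k: "k > 0" using h by (simp add: k_def)
  have "u \<in> gs_dual_h s k" using u k by (simp add: gs_dual_def)
  then have "\<exists>C. \<forall>f \<in> gs_space_h s k. ennreal (norm (u f)) \<le> ennreal C * gs_norm s k f"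
    by (simp add: gs_dual_h_def)
  then obtain C where C: "\<And>f :: real^'n \<Rightarrow> complex. f \<in> gs_space_h s k \<Longrightarrow> ennreal (norm (u f)) \<le> ennreal C * gs_norm s k f"
    by metis
  have "norm (u f) \<le> max 0 C * A" if A: "0 \<le> A" and f: "gsb UNIV s A h f" for A and f :: "real^'n \<Rightarrow> complex"
  proof -
    have "ennreal (norm (u f)) \<le> ennreal C * gs_norm s k f"
      unfolding k_def by (rule C[unfolded k_def, OF gsb_in_gs_space_h[OF f]]) (use A s h in auto)
    also have "\<dots> \<le> ennreal (max 0 C) * ennreal A"
      unfolding k_def using A s h by (intro mult_mono gsb_imp_gs_norm[OF f] ennreal_leI) auto
    finally have "ennreal (norm (u f)) \<le> ennreal (max 0 C * A)" using A by (simp only: ennreal_mult max.cobounded1)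
    then show ?thesis using A by (subst (asm) ennreal_le_iff) auto
  qed
  then show ?thesis using that[of "max 0 C"] by auto
qed

text \<open>Pairing with a bounded function uses only the decay of the test function, so the bounds
  on \<open>pure_lists\<close>, which hold directly in each \<open>gs_space_h s h\<close>, are
  enough.\<close>

lemma regular_functional_gs_dual:
  fixes F :: "real^'n::finite \<Rightarrow> complex"
  assumes m: "F \<in> borel_measurable borel" and b: "\<And>x. norm (F x) \<le> B"
  shows "regular_functional F \<in> gs_dual s"
  unfolding gs_dual_def
proof (intro INT_I)
  fix h :: real assume "h \<in> {0<..}"
  then have h: "h > 0" by simp
  define k where "k = max 1 (real CARD('n) * h)"
  define \<Omega> where "\<Omega> = (\<integral>x. omega x \<partial>(lborel :: (real^'n) measure))"
  have \<Omega>: "\<Omega> \<ge> 0" unfolding \<Omega>_def by (rule Bochner_Integration.integral_nonneg) simp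
  have B: "B \<ge> 0" using b[of 0] norm_ge_zero order_trans by blast
  \<comment> \<open>Collects the constants of \<open>weight_bound\<close> for the exponents 0 and 2
    n, per unit of the norm of the test function.\<close>
  define D where "D = 2 ^ (CARD('n) + 1) * max 1 (k ^ (2 * CARD('n)) * gfact s (2 * CARD('n)))"
  have D: "D \<ge> 0" by (simp add: D_def)
  have dom: "norm (f x) \<le> D * enn2real (gs_norm s h f) * omega x" if f: "f \<in> gs_space_h s h" for f :: "real^'n \<Rightarrow> complex" and x
  proof -
    define A where "A = enn2real (gs_norm s h f)"
    have A: "A \<ge> 0" by (simp add: A_def)
    have g: "gsb pure_lists s A k f" unfolding A_def k_def by (rule gs_space_h_gsb[OF f h])
    have "norm (f x) \<le> 2 ^ (CARD('n) + 1) * (A * max 1 (k ^ (2 * CARD('n)) * gfact s (2 * CARD('n)))) * omega x"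
    proof (rule weight_bound)
      have "norm (f x) \<le> A * 1" using gsbD[OF g Nil_pure, of x 0] by simp
      also have "\<dots> \<le> A * max 1 (k ^ (2 * CARD('n)) * gfact s (2 * CARD('n)))"
        using A by (intro mult_left_mono) auto
      finally show "norm (f x) \<le> A * max 1 (k ^ (2 * CARD('n)) * gfact s (2 * CARD('n)))" .
      have "norm x ^ (2 * CARD('n)) * norm (f x) \<le> A * (k ^ (2 * CARD('n)) * gfact s (2 * CARD('n)))"
        using gsbD[OF g Nil_pure, of x "2 * CARD('n)"] by simp
      also have "\<dots> \<le> A * max 1 (k ^ (2 * CARD('n)) * gfact s (2 * CARD('n)))"
        using A by (intro mult_left_mono) auto
      finally show "norm x ^ (2 * CARD('n)) * norm (f x) \<le> A * max 1 (k ^ (2 * CARD('n)) * gfact s (2 * CARD('n)))" .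
    qed simp
    then show ?thesis by (simp add: D_def A_def mult_ac)
  qed
  have mf: "f \<in> borel_measurable borel" if "f \<in> gs_space_h s h" for f :: "real^'n \<Rightarrow> complex"
    using that by (auto simp: gs_space_h_def intro!: borel_measurable_continuous_onI smooth_fun_continuous)
  have dom2: "norm (F x * f x) \<le> (B * (D * enn2real (gs_norm s h f))) * omega x" if "f \<in> gs_space_h s h" for f :: "real^'n \<Rightarrow> complex" and x
    using mult_mono[OF b[of x] dom[OF that, of x] B] by (simp add: norm_mult mult.assoc)
  have int: "integrable lborel (\<lambda>x. F x * f x)" if "f \<in> gs_space_h s h" for f
    by (rule integrable_omega_bound[OF _ dom2[OF that]]) (use m mf[OF that] in measurable)
  show "regular_functional F \<in> gs_dual_h s h"
    unfolding gs_dual_h_def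
  proof (intro CollectI conjI ballI allI exI[of _ "B * D * \<Omega>"])
    fix f g :: "real^'n \<Rightarrow> complex" assume fg: "f \<in> gs_space_h s h" "g \<in> gs_space_h s h"
    show "regular_functional F (\<lambda>x. f x + g x) = regular_functional F f + regular_functional F g"
      unfolding regular_functional_def distrib_left
      by (rule Bochner_Integration.integral_add[OF int[OF fg(1)] int[OF fg(2)]])
  next
    fix c and f :: "real^'n \<Rightarrow> complex"
    show "regular_functional F (\<lambda>x. c * f x) = c * regular_functional F f"
      unfolding regular_functional_def by (simp add: mult.left_commute)
  next
    fix f :: "real^'n \<Rightarrow> complex" assume f: "f \<in> gs_space_h s h"
    define A where "A = enn2real (gs_norm s h f)"
    have A: "A \<ge> 0" "ennreal A = gs_norm s h f" using f by (auto simp: A_def gs_space_h_def ennreal_enn2real_if)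
    have "norm (regular_functional F f) \<le> (\<integral>x. norm (F x * f x) \<partial>lborel)"
      unfolding regular_functional_def by (rule integral_norm_bound)
    also have "\<dots> \<le> (B * (D * A)) * \<Omega>"
      unfolding \<Omega>_def A_def by (rule integral_omega_bound[OF _ dom2[OF f]]) (use m mf[OF f] in measurable)
    finally have "norm (regular_functional F f) \<le> (B * D * \<Omega>) * A" by (simp add: mult_ac)
    then have "ennreal (norm (regular_functional F f)) \<le> ennreal (B * D * \<Omega>) * ennreal A"
      using B D \<Omega> A(1) ennreal_leI by (subst ennreal_mult[symmetric]) auto
    then show "ennreal (norm (regular_functional F f)) \<le> ennreal (B * D * \<Omega>) * gs_norm s h f"
      by (simp only: A(2))
  qed
qed

section \<open>Fourier multipliers\<close>

text \<open>The transpose of a Fourier multiplier: duality moves the operators to the test function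
  and reverses their order, so \<open>inv_fourier\<close> acts first.\<close>

definition multop :: "(real^'n::finite \<Rightarrow> complex) \<Rightarrow> (real^'n \<Rightarrow> complex) \<Rightarrow> real^'n \<Rightarrow> complex" where
  "multop m f = fourier (\<lambda>\<xi>. m \<xi> * inv_fourier f \<xi>)"

text \<open>The factor (2 pi)^(-n/2) turns the multiplier into a plain convolution with this
  kernel.\<close>

definition kern :: "(real^'n::finite \<Rightarrow> complex) \<Rightarrow> real^'n \<Rightarrow> complex" where
  "kern m z = of_real (ftc TYPE('n)) * inv_fourier m z"

lemma freq_box_eq: "freq_box \<rho> k u f = u (multop (sigma_fun \<rho> k) f)"
  by (simp add: freq_box_def dual_inv_fourier_def dual_times_def dual_fourier_def multop_def)

lemma borel_prod_measurable:
  "f \<in> borel_measurable (borel :: (('a::euclidean_space) \<times> ('b::euclidean_space)) measure)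
    \<Longrightarrow> f \<in> borel_measurable (lborel \<Otimes>\<^sub>M lborel)"
  by (simp add: lborel_prod)

text \<open>Fubini. The kernel is evaluated at \<open>y - x\<close> because \<open>multop\<close> is
  the transpose of a convolution.\<close>

lemma multop_conv:
  fixes m f :: "real^'n::finite \<Rightarrow> complex"
  assumes m: "integrable lborel m" and f: "integrable lborel f"
  shows "multop m f x = (\<integral>y. f y * kern m (y - x) \<partial>lborel)"
proof -
  define c :: complex where "c = of_real (ftc TYPE('n))"
  have [measurable]: "m \<in> borel_measurable borel" "f \<in> borel_measurable borel" using m f by auto
  define G where "G \<xi> y = m \<xi> * f y * exp (\<i> * of_real (\<xi> \<bullet> (y - x)))" for \<xi> y
  have mG: "(\<lambda>(\<xi>, y). G \<xi> y) \<in> borel_measurable (lborel \<Otimes>\<^sub>M lborel)"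
  proof -
    have [measurable]: "(\<lambda>p :: (real^'n) \<times> (real^'n). exp (\<i> * of_real (fst p \<bullet> (snd p - x)))) \<in> borel_measurable (lborel \<Otimes>\<^sub>M lborel)"
      by (intro borel_prod_measurable borel_measurable_continuous_onI continuous_intros)
    show ?thesis unfolding G_def case_prod_beta' by measurable
  qed
  have "(\<integral>\<^sup>+\<xi>. (\<integral>\<^sup>+y. ennreal (norm (G \<xi> y)) \<partial>lborel) \<partial>lborel)
     = (\<integral>\<^sup>+\<xi>. (\<integral>\<^sup>+y. ennreal (norm (m \<xi>)) * ennreal (norm (f y)) \<partial>lborel) \<partial>lborel)"
    by (simp add: G_def norm_mult norm_iexp ennreal_mult)
  also have "\<dots> = (\<integral>\<^sup>+\<xi>. ennreal (norm (m \<xi>)) \<partial>lborel) * (\<integral>\<^sup>+y. ennreal (norm (f y)) \<partial>lborel)"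
    by (simp add: nn_integral_multc nn_integral_cmult)
  also have "\<dots> < \<infinity>" using m f by (simp add: ennreal_mult_less_top integrable_iff_bounded)
  finally have fin: "(\<integral>\<^sup>+\<xi>. (\<integral>\<^sup>+y. ennreal (norm (G \<xi> y)) \<partial>lborel) \<partial>lborel) < \<infinity>" .
  have e: "exp (\<i> * complex_of_real (\<xi> \<bullet> (y - x))) = exp (\<i> * complex_of_real (\<xi> \<bullet> y)) * exp (- \<i> * complex_of_real (\<xi> \<bullet> x))" for \<xi> y
    by (simp add: exp_add[symmetric] inner_diff_right algebra_simps)
  have "multop m f x = c * (\<integral>\<xi>. m \<xi> * (c * (\<integral>y. f y * exp (\<i> * of_real (\<xi> \<bullet> y)) \<partial>lborel)) * exp (- \<i> * of_real (\<xi> \<bullet> x)) \<partial>lborel)"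
    by (simp add: multop_def fourier_eq inv_fourier_eq c_def)
  also have "\<dots> = c * (\<integral>\<xi>. c * (\<integral>y. G \<xi> y \<partial>lborel) \<partial>lborel)"
  proof -
    have "m \<xi> * (c * (\<integral>y. f y * exp (\<i> * of_real (\<xi> \<bullet> y)) \<partial>lborel)) * exp (- \<i> * of_real (\<xi> \<bullet> x))
       = c * (\<integral>y. G \<xi> y \<partial>lborel)" for \<xi>
    proof -
      have "(\<integral>y. G \<xi> y \<partial>lborel) = (\<integral>y. (m \<xi> * exp (- \<i> * of_real (\<xi> \<bullet> x))) * (f y * exp (\<i> * of_real (\<xi> \<bullet> y))) \<partial>lborel)"
        unfolding G_def e by (simp only: mult_ac)
      also have "\<dots> = (m \<xi> * exp (- \<i> * of_real (\<xi> \<bullet> x))) * (\<integral>y. f y * exp (\<i> * of_real (\<xi> \<bullet> y)) \<partial>lborel)"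
        by (rule integral_mult_right_zero)
      finally show ?thesis by (simp add: mult_ac)
    qed
    then show ?thesis by (simp only:)
  qed
  also have "\<dots> = c * c * (\<integral>\<xi>. (\<integral>y. G \<xi> y \<partial>lborel) \<partial>lborel)" by simp
  also have "\<dots> = c * c * (\<integral>y. (\<integral>\<xi>. G \<xi> y \<partial>lborel) \<partial>lborel)" by (simp only: fubini_swap(1)[OF mG fin])
  also have "\<dots> = (\<integral>y. c * c * (\<integral>\<xi>. G \<xi> y \<partial>lborel) \<partial>lborel)" by simp
  also have "\<dots> = (\<integral>y. f y * kern m (y - x) \<partial>lborel)"
  proof (intro Bochner_Integration.integral_cong refl)
    fix y
    have "(\<integral>\<xi>. G \<xi> y \<partial>lborel) = (\<integral>\<xi>. f y * (m \<xi> * exp (\<i> * of_real ((y - x) \<bullet> \<xi>))) \<partial>lborel)"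
      by (simp add: G_def inner_commute mult_ac)
    then show "c * c * (\<integral>\<xi>. G \<xi> y \<partial>lborel) = f y * kern m (y - x)"
      by (simp add: kern_def inv_fourier_eq c_def[symmetric])
  qed
  finally show ?thesis .
qed

lemma multop_multop:
  assumes "(\<lambda>\<xi>. m \<xi> * inv_fourier f \<xi>) \<in> gs_space s" "1 \<le> s"
  shows "multop m' (multop m f) = multop (\<lambda>\<xi>. m' \<xi> * m \<xi>) f"
  unfolding multop_def gs_space_fourier(4)[OF assms] by (simp add: mult.assoc)

lemma multop_gs_space:
  assumes "mbound s B b m" "0 \<le> B" "f \<in> gs_space s" "1 \<le> s"
  shows "(\<lambda>\<xi>. m \<xi> * inv_fourier f \<xi>) \<in> gs_space s" "multop m f \<in> gs_space s"
proof -
  show "(\<lambda>\<xi>. m \<xi> * inv_fourier f \<xi>) \<in> gs_space s"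
    by (intro gs_space_mult[OF assms(1,2)] gs_space_fourier assms)
  then show "multop m f \<in> gs_space s" unfolding multop_def by (rule gs_space_fourier(1)[OF _ assms(4)])
qed

section \<open>Lattice sums and the partition of unity\<close>

section \<open>Lattice points near a given point\<close>

definition near :: "real \<Rightarrow> real^'n::finite \<Rightarrow> (int^'n) set" where
  "near R x = {l. \<forall>i. \<bar>x $ i - real_of_int (l $ i)\<bar> \<le> R}"

lemma finite_int_box: "finite {j :: int^'n::finite. \<forall>i. \<bar>j $ i\<bar> \<le> K}"
proof (rule finite_subset)
  show "{j :: int^'n. \<forall>i. \<bar>j $ i\<bar> \<le> K} \<subseteq> (\<lambda>f. \<chi> i. f i) ` (UNIV \<rightarrow>\<^sub>E {- K..K})"
  proof
    fix j :: "int^'n" assume "j \<in> {j. \<forall>i. \<bar>j $ i\<bar> \<le> K}"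
    then have "(\<lambda>i. j $ i) \<in> UNIV \<rightarrow>\<^sub>E {- K..K}" by (auto simp: abs_le_iff) (metis minus_le_iff)
    moreover have "j = (\<chi> i. (\<lambda>i. j $ i) i)" by (simp add: vec_eq_iff)
    ultimately show "j \<in> (\<lambda>f. \<chi> i. f i) ` (UNIV \<rightarrow>\<^sub>E {- K..K})" by blast
  qed
  show "finite ((\<lambda>f. (\<chi> i. f i) :: int^'n) ` (UNIV \<rightarrow>\<^sub>E {- K..K}))"
    by (intro finite_imageI finite_PiE) auto
qed

text \<open>Translation by the integer part of x puts all these sets into one box, which bounds
  their size independently of x.\<close>

lemma near_subset:
  "near R x \<subseteq> (\<lambda>j. j + (\<chi> i. \<lfloor>x $ i\<rfloor>)) ` {j. \<forall>i. \<bar>j $ i\<bar> \<le> \<lceil>R\<rceil> + 1}"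
proof
  fix l assume l: "l \<in> near R x"
  let ?j = "l - (\<chi> i. \<lfloor>x $ i\<rfloor>)"
  have "\<bar>?j $ i\<bar> \<le> \<lceil>R\<rceil> + 1" for i
  proof -
    have "\<bar>x $ i - real_of_int (l $ i)\<bar> \<le> R" using l by (simp add: near_def)
    moreover have "real_of_int \<lfloor>x $ i\<rfloor> \<le> x $ i" "x $ i < real_of_int \<lfloor>x $ i\<rfloor> + 1" by linarith+
    moreover have "R \<le> real_of_int \<lceil>R\<rceil>" by linarith
    ultimately have "\<bar>real_of_int (l $ i) - real_of_int \<lfloor>x $ i\<rfloor>\<bar> \<le> real_of_int \<lceil>R\<rceil> + 1" by linarith
    then have "real_of_int \<bar>l $ i - \<lfloor>x $ i\<rfloor>\<bar> \<le> real_of_int (\<lceil>R\<rceil> + 1)" by simp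
    then show ?thesis by (simp only: of_int_le_iff) simp
  qed
  then show "l \<in> (\<lambda>j. j + (\<chi> i. \<lfloor>x $ i\<rfloor>)) ` {j. \<forall>i. \<bar>j $ i\<bar> \<le> \<lceil>R\<rceil> + 1}"
    by (intro image_eqI[where x = ?j]) auto
qed

lemma finite_near: "finite (near R x)"
  by (rule finite_subset[OF near_subset]) (intro finite_imageI finite_int_box)

definition near_card :: "'n::finite itself \<Rightarrow> real \<Rightarrow> real" where
  "near_card _ R = real (card {j :: int^'n. \<forall>i. \<bar>j $ i\<bar> \<le> \<lceil>R\<rceil> + 1})"

lemma card_near: "real (card (near R (x :: real^'n::finite))) \<le> near_card TYPE('n) R"
  unfolding near_card_def of_nat_le_iff
  by (rule order_trans[OF card_mono[OF _ near_subset]])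
     (auto intro!: finite_imageI finite_int_box card_image_le)

lemma lattice_point_nth [simp]: "lattice_point k $ i = real_of_int (k $ i)"
  by (simp add: lattice_point_def)

lemma lattice_point_add: "lattice_point (k + l) = lattice_point k + lattice_point l"
  and lattice_point_0: "lattice_point 0 = 0"
  by (simp_all add: vec_eq_iff)

section \<open>Gevrey estimates for reciprocals\<close>

lemma mboundD: "mbound s B b f \<Longrightarrow> norm (iter_pdiff is f x) \<le> B * b ^ length is * gfact s (length is)"
  by (simp add: mbound_def)

lemma mbound_smooth: "mbound s B b f \<Longrightarrow> smooth_fun f"
  by (simp add: mbound_def)

lemma geometric_bound:
  assumes "1 < q" shows "(q - 1) * (\<Sum>j\<in>{1..m::nat}. (1 / q) ^ j) \<le> (1 :: real)"
proof -
  have "(q - 1) * (\<Sum>j\<in>{1..m::nat}. (1 / q) ^ j) = 1 - (1 / q) ^ m"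
  proof (induction m)
    case (Suc m)
    have "(q - 1) * (\<Sum>j\<in>{1..Suc m}. (1 / q) ^ j) = 1 - (1 / q) ^ m + (q - 1) * (1 / q) ^ Suc m"
      using Suc.IH by (simp add: distrib_left)
    also have "\<dots> = 1 - (1 / q) ^ Suc m" using assms by (simp add: field_simps)
    finally show ?case .
  qed simp
  then show ?thesis using assms by simp
qed

lemma mbound_inverse:
  fixes f :: "real^'n::finite \<Rightarrow> complex"
  assumes f: "mbound s B b f" and s: "1 \<le> s" and b: "1 \<le> b" and B: "0 \<le> B" and c: "0 < c"
    and fc: "\<And>x. c \<le> norm (f x)"
  \<comment> \<open>\<open>q - 1 > B / c\<close> keeps the geometric series from the Leibniz recursion at most 1\<close>
  defines "q \<equiv> 2 + B / c"
  shows "mbound s (1 / c) (b * q) (\<lambda>x. inverse (f x))"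
  unfolding mbound_def
proof (intro conjI allI)
  have f0: "f x \<noteq> 0" for x using fc[of x] c by auto
  show sv: "smooth_fun (\<lambda>x. inverse (f x))" by (rule smooth_fun_inverse[OF f0 mbound_smooth[OF f]])
  define v where "v = (\<lambda>x. inverse (f x))"
  have "0 \<le> B / c" using B c by simp
  then have q: "q \<ge> 2" "q > 1" by (simp_all add: q_def)
  fix "is" :: "'n list" and x
  show "norm (iter_pdiff is (\<lambda>x. inverse (f x)) x) \<le> 1 / c * (b * q) ^ length is * gfact s (length is)"
    unfolding v_def[symmetric]
  proof (induction "is" rule: length_induct)
    case (1 "is")
    define m where "m = length is"
    show ?case
    proof (cases "is = []")
      case True
      then show ?thesis using fc[of x] c by (simp add: v_def norm_inverse divide_inverse le_imp_inverse_le)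
    next
      case False
      \<comment> \<open>Leibniz for the constant product f v = 1 isolates f times the top derivative
        of v; what remains are lower derivatives of v, covered by the induction hypothesis.\<close>
      have one: "(\<lambda>x. f x * v x) = (\<lambda>x. 1)" using f0 by (simp add: v_def fun_eq_iff)
      have "norm (iter_pdiff is (\<lambda>x. f x * v x) x - f x * iter_pdiff is v x)
        \<le> binom_conv m (\<lambda>j. if j = 0 then 0 else B * b ^ j * gfact s j) (\<lambda>j. 1 / c * (b * q) ^ j * gfact s j)"
        unfolding m_def using mboundD[OF f] 1
        by (intro leibniz_bound_diff mbound_smooth[OF f] sv[folded v_def]) auto
      also have "\<dots> \<le> (\<Sum>j\<in>{1..m}. (B / c * (b * q) ^ m * gfact s m) * (1 / q) ^ j)"
      proof -
        have "binom_conv m (\<lambda>j. if j = 0 then 0 else B * b ^ j * gfact s j) (\<lambda>j. 1 / c * (b * q) ^ j * gfact s j)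
          = (\<Sum>j\<in>{1..m}. real (m choose j) * (B * b ^ j * gfact s j) * (1 / c * (b * q) ^ (m - j) * gfact s (m - j)))"
          unfolding binom_conv_def by (rule sum.mono_neutral_cong_right) (auto simp: Suc_le_eq)
        also have "\<dots> = (\<Sum>j\<in>{1..m}. (B / c * (b ^ j * (b * q) ^ (m - j))) * (real (m choose j) * gfact s j * gfact s (m - j)))"
          by (intro sum.cong) (auto simp: mult_ac)
        also have "\<dots> \<le> (\<Sum>j\<in>{1..m}. (B / c * (b ^ j * (b * q) ^ (m - j))) * gfact s m)"
          using B b c q by (intro sum_mono mult_left_mono gfact_binomial[OF s]) auto
        also have "\<dots> = (\<Sum>j\<in>{1..m}. (B / c * (b * q) ^ m * gfact s m) * (1 / q) ^ j)"
        proof (intro sum.cong refl)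
          fix j assume "j \<in> {1..m}"
          then have "(b * q) ^ m = (b * q) ^ j * (b * q) ^ (m - j)" by (simp add: power_add[symmetric])
          moreover have "q ^ j * (1 / q) ^ j = 1" using q by (simp add: power_mult_distrib[symmetric])
          ultimately have "(b * q) ^ m * (1 / q) ^ j = b ^ j * (b * q) ^ (m - j)"
            by (simp add: power_mult_distrib mult_ac)
          then show "(B / c * (b ^ j * (b * q) ^ (m - j))) * gfact s m = (B / c * (b * q) ^ m * gfact s m) * (1 / q) ^ j"
            by (metis mult.assoc mult.commute)
        qed
        finally show ?thesis .
      qed
      also have "\<dots> = ((b * q) ^ m * gfact s m) * (B / c * (\<Sum>j\<in>{1..m}. (1 / q) ^ j))"
        by (simp add: sum_distrib_left mult_ac)
      also have "\<dots> \<le> ((b * q) ^ m * gfact s m) * 1"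
      proof (intro mult_left_mono)
        have "B / c * (\<Sum>j\<in>{1..m}. (1 / q) ^ j) \<le> (q - 1) * (\<Sum>j\<in>{1..m}. (1 / q) ^ j)"
          using q by (intro mult_right_mono sum_nonneg) (auto simp: q_def)
        also have "\<dots> \<le> 1" by (rule geometric_bound) (use q in auto)
        finally show "B / c * (\<Sum>j\<in>{1..m}. (1 / q) ^ j) \<le> 1" .
      qed (use b q in auto)
      finally have "norm (f x) * norm (iter_pdiff is v x) \<le> (b * q) ^ m * gfact s m"
        using False by (simp add: one iter_pdiff_const norm_mult)
      moreover have "c * norm (iter_pdiff is v x) \<le> norm (f x) * norm (iter_pdiff is v x)"
        by (intro mult_right_mono fc) auto
      ultimately have "c * norm (iter_pdiff is v x) \<le> (b * q) ^ m * gfact s m" by linarith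
      then show ?thesis using c by (simp add: m_def field_simps)
    qed
  qed
qed

lemma mbound_shift:
  assumes "mbound s B b f" shows "mbound s B b (\<lambda>x. f (x - a))"
proof -
  have sm: "smooth_fun f" using assms by (rule mbound_smooth)
  have eq: "(\<lambda>x. f (x - a)) = (\<lambda>x. f (1 *\<^sub>R x + (- a)))" by simp
  show ?thesis
    unfolding mbound_def eq iter_pdiff_affine[OF sm]
    using mboundD[OF assms] smooth_fun_affine[OF sm, of 1 "- a"] by simp
qed

section \<open>The partition of unity\<close>

locale freq_decomp =
  fixes \<rho> :: "real^'n::finite \<Rightarrow> real" and s :: real
  assumes s1: "1 < s" and freq: "freq_uniform s \<rho>"
begin

abbreviation (input) lp :: "int^'n \<Rightarrow> real^'n" where "lp \<equiv> lattice_point"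

definition \<rho>c :: "real^'n \<Rightarrow> complex" where "\<rho>c x = of_real (\<rho> x)"

definition psum :: "real^'n \<Rightarrow> real" where "psum \<xi> = (\<Sum>\<^sub>\<infinity>l. \<rho> (\<xi> - lattice_point l))"

abbreviation \<sigma> :: "int^'n \<Rightarrow> real^'n \<Rightarrow> complex" where "\<sigma> \<equiv> sigma_fun \<rho>"

lemma s_ge1: "1 \<le> s" and s_ge0: "0 \<le> s" using s1 by auto

lemma \<rho>c_gs: "\<rho>c \<in> gs_space s"
  using freq by (simp add: freq_uniform_def \<rho>c_def[abs_def])

lemma \<rho>_bounds: "0 \<le> \<rho> \<xi>" "\<rho> \<xi> \<le> 1"
  using freq by (auto simp: freq_uniform_def)

lemma \<rho>_support: "\<rho> \<xi> \<noteq> 0 \<Longrightarrow> \<bar>\<xi> $ i\<bar> \<le> 1"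
proof -
  assume "\<rho> \<xi> \<noteq> 0"
  then have "\<xi> \<in> closure {\<xi>. \<rho> \<xi> \<noteq> 0}" by (intro subsetD[OF closure_subset]) simp
  moreover have "closure {\<xi>. \<rho> \<xi> \<noteq> 0} \<subseteq> {\<xi>. \<forall>i. -1 \<le> \<xi> $ i \<and> \<xi> $ i \<le> 1}"
    using freq by (simp add: freq_uniform_def)
  ultimately have "- 1 \<le> \<xi> $ i \<and> \<xi> $ i \<le> 1" by blast
  then show ?thesis by linarith
qed

lemma \<rho>_eq_1: "norm \<xi> \<le> 1 / 2 \<Longrightarrow> \<rho> \<xi> = 1"
  using freq by (simp add: freq_uniform_def)

lemma psum_pos: "psum \<xi> > 0"
  using freq by (simp add: freq_uniform_def psum_def)

lemma \<rho>_shift_near: "\<rho> (\<xi> - lp l) \<noteq> 0 \<Longrightarrow> l \<in> near 1 \<xi>"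
  using \<rho>_support[of "\<xi> - lp l"] by (simp add: near_def)

text \<open>One finite index set serves the whole unit ball around x, as is needed for derivatives
  at x.\<close>

lemma near_1_2: "dist x y < 1 \<Longrightarrow> near 1 y \<subseteq> near 2 x"
proof
  fix l assume d: "dist x y < 1" and l: "l \<in> near 1 y"
  have "\<bar>x $ i - real_of_int (l $ i)\<bar> \<le> 2" for i
  proof -
    have "\<bar>x $ i - y $ i\<bar> \<le> dist x y" using component_le_norm_cart[of "x - y" i] by (simp add: dist_norm)
    moreover have "\<bar>y $ i - real_of_int (l $ i)\<bar> \<le> 1" using l by (simp add: near_def)
    ultimately show ?thesis using d by linarith
  qed
  then show "l \<in> near 2 x" by (simp add: near_def)
qed

lemma psum_local:
  assumes "near 1 \<xi> \<subseteq> L" "finite L"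
  shows "psum \<xi> = (\<Sum>l\<in>L. \<rho> (\<xi> - lp l))"
proof -
  have "psum \<xi> = infsum (\<lambda>l. \<rho> (\<xi> - lp l)) L"
    unfolding psum_def using \<rho>_shift_near assms by (intro infsum_cong_neutral) auto
  then show ?thesis using assms by simp
qed

lemma psum_periodic: "psum (\<xi> - lp k) = psum \<xi>"
proof -
  have "psum (\<xi> - lp k) = (\<Sum>\<^sub>\<infinity>l. \<rho> (\<xi> - lattice_point (k + l)))"
    by (simp add: psum_def lattice_point_add diff_diff_eq)
  also have "\<dots> = psum \<xi>"
    unfolding psum_def
    by (rule infsum_reindex_bij_betw[where g = "\<lambda>l. k + l" and f = "\<lambda>l. \<rho> (\<xi> - lattice_point l)"])
       (rule bij_betwI[where g = "\<lambda>l. l - k"]; simp)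
  finally show ?thesis .
qed

lemma \<rho>c_mbound:
  obtains A h where "0 \<le> A" "1 \<le> h" "gsb UNIV s A h \<rho>c" "mbound s A h \<rho>c"
  by (metis gs_spaceE[OF \<rho>c_gs s_ge1] gsb_imp_mbound)

lemma \<rho>c_smooth: "smooth_fun (\<lambda>x. \<rho>c (x - a))"
  by (metis \<rho>c_mbound mbound_shift mbound_smooth)

lemma psum_smooth: "smooth_fun (\<lambda>\<xi>. complex_of_real (psum \<xi>))"
proof (rule smooth_fun_local)
  fix x :: "real^'n"
  show "\<exists>U g. open U \<and> x \<in> U \<and> smooth_fun g \<and> (\<forall>y\<in>U. complex_of_real (psum y) = g y)"
  proof (intro exI conjI ballI)
    show "open (ball x 1)" "x \<in> ball x 1" by auto
    show "smooth_fun (\<lambda>y. \<Sum>l\<in>near 2 x. \<rho>c (y - lp l))" by (intro smooth_fun_sum \<rho>c_smooth)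
    fix y assume "y \<in> ball x 1"
    then show "complex_of_real (psum y) = (\<Sum>l\<in>near 2 x. \<rho>c (y - lp l))"
      using psum_local[OF near_1_2 finite_near, of x y] by (simp add: \<rho>c_def)
  qed
qed

text \<open>Positivity is given only pointwise. Continuity on the compact unit cube and periodicity
  turn it into the uniform lower bound that the estimate of the reciprocal requires.\<close>

lemma psum_lower: obtains c where "0 < c" "\<And>\<xi>. c \<le> psum \<xi>"
proof -
  define Q where "Q = cbox (0 :: real^'n) (\<chi> i. 1)"
  have cont: "continuous_on Q psum"
  proof -
    have "continuous_on Q (\<lambda>\<xi>. Re (complex_of_real (psum \<xi>)))"
      by (intro continuous_intros smooth_fun_continuous psum_smooth)
    then show ?thesis by simp
  qed
  have "0 \<in> Q" by (simp add: Q_def mem_box_cart)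
  then have "compact Q" "Q \<noteq> {}" by (auto simp: Q_def compact_cbox)
  then obtain z where z: "z \<in> Q" "\<And>y. y \<in> Q \<Longrightarrow> psum z \<le> psum y"
    using continuous_attains_inf[OF _ _ cont] by blast
  have "psum z \<le> psum \<xi>" for \<xi>
  proof -
    define k where "k = (\<chi> i. \<lfloor>\<xi> $ i\<rfloor>)"
    have "\<xi> - lp k \<in> Q"
      unfolding Q_def mem_box_cart by (simp add: k_def) (metis le_less linorder_not_less floor_le_iff less_eq_real_def diff_le_eq add.commute real_of_int_floor_add_one_ge)
    then show ?thesis using z(2) psum_periodic by metis
  qed
  then show ?thesis using that[of "psum z"] psum_pos by blast
qed

text \<open>Near x the lattice sum has at most \<open>near_card TYPE('n) 2\<close> terms, all of
  them translates of one function.\<close>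

lemma psum_mbound:
  obtains B b where "0 \<le> B" "1 \<le> b" "mbound s B b (\<lambda>\<xi>. complex_of_real (psum \<xi>))"
proof -
  obtain A h where A: "0 \<le> A" "1 \<le> h" and m: "mbound s A h \<rho>c" by (rule \<rho>c_mbound)
  have "mbound s (near_card TYPE('n) 2 * A) h (\<lambda>\<xi>. complex_of_real (psum \<xi>))"
    unfolding mbound_def
  proof (intro conjI allI psum_smooth)
    fix "is" :: "'n list" and x
    have "iter_pdiff is (\<lambda>\<xi>. complex_of_real (psum \<xi>)) x = iter_pdiff is (\<lambda>y. \<Sum>l\<in>near 2 x. \<rho>c (y - lp l)) x"
    proof (rule iter_pdiff_cong_open)
      fix y assume "y \<in> ball x 1"
      then show "complex_of_real (psum y) = (\<Sum>l\<in>near 2 x. \<rho>c (y - lp l))"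
        using psum_local[OF near_1_2 finite_near, of x y] by (simp add: \<rho>c_def)
    qed auto
    also have "\<dots> = (\<Sum>l\<in>near 2 x. iter_pdiff is (\<lambda>y. \<rho>c (y - lp l)) x)"
      by (subst iter_pdiff_sum) (auto intro: \<rho>c_smooth)
    also have "norm \<dots> \<le> real (card (near 2 x)) * (A * h ^ length is * gfact s (length is))"
      by (rule sum_norm_bound) (rule mboundD[OF mbound_shift[OF m]])
    also have "\<dots> \<le> near_card TYPE('n) 2 * (A * h ^ length is * gfact s (length is))"
      using A by (intro mult_right_mono card_near) auto
    finally show "norm (iter_pdiff is (\<lambda>\<xi>. complex_of_real (psum \<xi>)) x)
       \<le> near_card TYPE('n) 2 * A * h ^ length is * gfact s (length is)" by (simp add: mult.assoc)
  qed
  moreover have "0 \<le> near_card TYPE('n) 2 * A" using A by (simp add: near_card_def)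
  ultimately show ?thesis using that A by blast
qed

lemma \<sigma>_eq: "\<sigma> k = (\<lambda>\<xi>. \<rho>c (\<xi> - lp k) * inverse (complex_of_real (psum \<xi>)))"
  by (simp add: sigma_fun_def \<rho>c_def psum_def fun_eq_iff)

lemma \<sigma>_shift: "\<sigma> k \<xi> = \<sigma> 0 (\<xi> - lp k)"
  by (simp add: \<sigma>_eq psum_periodic lattice_point_0)

text \<open>The bounds are uniform in k because \<open>\<sigma> k\<close> is a translate of
  \<open>\<rho>c\<close> divided by the fixed function \<open>psum\<close>.\<close>

lemma \<sigma>_mbound_ex:
  "\<exists>B b. 0 \<le> B \<and> 1 \<le> b \<and> (\<forall>k. mbound s B b (\<sigma> k)) \<and> \<sigma> 0 \<in> gs_space s"
proof -
  obtain B b where B: "0 \<le> B" "1 \<le> b" and P: "mbound s B b (\<lambda>\<xi>. complex_of_real (psum \<xi>))" by (rule psum_mbound)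
  obtain c where c: "0 < c" and cP: "\<And>\<xi>. c \<le> psum \<xi>" using psum_lower by blast
  have cP': "c \<le> norm (complex_of_real (psum \<xi>))" for \<xi> using cP[of \<xi>] by simp
  define q where "q = b * (2 + B / c)"
  have q: "1 \<le> q" using mult_mono[of 1 b 1 "2 + B / c"] B c by (simp add: q_def)
  have V: "mbound s (1 / c) q (\<lambda>\<xi>. inverse (complex_of_real (psum \<xi>)))"
    unfolding q_def by (rule mbound_inverse[OF P s_ge1 B(2,1) c cP'])
  obtain A h where A: "0 \<le> A" "1 \<le> h" and g: "gsb UNIV s A h \<rho>c" and m: "mbound s A h \<rho>c" by (rule \<rho>c_mbound)
  have "mbound s (1 / c * A) (2 * h * q) (\<sigma> k)" for k
    unfolding \<sigma>_eq by (rule mbound_mult[OF mbound_shift[OF m] V s_ge1]) (use A c q in auto)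
  moreover have "(\<lambda>\<xi>. inverse (complex_of_real (psum \<xi>)) * \<rho>c \<xi>) \<in> gs_space s"
    by (rule gs_space_mult[OF V _ \<rho>c_gs s_ge1]) (use c in auto)
  then have "\<sigma> 0 \<in> gs_space s" by (simp add: \<sigma>_eq lattice_point_0 mult.commute)
  moreover have "1 \<le> 2 * h * q" using mult_mono[of 1 "2 * h" 1 q] A q by simp
  moreover have "0 \<le> 1 / c * A" using A c by simp
  ultimately show ?thesis by blast
qed

lemma \<sigma>_gs: "\<sigma> k \<in> gs_space s"
proof -
  have "(\<lambda>\<xi>. \<sigma> 0 (1 *\<^sub>R \<xi> + (- lp k))) \<in> gs_space s"
    by (rule gs_space_affine) (use \<sigma>_mbound_ex s_ge1 in auto)
  also have "(\<lambda>\<xi>. \<sigma> 0 (1 *\<^sub>R \<xi> + (- lp k))) = \<sigma> k" by (rule ext) (subst \<sigma>_shift[of k], simp)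
  finally show ?thesis .
qed

lemma \<sigma>_support: "\<sigma> k \<xi> \<noteq> 0 \<Longrightarrow> k \<in> near 1 \<xi>"
  using \<rho>_shift_near[of \<xi> k] by (auto simp: \<sigma>_eq \<rho>c_def)

lemma \<sigma>_sum:
  assumes "near 1 \<xi> \<subseteq> L" "finite L"
  shows "(\<Sum>l\<in>L. \<sigma> l \<xi>) = 1"
proof -
  have "(\<Sum>l\<in>L. \<sigma> l \<xi>) = complex_of_real (\<Sum>l\<in>L. \<rho> (\<xi> - lp l)) * inverse (complex_of_real (psum \<xi>))"
    by (simp add: \<sigma>_eq sum_distrib_right \<rho>c_def)
  also have "\<dots> = complex_of_real (psum \<xi>) * inverse (complex_of_real (psum \<xi>))"
    by (simp only: psum_local[OF assms])
  finally show ?thesis using psum_pos[of \<xi>] by simp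
qed

lemma \<sigma>_smooth: "smooth_fun (\<sigma> k)"
  using \<sigma>_mbound_ex mbound_smooth by blast

text \<open>One minus a partial sum of the partition, written additively so that the rules for sums
  and scalar multiples apply directly.\<close>

definition cutoff :: "nat \<Rightarrow> real^'n \<Rightarrow> complex" where
  "cutoff N \<xi> = 1 + (\<Sum>l\<in>near (real N) 0. (- 1) * \<sigma> l \<xi>)"

text \<open>The number of summands grows with N, but near any point only boundedly many of them are
  nonzero, so the constants are independent of N.\<close>

lemma cutoff_mbound: "\<exists>B b. 0 \<le> B \<and> 1 \<le> b \<and> (\<forall>N. mbound s B b (cutoff N))"
proof -
  obtain B b where B: "0 \<le> B" "1 \<le> b" and m: "\<And>k. mbound s B b (\<sigma> k)" using \<sigma>_mbound_ex by blast
  define M where "M = near_card TYPE('n) 2"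
  have M: "M \<ge> 0" by (simp add: M_def near_card_def)
  have "mbound s (1 + M * B) b (cutoff N)" for N
    unfolding mbound_def
  proof (intro conjI allI)
    have sm: "smooth_fun (\<lambda>\<xi>. (- 1) * \<sigma> l \<xi>)" for l by (intro smooth_fun_mult smooth_fun_const \<sigma>_smooth)
    have smS: "smooth_fun (\<lambda>\<xi>. \<Sum>l\<in>near (real N) 0. (- 1) * \<sigma> l \<xi>)" by (intro smooth_fun_sum sm)
    show "smooth_fun (cutoff N)" unfolding cutoff_def[abs_def] by (intro smooth_fun_add smooth_fun_const smS)
    fix "is" :: "'n list" and x
    let ?Q = "b ^ length is * gfact s (length is)"
    have zero: "iter_pdiff is (\<sigma> l) x = 0" if "l \<notin> near 2 x" for l
    proof -
      have "iter_pdiff is (\<sigma> l) x = iter_pdiff is (\<lambda>_. 0) x"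
      proof (rule iter_pdiff_cong_open)
        fix y assume "y \<in> ball x 1"
        then have "l \<notin> near 1 y" using near_1_2[of x y] that by auto
        then show "\<sigma> l y = 0" using \<sigma>_support by blast
      qed auto
      then show ?thesis by (simp add: iter_pdiff_const)
    qed
    have "iter_pdiff is (cutoff N) x = iter_pdiff is (\<lambda>x. 1) x + (\<Sum>l\<in>near (real N) 0. (- 1) * iter_pdiff is (\<sigma> l) x)"
      unfolding cutoff_def[abs_def] iter_pdiff_add[OF smooth_fun_const smS] iter_pdiff_sum[OF sm] iter_pdiff_cmult[OF \<sigma>_smooth] ..
    also have "(\<Sum>l\<in>near (real N) 0. (- 1) * iter_pdiff is (\<sigma> l) x) = (\<Sum>l\<in>near (real N) 0 \<inter> near 2 x. (- 1) * iter_pdiff is (\<sigma> l) x)"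
      by (rule sum.mono_neutral_right) (auto simp: finite_near zero)
    finally have "norm (iter_pdiff is (cutoff N) x) \<le> norm (iter_pdiff is (\<lambda>x. 1 :: complex) x)
        + norm (\<Sum>l\<in>near (real N) 0 \<inter> near 2 x. (- 1) * iter_pdiff is (\<sigma> l) x)"
      by (simp add: norm_triangle_ineq)
    also have "\<dots> \<le> 1 * ?Q + M * B * ?Q"
    proof (rule add_mono)
      show "norm (iter_pdiff is (\<lambda>x. 1 :: complex) x) \<le> 1 * ?Q"
        using B by (simp add: iter_pdiff_const)
      have "norm (\<Sum>l\<in>near (real N) 0 \<inter> near 2 x. (- 1) * iter_pdiff is (\<sigma> l) x)
         \<le> real (card (near (real N) 0 \<inter> near 2 x)) * (B * ?Q)"
        by (rule sum_norm_bound) (use mboundD[OF m] in \<open>simp add: mult.assoc\<close>)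
      also have "\<dots> \<le> M * (B * ?Q)"
      proof (rule mult_right_mono)
        have "card (near (real N) 0 \<inter> near 2 x) \<le> card (near 2 x)" by (intro card_mono finite_near) auto
        then show "real (card (near (real N) 0 \<inter> near 2 x)) \<le> M"
          unfolding M_def using card_near[of 2 x] by linarith
      qed (use B in auto)
      finally show "norm (\<Sum>l\<in>near (real N) 0 \<inter> near 2 x. (- 1) * iter_pdiff is (\<sigma> l) x) \<le> M * B * ?Q"
        by (simp add: mult.assoc)
    qed
    also have "\<dots> = (1 + M * B) * b ^ length is * gfact s (length is)" by (simp add: algebra_simps)
    finally show "norm (iter_pdiff is (cutoff N) x) \<le> (1 + M * B) * b ^ length is * gfact s (length is)" .
  qed
  moreover have "0 \<le> 1 + M * B" using M B by simp
  ultimately show ?thesis using B by blast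
qed

text \<open>The step to \<open>Suc N\<close> makes room for the supports of sup-radius 1: every
  index active at x is then included, and the partition adds up to 1.\<close>

lemma cutoff_zero:
  assumes "norm x < real N" shows "cutoff (Suc N) x = 0"
proof -
  have "near 1 x \<subseteq> near (real (Suc N)) 0"
  proof
    fix l assume l: "l \<in> near 1 x"
    have "\<bar>real_of_int (l $ i)\<bar> \<le> real (Suc N)" for i
    proof -
      have "\<bar>x $ i - real_of_int (l $ i)\<bar> \<le> 1" using l by (simp add: near_def)
      then show ?thesis using component_le_norm_cart[of x i] assms by simp
    qed
    then show "l \<in> near (real (Suc N)) 0" by (simp add: near_def)
  qed
  then show ?thesis using \<sigma>_sum[OF _ finite_near, of x "real (Suc N)" 0] by (simp add: cutoff_def sum_negf)
qed

text \<open>The product vanishes for |x| < N, so one spare power of |x| yields the factor 1 / N. It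
  raises k by one, and the larger factorial costs a factor \<open>2 powr s\<close> in the
  scale.\<close>

lemma tail_gsb:
  assumes f: "f \<in> gs_space s"
  shows "\<exists>A h. 0 \<le> A \<and> 1 \<le> h \<and> (\<forall>N. 0 < N \<longrightarrow> gsb UNIV s (A / real N) h (\<lambda>x. cutoff (Suc N) x * f x))"
proof -
  obtain B b where B: "0 \<le> B" "1 \<le> b" and m: "\<And>N. mbound s B b (cutoff N)" using cutoff_mbound by blast
  obtain A h where A: "0 \<le> A" "1 \<le> h" and g: "gsb UNIV s A h f" using gs_spaceE[OF f s_ge1] .
  define h1 where "h1 = 2 * b * h"
  have h1: "1 \<le> h1" using mult_mono[of 1 "2 * b" 1 h] A B by (simp add: h1_def)
  have G: "gsb UNIV s (A * B) h1 (\<lambda>x. cutoff (Suc N) x * f x)" for N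
    unfolding h1_def by (rule gsb_mult[OF m g s_ge1 B(2) A(2,1) B(1)])
  define p where "p = 2 powr s"
  have p: "1 \<le> p" unfolding p_def using s1 by (intro ge_one_powr_ge_zero) auto
  define A' where "A' = A * B * h1 * p"
  have A': "A' \<ge> 0" using A B h1 p by (simp add: A'_def)
  have "gsb UNIV s (A' / real N) (h1 * p) (\<lambda>x. cutoff (Suc N) x * f x)" if N: "0 < N" for N
    unfolding gsb_def
  proof (intro conjI allI ballI)
    let ?g = "\<lambda>x. cutoff (Suc N) x * f x"
    show "smooth_fun ?g" by (rule gsb_smooth[OF G])
    fix k and x :: "real^'n" and "is" :: "'n list"
    let ?R = "A' / real N * (h1 * p) ^ (k + length is) * (gfact s k * gfact s (length is))"
    have R: "?R \<ge> 0" using A' h1 p by simp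
    show "norm x ^ k * norm (iter_pdiff is ?g x) \<le> ?R"
    proof (cases "norm x < real N")
      case True
      have "iter_pdiff is ?g x = iter_pdiff is (\<lambda>_. 0) x"
      proof (rule iter_pdiff_cong_open)
        show "open (ball (0 :: real^'n) (real N))" "x \<in> ball 0 (real N)" using True by auto
        fix y :: "real^'n" assume "y \<in> ball 0 (real N)"
        then show "?g y = 0" using cutoff_zero[of y N] by simp
      qed
      then show ?thesis using R by (simp add: iter_pdiff_const)
    next
      case False
      have "real N * (norm x ^ k * norm (iter_pdiff is ?g x)) \<le> norm x ^ Suc k * norm (iter_pdiff is ?g x)"
        using False by (simp add: mult.assoc[symmetric] mult_right_mono)
      also have "\<dots> \<le> A * B * h1 ^ (Suc k + length is) * (gfact s (Suc k) * gfact s (length is))"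
        by (rule gsbD[OF G UNIV_I])
      also have "\<dots> \<le> A * B * h1 ^ (Suc k + length is) * ((p ^ (Suc k + length is) * gfact s k) * gfact s (length is))"
      proof (intro mult_left_mono mult_right_mono)
        have "gfact s (k + 1) \<le> p ^ (k + 1) * gfact s k * gfact s 1"
          unfolding p_def by (rule gfact_add_le[OF s_ge0])
        also have "\<dots> \<le> p ^ (Suc k + length is) * gfact s k"
          using p by (simp add: power_increasing mult_right_mono del: power_Suc)
        finally show "gfact s (Suc k) \<le> p ^ (Suc k + length is) * gfact s k" by simp
      qed (use A B h1 in auto)
      also have "\<dots> = real N * ?R" using N by (simp add: A'_def power_mult_distrib mult_ac)
      finally have "real N * (norm x ^ k * norm (iter_pdiff is ?g x)) \<le> real N * ?R" .
      then show ?thesis using N by (subst (asm) mult_le_cancel_left_pos) auto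
    qed
  qed
  moreover have "1 \<le> h1 * p" using mult_mono[OF h1 p] h1 by simp
  ultimately show ?thesis using A' by blast
qed

lemma multop_\<sigma>_gs: "f \<in> gs_space s \<Longrightarrow> multop (\<sigma> k) f \<in> gs_space s"
  using \<sigma>_mbound_ex multop_gs_space(2)[OF _ _ _ s_ge1] by blast

text \<open>The remainder after finitely many pieces is u at the transform of
  \<open>cutoff (Suc N)\<close> times \<open>inv_fourier f\<close>. Its Gelfand-Shilov constant is
  O(1 / N) at a scale independent of N, so continuity of u at that one scale suffices.\<close>

theorem partition_limit:
  assumes u: "u \<in> gs_dual s" and f: "f \<in> gs_space s"
  shows "(\<lambda>N. \<Sum>l\<in>near (real (Suc N)) 0. u (multop (\<sigma> l) f)) \<longlonglongrightarrow> u f"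
proof -
  define \<psi> where "\<psi> = inv_fourier f"
  have \<psi>: "\<psi> \<in> gs_space s" unfolding \<psi>_def by (rule gs_space_fourier(2)[OF f s_ge1])
  obtain B b where Bb: "0 \<le> B" "1 \<le> b" "\<And>k. mbound s B b (\<sigma> k)" using \<sigma>_mbound_ex by blast
  have sg: "(\<lambda>\<xi>. \<sigma> k \<xi> * \<psi> \<xi>) \<in> gs_space s" for k by (rule gs_space_mult[OF Bb(3,1) \<psi> s_ge1])
  obtain A h where A: "0 \<le> A" "1 \<le> h" and t: "\<And>N. 0 < N \<Longrightarrow> gsb UNIV s (A / real N) h (\<lambda>x. cutoff (Suc N) x * \<psi> x)"
    using tail_gsb[OF \<psi>] by blast
  obtain C h' where C: "0 \<le> C" "1 \<le> h'" and F: "\<And>A f. 0 \<le> A \<Longrightarrow> gsb pure_lists s A h f \<Longrightarrow> gsb UNIV s (C * A) h' (fourier (f :: real^'n \<Rightarrow> complex))"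
    using fourier_gsb[OF s_ge1 A(2), where 'n = 'n] by blast
  obtain D where D: "0 \<le> D" "\<And>A f. 0 \<le> A \<Longrightarrow> gsb UNIV s A h' f \<Longrightarrow> norm (u f) \<le> D * A"
    using gs_dual_continuous[OF u s_ge1 C(2)] by blast
  have split: "(\<Sum>l\<in>near (real (Suc N)) 0. u (multop (\<sigma> l) f)) - u f = - u (fourier (\<lambda>x. cutoff (Suc N) x * \<psi> x))" if N: "0 < N" for N
  proof -
    let ?L = "near (real (Suc N)) (0 :: real^'n)"
    have tg: "(\<lambda>x. cutoff (Suc N) x * \<psi> x) \<in> gs_space s"
      by (rule gs_spaceI[OF t[OF N]]) (use A s_ge1 in auto)
    have S: "(\<lambda>x. \<Sum>l\<in>?L. multop (\<sigma> l) f x) \<in> gs_space s" by (intro gs_space_sum multop_\<sigma>_gs f s_ge1)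
    have "f = (\<lambda>x. (\<Sum>l\<in>?L. multop (\<sigma> l) f x) + fourier (\<lambda>x. cutoff (Suc N) x * \<psi> x) x)"
    proof
      fix x :: "real^'n"
      let ?e = "\<lambda>\<xi>. exp (- \<i> * complex_of_real (\<xi> \<bullet> x))"
      have i: "integrable lborel (\<lambda>\<xi>. g \<xi> * ?e \<xi>)" if "g \<in> gs_space s" for g
        by (rule integrable_mult_unimodular[OF gs_space_integrable[OF that s_ge1]]) (auto simp: norm_iexp)
      have "\<psi> \<xi> * ?e \<xi> = (\<Sum>l\<in>?L. (\<sigma> l \<xi> * \<psi> \<xi>) * ?e \<xi>) + (cutoff (Suc N) \<xi> * \<psi> \<xi>) * ?e \<xi>" for \<xi>
      proof -
        have 1: "(\<Sum>l\<in>?L. (\<sigma> l \<xi> * \<psi> \<xi>) * ?e \<xi>) = (\<Sum>l\<in>?L. \<sigma> l \<xi>) * (\<psi> \<xi> * ?e \<xi>)"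
          by (simp only: sum_distrib_right mult.assoc)
        have 2: "cutoff (Suc N) \<xi> = 1 - (\<Sum>l\<in>?L. \<sigma> l \<xi>)"
          by (simp add: cutoff_def sum_negf)
        show ?thesis unfolding 1 2 by (simp only: left_diff_distrib mult_1_left mult.assoc add_diff_eq add_diff_cancel_left')
      qed
      then have "(\<integral>\<xi>. \<psi> \<xi> * ?e \<xi> \<partial>lborel) = (\<integral>\<xi>. (\<Sum>l\<in>?L. (\<sigma> l \<xi> * \<psi> \<xi>) * ?e \<xi>) + (cutoff (Suc N) \<xi> * \<psi> \<xi>) * ?e \<xi> \<partial>lborel)"
        by (simp only:)
      also have "\<dots> = (\<Sum>l\<in>?L. (\<integral>\<xi>. (\<sigma> l \<xi> * \<psi> \<xi>) * ?e \<xi> \<partial>lborel)) + (\<integral>\<xi>. (cutoff (Suc N) \<xi> * \<psi> \<xi>) * ?e \<xi> \<partial>lborel)"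
        by (simp only: Bochner_Integration.integral_add Bochner_Integration.integral_sum Bochner_Integration.integrable_sum i sg tg)
      finally have "fourier \<psi> x = (\<Sum>l\<in>?L. fourier (\<lambda>\<xi>. \<sigma> l \<xi> * \<psi> \<xi>) x) + fourier (\<lambda>x. cutoff (Suc N) x * \<psi> x) x"
        unfolding fourier_eq by (simp only: distrib_left sum_distrib_left)
      then show "f x = (\<Sum>l\<in>?L. multop (\<sigma> l) f x) + fourier (\<lambda>x. cutoff (Suc N) x * \<psi> x) x"
        by (simp only: multop_def \<psi>_def gs_space_fourier(3)[OF f s_ge1])
    qed
    then have "u f = u (\<lambda>x. (\<Sum>l\<in>?L. multop (\<sigma> l) f x) + fourier (\<lambda>x. cutoff (Suc N) x * \<psi> x) x)" by simp
    also have "\<dots> = u (\<lambda>x. \<Sum>l\<in>?L. multop (\<sigma> l) f x) + u (fourier (\<lambda>x. cutoff (Suc N) x * \<psi> x))"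
      by (rule gs_dual_add[OF u S gs_space_fourier(1)[OF tg s_ge1] s_ge1])
    also have "u (\<lambda>x. \<Sum>l\<in>?L. multop (\<sigma> l) f x) = (\<Sum>l\<in>?L. u (multop (\<sigma> l) f))"
      by (rule gs_dual_sum[OF u multop_\<sigma>_gs[OF f] s_ge1])
    finally show ?thesis by simp
  qed
  have "(\<lambda>N. (\<Sum>l\<in>near (real (Suc N)) 0. u (multop (\<sigma> l) f)) - u f) \<longlonglongrightarrow> 0"
  proof (rule Lim_null_comparison)
    show "\<forall>\<^sub>F N in sequentially. norm ((\<Sum>l\<in>near (real (Suc N)) 0. u (multop (\<sigma> l) f)) - u f) \<le> D * (C * (A / real N))"
      using eventually_gt_at_top[of 0]
    proof eventually_elim
      case (elim N)
      have "gsb UNIV s (C * (A / real N)) h' (fourier (\<lambda>x. cutoff (Suc N) x * \<psi> x))"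
        by (rule F[OF _ gsb_subset[OF t[OF elim]]]) (use A in auto)
      from D(2)[OF _ this] show ?case unfolding split[OF elim] using A C by simp
    qed
    show "(\<lambda>N. D * (C * (A / real N))) \<longlonglongrightarrow> 0"
      using tendsto_mult_right_zero[OF tendsto_mult_right_zero[OF lim_const_over_n]] by blast
  qed
  then show ?thesis by (simp add: LIM_zero_iff)
qed

end

section \<open>Lebesgue norms with values in [0, \<infinity>]\<close>

section \<open>Lebesgue norms of extended nonnegative functions\<close>

lemma ennreal_powr_ennreal: "0 \<le> r \<Longrightarrow> ennreal_powr (ennreal r) a = ennreal (r powr a)"
  by (simp add: ennreal_powr_def)

lemma ennreal_powr_top [simp]: "ennreal_powr \<infinity> a = \<infinity>" "ennreal_powr \<top> a = \<top>"
  by (simp_all add: ennreal_powr_def)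

lemma ennreal_powr_0 [simp]: "ennreal_powr 0 a = 0"
  by (simp add: ennreal_powr_def)

lemma ennreal_powr_mono: "x \<le> y \<Longrightarrow> 0 \<le> a \<Longrightarrow> ennreal_powr x a \<le> ennreal_powr y a"
  by (cases x; cases y) (auto simp: ennreal_powr_ennreal powr_mono2 top_unique)

lemma ennreal_powr_mult: "0 < a \<Longrightarrow> ennreal_powr (x * y) a = ennreal_powr x a * ennreal_powr y a"
proof (cases x; cases y)
  fix r q assume "0 \<le> r" "x = ennreal r" "0 \<le> q" "y = ennreal q"
  then show "ennreal_powr (x * y) a = ennreal_powr x a * ennreal_powr y a"
    by (simp add: ennreal_mult[symmetric] ennreal_powr_ennreal powr_mult)
next
  fix r assume a: "0 < a" and r: "0 \<le> r" "x = ennreal r" "y = \<top>"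
  then show "ennreal_powr (x * y) a = ennreal_powr x a * ennreal_powr y a"
    by (cases "r = 0") (auto simp: ennreal_powr_ennreal ennreal_mult_top)
next
  fix r assume a: "0 < a" and r: "0 \<le> r" "y = ennreal r" "x = \<top>"
  then show "ennreal_powr (x * y) a = ennreal_powr x a * ennreal_powr y a"
    by (cases "r = 0") (auto simp: ennreal_powr_ennreal ennreal_top_mult)
qed auto

lemma ennreal_powr_powr: "ennreal_powr (ennreal_powr x a) b = ennreal_powr x (a * b)"
  by (cases x) (simp_all add: ennreal_powr_ennreal powr_powr)

lemma ennreal_powr_one [simp]: "ennreal_powr x 1 = x"
  by (cases x) (simp_all add: ennreal_powr_ennreal)

lemma ennreal_powr_two: "x\<^sup>2 = ennreal_powr x 2"
  by (cases x) (simp_all add: ennreal_powr_ennreal ennreal_power powr_numeral)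

lemma ennreal_powr_eq_top_iff [simp]: "ennreal_powr x a = \<top> \<longleftrightarrow> x = \<top>"
  by (cases x) (simp_all add: ennreal_powr_ennreal)

lemma ennreal_powr_inverse: "a \<noteq> 0 \<Longrightarrow> ennreal_powr (ennreal_powr x a) (1 / a) = x"
  "a \<noteq> 0 \<Longrightarrow> ennreal_powr (ennreal_powr x (1 / a)) a = x"
  by (simp_all add: ennreal_powr_powr)

lemma ennreal_powr_cancel:
  assumes "0 < a" "ennreal_powr x a \<le> ennreal_powr y a" shows "x \<le> y"
  using ennreal_powr_mono[OF assms(2), of "1 / a"] assms(1) by (simp add: ennreal_powr_inverse)

lemma ennreal_powr_le_iff:
  assumes "0 < a" shows "ennreal_powr x (1 / a) \<le> y \<longleftrightarrow> x \<le> ennreal_powr y a"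
  using assms ennreal_powr_mono[of "ennreal_powr x (1 / a)" y a] ennreal_powr_mono[of x "ennreal_powr y a" "1 / a"]
  by (auto simp: ennreal_powr_inverse)

lemma ennreal_powr_measurable [measurable]:
  assumes [measurable]: "f \<in> borel_measurable M"
  shows "(\<lambda>x. ennreal_powr (f x) a) \<in> borel_measurable M"
  unfolding ennreal_powr_def by measurable

text \<open>The tangent to the convex curve \<open>y powr P\<close> at t lies below the
  curve.\<close>

lemma powr_young:
  fixes y t P :: real
  assumes "0 \<le> y" "0 < t" "1 \<le> P"
  shows "P * t powr (P - 1) * y \<le> y powr P + (P - 1) * t powr P"
proof (cases "y = 0")
  case False
  then have y: "y > 0" using assms by simp
  have "(y powr P) powr (1 / P) * (t powr P) powr (1 - 1 / P) \<le> 1 / P * y powr P + (1 - 1 / P) * t powr P"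
    using assms y by (intro Youngs_inequality_0) auto
  moreover have "(y powr P) powr (1 / P) = y" using assms y by (simp add: powr_powr)
  moreover have "(t powr P) powr (1 - 1 / P) = t powr (P - 1)" using assms by (simp add: powr_powr right_diff_distrib)
  ultimately have "y * t powr (P - 1) \<le> 1 / P * y powr P + (1 - 1 / P) * t powr P" by simp
  then have "P * (y * t powr (P - 1)) \<le> P * (1 / P * y powr P + (1 - 1 / P) * t powr P)"
    using assms by (intro mult_left_mono) auto
  also have "\<dots> = y powr P + (P - 1) * t powr P" using assms by (simp add: field_simps)
  finally show ?thesis by (simp add: mult_ac)
qed (use assms in auto)

text \<open>The tangent inequality is integrated at t equal to the weighted integral of f; mass at
  most 1 is enough because the constant term is nonnegative. If that integral is infinite, y \<le> 1
  + y^P makes the right-hand side infinite as well.\<close>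

lemma jensen_powr:
  assumes [measurable]: "f \<in> borel_measurable M" "w \<in> borel_measurable M"
    and w: "(\<integral>\<^sup>+x. w x \<partial>M) \<le> 1" and P: "1 \<le> P"
  shows "ennreal_powr (\<integral>\<^sup>+x. f x * w x \<partial>M) P \<le> (\<integral>\<^sup>+x. ennreal_powr (f x) P * w x \<partial>M)"
proof (cases "\<integral>\<^sup>+x. f x * w x \<partial>M")
  case top
  have le: "y \<le> 1 + ennreal_powr y P" for y
  proof (cases y)
    case (real r)
    have "r \<le> 1 + r powr P"
    proof (cases "r \<le> 1")
      case False
      then have "r powr 1 \<le> r powr P" using P by (intro powr_mono) auto
      then show ?thesis using False by simp
    qed (simp add: add_increasing2)
    then show ?thesis using real
      by (simp add: ennreal_powr_ennreal ennreal_plus[symmetric] ennreal_1[symmetric] del: ennreal_plus ennreal_1)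
  qed simp
  have "\<top> \<le> (\<integral>\<^sup>+x. (1 + ennreal_powr (f x) P) * w x \<partial>M)"
    unfolding top[symmetric] by (intro nn_integral_mono mult_right_mono le) auto
  also have "\<dots> = (\<integral>\<^sup>+x. w x \<partial>M) + (\<integral>\<^sup>+x. ennreal_powr (f x) P * w x \<partial>M)"
    by (subst nn_integral_add[symmetric]) (auto simp: distrib_right)
  also have "\<dots> \<le> 1 + (\<integral>\<^sup>+x. ennreal_powr (f x) P * w x \<partial>M)" by (intro add_right_mono w)
  finally have "(\<integral>\<^sup>+x. ennreal_powr (f x) P * w x \<partial>M) = \<top>"
    by (simp add: top_unique ennreal_add_eq_top)
  then show ?thesis by simp
next
  case (real t)
  define J where "J = (\<integral>\<^sup>+x. ennreal_powr (f x) P * w x \<partial>M)"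
  show ?thesis
  proof (cases "t = 0")
    case False
    then have t: "t > 0" using real by simp
    have young: "ennreal (P * t powr (P - 1)) * y \<le> ennreal_powr y P + ennreal ((P - 1) * t powr P)" for y
    proof (cases y)
      case (real r)
      then show ?thesis
        using powr_young[OF real(1) t P] P
        by (simp add: ennreal_powr_ennreal ennreal_mult[symmetric] ennreal_plus[symmetric] del: ennreal_plus)
    qed simp
    have "ennreal (P * t powr (P - 1)) * ennreal t = (\<integral>\<^sup>+x. (ennreal (P * t powr (P - 1)) * f x) * w x \<partial>M)"
      unfolding real(2)[symmetric] by (subst nn_integral_cmult[symmetric]) (auto simp: mult.assoc)
    also have "\<dots> \<le> (\<integral>\<^sup>+x. (ennreal_powr (f x) P + ennreal ((P - 1) * t powr P)) * w x \<partial>M)"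
      by (intro nn_integral_mono mult_right_mono young) auto
    also have "\<dots> = J + ennreal ((P - 1) * t powr P) * (\<integral>\<^sup>+x. w x \<partial>M)"
      unfolding J_def by (simp add: distrib_right nn_integral_add nn_integral_cmult)
    also have "\<dots> \<le> J + ennreal ((P - 1) * t powr P) * 1"
      by (intro add_left_mono mult_left_mono w) auto
    finally have "ennreal (P * t powr (P - 1)) * ennreal t \<le> J + ennreal ((P - 1) * t powr P)" by simp
    also have "ennreal (P * t powr (P - 1)) * ennreal t = ennreal (t powr P) + ennreal ((P - 1) * t powr P)"
    proof -
      have "t powr (P - 1) * t = t powr P" using powr_add[of t "P - 1" 1] t by simp
      then have "P * t powr (P - 1) * t = t powr P + (P - 1) * t powr P" by (simp add: algebra_simps)
      then show ?thesis using t P by (simp add: ennreal_mult[symmetric] ennreal_plus[symmetric] del: ennreal_plus)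
    qed
    finally have "ennreal (t powr P) \<le> J" by (simp add: ennreal_add_left_cancel_le add.commute[of _ "ennreal ((P - 1) * t powr P)"])
    then show ?thesis using real by (simp add: J_def ennreal_powr_ennreal)
  qed (use real in simp)
qed

text \<open>One definition for the L^p norm on \<open>lborel\<close> and for the l^q norm on a
  counting measure; extended values spare integrability assumptions.\<close>

definition eLp :: "'a measure \<Rightarrow> ennreal \<Rightarrow> ('a \<Rightarrow> ennreal) \<Rightarrow> ennreal" where
  "eLp M p f = (if p = \<infinity> then esssup M f
     else ennreal_powr (\<integral>\<^sup>+x. ennreal_powr (f x) (enn2real p) \<partial>M) (1 / enn2real p))"

lemma enn2real_ge_1: "1 \<le> p \<Longrightarrow> p \<noteq> \<infinity> \<Longrightarrow> 1 \<le> enn2real p"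
  by (cases p) auto

lemma eLp_mono:
  assumes "f \<in> borel_measurable M" "AE x in M. f x \<le> g x"
  shows "eLp M p f \<le> eLp M p g"
proof (cases "p = \<infinity>")
  case True
  then show ?thesis using assms by (simp add: eLp_def esssup_AE_mono)
next
  case False
  have "(\<integral>\<^sup>+x. ennreal_powr (f x) (enn2real p) \<partial>M) \<le> (\<integral>\<^sup>+x. ennreal_powr (g x) (enn2real p) \<partial>M)"
    by (rule nn_integral_mono_AE) (use assms(2) in \<open>auto elim!: AE_mp intro!: ennreal_powr_mono\<close>)
  then show ?thesis using False by (simp add: eLp_def ennreal_powr_mono)
qed

lemma eLp_cong: "f \<in> borel_measurable M \<Longrightarrow> g \<in> borel_measurable M \<Longrightarrow> AE x in M. f x = g x \<Longrightarrow> eLp M p f = eLp M p g"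
  by (intro antisym eLp_mono) (auto elim: AE_mp)

lemma eLp_zero: "1 \<le> p \<Longrightarrow> eLp M p (\<lambda>x. 0) = 0"
  using esssup_I[of "\<lambda>x. 0 :: ennreal" M 0] by (auto simp: eLp_def)

lemma eLp_le_iff:
  assumes "1 \<le> p" "p \<noteq> \<infinity>"
  shows "eLp M p f \<le> y \<longleftrightarrow> (\<integral>\<^sup>+x. ennreal_powr (f x) (enn2real p) \<partial>M) \<le> ennreal_powr y (enn2real p)"
  using assms enn2real_ge_1[OF assms] by (simp add: eLp_def ennreal_powr_le_iff)

lemma eLp_powr:
  assumes "1 \<le> p" "p \<noteq> \<infinity>"
  shows "ennreal_powr (eLp M p f) (enn2real p) = (\<integral>\<^sup>+x. ennreal_powr (f x) (enn2real p) \<partial>M)"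
  using assms enn2real_ge_1[OF assms] by (simp add: eLp_def ennreal_powr_inverse)

lemma eLp_cmult:
  assumes [measurable]: "f \<in> borel_measurable M" and p: "1 \<le> p"
  shows "eLp M p (\<lambda>x. c * f x) \<le> c * eLp M p f"
proof (cases "p = \<infinity>")
  case True
  have "AE x in M. c * f x \<le> c * esssup M f"
    using esssup_AE[of f M] by (rule AE_mp) (auto intro!: mult_left_mono)
  then show ?thesis using True by (auto simp: eLp_def intro!: esssup_I)
next
  case False
  have P: "enn2real p > 0" using enn2real_ge_1[OF p False] by simp
  show ?thesis
    using P by (subst eLp_le_iff[OF p False]) (simp add: ennreal_powr_mult eLp_powr[OF p False] nn_integral_cmult)
qed

text \<open>Cauchy-Schwarz for the p-th powers of f and g; this is the source of the exponent 2
  p.\<close>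

lemma eLp_product:
  assumes [measurable]: "f \<in> borel_measurable M" "g \<in> borel_measurable M" and p: "1 \<le> p"
  shows "eLp M p (\<lambda>x. f x * g x) \<le> eLp M (2 * p) f * eLp M (2 * p) g"
proof (cases "p = \<infinity>")
  case True
  have p2: "2 * p = \<infinity>" using True by (simp add: ennreal_mult_top)
  have "AE x in M. f x * g x \<le> esssup M f * esssup M g"
    using esssup_AE[of f M] esssup_AE[of g M] by eventually_elim (auto intro: mult_mono)
  then show ?thesis unfolding eLp_def p2 using True by (auto intro!: esssup_I)
next
  case False
  have P: "enn2real p > 0" using enn2real_ge_1[OF p False] by simp
  have p2: "2 * p \<noteq> \<infinity>" using False by (simp add: ennreal_mult_eq_top_iff)
  have p21: "1 \<le> 2 * p" using p by (metis mult_2 add_increasing2 zero_le)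
  have P2: "enn2real (2 * p) = 2 * enn2real p" by (simp add: enn2real_mult)
  define X where "X = (\<integral>\<^sup>+x. ennreal_powr (f x) (enn2real (2 * p)) \<partial>M)"
  define Y where "Y = (\<integral>\<^sup>+x. ennreal_powr (g x) (enn2real (2 * p)) \<partial>M)"
  define Z where "Z = (\<integral>\<^sup>+x. ennreal_powr (f x * g x) (enn2real p) \<partial>M)"
  have sq: "(ennreal_powr y (enn2real p))\<^sup>2 = ennreal_powr y (enn2real (2 * p))" for y
    unfolding P2 ennreal_powr_two ennreal_powr_powr by (simp add: mult.commute)
  have "Z\<^sup>2 = (\<integral>\<^sup>+x. ennreal_powr (f x) (enn2real p) * ennreal_powr (g x) (enn2real p) \<partial>M)\<^sup>2"
    unfolding Z_def ennreal_powr_mult[OF P] ..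
  also have "\<dots> \<le> X * Y" unfolding X_def Y_def sq[symmetric] by (rule Cauchy_Schwarz_nn_integral) measurable
  finally have "ennreal_powr (Z\<^sup>2) (1 / 2) \<le> ennreal_powr (X * Y) (1 / 2)" by (rule ennreal_powr_mono) simp
  then have "Z \<le> ennreal_powr (X * Y) (1 / 2)" unfolding ennreal_powr_two ennreal_powr_powr by simp
  also have "\<dots> = ennreal_powr (eLp M (2 * p) f * eLp M (2 * p) g) (enn2real p)"
    unfolding X_def Y_def eLp_powr[OF p21 p2, symmetric]
    using P by (simp add: ennreal_powr_mult ennreal_powr_powr P2)
  finally show ?thesis by (simp add: eLp_le_iff[OF p False] Z_def)
qed

section \<open>Minkowski's inequality for countable sums\<close>

lemma nn_integral_count_space_measurable:
  fixes f :: "'j::countable \<Rightarrow> 'a \<Rightarrow> ennreal"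
  assumes "\<And>j. f j \<in> borel_measurable M"
  shows "(\<lambda>x. \<integral>\<^sup>+j. f j x \<partial>count_space UNIV) \<in> borel_measurable M"
proof -
  interpret sigma_finite_measure "count_space (UNIV :: 'j set)"
    by (rule sigma_finite_measure_count_space_countable) auto
  have "(\<lambda>p. f (fst p) (snd p)) \<in> borel_measurable (count_space UNIV \<Otimes>\<^sub>M M)"
    by (rule measurable_pair_measure_countable1) (use assms in auto)
  from measurable_compose[OF measurable_pair_swap' this]
  have "(\<lambda>p. f (snd p) (fst p)) \<in> borel_measurable (M \<Otimes>\<^sub>M count_space UNIV)"
    by (simp add: case_prod_beta')
  from borel_measurable_nn_integral_fst[OF this] show ?thesis by simp
qed

lemma small_weights:
  fixes e :: real
  assumes "0 < e"
  shows "(\<integral>\<^sup>+j. ennreal (e * (1 / 2) ^ Suc (to_nat (j :: 'j::countable))) \<partial>count_space UNIV) \<le> ennreal e"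
proof -
  have "(\<integral>\<^sup>+j. ennreal (e * (1 / 2) ^ Suc (to_nat (j :: 'j))) \<partial>count_space UNIV)
     = (\<integral>\<^sup>+n. ennreal (e * (1 / 2) ^ Suc n) \<partial>count_space (range (to_nat :: 'j \<Rightarrow> nat)))"
    by (rule nn_integral_bij_count_space) (simp add: bij_betw_def)
  also have "\<dots> \<le> (\<integral>\<^sup>+n. ennreal (e * (1 / 2) ^ Suc n) \<partial>count_space UNIV)"
    by (subst nn_integral_count_space_indicator) (auto intro!: nn_integral_mono split: split_indicator)
  also have "\<dots> = (\<Sum>n. ennreal (e * (1 / 2) ^ Suc n))" by (rule nn_integral_count_space_nat)
  also have "\<dots> = ennreal (e * 1)"
    by (rule suminf_ennreal_eq) (use assms sums_mult[OF power_half_series, of e] in auto)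
  finally show ?thesis by simp
qed

text \<open>The sum is B times a weighted mean of f j / b j with weights b j / B, where b j lies
  slightly above the norm of f j. Jensen and integration bound the norm of that mean by 1.\<close>

lemma eLp_minkowski:
  fixes f :: "'j::countable \<Rightarrow> 'a \<Rightarrow> ennreal"
  assumes [measurable]: "\<And>j. f j \<in> borel_measurable M" and p: "1 \<le> p"
  shows "eLp M p (\<lambda>x. \<integral>\<^sup>+j. f j x \<partial>count_space UNIV) \<le> (\<integral>\<^sup>+j. eLp M p (f j) \<partial>count_space UNIV)"
proof (cases "p = \<infinity>")
  case True
  have "AE x in M. \<forall>j. f j x \<le> esssup M (f j)"
    unfolding AE_all_countable by (intro allI esssup_AE)
  then have "AE x in M. (\<integral>\<^sup>+j. f j x \<partial>count_space UNIV) \<le> (\<integral>\<^sup>+j. esssup M (f j) \<partial>count_space UNIV)"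
    by eventually_elim (auto intro: nn_integral_mono)
  then show ?thesis using True
    by (auto simp: eLp_def intro!: esssup_I nn_integral_count_space_measurable)
next
  case False
  define P where "P = enn2real p"
  have P: "1 \<le> P" using enn2real_ge_1[OF p False] by (simp add: P_def)
  define S where "S = (\<integral>\<^sup>+j. eLp M p (f j) \<partial>count_space UNIV)"
  show ?thesis
    unfolding S_def[symmetric]
  proof (rule ennreal_le_epsilon)
    fix e :: real assume S: "S < \<top>" and e: "0 < e"
    \<comment> \<open>The surplus keeps b j positive, so that division is safe where the norm is 0;
      in total it adds at most e.\<close>
    define b where "b j = eLp M p (f j) + ennreal (e * (1 / 2) ^ Suc (to_nat j))" for j
    have b0: "b j \<noteq> 0" for j using e by (simp add: b_def add_eq_0_iff_both_eq_0 ennreal_eq_0_iff not_le)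
    have "eLp M p (f j) \<le> S" for j unfolding S_def by (rule nn_integral_ge_point) simp
    then have "eLp M p (f j) \<noteq> \<top>" for j using S by (metis le_less_trans less_irrefl)
    then have bt: "b j \<noteq> \<top>" for j by (simp add: b_def ennreal_add_eq_top)
    have bbt: "b j * (1 / b j) = 1" for j
      using ennreal_divide_self[OF b0, of j] bt[of j] by (simp add: ennreal_times_divide less_top)
    define B where "B = (\<integral>\<^sup>+j. b j \<partial>count_space UNIV)"
    have BS: "B \<le> S + ennreal e"
    proof -
      have "B = S + (\<integral>\<^sup>+j. ennreal (e * (1 / 2) ^ Suc (to_nat (j :: 'j))) \<partial>count_space UNIV)"
        unfolding B_def b_def S_def by (rule nn_integral_add) auto
      then show ?thesis by (simp only: add_left_mono small_weights[OF e])
    qed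
    have Bt: "B \<noteq> \<top>" using BS S by (auto simp: top_unique ennreal_add_eq_top less_le)
    have "b undefined \<le> B" unfolding B_def by (rule nn_integral_ge_point) simp
    then have B0: "B \<noteq> 0" using b0[of undefined] by auto
    have BB: "B * (1 / B) = 1" using ennreal_divide_self[OF B0] Bt by (simp add: ennreal_times_divide less_top)
    define w where "w j = b j * (1 / B)" for j
    define g where "g j x = f j x * (1 / b j)" for j x
    have w1: "(\<integral>\<^sup>+j. w j \<partial>count_space UNIV) = 1"
      unfolding w_def by (subst nn_integral_multc) (auto simp: B_def[symmetric] BB)
    have fx: "(\<integral>\<^sup>+j. f j x \<partial>count_space UNIV) = B * (\<integral>\<^sup>+j. g j x * w j \<partial>count_space UNIV)" for x
    proof -
      have "f j x = B * (g j x * w j)" for j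
      proof -
        have "B * (g j x * w j) = f j x * (b j * (1 / b j)) * (B * (1 / B))" by (simp only: g_def w_def mult_ac)
        then show ?thesis by (simp add: bbt BB)
      qed
      then show ?thesis by (subst nn_integral_cmult[symmetric]) auto
    qed
    have [measurable]: "g j \<in> borel_measurable M" for j unfolding g_def[abs_def] by measurable
    have gP: "(\<integral>\<^sup>+x. ennreal_powr (g j x) P \<partial>M) \<le> 1" for j
    proof -
      have "(\<integral>\<^sup>+x. ennreal_powr (g j x) P \<partial>M) = (\<integral>\<^sup>+x. ennreal_powr (f j x) P \<partial>M) * ennreal_powr (1 / b j) P"
        using P by (simp add: g_def ennreal_powr_mult nn_integral_multc)
      also have "(\<integral>\<^sup>+x. ennreal_powr (f j x) P \<partial>M) = ennreal_powr (eLp M p (f j)) P"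
        unfolding P_def by (rule eLp_powr[OF p False, symmetric])
      also have "\<dots> * ennreal_powr (1 / b j) P \<le> ennreal_powr (b j) P * ennreal_powr (1 / b j) P"
        using P by (intro mult_right_mono ennreal_powr_mono) (auto simp: b_def)
      also have "\<dots> = ennreal_powr 1 P" using P by (simp add: ennreal_powr_mult[symmetric] bbt)
      also have "\<dots> = 1" using ennreal_powr_ennreal[of 1 P] by simp
      finally show ?thesis .
    qed
    have "(\<integral>\<^sup>+x. ennreal_powr (\<integral>\<^sup>+j. f j x \<partial>count_space UNIV) P \<partial>M)
       \<le> (\<integral>\<^sup>+x. ennreal_powr B P * (\<integral>\<^sup>+j. ennreal_powr (g j x) P * w j \<partial>count_space UNIV) \<partial>M)"
      unfolding fx using P
      by (intro nn_integral_mono) (auto simp: ennreal_powr_mult w1 intro!: mult_left_mono jensen_powr)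
    also have "\<dots> = ennreal_powr B P * (\<integral>\<^sup>+x. (\<integral>\<^sup>+j. ennreal_powr (g j x) P * w j \<partial>count_space UNIV) \<partial>M)"
      by (rule nn_integral_cmult) (intro nn_integral_count_space_measurable, measurable)
    also have "(\<integral>\<^sup>+x. (\<integral>\<^sup>+j. ennreal_powr (g j x) P * w j \<partial>count_space UNIV) \<partial>M)
       = (\<integral>\<^sup>+j. (\<integral>\<^sup>+x. ennreal_powr (g j x) P * w j \<partial>M) \<partial>count_space UNIV)"
      by (rule nn_integral_count_space_nn_integral) auto
    also have "\<dots> = (\<integral>\<^sup>+j. (\<integral>\<^sup>+x. ennreal_powr (g j x) P \<partial>M) * w j \<partial>count_space UNIV)"
      by (simp add: nn_integral_multc)
    also have "\<dots> \<le> (\<integral>\<^sup>+j. 1 * w j \<partial>count_space UNIV)"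
      by (intro nn_integral_mono mult_right_mono gP) auto
    also have "\<dots> = 1" using w1 by simp
    finally have "(\<integral>\<^sup>+x. ennreal_powr (\<integral>\<^sup>+j. f j x \<partial>count_space UNIV) P \<partial>M) \<le> ennreal_powr B P"
      by (simp add: mult_left_mono)
    then have "eLp M p (\<lambda>x. \<integral>\<^sup>+j. f j x \<partial>count_space UNIV) \<le> B"
      by (simp add: eLp_le_iff[OF p False] P_def)
    with BS show "eLp M p (\<lambda>x. \<integral>\<^sup>+j. f j x \<partial>count_space UNIV) \<le> S + ennreal e" by (rule order_trans[rotated])
  qed
qed

text \<open>Two functions form a family over the two-element type \<open>bool\<close>.\<close>

lemma eLp_add:
  assumes [measurable]: "f \<in> borel_measurable M" "g \<in> borel_measurable M" and p: "1 \<le> p"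
  shows "eLp M p (\<lambda>x. f x + g x) \<le> eLp M p f + eLp M p g"
proof -
  have "eLp M p (\<lambda>x. \<integral>\<^sup>+j. (if j then f x else g x) \<partial>count_space UNIV)
     \<le> (\<integral>\<^sup>+j. eLp M p (\<lambda>x. if j then f x else g x) \<partial>count_space UNIV)"
    by (rule eLp_minkowski[OF _ p]) measurable
  then show ?thesis by (simp add: nn_integral_count_space_finite UNIV_bool add.commute)
qed

section \<open>Convolution estimates\<close>

text \<open>Jensen with the weight k / M, of mass at most 1. Integrating over y gives Young's
  inequality for an integrable kernel; bounding k by M pointwise gives the supremum
  estimate.\<close>

lemma
  fixes f k :: "'a::euclidean_space \<Rightarrow> ennreal"
  assumes [measurable]: "f \<in> borel_measurable borel" "k \<in> borel_measurable borel"
    and p: "1 \<le> p" and kM: "(\<integral>\<^sup>+x. k x \<partial>lborel) \<le> ennreal M" and M: "0 < M"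
  shows eLp_conv: "eLp lborel p (\<lambda>y. \<integral>\<^sup>+x. f x * k (y - x) \<partial>lborel) \<le> ennreal M * eLp lborel p f"
    and eLp_conv_sup: "(\<And>x. k x \<le> ennreal M) \<Longrightarrow> (\<integral>\<^sup>+x. f x * k (y - x) \<partial>lborel) \<le> ennreal M * eLp lborel p f"
proof -
  have km: "(\<lambda>x. k (y - x)) \<in> borel_measurable borel" for y by measurable
  have kM': "(\<integral>\<^sup>+x. k (y - x) \<partial>lborel) \<le> ennreal M" for y
    using kM by (simp add: nn_integral_lborel_shift(4)[of k])
  have mc: "(\<lambda>y. \<integral>\<^sup>+x. f x * k (y - x) \<partial>lborel) \<in> borel_measurable lborel"
    by measurable
  have inf: "(\<integral>\<^sup>+x. f x * k (y - x) \<partial>lborel) \<le> ennreal M * esssup lborel f" for y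
  proof -
    have "AE x in lborel. f x * k (y - x) \<le> esssup lborel f * k (y - x)"
      using esssup_AE[of f lborel] by eventually_elim (auto intro: mult_right_mono)
    then have "(\<integral>\<^sup>+x. f x * k (y - x) \<partial>lborel) \<le> (\<integral>\<^sup>+x. esssup lborel f * k (y - x) \<partial>lborel)"
      by (rule nn_integral_mono_AE)
    also have "\<dots> = esssup lborel f * (\<integral>\<^sup>+x. k (y - x) \<partial>lborel)" by (rule nn_integral_cmult) simp
    also have "\<dots> \<le> esssup lborel f * ennreal M" by (intro mult_left_mono kM') auto
    finally show ?thesis by (simp add: mult.commute)
  qed
  define P where "P = enn2real p"
  have Mi: "ennreal M * ennreal (1 / M) = 1" using M by (simp flip: ennreal_mult)
  have fin: "ennreal_powr (\<integral>\<^sup>+x. f x * k (y - x) \<partial>lborel) P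
      \<le> ennreal_powr (ennreal M) P * (\<integral>\<^sup>+x. ennreal_powr (f x) P * (k (y - x) * ennreal (1 / M)) \<partial>lborel)"
    if "p \<noteq> \<infinity>" for y
  proof -
    have P: "1 \<le> P" using enn2real_ge_1[OF p that] by (simp add: P_def)
    have "f x * k (y - x) = ennreal M * (f x * (k (y - x) * ennreal (1 / M)))" for x
    proof -
      have "ennreal M * (f x * (k (y - x) * ennreal (1 / M))) = (ennreal M * ennreal (1 / M)) * (f x * k (y - x))"
        by (simp only: mult_ac)
      then show ?thesis by (simp add: Mi)
    qed
    then have "(\<integral>\<^sup>+x. f x * k (y - x) \<partial>lborel) = ennreal M * (\<integral>\<^sup>+x. f x * (k (y - x) * ennreal (1 / M)) \<partial>lborel)"
      by (subst nn_integral_cmult[symmetric]) auto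
    then have "ennreal_powr (\<integral>\<^sup>+x. f x * k (y - x) \<partial>lborel) P
       = ennreal_powr (ennreal M) P * ennreal_powr (\<integral>\<^sup>+x. f x * (k (y - x) * ennreal (1 / M)) \<partial>lborel) P"
      using P by (simp add: ennreal_powr_mult)
    also have "\<dots> \<le> ennreal_powr (ennreal M) P * (\<integral>\<^sup>+x. ennreal_powr (f x) P * (k (y - x) * ennreal (1 / M)) \<partial>lborel)"
    proof (intro mult_left_mono jensen_powr P)
      have "(\<integral>\<^sup>+x. k (y - x) * ennreal (1 / M) \<partial>lborel) = (\<integral>\<^sup>+x. k (y - x) \<partial>lborel) * ennreal (1 / M)"
        by (rule nn_integral_multc) simp
      also have "\<dots> \<le> ennreal M * ennreal (1 / M)" by (intro mult_right_mono kM') auto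
      finally show "(\<integral>\<^sup>+x. k (y - x) * ennreal (1 / M) \<partial>lborel) \<le> 1" by (simp add: Mi)
    qed auto
    finally show ?thesis .
  qed
  show "eLp lborel p (\<lambda>y. \<integral>\<^sup>+x. f x * k (y - x) \<partial>lborel) \<le> ennreal M * eLp lborel p f"
  proof (cases "p = \<infinity>")
    case True
    then show ?thesis using inf mc by (auto simp: eLp_def intro!: esssup_I)
  next
    case False
    have P: "1 \<le> P" using enn2real_ge_1[OF p False] by (simp add: P_def)
    have "(\<integral>\<^sup>+y. ennreal_powr (\<integral>\<^sup>+x. f x * k (y - x) \<partial>lborel) P \<partial>lborel)
      \<le> (\<integral>\<^sup>+y. ennreal_powr (ennreal M) P * (\<integral>\<^sup>+x. ennreal_powr (f x) P * (k (y - x) * ennreal (1 / M)) \<partial>lborel) \<partial>lborel)"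
      by (intro nn_integral_mono fin[OF False])
    also have "\<dots> = ennreal_powr (ennreal M) P * (\<integral>\<^sup>+y. (\<integral>\<^sup>+x. ennreal_powr (f x) P * (k (y - x) * ennreal (1 / M)) \<partial>lborel) \<partial>lborel)"
      by (rule nn_integral_cmult) measurable
    also have "(\<integral>\<^sup>+y. (\<integral>\<^sup>+x. ennreal_powr (f x) P * (k (y - x) * ennreal (1 / M)) \<partial>lborel) \<partial>lborel)
      = (\<integral>\<^sup>+x. (\<integral>\<^sup>+y. ennreal_powr (f x) P * (k (y - x) * ennreal (1 / M)) \<partial>lborel) \<partial>lborel)"
      by (rule lborel_pair.Fubini') measurable
    also have "\<dots> = (\<integral>\<^sup>+x. ennreal_powr (f x) P * ((\<integral>\<^sup>+y. k (y - x) \<partial>lborel) * ennreal (1 / M)) \<partial>lborel)"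
      by (intro nn_integral_cong) (simp add: nn_integral_cmult nn_integral_multc)
    also have "\<dots> \<le> (\<integral>\<^sup>+x. ennreal_powr (f x) P * (ennreal M * ennreal (1 / M)) \<partial>lborel)"
      by (intro nn_integral_mono mult_left_mono mult_right_mono)
         (auto simp: nn_integral_lborel_shift(3)[of k] kM)
    also have "\<dots> = ennreal_powr (eLp lborel p f) P"
      by (simp add: Mi P_def eLp_powr[OF p False])
    finally have "(\<integral>\<^sup>+y. ennreal_powr (\<integral>\<^sup>+x. f x * k (y - x) \<partial>lborel) P \<partial>lborel)
      \<le> ennreal_powr (ennreal M) P * ennreal_powr (eLp lborel p f) P"
      by (simp add: mult_left_mono)
    then show ?thesis
      using P by (simp add: eLp_le_iff[OF p False] P_def[symmetric] ennreal_powr_mult)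
  qed
  assume kb: "\<And>x. k x \<le> ennreal M"
  show "(\<integral>\<^sup>+x. f x * k (y - x) \<partial>lborel) \<le> ennreal M * eLp lborel p f"
  proof (cases "p = \<infinity>")
    case True
    then show ?thesis using inf by (simp add: eLp_def)
  next
    case False
    have P: "1 \<le> P" using enn2real_ge_1[OF p False] by (simp add: P_def)
    have "ennreal_powr (\<integral>\<^sup>+x. f x * k (y - x) \<partial>lborel) P
      \<le> ennreal_powr (ennreal M) P * (\<integral>\<^sup>+x. ennreal_powr (f x) P * (k (y - x) * ennreal (1 / M)) \<partial>lborel)"
      by (rule fin[OF False])
    also have "\<dots> \<le> ennreal_powr (ennreal M) P * (\<integral>\<^sup>+x. ennreal_powr (f x) P * (ennreal M * ennreal (1 / M)) \<partial>lborel)"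
      by (intro mult_left_mono nn_integral_mono mult_right_mono kb) auto
    also have "\<dots> = ennreal_powr (ennreal M * eLp lborel p f) P"
      using P by (simp add: Mi P_def eLp_powr[OF p False] ennreal_powr_mult)
    finally show ?thesis by (rule ennreal_powr_cancel[rotated]) (use P in simp)
  qed
qed

section \<open>Norms of families\<close>

text \<open>\<open>gm_norm\<close> is defined with infinite sums; as integrals over a counting
  measure they fall under \<open>eLp\<close>.\<close>

lemma infsum_ennreal_eq:
  fixes f :: "'j::countable \<Rightarrow> ennreal"
  shows "(\<Sum>\<^sub>\<infinity>j. f j) = (\<integral>\<^sup>+j. f j \<partial>count_space UNIV)"
proof (rule antisym)
  have S: "(\<Sum>\<^sub>\<infinity>j. f j) = (SUP F\<in>{F. finite F \<and> F \<subseteq> UNIV}. sum f F)"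
    by (rule nonneg_infsum_complete) auto
  show "(\<Sum>\<^sub>\<infinity>j. f j) \<le> (\<integral>\<^sup>+j. f j \<partial>count_space UNIV)"
    unfolding S
  proof (rule SUP_least)
    fix F :: "'j set" assume "F \<in> {F. finite F \<and> F \<subseteq> UNIV}"
    then have "sum f F = (\<integral>\<^sup>+j. f j \<partial>count_space F)" by (simp add: nn_integral_count_space_finite)
    also have "\<dots> \<le> (\<integral>\<^sup>+j. f j \<partial>count_space UNIV)"
      by (subst nn_integral_count_space_indicator)
         (auto simp: NO_MATCH_def intro!: nn_integral_mono split: split_indicator)
    finally show "sum f F \<le> (\<integral>\<^sup>+j. f j \<partial>count_space UNIV)" .
  qed
  define g where "g n = (if n \<in> range (to_nat :: 'j \<Rightarrow> nat) then f (from_nat n) else 0)" for n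
  have "(\<integral>\<^sup>+j. f j \<partial>count_space UNIV) = (\<integral>\<^sup>+j. g (to_nat j) \<partial>count_space (UNIV :: 'j set))"
    by (simp add: g_def)
  also have "\<dots> = (\<integral>\<^sup>+n. g n \<partial>count_space (range (to_nat :: 'j \<Rightarrow> nat)))"
    by (rule nn_integral_bij_count_space) (simp add: bij_betw_def)
  also have "\<dots> = (\<integral>\<^sup>+n. g n \<partial>count_space UNIV)"
    by (rule nn_integral_count_space_eq) (auto simp: g_def)
  also have "\<dots> = (\<Sum>n. g n)" by (rule nn_integral_count_space_nat)
  also have "\<dots> = (SUP n. \<Sum>i<n. g i)" by (rule suminf_eq_SUP)
  also have "\<dots> \<le> (\<Sum>\<^sub>\<infinity>j. f j)"
  proof (rule SUP_least)
    fix n :: nat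
    define F where "F = {j :: 'j. to_nat j < n}"
    have fF: "finite F" unfolding F_def by (rule finite_subset[OF _ finite_vimageI[of "{..<n}" to_nat]]) auto
    have "(\<Sum>i<n. g i) = (\<Sum>i\<in>to_nat ` F. g i)"
      by (rule sum.mono_neutral_right) (auto simp: F_def g_def)
    also have "\<dots> = sum f F" by (subst sum.reindex) (auto simp: g_def inj_on_def)
    also have "\<dots> \<le> (\<Sum>\<^sub>\<infinity>j. f j)" unfolding S by (rule SUP_upper) (use fF in auto)
    finally show "(\<Sum>i<n. g i) \<le> (\<Sum>\<^sub>\<infinity>j. f j)" .
  qed
  finally show "(\<integral>\<^sup>+j. f j \<partial>count_space UNIV) \<le> (\<Sum>\<^sub>\<infinity>j. f j)" .
qed

abbreviation elq :: "ennreal \<Rightarrow> ('j \<Rightarrow> ennreal) \<Rightarrow> ennreal" where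
  "elq \<equiv> eLp (count_space UNIV)"

lemma elq_infty: "elq \<infinity> f = (SUP k. f k)"
proof (rule antisym)
  show "elq \<infinity> f \<le> (SUP k. f k)"
    by (auto simp: eLp_def AE_count_space intro!: esssup_I SUP_upper)
  show "(SUP k. f k) \<le> elq \<infinity> f"
    using esssup_AE[of f "count_space UNIV"] by (auto simp: eLp_def AE_count_space intro: SUP_least)
qed

lemma elq_point:
  assumes p: "1 \<le> p" shows "f k \<le> elq p f"
proof (cases "p = \<infinity>")
  case True
  then show ?thesis unfolding True elq_infty by (intro SUP_upper) auto
next
  case False
  have P: "1 \<le> enn2real p" by (rule enn2real_ge_1[OF p False])
  have "ennreal_powr (f k) (enn2real p) \<le> (\<integral>\<^sup>+k. ennreal_powr (f k) (enn2real p) \<partial>count_space UNIV)"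
    by (rule nn_integral_ge_point) simp
  then have "ennreal_powr (ennreal_powr (f k) (enn2real p)) (1 / enn2real p) \<le> elq p f"
    using False P by (simp add: eLp_def ennreal_powr_mono)
  then show ?thesis using P by (simp add: ennreal_powr_inverse)
qed

lemma elq_mono: "(\<And>k. f k \<le> g k) \<Longrightarrow> elq p f \<le> elq p g"
  by (rule eLp_mono) auto

lemma elq_bij:
  assumes "bij \<pi>" shows "elq p (\<lambda>k. f (\<pi> k)) = elq p f"
proof (cases "p = \<infinity>")
  case True
  have "(SUP k. f (\<pi> k)) = Sup (f ` range \<pi>)" by (simp add: image_image)
  then show ?thesis unfolding True elq_infty using assms by (simp add: bij_is_surj)
next
  case False
  then show ?thesis
    using nn_integral_bij_count_space[OF assms, of "\<lambda>k. ennreal_powr (f k) (enn2real p)"]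
    by (simp add: eLp_def)
qed

text \<open>Minkowski moves the norm inside the sum over m, where all translates of a have the same
  norm.\<close>

lemma elq_young:
  fixes w a :: "'j::{countable, ab_group_add} \<Rightarrow> ennreal"
  assumes p: "1 \<le> p"
  shows "elq p (\<lambda>k. \<integral>\<^sup>+m. w m * a (k - c - m) \<partial>count_space UNIV) \<le> (\<integral>\<^sup>+m. w m \<partial>count_space UNIV) * elq p a"
proof -
  have "elq p (\<lambda>k. \<integral>\<^sup>+m. w m * a (k - c - m) \<partial>count_space UNIV)
      \<le> (\<integral>\<^sup>+m. elq p (\<lambda>k. w m * a (k - c - m)) \<partial>count_space UNIV)"
    by (rule eLp_minkowski[OF _ p]) auto
  also have "\<dots> \<le> (\<integral>\<^sup>+m. w m * elq p a \<partial>count_space UNIV)"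
  proof (intro nn_integral_mono)
    fix m
    have "elq p (\<lambda>k. w m * a (k - c - m)) \<le> w m * elq p (\<lambda>k. a (k - c - m))"
      by (rule eLp_cmult[OF _ p]) auto
    also have "elq p (\<lambda>k. a (k - c - m)) = elq p a"
      by (rule elq_bij[of "\<lambda>k. k - c - m"]) (rule bij_betwI[where g = "\<lambda>k. k + m + c"]; simp add: algebra_simps)
    finally show "elq p (\<lambda>k. w m * a (k - c - m)) \<le> w m * elq p a" .
  qed
  also have "\<dots> = (\<integral>\<^sup>+m. w m \<partial>count_space UNIV) * elq p a" by (rule nn_integral_multc) simp
  finally show ?thesis .
qed

section \<open>Representing functions and frequency kernels\<close>

section \<open>Uniqueness of representing functions\<close>

lemma fun_Lp_norm_eq: "fun_Lp_norm p F = eLp lborel p (\<lambda>x. ennreal (norm (F x)))"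
  by (simp add: fun_Lp_norm_def eLp_def ennreal_powr_ennreal)

lemma norm_le_card:
  fixes x :: "real^'n::finite"
  assumes "\<And>i. \<bar>x $ i\<bar> \<le> c" shows "norm x \<le> real CARD('n) * c"
proof -
  have "norm x \<le> (\<Sum>i\<in>UNIV. \<bar>x $ i\<bar>)" by (rule norm_le_l1_cart)
  also have "\<dots> \<le> (\<Sum>i\<in>(UNIV :: 'n set). c)" by (intro sum_mono assms)
  finally show ?thesis by simp
qed

text \<open>Lebesgue differentiation over cubes: at almost every point f is the limit of its
  averages, and these are all 0.\<close>

lemma AE_eq_0_if_box_integrals_0:
  fixes f :: "real^'n::finite \<Rightarrow> complex"
  assumes int: "\<And>a b. integrable lborel (\<lambda>x. indicator (cbox a b) x *\<^sub>R f x)"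
    and zero: "\<And>a b. (\<integral>x. indicator (cbox a b) x *\<^sub>R f x \<partial>lborel) = 0"
  shows "AE x in lborel. f x = 0"
proof -
  have si: "set_integrable lborel (cbox a b) f" for a b
    using int by (simp add: set_integrable_def)
  have i: "f integrable_on cbox a b" for a b by (rule set_borel_integral_eq_integral(1)[OF si])
  have z: "integral (cbox a b) f = 0" for a b
    using set_borel_integral_eq_integral(2)[OF si, of a b] zero[of a b] by (simp add: set_lebesgue_integral_def)
  obtain N where N: "negligible N"
    "\<And>x e. \<lbrakk>x \<notin> N; 0 < e\<rbrakk> \<Longrightarrow> \<exists>d>0. \<forall>h. 0 < h \<and> h < d \<longrightarrow>
        norm (integral (cbox x (x + h *\<^sub>R One)) f /\<^sub>R h ^ DIM(real^'n) - f x) < e"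
    using integrable_ccontinuous_explicit[OF i] by metis
  have "f x = 0" if xN: "x \<notin> N" for x
  proof (rule ccontr)
    assume "f x \<noteq> 0"
    then obtain d where d: "d > 0" "\<And>h. 0 < h \<Longrightarrow> h < d \<Longrightarrow>
        norm (integral (cbox x (x + h *\<^sub>R One)) f /\<^sub>R h ^ DIM(real^'n) - f x) < norm (f x)"
      using N(2)[OF xN, of "norm (f x)"] by auto
    from d(2)[of "d / 2"] d(1) z show False by simp
  qed
  then have "AE x in lebesgue. f x = 0"
    using N(1) by (intro AE_I'[of N]) (auto simp: negligible_iff_null_sets)
  then show ?thesis by (simp add: AE_completion_iff)
qed

context freq_decomp
begin

text \<open>Finite sums of rescaled partition functions are test functions, so the indicator of a box is a
  dominated limit of test functions and no mollifier is needed.\<close>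

definition box_approx :: "real^'n \<Rightarrow> real^'n \<Rightarrow> nat \<Rightarrow> real^'n \<Rightarrow> complex" where
  "box_approx a b j x = (\<Sum>l\<in>{l. lattice_point l \<in> (\<lambda>x. real (Suc j) *\<^sub>R x) ` cbox a b}.
     \<sigma> l (real (Suc j) *\<^sub>R x + 0))"

lemma \<sigma>_real: "\<sigma> l \<xi> = of_real (norm (\<sigma> l \<xi>))"
  using \<rho>_bounds psum_pos[of \<xi>] by (simp add: \<sigma>_eq \<rho>c_def norm_mult norm_inverse)

lemma \<sigma>_norm_sum:
  assumes "finite L" shows "(\<Sum>l\<in>L. norm (\<sigma> l \<xi>)) \<le> 1"
proof -
  have "(\<Sum>l\<in>L. norm (\<sigma> l \<xi>)) \<le> (\<Sum>l\<in>L \<union> near 1 \<xi>. norm (\<sigma> l \<xi>))"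
    by (rule sum_mono2) (use assms finite_near in auto)
  also have "complex_of_real (\<Sum>l\<in>L \<union> near 1 \<xi>. norm (\<sigma> l \<xi>)) = (\<Sum>l\<in>L \<union> near 1 \<xi>. \<sigma> l \<xi>)"
    by (simp add: \<sigma>_real[symmetric])
  then have "(\<Sum>l\<in>L \<union> near 1 \<xi>. norm (\<sigma> l \<xi>)) = 1"
    using \<sigma>_sum[of \<xi> "L \<union> near 1 \<xi>"] assms finite_near[of 1 \<xi>] by (metis Un_upper2 finite_Un of_real_eq_1_iff)
  finally show ?thesis .
qed

lemma box_index_finite: "finite {l :: int^'n. lattice_point l \<in> (\<lambda>x. real (Suc j) *\<^sub>R x) ` cbox a b}"
proof -
  have "bounded ((\<lambda>x. real (Suc j) *\<^sub>R x) ` cbox a b)" by (intro bounded_scaling bounded_cbox)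
  then obtain R where R: "\<And>y. y \<in> (\<lambda>x. real (Suc j) *\<^sub>R x) ` cbox a b \<Longrightarrow> norm y \<le> R" unfolding bounded_iff by blast
  have "{l :: int^'n. lattice_point l \<in> (\<lambda>x. real (Suc j) *\<^sub>R x) ` cbox a b} \<subseteq> near R 0"
  proof
    fix l :: "int^'n" assume "l \<in> {l. lattice_point l \<in> (\<lambda>x. real (Suc j) *\<^sub>R x) ` cbox a b}"
    then have "norm (lattice_point l) \<le> R" using R by auto
    then have "\<bar>real_of_int (l $ i)\<bar> \<le> R" for i using component_le_norm_cart[of "lattice_point l" i] by simp
    then show "l \<in> near R 0" by (simp add: near_def)
  qed
  then show ?thesis using finite_near finite_subset by blast
qed

lemma box_approx_gs: "box_approx a b j \<in> gs_space s"
  unfolding box_approx_def[abs_def] by (intro gs_space_sum gs_space_affine \<sigma>_gs s_ge1) auto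

lemma box_approx_le_1: "norm (box_approx a b j x) \<le> 1"
  unfolding box_approx_def by (rule order_trans[OF norm_sum \<sigma>_norm_sum[OF box_index_finite]])

lemma \<sigma>_scaled_support:
  assumes "\<sigma> l (real (Suc j) *\<^sub>R x + 0) \<noteq> 0"
  shows "norm (x - (1 / real (Suc j)) *\<^sub>R lattice_point l) \<le> real CARD('n) / real (Suc j)"
proof -
  have "l \<in> near 1 (real (Suc j) *\<^sub>R x)" using \<sigma>_support[OF assms] by simp
  then have 1: "\<bar>real (Suc j) * x $ i - real_of_int (l $ i)\<bar> \<le> 1" for i by (simp add: near_def)
  have "\<bar>(x - (1 / real (Suc j)) *\<^sub>R lattice_point l) $ i\<bar> \<le> 1 / real (Suc j)" for i
  proof -
    have "(x - (1 / real (Suc j)) *\<^sub>R lattice_point l) $ i = (real (Suc j) * x $ i - real_of_int (l $ i)) / real (Suc j)"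
      by (simp add: field_simps)
    then have "\<bar>(x - (1 / real (Suc j)) *\<^sub>R lattice_point l) $ i\<bar> = \<bar>real (Suc j) * x $ i - real_of_int (l $ i)\<bar> / real (Suc j)"
      by (simp only: abs_divide abs_of_nat)
    then show ?thesis using 1[of i] by (simp only: divide_right_mono of_nat_0_le_iff)
  qed
  from norm_le_card[OF this] show ?thesis by simp
qed

lemma box_index_iff: "lattice_point l \<in> (\<lambda>x. real (Suc j) *\<^sub>R x) ` cbox a b \<longleftrightarrow> (1 / real (Suc j)) *\<^sub>R lattice_point l \<in> cbox a b"
proof
  assume "(1 / real (Suc j)) *\<^sub>R lattice_point l \<in> cbox a b"
  then show "lattice_point l \<in> (\<lambda>x. real (Suc j) *\<^sub>R x) ` cbox a b"
    by (rule rev_image_eqI) (simp del: of_nat_Suc)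
qed (auto simp del: of_nat_Suc)

lemma box_approx_support:
  assumes R: "\<And>y. y \<in> cbox a b \<Longrightarrow> norm y \<le> R" and nz: "box_approx a b j x \<noteq> 0"
  shows "norm x \<le> R + real CARD('n)"
proof -
  obtain l where l: "(1 / real (Suc j)) *\<^sub>R lattice_point l \<in> cbox a b" "\<sigma> l (real (Suc j) *\<^sub>R x + 0) \<noteq> 0"
    using nz unfolding box_approx_def box_index_iff by (metis (no_types, lifting) mem_Collect_eq sum.neutral)
  have "norm x \<le> norm ((1 / real (Suc j)) *\<^sub>R lattice_point l) + norm (x - (1 / real (Suc j)) *\<^sub>R lattice_point l)"
    using norm_triangle_ineq[of "(1 / real (Suc j)) *\<^sub>R lattice_point l" "x - (1 / real (Suc j)) *\<^sub>R lattice_point l"]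
    by (simp del: of_nat_Suc)
  also have "\<dots> \<le> R + real CARD('n) / real (Suc j)" by (intro add_mono R l \<sigma>_scaled_support)
  also have "\<dots> \<le> R + real CARD('n)" by (simp add: divide_le_eq)
  finally show ?thesis .
qed

text \<open>Away from the boundary the convergence is an eventual equality: the rescaled lattice
  points active at x lie within n / (j + 1) of x, hence all inside or all outside the box, and the
  sum is 1 or 0.\<close>

lemma box_approx_tendsto:
  assumes x: "x \<notin> cbox a b - box a b"
  shows "(\<lambda>j. box_approx a b j x) \<longlonglongrightarrow> indicator (cbox a b) x"
proof -
  define U where "U = (if x \<in> box a b then box a b else - cbox a b)"
  have "open U" "x \<in> U" using x by (auto simp: U_def open_box closed_cbox)
  then obtain e where e: "e > 0" "ball x e \<subseteq> U" by (auto simp: open_contains_ball)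
  have "\<forall>\<^sub>F j in sequentially. real CARD('n) / real (Suc j) < e"
    using LIMSEQ_Suc[OF lim_const_over_n[of "real CARD('n)"]] e(1) by (rule order_tendstoD)
  then have "\<forall>\<^sub>F j in sequentially. box_approx a b j x = indicator (cbox a b) x"
  proof eventually_elim
    case (elim j)
    have near: "(1 / real (Suc j)) *\<^sub>R lattice_point l \<in> U" if "\<sigma> l (real (Suc j) *\<^sub>R x + 0) \<noteq> 0" for l
    proof -
      have "dist x ((1 / real (Suc j)) *\<^sub>R lattice_point l) < e"
        using \<sigma>_scaled_support[OF that] elim by (simp add: dist_norm del: of_nat_Suc)
      then show ?thesis using e(2) by auto
    qed
    show ?case
    proof (cases "x \<in> box a b")
      case True
      let ?L = "{l. lattice_point l \<in> (\<lambda>x. real (Suc j) *\<^sub>R x) ` cbox a b}"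
      let ?y = "real (Suc j) *\<^sub>R x + 0"
      have "\<sigma> l ?y = 0" if "l \<notin> ?L" for l
      proof (rule ccontr)
        assume "\<sigma> l ?y \<noteq> 0"
        from near[OF this] True have "(1 / real (Suc j)) *\<^sub>R lattice_point l \<in> cbox a b"
          using box_subset_cbox by (auto simp: U_def)
        then show False using that by (simp add: box_index_iff del: of_nat_Suc)
      qed
      then have "box_approx a b j x = (\<Sum>l\<in>?L \<union> near 1 ?y. \<sigma> l ?y)"
        unfolding box_approx_def
        by (intro sum.mono_neutral_left ballI) (use box_index_finite finite_near in \<open>blast+\<close>)
      also have "\<dots> = 1" by (rule \<sigma>_sum) (use box_index_finite finite_near in \<open>blast+\<close>)
      finally show ?thesis using True box_subset_cbox by (auto simp: indicator_def)
    next
      case False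
      then have out: "x \<notin> cbox a b" using x by auto
      have "\<sigma> l (real (Suc j) *\<^sub>R x + 0) = 0" if "(1 / real (Suc j)) *\<^sub>R lattice_point l \<in> cbox a b" for l
        using near[of l] that False by (auto simp: U_def simp del: of_nat_Suc)
      then show ?thesis using out unfolding box_approx_def box_index_iff by (simp del: of_nat_Suc)
    qed
  qed
  then show ?thesis by (rule tendsto_eventually)
qed

text \<open>Testing with a dilated \<rho> that is 1 on a given ball makes F locally integrable;
  dominated convergence along \<open>box_approx\<close> then shows that all box integrals
  vanish.\<close>

lemma AE_eq_0_if_annihilates:
  fixes F :: "real^'n \<Rightarrow> complex"
  assumes [measurable]: "F \<in> borel_measurable borel"
    and int: "\<And>\<phi>. \<phi> \<in> gs_space s \<Longrightarrow> integrable lborel (\<lambda>x. F x * \<phi> x)"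
    and zero: "\<And>\<phi>. \<phi> \<in> gs_space s \<Longrightarrow> (\<integral>x. F x * \<phi> x \<partial>lborel) = 0"
  shows "AE x in lborel. F x = 0"
proof -
  have loc: "integrable lborel (\<lambda>x. indicator (cball 0 R) x *\<^sub>R F x)" for R
  proof -
    \<comment> \<open>Positive whatever the sign of R and at least R, so that division by
      \<open>2 * R'\<close> maps the ball of radius R to where \<rho> is 1.\<close>
    define R' where "R' = \<bar>R\<bar> + 1"
    have R': "R' > 0" by (simp add: R'_def)
    define \<phi> where "\<phi> = (\<lambda>x. \<rho>c ((1 / (2 * R')) *\<^sub>R x + 0))"
    have \<phi>: "\<phi> \<in> gs_space s" unfolding \<phi>_def by (rule gs_space_affine[OF \<rho>c_gs s_ge1]) (use R' in simp)
    have "\<phi> x = 1" if "norm x \<le> R" for x :: "real^'n"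
    proof -
      have "norm ((1 / (2 * R')) *\<^sub>R x + 0) \<le> 1 / 2" using that R' by (simp add: R'_def field_simps)
      then show ?thesis by (simp only: \<phi>_def \<rho>c_def \<rho>_eq_1 of_real_1)
    qed
    then have "norm (indicator (cball 0 R) x *\<^sub>R F x) \<le> norm (F x * \<phi> x)" for x :: "real^'n"
      by (auto split: split_indicator simp: norm_mult)
    moreover have "(\<lambda>x. indicator (cball 0 R) x *\<^sub>R F x) \<in> borel_measurable lborel"
      using borel_closed[OF closed_cball] assms(1)
      by (intro borel_measurable_scaleR borel_measurable_indicator) auto
    ultimately show ?thesis
      by (intro Bochner_Integration.integrable_bound[OF int[OF \<phi>]]) auto
  qed
  show ?thesis
  proof (rule AE_eq_0_if_box_integrals_0)
    fix a b :: "real^'n"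
    obtain R where R: "\<And>y. y \<in> cbox a b \<Longrightarrow> norm y \<le> R" using bounded_cbox[of a b] by (auto simp: bounded_iff)
    define w where "w = (\<lambda>x. norm (indicator (cball 0 (R + real CARD('n))) x *\<^sub>R F x))"
    have w: "integrable lborel w" unfolding w_def by (intro integrable_norm loc)
    show "integrable lborel (\<lambda>x. indicator (cbox a b) x *\<^sub>R F x)"
      by (rule Bochner_Integration.integrable_bound[OF loc[of R]]) (auto split: split_indicator dest: R)
    have m: "box_approx a b j \<in> borel_measurable borel" for j
      by (rule gs_space_measurable[OF box_approx_gs s_ge1])
    have "(\<lambda>j. \<integral>x. F x * box_approx a b j x \<partial>lborel) \<longlonglongrightarrow> (\<integral>x. F x * indicator (cbox a b) x \<partial>lborel)"
    proof (rule integral_dominated_convergence[where w = w])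
      show "AE x in lborel. (\<lambda>j. F x * box_approx a b j x) \<longlonglongrightarrow> F x * indicator (cbox a b) x"
      proof -
        have "negligible (cbox a b - box a b)" by (rule negligible_frontier_interval)
        then have "AE x in lebesgue. x \<notin> cbox a b - box a b"
          by (intro AE_not_in) (auto simp: negligible_iff_null_sets)
        then have "AE x in lborel. x \<notin> cbox a b - box a b" by (simp add: AE_completion_iff)
        then show ?thesis by eventually_elim (intro tendsto_intros box_approx_tendsto)
      qed
      show "AE x in lborel. norm (F x * box_approx a b j x) \<le> w x" for j
      proof (rule AE_I2)
        fix x :: "real^'n"
        show "norm (F x * box_approx a b j x) \<le> w x"
        proof (cases "box_approx a b j x = 0")
          case False
          then have "norm x \<le> R + real CARD('n)" using R by (intro box_approx_support)
          then show ?thesis using box_approx_le_1[of a b j x] by (simp add: w_def norm_mult mult_left_le)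
        qed (simp add: w_def)
      qed
    qed (use m w in auto)
    moreover have "(\<integral>x. F x * box_approx a b j x \<partial>lborel) = 0" for j by (rule zero[OF box_approx_gs])
    ultimately have "(\<integral>x. F x * indicator (cbox a b) x \<partial>lborel) = 0" by (simp add: LIMSEQ_const_iff)
    moreover have "(\<lambda>x. F x * indicator (cbox a b) x) = (\<lambda>x. indicator (cbox a b) x *\<^sub>R F x)"
      by (auto simp: fun_eq_iff split: split_indicator)
    ultimately show "(\<integral>x. indicator (cbox a b) x *\<^sub>R F x \<partial>lborel) = 0" by simp
  qed
qed

lemma represents_unique:
  fixes F G :: "real^'n \<Rightarrow> complex"
  assumes "represents s F u" "represents s G u"
  shows "AE x in lborel. F x = G x"
proof -
  have "AE x in lborel. F x - G x = 0"
    by (rule AE_eq_0_if_annihilates) (use assms in \<open>auto simp: represents_def regular_functional_def left_diff_distrib\<close>)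
  then show ?thesis by simp
qed

text \<open>All representatives agree almost everywhere and have the same norm, so the infimum in
  \<open>Lp_norm\<close> ranges over a single value.\<close>

lemma Lp_norm_eq:
  fixes F :: "real^'n \<Rightarrow> complex"
  assumes F: "represents s F u"
  shows "Lp_norm s p u = eLp lborel p (\<lambda>x. ennreal (norm (F x)))"
proof -
  have "fun_Lp_norm p G = eLp lborel p (\<lambda>x. ennreal (norm (F x)))" if "represents s G u" for G
    unfolding fun_Lp_norm_eq
  proof (rule eLp_cong)
    show "AE x in lborel. ennreal (norm (G x)) = ennreal (norm (F x))"
      using represents_unique[OF that F] by eventually_elim simp
  qed (use that F in \<open>auto simp: represents_def\<close>)
  then have "fun_Lp_norm p ` {G. represents s G u} = {eLp lborel p (\<lambda>x. ennreal (norm (F x)))}"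
    using F by auto
  then show ?thesis by (simp add: Lp_norm_def)
qed

lemma Lp_norm_finite_represents:
  assumes "Lp_norm s p u < \<infinity>" obtains F where "represents s F u"
proof -
  have "{F. represents s F u} \<noteq> {}"
  proof
    assume "{F. represents s F u} = {}"
    then show False using assms by (simp add: Lp_norm_def)
  qed
  then show ?thesis using that by auto
qed

end

section \<open>Convolution with the kernel of a multiplier\<close>

definition conv :: "(real^'n::finite \<Rightarrow> complex) \<Rightarrow> (real^'n \<Rightarrow> complex) \<Rightarrow> real^'n \<Rightarrow> complex" where
  "conv F K y = (\<integral>x. F x * K (y - x) \<partial>lborel)"

lemma ennreal_norm_integral_le:
  fixes f :: "'a \<Rightarrow> complex"
  shows "ennreal (norm (\<integral>x. f x \<partial>M)) \<le> (\<integral>\<^sup>+x. ennreal (norm (f x)) \<partial>M)"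
proof (cases "integrable M f")
  case True
  then show ?thesis by (rule integral_norm_bound_ennreal)
qed (simp add: not_integrable_integral_eq)

lemma kern_gs:
  assumes "m \<in> gs_space s" "1 \<le> s" shows "kern m \<in> gs_space s"
  using gs_space_cmult[OF gs_space_fourier(2)[OF assms] assms(2)] by (simp add: kern_def[abs_def])

lemma kern_bound:
  fixes m :: "real^'n::finite \<Rightarrow> complex"
  assumes "m \<in> gs_space s" "1 \<le> s"
  obtains M where "0 < M" "(\<integral>\<^sup>+z. ennreal (norm (kern m z)) \<partial>lborel) \<le> ennreal M" "\<And>z. ennreal (norm (kern m z)) \<le> ennreal M"
proof -
  note k = kern_gs[OF assms]
  obtain B where B: "0 \<le> B" "\<And>z. norm (kern m z) \<le> B" using gs_space_bounded[OF k assms(2)] by blast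
  define I where "I = (\<integral>z. norm (kern m z) \<partial>lborel)"
  have I: "I \<ge> 0" "(\<integral>\<^sup>+z. ennreal (norm (kern m z)) \<partial>lborel) = ennreal I"
    unfolding I_def using gs_space_integrable[OF k assms(2)]
    by (auto intro!: nn_integral_eq_integral)
  show ?thesis
  proof (rule that[of "1 + B + I"])
    show "ennreal (norm (kern m z)) \<le> ennreal (1 + B + I)" for z
      using B(2)[of z] I(1) by (intro ennreal_leI) linarith
  qed (use B(1) I in \<open>auto intro: ennreal_leI\<close>)
qed

text \<open>Translating the symbol multiplies the kernel by a character of modulus 1. Kernel bounds
  are therefore uniform over the lattice.\<close>

lemma norm_kern_shift:
  fixes m :: "real^'n::finite \<Rightarrow> complex"
  assumes [measurable]: "m \<in> borel_measurable borel"
  shows "norm (kern (\<lambda>\<xi>. m (\<xi> - a)) z) = norm (kern m z)"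
proof -
  have "(\<integral>\<xi>. m (\<xi> - a) * exp (\<i> * complex_of_real (z \<bullet> \<xi>)) \<partial>lborel)
      = (\<integral>\<xi>. (\<lambda>\<xi>. m \<xi> * exp (\<i> * complex_of_real (z \<bullet> (\<xi> + a)))) (\<xi> - a) \<partial>lborel)" by simp
  also have "\<dots> = (\<integral>\<xi>. m \<xi> * exp (\<i> * complex_of_real (z \<bullet> (\<xi> + a))) \<partial>lborel)"
  proof (rule integral_lborel_shift(3))
    have "(\<lambda>\<xi>. exp (\<i> * complex_of_real (z \<bullet> (\<xi> + a)))) \<in> borel_measurable borel"
      by (intro borel_measurable_continuous_onI continuous_intros)
    then show "(\<lambda>\<xi>. m \<xi> * exp (\<i> * complex_of_real (z \<bullet> (\<xi> + a)))) \<in> borel_measurable borel" by measurable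
  qed
  also have "\<dots> = (\<integral>\<xi>. exp (\<i> * complex_of_real (z \<bullet> a)) * (m \<xi> * exp (\<i> * complex_of_real (z \<bullet> \<xi>))) \<partial>lborel)"
    by (simp add: inner_add_right distrib_left exp_add mult_ac)
  also have "\<dots> = exp (\<i> * complex_of_real (z \<bullet> a)) * (\<integral>\<xi>. m \<xi> * exp (\<i> * complex_of_real (z \<bullet> \<xi>)) \<partial>lborel)"
    by (rule integral_mult_right_zero)
  finally show ?thesis by (simp add: kern_def inv_fourier_eq norm_mult norm_iexp)
qed

lemma conv_measurable:
  assumes [measurable]: "F \<in> borel_measurable borel" "K \<in> borel_measurable borel"
  shows "conv F K \<in> borel_measurable borel"
proof -
  have "(\<lambda>y. \<integral>x. F x * K (y - x) \<partial>lborel) \<in> borel_measurable lborel" by measurable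
  then show ?thesis by (simp add: conv_def[abs_def])
qed

text \<open>Hypothesis \<open>b\<close> supplies absolute convergence for Fubini without fixing a
  norm of F, so that both bounded F and F in some L^r are covered.\<close>

lemma conv_adjoint:
  fixes F m \<phi> :: "real^'n::finite \<Rightarrow> complex"
  assumes F [measurable]: "F \<in> borel_measurable borel" and m: "m \<in> gs_space s" and \<phi>: "\<phi> \<in> gs_space s" and s: "1 \<le> s"
    and b: "\<And>y. (\<integral>\<^sup>+x. ennreal (norm (F x)) * ennreal (norm (kern m (y - x))) \<partial>lborel) \<le> ennreal B"
  shows "(\<integral>x. F x * multop m \<phi> x \<partial>lborel) = (\<integral>y. conv F (kern m) y * \<phi> y \<partial>lborel)"
    and "integrable lborel (\<lambda>y. conv F (kern m) y * \<phi> y)"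
    and "ennreal (norm (conv F (kern m) y)) \<le> ennreal B"
proof -
  have [measurable]: "kern m \<in> borel_measurable borel" "\<phi> \<in> borel_measurable borel"
    using gs_space_measurable[OF kern_gs[OF m s] s] gs_space_measurable[OF \<phi> s] .
  have i: "integrable lborel m" "integrable lborel \<phi>" using gs_space_integrable m \<phi> s by auto
  define G where "G y x = F x * (\<phi> y * kern m (y - x))" for x y
  have mG: "(\<lambda>(y, x). G y x) \<in> borel_measurable (lborel \<Otimes>\<^sub>M lborel)"
    unfolding G_def by measurable
  have "(\<integral>\<^sup>+y. (\<integral>\<^sup>+x. ennreal (norm (G y x)) \<partial>lborel) \<partial>lborel)
      = (\<integral>\<^sup>+y. ennreal (norm (\<phi> y)) * (\<integral>\<^sup>+x. ennreal (norm (F x)) * ennreal (norm (kern m (y - x))) \<partial>lborel) \<partial>lborel)"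
    by (intro nn_integral_cong, subst nn_integral_cmult[symmetric]) (auto simp: G_def norm_mult ennreal_mult mult_ac)
  also have "\<dots> \<le> (\<integral>\<^sup>+y. ennreal (norm (\<phi> y)) * ennreal B \<partial>lborel)"
    by (intro nn_integral_mono mult_left_mono b) auto
  also have "\<dots> = (\<integral>\<^sup>+y. ennreal (norm (\<phi> y)) \<partial>lborel) * ennreal B" by (rule nn_integral_multc) simp
  also have "\<dots> < \<infinity>" using i(2) by (simp add: integrable_iff_bounded ennreal_mult_less_top)
  finally have fin: "(\<integral>\<^sup>+y. (\<integral>\<^sup>+x. ennreal (norm (G y x)) \<partial>lborel) \<partial>lborel) < \<infinity>" .
  have c: "conv F (kern m) y * \<phi> y = (\<integral>x. G y x \<partial>lborel)" for y
    unfolding conv_def G_def by (subst integral_mult_left_zero[symmetric]) (simp add: mult_ac)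
  have t: "F x * multop m \<phi> x = (\<integral>y. G y x \<partial>lborel)" for x
    unfolding multop_conv[OF i] G_def by simp
  show "(\<integral>x. F x * multop m \<phi> x \<partial>lborel) = (\<integral>y. conv F (kern m) y * \<phi> y \<partial>lborel)"
    unfolding c t using fubini_swap(1)[OF mG fin] by simp
  show "integrable lborel (\<lambda>y. conv F (kern m) y * \<phi> y)"
    unfolding c by (rule fubini_swap(2)[OF mG fin])
  have "ennreal (norm (conv F (kern m) y)) \<le> (\<integral>\<^sup>+x. ennreal (norm (F x * kern m (y - x))) \<partial>lborel)"
    unfolding conv_def by (rule ennreal_norm_integral_le)
  also have "\<dots> \<le> ennreal B" using b[of y] by (simp add: norm_mult ennreal_mult)
  finally show "ennreal (norm (conv F (kern m) y)) \<le> ennreal B" .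
qed

lemma eLp_infty_bounded:
  fixes F :: "real^'n::finite \<Rightarrow> complex"
  assumes "F \<in> borel_measurable borel" "\<And>x. norm (F x) \<le> B"
  shows "eLp lborel \<infinity> (\<lambda>x. ennreal (norm (F x))) \<le> ennreal B"
  unfolding eLp_def using assms by (auto intro!: esssup_I ennreal_leI)

context freq_decomp
begin

text \<open>Built to equal 1 on the support of \<open>\<sigma> l\<close>: there \<xi> is at distance
  at most n from the lattice point, having n coordinate differences of size at most 1, and the
  dilation by 1 / (2 n) moves it into the ball of radius 1 / 2 where \<rho> is 1.\<close>

definition \<tau> :: "int^'n \<Rightarrow> real^'n \<Rightarrow> complex" where
  "\<tau> l \<xi> = \<rho>c ((1 / (2 * real CARD('n))) *\<^sub>R (\<xi> - lattice_point l))"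

lemma \<tau>_shift: "\<tau> l = (\<lambda>\<xi>. \<tau> 0 (\<xi> - lattice_point l))"
  by (simp add: \<tau>_def lattice_point_0 fun_eq_iff)

lemma \<tau>_gs: "\<tau> l \<in> gs_space s"
proof -
  have "\<tau> l = (\<lambda>\<xi>. \<rho>c ((1 / (2 * real CARD('n))) *\<^sub>R \<xi> + (- (1 / (2 * real CARD('n))) *\<^sub>R lattice_point l)))"
    by (simp add: \<tau>_def fun_eq_iff scaleR_diff_right)
  then show ?thesis by (simp only:) (rule gs_space_affine[OF \<rho>c_gs s_ge1], simp)
qed

lemma \<sigma>_\<tau>: "\<sigma> l \<xi> * \<tau> l \<xi> = \<sigma> l \<xi>"
proof (cases "\<sigma> l \<xi> = 0")
  case False
  then have "l \<in> near 1 \<xi>" by (rule \<sigma>_support)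
  then have "\<bar>(\<xi> - lattice_point l) $ i\<bar> \<le> 1" for i by (simp add: near_def)
  then have "norm (\<xi> - lattice_point l) \<le> real CARD('n)" using norm_le_card[of "\<xi> - lattice_point l" 1] by simp
  then have "norm ((1 / (2 * real CARD('n))) *\<^sub>R (\<xi> - lattice_point l)) \<le> 1 / 2" unfolding norm_scaleR by (simp add: field_simps)
  then have "\<tau> l \<xi> = 1" by (simp only: \<tau>_def \<rho>c_def \<rho>_eq_1 of_real_1)
  then show ?thesis by simp
qed simp

lemma \<sigma>_integrable: "integrable lborel (\<sigma> k)"
  by (rule gs_space_integrable[OF \<sigma>_gs s_ge1])

text \<open>A choice fixed by the decomposition alone, bounding both the L^1 norms and the suprema
  of all kernels at once; the final constants are built from it.\<close>

definition kM :: real where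
  "kM = (SOME M. 0 < M \<and> (\<forall>l z. (\<integral>\<^sup>+z. ennreal (norm (kern (\<tau> l) z)) \<partial>lborel) \<le> ennreal M
      \<and> ennreal (norm (kern (\<tau> l) z)) \<le> ennreal M
      \<and> (\<integral>\<^sup>+z. ennreal (norm (kern (\<sigma> l) z)) \<partial>lborel) \<le> ennreal M
      \<and> ennreal (norm (kern (\<sigma> l) z)) \<le> ennreal M))"

lemma kM:
  shows kM_pos: "0 < kM"
    and kM_\<tau>: "(\<integral>\<^sup>+z. ennreal (norm (kern (\<tau> l) z)) \<partial>lborel) \<le> ennreal kM" "ennreal (norm (kern (\<tau> l) z)) \<le> ennreal kM"
    and kM_\<sigma>: "(\<integral>\<^sup>+z. ennreal (norm (kern (\<sigma> l) z)) \<partial>lborel) \<le> ennreal kM" "ennreal (norm (kern (\<sigma> l) z)) \<le> ennreal kM"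
proof -
  obtain M1 where M1: "0 < M1" "(\<integral>\<^sup>+z. ennreal (norm (kern (\<tau> 0) z)) \<partial>lborel) \<le> ennreal M1" "\<And>z. ennreal (norm (kern (\<tau> 0) z)) \<le> ennreal M1"
    using kern_bound[OF \<tau>_gs s_ge1] by blast
  obtain M2 where M2: "0 < M2" "(\<integral>\<^sup>+z. ennreal (norm (kern (\<sigma> 0) z)) \<partial>lborel) \<le> ennreal M2" "\<And>z. ennreal (norm (kern (\<sigma> 0) z)) \<le> ennreal M2"
    using kern_bound[OF \<sigma>_gs s_ge1] by blast
  have \<tau>: "norm (kern (\<tau> l) z) = norm (kern (\<tau> 0) z)" for l z
    by (subst \<tau>_shift) (rule norm_kern_shift[OF gs_space_measurable[OF \<tau>_gs s_ge1]])
  have eq: "\<sigma> l = (\<lambda>\<xi>. \<sigma> 0 (\<xi> - lattice_point l))" for l by (rule ext) (rule \<sigma>_shift)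
  have \<sigma>: "norm (kern (\<sigma> l) z) = norm (kern (\<sigma> 0) z)" for l z
    by (subst eq[of l]) (rule norm_kern_shift[OF gs_space_measurable[OF \<sigma>_gs s_ge1]])
  have le: "ennreal M1 \<le> ennreal (M1 + M2)" "ennreal M2 \<le> ennreal (M1 + M2)" using M1(1) M2(1) by (auto intro: ennreal_leI)
  have "\<exists>M. 0 < M \<and> (\<forall>l z. (\<integral>\<^sup>+z. ennreal (norm (kern (\<tau> l) z)) \<partial>lborel) \<le> ennreal M
      \<and> ennreal (norm (kern (\<tau> l) z)) \<le> ennreal M
      \<and> (\<integral>\<^sup>+z. ennreal (norm (kern (\<sigma> l) z)) \<partial>lborel) \<le> ennreal M
      \<and> ennreal (norm (kern (\<sigma> l) z)) \<le> ennreal M)"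
  proof (intro exI[of _ "M1 + M2"] conjI allI)
    show "0 < M1 + M2" using M1(1) M2(1) by simp
    fix l z
    show "(\<integral>\<^sup>+z. ennreal (norm (kern (\<tau> l) z)) \<partial>lborel) \<le> ennreal (M1 + M2)"
      unfolding \<tau>[of l] by (rule order_trans[OF M1(2) le(1)])
    show "ennreal (norm (kern (\<tau> l) z)) \<le> ennreal (M1 + M2)"
      unfolding \<tau>[of l] by (rule order_trans[OF M1(3) le(1)])
    show "(\<integral>\<^sup>+z. ennreal (norm (kern (\<sigma> l) z)) \<partial>lborel) \<le> ennreal (M1 + M2)"
      unfolding \<sigma>[of l] by (rule order_trans[OF M2(2) le(2)])
    show "ennreal (norm (kern (\<sigma> l) z)) \<le> ennreal (M1 + M2)"
      unfolding \<sigma>[of l] by (rule order_trans[OF M2(3) le(2)])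
  qed
  from someI_ex[OF this, folded kM_def]
  show "0 < kM"
    and "(\<integral>\<^sup>+z. ennreal (norm (kern (\<tau> l) z)) \<partial>lborel) \<le> ennreal kM" "ennreal (norm (kern (\<tau> l) z)) \<le> ennreal kM"
    and "(\<integral>\<^sup>+z. ennreal (norm (kern (\<sigma> l) z)) \<partial>lborel) \<le> ennreal kM" "ennreal (norm (kern (\<sigma> l) z)) \<le> ennreal kM"
    by simp_all
qed

text \<open>\<open>freq_box\<close> acts on u through \<open>multop (\<sigma> k)\<close>, which
  \<open>conv_adjoint\<close> moves over to F; boundedness of F and integrability of the kernel give
  the uniform bound required there.\<close>

lemma conv_\<sigma>_represents:
  assumes F: "F \<in> borel_measurable borel" "\<And>x. norm (F x) \<le> B"
    and u: "\<And>\<phi>. \<phi> \<in> gs_space s \<Longrightarrow> u \<phi> = (\<integral>x. F x * \<phi> x \<partial>lborel)"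
  shows "represents s (conv F (kern (\<sigma> k))) (freq_box \<rho> k u)"
proof -
  obtain M where M: "0 < M" "(\<integral>\<^sup>+z. ennreal (norm (kern (\<sigma> k) z)) \<partial>lborel) \<le> ennreal M" "\<And>z. ennreal (norm (kern (\<sigma> k) z)) \<le> ennreal M"
    using kern_bound[OF \<sigma>_gs s_ge1] by blast
  have [measurable]: "kern (\<sigma> k) \<in> borel_measurable borel" by (rule gs_space_measurable[OF kern_gs[OF \<sigma>_gs s_ge1] s_ge1])
  have [measurable]: "F \<in> borel_measurable borel" by (rule F(1))
  have B: "0 \<le> B" using F(2)[of 0] norm_ge_zero order_trans by blast
  have b: "(\<integral>\<^sup>+x. ennreal (norm (F x)) * ennreal (norm (kern (\<sigma> k) (y - x))) \<partial>lborel) \<le> ennreal (M * B)" for y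
  proof -
    have "(\<integral>\<^sup>+x. ennreal (norm (F x)) * ennreal (norm (kern (\<sigma> k) (y - x))) \<partial>lborel)
       \<le> ennreal M * eLp lborel \<infinity> (\<lambda>x. ennreal (norm (F x)))"
      by (rule eLp_conv_sup[OF _ _ _ M(2,1,3)]) auto
    also have "\<dots> \<le> ennreal M * ennreal B" by (intro mult_left_mono eLp_infty_bounded F) auto
    finally show ?thesis using M(1) B by (simp add: ennreal_mult)
  qed
  show ?thesis
    unfolding represents_def
  proof (intro conjI ballI)
    show "conv F (kern (\<sigma> k)) \<in> borel_measurable lborel" using conv_measurable[of F "kern (\<sigma> k)"] by simp
    fix \<phi> :: "real^'n \<Rightarrow> complex" assume \<phi>: "\<phi> \<in> gs_space s"
    show "integrable lborel (\<lambda>x. conv F (kern (\<sigma> k)) x * \<phi> x)"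
      by (rule conv_adjoint(2)[OF F(1) \<sigma>_gs \<phi> s_ge1 b])
    show "freq_box \<rho> k u \<phi> = regular_functional (conv F (kern (\<sigma> k))) \<phi>"
      unfolding freq_box_eq regular_functional_def u[OF multop_\<sigma>_gs[OF \<phi>]]
      by (rule conv_adjoint(1)[OF F(1) \<sigma>_gs \<phi> s_ge1 b])
  qed
qed

text \<open>A given representative is replaced by its convolution with
  \<open>kern (\<tau> l)\<close>. By \<open>\<sigma>_\<tau>\<close> the new function represents the
  same functional, and its bound holds at every point, not just almost everywhere.\<close>

lemma bernstein:
  assumes r: "1 \<le> r" and fin: "Lp_norm s r (freq_box \<rho> l u) < \<infinity>"
  shows "\<exists>D. represents s D (freq_box \<rho> l u) \<and> (\<forall>y. ennreal (norm (D y)) \<le> ennreal kM * Lp_norm s r (freq_box \<rho> l u))"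
proof -
  obtain F where F: "represents s F (freq_box \<rho> l u)" using Lp_norm_finite_represents[OF fin] .
  have mF [measurable]: "F \<in> borel_measurable borel" using F by (simp add: represents_def)
  have [measurable]: "kern (\<tau> l) \<in> borel_measurable borel" by (rule gs_space_measurable[OF kern_gs[OF \<tau>_gs s_ge1] s_ge1])
  define A where "A = Lp_norm s r (freq_box \<rho> l u)"
  have b0: "(\<integral>\<^sup>+x. ennreal (norm (F x)) * ennreal (norm (kern (\<tau> l) (y - x))) \<partial>lborel) \<le> ennreal kM * A" for y
    unfolding A_def Lp_norm_eq[OF F]
    by (rule eLp_conv_sup[OF _ _ r kM_\<tau>(1) kM_pos kM_\<tau>(2)]) auto
  have "ennreal kM * A < \<infinity>" using fin by (simp add: A_def ennreal_mult_less_top)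
  then obtain B where B: "ennreal kM * A = ennreal B" by (cases "ennreal kM * A") auto
  note b = b0[unfolded B]
  let ?D = "conv F (kern (\<tau> l))"
  have "represents s ?D (freq_box \<rho> l u)"
    unfolding represents_def
  proof (intro conjI ballI)
    show "?D \<in> borel_measurable lborel" using conv_measurable[of F "kern (\<tau> l)"] by simp
    fix \<phi> :: "real^'n \<Rightarrow> complex" assume \<phi>: "\<phi> \<in> gs_space s"
    show "integrable lborel (\<lambda>x. ?D x * \<phi> x)"
      by (rule conv_adjoint(2)[OF mF \<tau>_gs \<phi> s_ge1 b])
    obtain C c where C: "0 \<le> C" "gsb UNIV s C c (\<tau> l)"
      using gs_spaceE[OF \<tau>_gs[of l] s_ge1] by blast
    note T = multop_gs_space[OF gsb_imp_mbound[OF C(2)] C(1) \<phi> s_ge1]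
    have "regular_functional ?D \<phi> = (\<integral>x. F x * multop (\<tau> l) \<phi> x \<partial>lborel)"
      unfolding regular_functional_def by (rule conv_adjoint(1)[OF mF \<tau>_gs \<phi> s_ge1 b, symmetric])
    also have "\<dots> = freq_box \<rho> l u (multop (\<tau> l) \<phi>)"
      using F T(2) by (simp add: represents_def regular_functional_def)
    also have "\<dots> = u (multop (\<lambda>\<xi>. \<sigma> l \<xi> * \<tau> l \<xi>) \<phi>)"
      unfolding freq_box_eq by (subst multop_multop[OF T(1) s_ge1]) (rule refl)
    also have "\<dots> = freq_box \<rho> l u \<phi>" by (simp add: \<sigma>_\<tau> freq_box_eq)
    finally show "freq_box \<rho> l u \<phi> = regular_functional ?D \<phi>" by simp
  qed
  moreover have "ennreal (norm (?D y)) \<le> ennreal kM * A" for y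
    unfolding B by (rule conv_adjoint(3)[OF mF \<tau>_gs \<sigma>_gs s_ge1 b])
  ultimately show ?thesis unfolding A_def by blast
qed

end

section \<open>Summing the frequency components\<close>

text \<open>Sums over l are written as Bochner integrals over a counting measure, so that exchanging
  them with integrals is Fubini on a product space.\<close>

lemma integral_sum_swap:
  fixes F :: "'j::countable \<Rightarrow> 'a::euclidean_space \<Rightarrow> complex" and c :: "'j \<Rightarrow> ennreal"
  assumes [measurable]: "\<And>l. F l \<in> borel_measurable borel" and b: "\<And>l x. ennreal (norm (F l x)) \<le> c l"
    and c: "(\<integral>\<^sup>+l. c l \<partial>count_space UNIV) < \<infinity>" and \<Phi>: "integrable lborel \<Phi>"
  defines "S \<equiv> \<lambda>x. \<integral>l. F l x \<partial>count_space UNIV"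
  shows "(\<integral>x. S x * \<Phi> x \<partial>lborel) = (\<integral>l. (\<integral>x. F l x * \<Phi> x \<partial>lborel) \<partial>count_space UNIV)"
    and "integrable (count_space UNIV) (\<lambda>l. \<integral>x. F l x * \<Phi> x \<partial>lborel)"
    and "S \<in> borel_measurable borel"
    and "ennreal (norm (S x)) \<le> (\<integral>\<^sup>+l. c l \<partial>count_space UNIV)"
proof -
  interpret C: sigma_finite_measure "count_space (UNIV :: 'j set)"
    by (rule sigma_finite_measure_count_space_countable) auto
  interpret P: pair_sigma_finite "lborel :: 'a measure" "count_space (UNIV :: 'j set)" ..
  have [measurable]: "\<Phi> \<in> borel_measurable borel" using \<Phi> by auto
  have "(\<lambda>p. F (fst p) (snd p)) \<in> borel_measurable (count_space UNIV \<Otimes>\<^sub>M lborel)"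
    by (rule measurable_pair_measure_countable1) auto
  from measurable_compose[OF measurable_pair_swap' this]
  have mF [measurable]: "(\<lambda>p. F (snd p) (fst p)) \<in> borel_measurable (lborel \<Otimes>\<^sub>M count_space UNIV)"
    by (simp add: case_prod_beta')
  have "S \<in> borel_measurable lborel"
    unfolding S_def using C.borel_measurable_lebesgue_integral[of "\<lambda>x l. F l x" lborel] mF by (simp add: case_prod_beta')
  then show "S \<in> borel_measurable borel" by simp
  show "ennreal (norm (S x)) \<le> (\<integral>\<^sup>+l. c l \<partial>count_space UNIV)"
    unfolding S_def by (rule order_trans[OF ennreal_norm_integral_le nn_integral_mono]) (rule b)
  have int: "integrable (lborel \<Otimes>\<^sub>M count_space UNIV) (\<lambda>p. F (snd p) (fst p) * \<Phi> (fst p))"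
  proof (rule integrableI_bounded)
    have "(\<integral>\<^sup>+p. ennreal (norm (F (snd p) (fst p) * \<Phi> (fst p))) \<partial>(lborel \<Otimes>\<^sub>M count_space UNIV))
       = (\<integral>\<^sup>+x. (\<integral>\<^sup>+l. ennreal (norm (F l x * \<Phi> x)) \<partial>count_space UNIV) \<partial>lborel)"
      by (subst C.nn_integral_fst[symmetric]) auto
    also have "\<dots> \<le> (\<integral>\<^sup>+x. (\<integral>\<^sup>+l. c l * ennreal (norm (\<Phi> x)) \<partial>count_space UNIV) \<partial>lborel)"
      by (intro nn_integral_mono) (auto simp: norm_mult ennreal_mult intro!: mult_right_mono b)
    also have "\<dots> = (\<integral>\<^sup>+l. c l \<partial>count_space UNIV) * (\<integral>\<^sup>+x. ennreal (norm (\<Phi> x)) \<partial>lborel)"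
      by (simp add: nn_integral_multc nn_integral_cmult)
    also have "\<dots> < \<infinity>" using c \<Phi> by (simp add: integrable_iff_bounded ennreal_mult_less_top)
    finally show "(\<integral>\<^sup>+p. ennreal (norm (F (snd p) (fst p) * \<Phi> (fst p))) \<partial>(lborel \<Otimes>\<^sub>M count_space UNIV)) < \<infinity>" .
  qed measurable
  then have int': "integrable (lborel \<Otimes>\<^sub>M count_space UNIV) (case_prod (\<lambda>x l. F l x * \<Phi> x))"
    by (simp add: case_prod_beta')
  have "(\<integral>x. S x * \<Phi> x \<partial>lborel) = (\<integral>x. (\<integral>l. F l x * \<Phi> x \<partial>count_space UNIV) \<partial>lborel)"
    by (simp add: S_def)
  then show "(\<integral>x. S x * \<Phi> x \<partial>lborel) = (\<integral>l. (\<integral>x. F l x * \<Phi> x \<partial>lborel) \<partial>count_space UNIV)"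
    using P.Fubini_integral[OF int'] by simp
  show "integrable (count_space UNIV) (\<lambda>l. \<integral>x. F l x * \<Phi> x \<partial>lborel)"
    using P.integrable_snd[OF int'] by simp
qed

context freq_decomp
begin

lemma near_exhausts: "\<forall>\<^sub>F N in sequentially. (l :: int^'n) \<in> near (real (Suc N)) 0"
proof -
  obtain K :: nat where K: "norm (lattice_point l) \<le> real K" using real_arch_simple by blast
  show ?thesis
    using eventually_ge_at_top[of K]
  proof eventually_elim
    case (elim N)
    have "\<bar>real_of_int (l $ i)\<bar> \<le> real (Suc N)" for i
      using component_le_norm_cart[of "lattice_point l" i] K elim by simp
    then show ?case by (simp add: near_def)
  qed
qed

text \<open>\<open>partition_limit\<close> recovers u along growing boxes of indices; the bound
  \<open>c\<close> makes the series absolutely convergent, so the sum over all indices has the same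
  value.\<close>

lemma represents_sum:
  assumes u: "u \<in> gs_dual s" and F: "\<And>l. represents s (F l) (freq_box \<rho> l u)"
    and b: "\<And>l x. ennreal (norm (F l x)) \<le> c l" and c: "(\<integral>\<^sup>+l. c l \<partial>count_space UNIV) < \<infinity>"
  shows "represents s (\<lambda>x. \<integral>l. F l x \<partial>count_space UNIV) u"
    and "\<exists>B. \<forall>x. norm (\<integral>l. F l x \<partial>count_space UNIV) \<le> B"
proof -
  define S where "S = (\<lambda>x. \<integral>l. F l x \<partial>count_space UNIV)"
  have mF: "F l \<in> borel_measurable borel" for l using F[of l] by (simp add: represents_def)
  obtain B where B: "(\<integral>\<^sup>+l. c l \<partial>count_space UNIV) = ennreal B" "0 \<le> B"
    using c by (cases "\<integral>\<^sup>+l. c l \<partial>count_space UNIV") auto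
  note sw = integral_sum_swap[OF mF b c, folded S_def]
  have mS: "S \<in> borel_measurable borel" by (rule sw(3)[OF gs_space_integrable[OF \<sigma>_gs s_ge1]])
  have bS: "norm (S x) \<le> B" for x
    using sw(4)[OF gs_space_integrable[OF \<sigma>_gs s_ge1], of x] B by (simp add: S_def)
  then show "\<exists>B. \<forall>x. norm (\<integral>l. F l x \<partial>count_space UNIV) \<le> B" unfolding S_def by blast
  show "represents s (\<lambda>x. \<integral>l. F l x \<partial>count_space UNIV) u"
    unfolding S_def[symmetric] represents_def
  proof (intro conjI ballI)
    show "S \<in> borel_measurable lborel" using mS by simp
    fix \<phi> :: "real^'n \<Rightarrow> complex" assume \<phi>: "\<phi> \<in> gs_space s"
    have i: "integrable lborel \<phi>" by (rule gs_space_integrable[OF \<phi> s_ge1])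
    have [measurable]: "\<phi> \<in> borel_measurable borel" using i by auto
    show "integrable lborel (\<lambda>x. S x * \<phi> x)"
      by (rule Bochner_Integration.integrable_bound[of _ "\<lambda>x. of_real B * \<phi> x"])
         (use i mS bS B in \<open>auto simp: norm_mult intro!: mult_right_mono\<close>)
    define a where "a l = (\<integral>x. F l x * \<phi> x \<partial>lborel)" for l
    have a: "a l = u (multop (\<sigma> l) \<phi>)" for l
      using F[of l] \<phi> by (simp add: a_def represents_def regular_functional_def freq_box_eq)
    have ia: "integrable (count_space UNIV) a" using sw(2)[OF i] by (simp add: a_def[abs_def])
    have "(\<lambda>N. \<integral>l. indicator (near (real (Suc N)) 0) l *\<^sub>R a l \<partial>count_space UNIV) \<longlonglongrightarrow> (\<integral>l. a l \<partial>count_space UNIV)"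
    proof (rule integral_dominated_convergence[where w = "\<lambda>l. norm (a l)"])
      show "AE l in count_space UNIV. (\<lambda>N. indicator (near (real (Suc N)) 0) l *\<^sub>R a l) \<longlonglongrightarrow> a l"
      proof (rule AE_I2)
        fix l :: "int^'n"
        show "(\<lambda>N. indicator (near (real (Suc N)) 0) l *\<^sub>R a l) \<longlonglongrightarrow> a l"
          by (rule tendsto_eventually, rule eventually_mono[OF near_exhausts[of l]]) simp
      qed
    qed (use ia in \<open>auto split: split_indicator\<close>)
    moreover have "(\<integral>l. indicator (near (real (Suc N)) 0) l *\<^sub>R a l \<partial>count_space UNIV) = (\<Sum>l\<in>near (real (Suc N)) 0. u (multop (\<sigma> l) \<phi>))" for N
    proof -
      let ?A = "near (real (Suc N)) (0 :: real^'n)"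
      have "finite {l \<in> UNIV. indicator ?A l *\<^sub>R a l \<noteq> 0}"
        by (rule finite_subset[OF _ finite_near[of "real (Suc N)" "0 :: real^'n"]]) (auto split: split_indicator_asm)
      then have "(\<integral>l. indicator ?A l *\<^sub>R a l \<partial>count_space UNIV)
         = (\<Sum>l | l \<in> UNIV \<and> indicator ?A l *\<^sub>R a l \<noteq> 0. indicator ?A l *\<^sub>R a l)"
        by (rule lebesgue_integral_count_space_finite_support)
      also have "\<dots> = (\<Sum>l\<in>?A. a l)"
        by (rule sum.mono_neutral_cong_left[OF finite_near]) (auto split: split_indicator_asm)
      finally show ?thesis by (simp only: a)
    qed
    ultimately have "(\<integral>l. a l \<partial>count_space UNIV) = u \<phi>"
      using partition_limit[OF u \<phi>] by (simp add: LIMSEQ_unique)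
    then show "u \<phi> = regular_functional S \<phi>"
      using sw(1)[OF i] by (simp add: a_def regular_functional_def S_def)
  qed
qed

end

section \<open>Frequency supports of products\<close>

section \<open>Spectral supports of products\<close>

text \<open>By Fubini the integral is a superposition, weighted by F, of the integrals against
  translates of K, which vanish.\<close>

lemma integral_conv_eq_0:
  fixes F K \<Phi> :: "real^'n::finite \<Rightarrow> complex"
  assumes [measurable]: "F \<in> borel_measurable borel" and B: "\<And>x. norm (F x) \<le> B"
    and K: "integrable lborel K" and \<Phi>: "integrable lborel \<Phi>"
    and zero: "\<And>z. (\<integral>x. K (x - z) * \<Phi> x \<partial>lborel) = 0"
  shows "(\<integral>x. conv F K x * \<Phi> x \<partial>lborel) = 0"
proof -
  have [measurable]: "K \<in> borel_measurable borel" "\<Phi> \<in> borel_measurable borel" using K \<Phi> by auto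
  have B0: "0 \<le> B" using B[of 0] norm_ge_zero order_trans by blast
  define G where "G x z = F z * (K (x - z) * \<Phi> x)" for x z
  have mG: "(\<lambda>(x, z). G x z) \<in> borel_measurable (lborel \<Otimes>\<^sub>M lborel)" unfolding G_def by measurable
  have "(\<integral>\<^sup>+x. (\<integral>\<^sup>+z. ennreal (norm (G x z)) \<partial>lborel) \<partial>lborel)
      \<le> (\<integral>\<^sup>+x. (\<integral>\<^sup>+z. ennreal B * ennreal (norm (K (x - z))) * ennreal (norm (\<Phi> x)) \<partial>lborel) \<partial>lborel)"
    unfolding G_def norm_mult using B B0
    by (intro nn_integral_mono) (auto simp: ennreal_mult[symmetric] mult.assoc intro!: ennreal_leI mult_right_mono)
  also have "\<dots> = (\<integral>\<^sup>+x. ennreal B * (\<integral>\<^sup>+z. ennreal (norm (K z)) \<partial>lborel) * ennreal (norm (\<Phi> x)) \<partial>lborel)"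
    by (intro nn_integral_cong)
       (simp add: nn_integral_multc nn_integral_cmult nn_integral_lborel_shift(4)[of "\<lambda>z. ennreal (norm (K z))"])
  also have "\<dots> = ennreal B * (\<integral>\<^sup>+z. ennreal (norm (K z)) \<partial>lborel) * (\<integral>\<^sup>+x. ennreal (norm (\<Phi> x)) \<partial>lborel)"
    by (rule nn_integral_cmult) measurable
  also have "\<dots> < \<infinity>" using K \<Phi> by (simp add: integrable_iff_bounded ennreal_mult_less_top)
  finally have fin: "(\<integral>\<^sup>+x. (\<integral>\<^sup>+z. ennreal (norm (G x z)) \<partial>lborel) \<partial>lborel) < \<infinity>" .
  have "conv F K x * \<Phi> x = (\<integral>z. G x z \<partial>lborel)" for x
    unfolding conv_def G_def by (subst integral_mult_left_zero[symmetric]) (simp add: mult.assoc)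
  then have "(\<integral>x. conv F K x * \<Phi> x \<partial>lborel) = (\<integral>x. (\<integral>z. G x z \<partial>lborel) \<partial>lborel)" by simp
  also have "\<dots> = (\<integral>z. (\<integral>x. G x z \<partial>lborel) \<partial>lborel)" by (rule fubini_swap(1)[OF mG fin])
  also have "\<dots> = 0" unfolding G_def by (simp add: zero)
  finally show ?thesis .
qed

text \<open>The kernel is a superposition of plane waves whose frequencies lie where m is nonzero,
  and each of them integrates to 0 against \<Phi>.\<close>

lemma integral_kern_eq_0:
  fixes m \<Phi> :: "real^'n::finite \<Rightarrow> complex"
  assumes m: "integrable lborel m" and \<Phi>: "integrable lborel \<Phi>"
    and zero: "\<And>a. m a \<noteq> 0 \<Longrightarrow> (\<integral>x. exp (\<i> * of_real (x \<bullet> a)) * \<Phi> x \<partial>lborel) = 0"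
  shows "(\<integral>x. kern m (x - z) * \<Phi> x \<partial>lborel) = 0"
proof -
  have [measurable]: "m \<in> borel_measurable borel" "\<Phi> \<in> borel_measurable borel" using m \<Phi> by auto
  define c :: complex where "c = of_real (ftc TYPE('n))"
  define G where "G x a = (m a * exp (\<i> * of_real ((x - z) \<bullet> a))) * \<Phi> x" for x a
  have mG: "(\<lambda>(x, a). G x a) \<in> borel_measurable (lborel \<Otimes>\<^sub>M lborel)"
  proof -
    have [measurable]: "(\<lambda>p :: (real^'n) \<times> (real^'n). exp (\<i> * of_real ((fst p - z) \<bullet> snd p))) \<in> borel_measurable (lborel \<Otimes>\<^sub>M lborel)"
      by (intro borel_prod_measurable borel_measurable_continuous_onI continuous_intros)
    show ?thesis unfolding G_def case_prod_beta' by measurable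
  qed
  have "(\<integral>\<^sup>+x. (\<integral>\<^sup>+a. ennreal (norm (G x a)) \<partial>lborel) \<partial>lborel)
      = (\<integral>\<^sup>+x. (\<integral>\<^sup>+a. ennreal (norm (m a)) * ennreal (norm (\<Phi> x)) \<partial>lborel) \<partial>lborel)"
    by (simp add: G_def norm_mult norm_iexp ennreal_mult)
  also have "\<dots> = (\<integral>\<^sup>+a. ennreal (norm (m a)) \<partial>lborel) * (\<integral>\<^sup>+x. ennreal (norm (\<Phi> x)) \<partial>lborel)"
    by (simp add: nn_integral_multc nn_integral_cmult)
  also have "\<dots> < \<infinity>" using m \<Phi> by (simp add: integrable_iff_bounded ennreal_mult_less_top)
  finally have fin: "(\<integral>\<^sup>+x. (\<integral>\<^sup>+a. ennreal (norm (G x a)) \<partial>lborel) \<partial>lborel) < \<infinity>" .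
  have k: "kern m (x - z) * \<Phi> x = c * c * (\<integral>a. G x a \<partial>lborel)" for x
    unfolding kern_def inv_fourier_eq G_def c_def by simp
  have "(\<integral>x. kern m (x - z) * \<Phi> x \<partial>lborel) = c * c * (\<integral>x. (\<integral>a. G x a \<partial>lborel) \<partial>lborel)"
    unfolding k by simp
  also have "(\<integral>x. (\<integral>a. G x a \<partial>lborel) \<partial>lborel) = (\<integral>a. (\<integral>x. G x a \<partial>lborel) \<partial>lborel)"
    by (rule fubini_swap(1)[OF mG fin])
  also have "\<dots> = (\<integral>a. 0 \<partial>(lborel :: (real^'n) measure))"
  proof (intro Bochner_Integration.integral_cong refl)
    fix a
    have "exp (\<i> * complex_of_real ((x - z) \<bullet> a)) = exp (- (\<i> * complex_of_real (z \<bullet> a))) * exp (\<i> * complex_of_real (x \<bullet> a))" for x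
      by (simp add: exp_add[symmetric] inner_diff_left algebra_simps)
    then have "G x a = (m a * exp (- (\<i> * complex_of_real (z \<bullet> a)))) * (exp (\<i> * complex_of_real (x \<bullet> a)) * \<Phi> x)" for x
      by (simp only: G_def mult_ac)
    then have "(\<integral>x. G x a \<partial>lborel) = (m a * exp (- (\<i> * complex_of_real (z \<bullet> a)))) * (\<integral>x. exp (\<i> * complex_of_real (x \<bullet> a)) * \<Phi> x \<partial>lborel)"
      by (simp only: integral_mult_right_zero)
    then show "(\<integral>x. G x a \<partial>lborel) = 0" using zero[of a] by (cases "m a = 0") auto
  qed
  finally show ?thesis by simp
qed

text \<open>Convolution with \<open>kern m\<close> multiplies a plane wave of frequency \<xi> by m
  \<xi>, as Fourier inversion for m shows.\<close>

lemma kern_modulation: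
  fixes m :: "real^'n::finite \<Rightarrow> complex"
  assumes m: "m \<in> gs_space s" and s: "1 \<le> s" and zero: "m \<xi> = 0"
  shows "(\<integral>x. exp (\<i> * complex_of_real (x \<bullet> \<xi>)) * kern m (y - x) \<partial>lborel) = 0"
proof -
  have [measurable]: "kern m \<in> borel_measurable borel" by (rule gs_space_measurable[OF kern_gs[OF m s] s])
  define h where "h x = exp (\<i> * complex_of_real ((y - x) \<bullet> \<xi>)) * kern m x" for x
  have "(\<lambda>x. exp (\<i> * complex_of_real ((y - x) \<bullet> \<xi>))) \<in> borel_measurable borel"
    by (intro borel_measurable_continuous_onI continuous_intros)
  then have mh: "h \<in> borel_measurable borel" unfolding h_def[abs_def] by measurable
  have "(\<integral>x. exp (\<i> * complex_of_real (x \<bullet> \<xi>)) * kern m (y - x) \<partial>lborel) = (\<integral>x. h (y - x) \<partial>lborel)"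
    by (simp add: h_def)
  also have "\<dots> = (\<integral>x. h x \<partial>lborel)" by (rule integral_lborel_shift(4)[OF mh])
  also have "\<dots> = (\<integral>x. exp (\<i> * complex_of_real (y \<bullet> \<xi>)) * (kern m x * exp (- \<i> * complex_of_real (x \<bullet> \<xi>))) \<partial>lborel)"
  proof -
    have "exp (\<i> * complex_of_real ((y - x) \<bullet> \<xi>)) = exp (\<i> * complex_of_real (y \<bullet> \<xi>)) * exp (- \<i> * complex_of_real (x \<bullet> \<xi>))" for x
      by (simp add: exp_add[symmetric] inner_diff_left algebra_simps)
    then show ?thesis by (simp only: h_def mult_ac)
  qed
  also have "\<dots> = exp (\<i> * complex_of_real (y \<bullet> \<xi>)) * (\<integral>x. kern m x * exp (- \<i> * complex_of_real (x \<bullet> \<xi>)) \<partial>lborel)"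
    by (rule integral_mult_right_zero)
  also have "(\<integral>x. kern m x * exp (- \<i> * complex_of_real (x \<bullet> \<xi>)) \<partial>lborel) = 0"
  proof -
    have "fourier (kern m) \<xi> = of_real (ftc TYPE('n)) * fourier (inv_fourier m) \<xi>"
      unfolding kern_def[abs_def] by (rule fourier_cmult)
    then have "of_real (ftc TYPE('n)) * (\<integral>x. kern m x * exp (- \<i> * complex_of_real (x \<bullet> \<xi>)) \<partial>lborel) = 0"
      by (simp add: gs_space_fourier(3)[OF m s] zero fourier_eq[of "kern m"])
    then show ?thesis using ftc_pos[of "TYPE('n)"] by simp
  qed
  finally show ?thesis by simp
qed

lemma integrable_bounded_mult:
  fixes f g :: "'a::euclidean_space \<Rightarrow> complex"
  assumes f: "integrable lborel f" and g: "g \<in> borel_measurable borel" "\<And>x. norm (g x) \<le> B"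
  shows "integrable lborel (\<lambda>x. g x * f x)"
proof -
  have B: "0 \<le> B" using g(2)[of 0] norm_ge_zero order_trans by blast
  show ?thesis
    by (rule Bochner_Integration.integrable_bound[of _ "\<lambda>x. of_real B * f x"])
       (use f g B in \<open>auto simp: norm_mult intro!: mult_right_mono\<close>)
qed

text \<open>The 3 is the sum of the sup-radii of three supports, each equal to 1: those of the two
  factors and that of the outer \<open>\<sigma> k\<close>.\<close>

definition J3 :: "(int^'n::finite) set" where "J3 = {j. \<forall>i. \<bar>j $ i\<bar> \<le> 3}"

lemma finite_J3: "finite J3"
  unfolding J3_def by (rule finite_int_box)

context freq_decomp
begin

lemma
  shows kern_\<sigma>_integrable: "integrable lborel (kern (\<sigma> k))"
    and kern_\<sigma>_measurable: "kern (\<sigma> k) \<in> borel_measurable borel"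
    and kern_\<sigma>_bounded: "norm (kern (\<sigma> k) z) \<le> kM"
proof -
  have 1: "kern (\<sigma> k) \<in> gs_space s" by (rule kern_gs[OF \<sigma>_gs s_ge1])
  show "integrable lborel (kern (\<sigma> k))" by (rule gs_space_integrable[OF 1 s_ge1])
  show "kern (\<sigma> k) \<in> borel_measurable borel" by (rule gs_space_measurable[OF 1 s_ge1])
  show "norm (kern (\<sigma> k) z) \<le> kM" using kM_\<sigma>(2)[of k z] kM_pos by (subst (asm) ennreal_le_iff) auto
qed

text \<open>The factors are bounded functions without a classical Fourier transform. The identity is
  therefore proved for plane waves, passed to kernels by \<open>integral_kern_eq_0\<close> and then
  to convolutions by \<open>integral_conv_eq_0\<close>, one factor at a time.\<close>

lemma spectral_vanish:
  assumes F: "F \<in> borel_measurable borel" "\<And>x. norm (F x) \<le> BF"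
    and G: "G \<in> borel_measurable borel" "\<And>x. norm (G x) \<le> BG"
    and k: "k - l - m \<notin> J3"
  shows "(\<integral>x. conv F (kern (\<sigma> l)) x * (conv G (kern (\<sigma> m)) x * kern (\<sigma> k) (y - x)) \<partial>lborel) = 0"
proof -
  note [measurable] = kern_\<sigma>_measurable F(1) G(1)
  have ky: "integrable lborel (\<lambda>x. kern (\<sigma> k) (y - x))" by (rule integrable_lborel_shift(4)[OF kern_\<sigma>_integrable])
  \<comment> \<open>For frequencies a and b in the two supports, a + b lies outside the support of
    \<open>\<sigma> k\<close>, so the plane wave of frequency a + b is annihilated.\<close>
  have base: "(\<integral>x. exp (\<i> * complex_of_real (x \<bullet> b)) * (exp (\<i> * complex_of_real (x \<bullet> a)) * kern (\<sigma> k) (y - x)) \<partial>lborel) = 0"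
    if a: "\<sigma> m a \<noteq> 0" and b: "\<sigma> l b \<noteq> 0" for a b
  proof -
    have "\<sigma> k (a + b) = 0"
    proof (rule ccontr)
      assume "\<sigma> k (a + b) \<noteq> 0"
      then have K: "\<bar>(a + b) $ i - real_of_int (k $ i)\<bar> \<le> 1" for i
        using \<sigma>_support[of k "a + b"] by (simp add: near_def)
      have A: "\<bar>a $ i - real_of_int (m $ i)\<bar> \<le> 1" "\<bar>b $ i - real_of_int (l $ i)\<bar> \<le> 1" for i
        using \<sigma>_support[OF a] \<sigma>_support[OF b] by (auto simp: near_def)
      have "\<bar>(k - l - m) $ i\<bar> \<le> 3" for i
      proof -
        have "\<bar>real_of_int ((k - l - m) $ i)\<bar> \<le> 3" using K[of i] A[of i] by simp
        then show ?thesis by linarith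
      qed
      then show False using k by (simp add: J3_def)
    qed
    from kern_modulation[OF \<sigma>_gs s_ge1 this, of y]
    show ?thesis by (simp add: inner_add_right distrib_left exp_add mult_ac)
  qed
  have e: "(\<lambda>x. exp (\<i> * complex_of_real (x \<bullet> a))) \<in> borel_measurable borel" for a :: "real^'n" by measurable
  have L: "(\<integral>x. kern (\<sigma> l) (x - z) * (exp (\<i> * complex_of_real (x \<bullet> a)) * kern (\<sigma> k) (y - x)) \<partial>lborel) = 0"
    if a: "\<sigma> m a \<noteq> 0" for a z
    by (rule integral_kern_eq_0[OF \<sigma>_integrable integrable_bounded_mult[OF ky e, where B = 1] base[OF a]]) (simp add: norm_iexp)
  have lz: "(\<lambda>x. kern (\<sigma> l) (x - z)) \<in> borel_measurable borel" for z by measurable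
  have ilk: "integrable lborel (\<lambda>x. kern (\<sigma> l) (x - z) * kern (\<sigma> k) (y - x))" for z
    by (rule integrable_bounded_mult[OF ky lz kern_\<sigma>_bounded])
  have M: "(\<integral>x. kern (\<sigma> m) (x - z') * (kern (\<sigma> l) (x - z) * kern (\<sigma> k) (y - x)) \<partial>lborel) = 0" for z z'
    by (rule integral_kern_eq_0[OF \<sigma>_integrable ilk]) (use L in \<open>simp add: mult.left_commute\<close>)
  have gconv: "conv G (kern (\<sigma> m)) \<in> borel_measurable borel" by (rule conv_measurable) measurable
  have bconv: "norm (conv G (kern (\<sigma> m)) x) \<le> BG * (\<integral>z. norm (kern (\<sigma> m) z) \<partial>lborel)" for x
  proof -
    have BG: "0 \<le> BG" using G(2)[of 0] norm_ge_zero order_trans by blast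
    have "ennreal (norm (conv G (kern (\<sigma> m)) x)) \<le> (\<integral>\<^sup>+z. ennreal (norm (G z * kern (\<sigma> m) (x - z))) \<partial>lborel)"
      unfolding conv_def by (rule ennreal_norm_integral_le)
    also have "\<dots> \<le> (\<integral>\<^sup>+z. ennreal BG * ennreal (norm (kern (\<sigma> m) (x - z))) \<partial>lborel)"
      using G(2) BG by (intro nn_integral_mono) (auto simp: norm_mult ennreal_mult[symmetric] intro!: ennreal_leI mult_right_mono)
    also have "\<dots> = ennreal BG * (\<integral>\<^sup>+z. ennreal (norm (kern (\<sigma> m) z)) \<partial>lborel)"
      by (simp add: nn_integral_cmult nn_integral_lborel_shift(4)[of "\<lambda>z. ennreal (norm (kern (\<sigma> m) z))"])
    also have "(\<integral>\<^sup>+z. ennreal (norm (kern (\<sigma> m) z)) \<partial>lborel) = ennreal (\<integral>z. norm (kern (\<sigma> m) z) \<partial>lborel)"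
      using kern_\<sigma>_integrable by (intro nn_integral_eq_integral) auto
    also have "ennreal BG * \<dots> = ennreal (BG * (\<integral>z. norm (kern (\<sigma> m) z) \<partial>lborel))"
      using BG by (simp add: ennreal_mult)
    finally show ?thesis using BG by (subst (asm) ennreal_le_iff) auto
  qed
  have N: "(\<integral>x. kern (\<sigma> l) (x - z) * (conv G (kern (\<sigma> m)) x * kern (\<sigma> k) (y - x)) \<partial>lborel) = 0" for z
    using integral_conv_eq_0[OF G kern_\<sigma>_integrable ilk M, of z] by (simp add: mult.left_commute)
  show ?thesis
    by (rule integral_conv_eq_0[OF F kern_\<sigma>_integrable integrable_bounded_mult[OF ky gconv bconv] N])
qed

end

section \<open>Subexponential weights and the discrete convolution\<close>

section \<open>Subexponential weights\<close>

text \<open>Bernoulli gives (1 + y/x)^a \<le> 1 + a y/x, and x^(a - 1) y \<le> y^a because y \<le>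
  x. The factor a < 1 before the smaller term is the gain on which the algebra property
  rests.\<close>

lemma powr_add_le:
  fixes x y a :: real
  assumes a: "0 < a" "a < 1" and y: "0 \<le> y" "y \<le> x"
  shows "(x + y) powr a \<le> x powr a + a * y powr a"
proof (cases "y = 0")
  case False
  then have y0: "y > 0" and x0: "x > 0" using y by auto
  have "(1 + y / x) powr a * 1 powr (1 - a) \<le> a * (1 + y / x) + (1 - a) * 1"
    by (rule Youngs_inequality_0) (use a y0 x0 in \<open>auto intro: add_pos_pos\<close>)
  then have 1: "(1 + y / x) powr a \<le> 1 + a * (y / x)" by (simp add: algebra_simps)
  have "x powr a * (y / x) = x powr (a - 1) * y" using x0 by (simp add: powr_diff)
  also have "\<dots> \<le> y powr (a - 1) * y"
    using y0 y a by (intro mult_right_mono powr_mono2') auto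
  also have "\<dots> = y powr a" using y0 by (simp add: powr_diff)
  finally have 2: "x powr a * (y / x) \<le> y powr a" .
  have "x + y = x * (1 + y / x)" using x0 by (simp add: field_simps)
  then have "(x + y) powr a = x powr a * (1 + y / x) powr a" using x0 y0 by (simp add: powr_mult)
  also have "\<dots> \<le> x powr a * (1 + a * (y / x))" by (intro mult_left_mono 1) auto
  also have "\<dots> = x powr a + a * (x powr a * (y / x))" by (simp add: algebra_simps)
  also have "\<dots> \<le> x powr a + a * y powr a" using a by (intro add_left_mono mult_left_mono 2) auto
  finally show ?thesis .
qed simp

lemma power_le_exp:
  fixes y :: real
  assumes "0 < d" "0 \<le> y"
  shows "y ^ N \<le> fact N / d ^ N * exp (d * y)"
proof -
  have "(d * y) ^ N / fact N = (\<Sum>n\<in>{N}. (d * y) ^ n /\<^sub>R fact n)" by (simp add: divide_inverse mult.commute)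
  also have "\<dots> \<le> (\<Sum>n. (d * y) ^ n /\<^sub>R fact n)"
    by (rule sum_le_suminf[OF summable_exp_generic]) (use assms in auto)
  also have "\<dots> = exp (d * y)" by (simp add: exp_def)
  finally show ?thesis using assms by (simp add: power_mult_distrib field_simps)
qed

text \<open>N is chosen with a N \<ge> 2 n, so that for r > 1 the power r^(2n) is at most the N-th
  power of \<open>r powr a\<close>, which a single term of the exponential series dominates.\<close>

lemma subexp_bound:
  fixes d a :: real and n :: nat
  assumes d: "0 < d" and a: "0 < a"
  shows "\<exists>C. 0 \<le> C \<and> (\<forall>r\<ge>0. (1 + r\<^sup>2) ^ n * exp (- (d * r powr a)) \<le> C)"
proof -
  define N where "N = nat \<lceil>2 * real n / a\<rceil>"
  have N: "2 * real n / a \<le> real N" unfolding N_def by linarith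
  define C where "C = 2 ^ n * (1 + fact N / d ^ N)"
  have Cp: "0 \<le> fact N / d ^ N" using d by simp
  have "(1 + r\<^sup>2) ^ n * exp (- (d * r powr a)) \<le> C" if r: "0 \<le> r" for r
  proof (cases "r \<le> 1")
    case True
    have "(1 + r\<^sup>2) ^ n * exp (- (d * r powr a)) \<le> 2 ^ n * 1"
    proof (intro mult_mono)
      have "r\<^sup>2 \<le> 1" using True r by (simp add: power_le_one)
      then show "(1 + r\<^sup>2) ^ n \<le> 2 ^ n" by (intro power_mono) auto
    qed (use d in auto)
    also have "\<dots> \<le> C" unfolding C_def using Cp by (intro mult_left_mono) auto
    finally show ?thesis .
  next
    case False
    then have r1: "1 < r" by simp
    have "(1 + r\<^sup>2) ^ n \<le> (2 * r\<^sup>2) ^ n"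
      using r1 by (intro power_mono) (auto simp: one_le_power)
    also have "\<dots> = 2 ^ n * r powr (2 * real n)"
    proof -
      have "r powr (2 * real n) = r powr real (2 * n)" by simp
      also have "\<dots> = r ^ (2 * n)" using r1 by (intro powr_realpow) simp
      finally show ?thesis by (simp only: power_mult_distrib power_mult)
    qed
    also have "r powr (2 * real n) = (r powr a) powr (2 * real n / a)" using a by (simp add: powr_powr)
    also have "(r powr a) powr (2 * real n / a) \<le> (r powr a) powr real N"
      using N r1 a by (intro powr_mono) (auto simp: ge_one_powr_ge_zero)
    also have "\<dots> = (r powr a) ^ N" using r1 by (simp add: powr_realpow)
    also have "\<dots> \<le> fact N / d ^ N * exp (d * r powr a)" by (rule power_le_exp[OF d]) simp
    finally have "(1 + r\<^sup>2) ^ n \<le> 2 ^ n * (fact N / d ^ N * exp (d * r powr a))" by simp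
    then have "(1 + r\<^sup>2) ^ n * exp (- (d * r powr a)) \<le> 2 ^ n * (fact N / d ^ N * exp (d * r powr a)) * exp (- (d * r powr a))"
      by (intro mult_right_mono) auto
    also have "\<dots> = 2 ^ n * (fact N / d ^ N)" by (simp add: exp_minus)
    also have "\<dots> \<le> C" unfolding C_def by (intro mult_left_mono) auto
    finally show ?thesis .
  qed
  moreover have "0 \<le> C" using Cp by (simp add: C_def)
  ultimately show ?thesis by blast
qed

lemma abs_summable_int_weight: "Infinite_Set_Sum.abs_summable_on (\<lambda>l :: int. inverse (1 + (real_of_int l)\<^sup>2)) UNIV"
proof -
  have nat: "Infinite_Set_Sum.abs_summable_on (\<lambda>n :: nat. inverse (1 + (real n)\<^sup>2)) UNIV"
    unfolding abs_summable_on_nat_iff'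
  proof (rule summable_comparison_test'[OF inverse_power_summable[of 2]])
    fix n :: nat assume "1 \<le> n"
    then show "norm (norm (inverse (1 + (real n)\<^sup>2))) \<le> inverse ((real n)\<^sup>2)"
      by (auto intro!: le_imp_inverse_le simp: add_nonneg_nonneg)
  qed simp
  have 1: "Infinite_Set_Sum.abs_summable_on (\<lambda>l :: int. inverse (1 + (real_of_int l)\<^sup>2)) (int ` UNIV)"
    by (subst abs_summable_on_reindex_iff[symmetric]) (use nat in \<open>auto simp: inj_on_def\<close>)
  have 2: "Infinite_Set_Sum.abs_summable_on (\<lambda>l :: int. inverse (1 + (real_of_int l)\<^sup>2)) ((\<lambda>n. - int n) ` UNIV)"
    by (subst abs_summable_on_reindex_iff[symmetric]) (use nat in \<open>auto simp: inj_on_def\<close>)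
  have "(UNIV :: int set) = int ` UNIV \<union> (\<lambda>n. - int n) ` UNIV"
  proof -
    have "l \<in> range int \<union> range (\<lambda>n. - int n)" for l
      by (cases l rule: int_cases2) auto
    then show ?thesis by blast
  qed
  then show ?thesis using abs_summable_on_union[OF 1 2] by simp
qed

text \<open>Comparison with the product of the weights 1 / (1 + t^2) over the coordinates t of l,
  which is summable over the lattice as a product of one-dimensional series.\<close>

lemma subexp_summable:
  fixes d a :: real
  assumes d: "0 < d" and a: "0 < a"
  shows "(\<integral>\<^sup>+l. ennreal (exp (- (d * norm (lattice_point (l :: int^'n::finite)) powr a))) \<partial>count_space UNIV) < \<infinity>"
proof -
  obtain C where C: "0 \<le> C" "\<And>r. 0 \<le> r \<Longrightarrow> (1 + r\<^sup>2) ^ CARD('n) * exp (- (d * r powr a)) \<le> C"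
    using subexp_bound[OF d a] by blast
  define g :: "('n \<Rightarrow> int) \<Rightarrow> real" where "g f = (\<Prod>i\<in>UNIV. inverse (1 + (real_of_int (f i))\<^sup>2))" for f
  have "Infinite_Set_Sum.abs_summable_on g (PiE UNIV (\<lambda>_. UNIV))"
    unfolding g_def by (rule abs_summable_on_prod_PiE) (auto intro: abs_summable_int_weight)
  then have "integrable (count_space UNIV) g" by (simp add: abs_summable_on_def PiE_UNIV_domain)
  then have fin: "(\<integral>\<^sup>+f. ennreal (norm (g f)) \<partial>count_space UNIV) < \<infinity>" by (simp add: integrable_iff_bounded)
  have g0: "0 \<le> g f" for f unfolding g_def by (intro prod_nonneg) auto
  have bound: "exp (- (d * norm (lattice_point l) powr a)) \<le> C * g (\<lambda>i. l $ i)" for l :: "int^'n"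
  proof -
    let ?r = "norm (lattice_point l)"
    have "(\<Prod>i\<in>UNIV. 1 + (real_of_int (l $ i))\<^sup>2) \<le> (\<Prod>i\<in>(UNIV :: 'n set). 1 + ?r\<^sup>2)"
    proof (intro prod_mono conjI add_left_mono)
      fix i show "(real_of_int (l $ i))\<^sup>2 \<le> ?r\<^sup>2"
        using component_le_norm_cart[of "lattice_point l" i] by (simp add: abs_le_square_iff[symmetric])
    qed (auto simp: add_nonneg_nonneg)
    then have "(\<Prod>i\<in>UNIV. 1 + (real_of_int (l $ i))\<^sup>2) * exp (- (d * ?r powr a)) \<le> (1 + ?r\<^sup>2) ^ CARD('n) * exp (- (d * ?r powr a))"
      by (intro mult_right_mono) auto
    also have "\<dots> \<le> C" by (rule C(2)) simp
    finally have 1: "(\<Prod>i\<in>UNIV. 1 + (real_of_int (l $ i))\<^sup>2) * exp (- (d * ?r powr a)) \<le> C" .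
    have 2: "g (\<lambda>i. l $ i) * (\<Prod>i\<in>UNIV. 1 + (real_of_int (l $ i))\<^sup>2) = 1"
    proof -
      have "inverse (1 + (real_of_int (l $ i))\<^sup>2) * (1 + (real_of_int (l $ i))\<^sup>2) = 1" for i
        by (rule left_inverse) (metis add_pos_nonneg less_irrefl zero_le_power2 zero_less_one)
      then show ?thesis unfolding g_def by (simp only: prod.distrib[symmetric]) simp
    qed
    have "exp (- (d * ?r powr a)) = g (\<lambda>i. l $ i) * (\<Prod>i\<in>UNIV. 1 + (real_of_int (l $ i))\<^sup>2) * exp (- (d * ?r powr a))"
      by (simp add: 2)
    also have "\<dots> \<le> g (\<lambda>i. l $ i) * C" using mult_left_mono[OF 1 g0] by (simp add: mult.assoc)
    finally show ?thesis by (simp add: mult.commute)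
  qed
  have "(\<integral>\<^sup>+l. ennreal (exp (- (d * norm (lattice_point (l :: int^'n)) powr a))) \<partial>count_space UNIV)
     \<le> (\<integral>\<^sup>+l. ennreal C * ennreal (norm (g (\<lambda>i. l $ i))) \<partial>count_space (UNIV :: (int^'n) set))"
    using bound C(1) g0 by (intro nn_integral_mono) (auto simp: ennreal_mult[symmetric] intro!: ennreal_leI)
  also have "\<dots> = ennreal C * (\<integral>\<^sup>+l. ennreal (norm (g (\<lambda>i. l $ i))) \<partial>count_space (UNIV :: (int^'n) set))"
    by (rule nn_integral_cmult) simp
  also have "(\<integral>\<^sup>+l. ennreal (norm (g (\<lambda>i. l $ i))) \<partial>count_space (UNIV :: (int^'n) set)) = (\<integral>\<^sup>+f. ennreal (norm (g f)) \<partial>count_space UNIV)"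
  proof (rule nn_integral_bij_count_space[where f = "\<lambda>f. ennreal (norm (g f))" and g = "\<lambda>l i. l $ i"])
    show "bij_betw (\<lambda>(l :: int^'n) i. l $ i) UNIV UNIV"
      by (rule bij_betwI[where g = "\<lambda>f. \<chi> i. f i"]) auto
  qed
  also have "ennreal C * \<dots> < \<infinity>" using fin by (simp add: ennreal_mult_less_top)
  finally show ?thesis .
qed

context freq_decomp
begin

definition wt :: "int^'n \<Rightarrow> real" where "wt l = norm (lattice_point l) powr (1 / s)"

text \<open>The gain in the triangle inequality for \<open>wt\<close>, positive precisely because s
  > 1.\<close>

definition \<delta> :: real where "\<delta> = 1 - 1 / s"

lemma inv_s: "0 < 1 / s" "1 / s < 1" and \<delta>_pos: "0 < \<delta>" and \<delta>_le: "\<delta> \<le> 1"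
  using s1 by (auto simp: \<delta>_def)

lemma wt_nonneg: "0 \<le> wt l"
  by (simp add: wt_def)

text \<open>\<open>powr_add_le\<close> saves an exponential factor in the smaller of the two
  indices; adding the corresponding factor of the other index makes the bound symmetric and free of
  a case distinction.\<close>

lemma exp_wt_add: "exp (wt (l + m)) \<le> exp (wt l) * exp (wt m) * (exp (- (\<delta> * wt l)) + exp (- (\<delta> * wt m)))"
proof -
  have main: "exp (wt (l + m)) \<le> exp (wt l) * exp (wt m) * exp (- (\<delta> * wt m))"
    if "norm (lattice_point m) \<le> norm (lattice_point l)" for l m
  proof -
    have "wt (l + m) \<le> (norm (lattice_point l) + norm (lattice_point m)) powr (1 / s)"
      unfolding wt_def lattice_point_add using inv_s by (intro powr_mono2 norm_triangle_ineq) auto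
    also have "\<dots> \<le> wt l + 1 / s * wt m"
      unfolding wt_def by (rule powr_add_le) (use inv_s that in auto)
    also have "\<dots> = wt l + wt m + - (\<delta> * wt m)" by (simp add: \<delta>_def algebra_simps)
    finally show ?thesis by (simp add: exp_add[symmetric])
  qed
  show ?thesis
  proof (cases "norm (lattice_point m) \<le> norm (lattice_point l)")
    case True
    from main[OF this] show ?thesis by (rule order_trans) (auto intro: mult_left_mono)
  next
    case False
    then have "exp (wt (m + l)) \<le> exp (wt m) * exp (wt l) * exp (- (\<delta> * wt l))" by (intro main) simp
    then have "exp (wt (l + m)) \<le> exp (wt l) * exp (wt m) * exp (- (\<delta> * wt l))" by (simp add: add.commute mult.commute)
    then show ?thesis by (rule order_trans) (auto intro: mult_left_mono)
  qed
qed

text \<open>A crude form for splitting off a shift from \<open>J3\<close>, which takes only finitely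
  many values.\<close>

lemma exp_wt_sub: "exp (wt (l + m)) \<le> 2 * exp (wt l) * exp (wt m)"
proof -
  have "exp (- (\<delta> * wt l)) + exp (- (\<delta> * wt m)) \<le> 2"
  proof -
    have "exp (- (\<delta> * wt j)) \<le> 1" for j using \<delta>_pos wt_nonneg[of j] by simp
    from this[of l] this[of m] show ?thesis by linarith
  qed
  then have "exp (wt l) * exp (wt m) * (exp (- (\<delta> * wt l)) + exp (- (\<delta> * wt m))) \<le> exp (wt l) * exp (wt m) * 2"
    by (intro mult_left_mono) auto
  from order_trans[OF exp_wt_add this] show ?thesis by (simp only: mult_ac)
qed

definition w :: "int^'n \<Rightarrow> ennreal" where "w l = ennreal (exp (- (\<delta> * wt l)))"

definition Wtot :: real where "Wtot = enn2real (\<integral>\<^sup>+l. w l \<partial>count_space UNIV)"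

lemma w_summable: "(\<integral>\<^sup>+l. w l \<partial>count_space UNIV) = ennreal Wtot"
proof -
  have "(\<integral>\<^sup>+l. w l \<partial>count_space UNIV) < \<infinity>"
    unfolding w_def wt_def by (rule subexp_summable[OF \<delta>_pos inv_s(1)])
  then show ?thesis by (simp add: Wtot_def)
qed

lemma gm_norm_eq:
  assumes q: "1 \<le> q"
  shows "gm_norm \<rho> s p q u = elq q (\<lambda>k. ennreal (exp (wt k)) * Lp_norm s p (freq_box \<rho> k u))"
proof (cases "q = \<infinity>")
  case True
  then show ?thesis unfolding True elq_infty gm_norm_def wt_def by simp
next
  case False
  have Q: "1 \<le> enn2real q" by (rule enn2real_ge_1[OF q False])
  have "ennreal_powr (ennreal (exp (wt k)) * Lp_norm s p (freq_box \<rho> k u)) (enn2real q)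
      = ennreal (exp (enn2real q * norm (lattice_point k) powr (1 / s))) * ennreal_powr (Lp_norm s p (freq_box \<rho> k u)) (enn2real q)" for k
    using Q by (simp add: ennreal_powr_mult ennreal_powr_ennreal wt_def exp_powr_real mult.commute)
  then show ?thesis using False by (simp add: gm_norm_def eLp_def infsum_ennreal_eq)
qed

text \<open>\<open>elq_point\<close> isolates one term of the norm. Weakening exp (- wt l) to
  \<open>w l\<close>, possible since \<delta> \<le> 1, lets one summable sequence serve here and in
  the product estimate.\<close>

lemma component_le_gm_norm:
  assumes q: "1 \<le> q"
  shows "Lp_norm s p (freq_box \<rho> l u) \<le> w l * gm_norm \<rho> s p q u"
proof -
  have "ennreal (exp (wt l)) * Lp_norm s p (freq_box \<rho> l u) \<le> gm_norm \<rho> s p q u"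
    unfolding gm_norm_eq[OF q] by (rule elq_point[OF q])
  then have "ennreal (exp (- wt l)) * (ennreal (exp (wt l)) * Lp_norm s p (freq_box \<rho> l u)) \<le> ennreal (exp (- wt l)) * gm_norm \<rho> s p q u"
    by (rule mult_left_mono) simp
  moreover have "ennreal (exp (- wt l)) * ennreal (exp (wt l)) = 1"
    by (simp add: ennreal_mult[symmetric] exp_add[symmetric])
  ultimately have "Lp_norm s p (freq_box \<rho> l u) \<le> ennreal (exp (- wt l)) * gm_norm \<rho> s p q u"
    by (simp add: mult.assoc[symmetric])
  also have "\<dots> \<le> w l * gm_norm \<rho> s p q u"
    unfolding w_def using mult_right_mono[OF \<delta>_le wt_nonneg[of l]] by (intro mult_right_mono ennreal_leI) auto
  finally show ?thesis .
qed

text \<open>Bernstein bounds each piece by its L^r norm, and these norms are summable through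
  \<open>w\<close> alone, for every q.\<close>

lemma gm_decomposition:
  assumes u: "u \<in> gm_space \<rho> s r q" and r: "1 \<le> r" and q: "1 \<le> q"
  shows "\<exists>F. (\<forall>l. represents s (F l) (freq_box \<rho> l u)) \<and>
     (\<forall>l y. ennreal (norm (F l y)) \<le> ennreal kM * Lp_norm s r (freq_box \<rho> l u)) \<and>
     (\<integral>\<^sup>+l. ennreal kM * Lp_norm s r (freq_box \<rho> l u) \<partial>count_space UNIV) < \<infinity> \<and>
     represents s (\<lambda>x. \<integral>l. F l x \<partial>count_space UNIV) u \<and>
     (\<exists>B. \<forall>x. norm (\<integral>l. F l x \<partial>count_space UNIV) \<le> B)"
proof -
  have ud: "u \<in> gs_dual s" and N: "gm_norm \<rho> s r q u < \<infinity>" using u by (auto simp: gm_space_def)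
  have fin: "Lp_norm s r (freq_box \<rho> l u) < \<infinity>" for l
  proof (rule le_less_trans[OF component_le_gm_norm[OF q]])
    show "w l * gm_norm \<rho> s r q u < \<infinity>" using N by (simp add: w_def ennreal_mult_less_top)
  qed
  have "\<exists>F. \<forall>l. represents s (F l) (freq_box \<rho> l u) \<and> (\<forall>y. ennreal (norm (F l y)) \<le> ennreal kM * Lp_norm s r (freq_box \<rho> l u))"
    by (rule choice) (use bernstein[OF r fin] in blast)
  then obtain F where F: "\<And>l. represents s (F l) (freq_box \<rho> l u)"
    "\<And>l y. ennreal (norm (F l y)) \<le> ennreal kM * Lp_norm s r (freq_box \<rho> l u)" by blast
  have "(\<integral>\<^sup>+l. ennreal kM * Lp_norm s r (freq_box \<rho> l u) \<partial>count_space UNIV)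
      \<le> (\<integral>\<^sup>+l. ennreal kM * (w l * gm_norm \<rho> s r q u) \<partial>count_space UNIV)"
    by (intro nn_integral_mono mult_left_mono component_le_gm_norm q) auto
  also have "\<dots> = ennreal kM * (ennreal Wtot * gm_norm \<rho> s r q u)"
    by (simp add: nn_integral_cmult nn_integral_multc w_summable)
  also have "\<dots> < \<infinity>" using N by (simp add: ennreal_mult_less_top)
  finally have S: "(\<integral>\<^sup>+l. ennreal kM * Lp_norm s r (freq_box \<rho> l u) \<partial>count_space UNIV) < \<infinity>" .
  show ?thesis
    using F S represents_sum[OF ud F S] by blast
qed

text \<open>Justifies the choice in \<open>density_fun\<close>: the sum of the frequency pieces is a
  bounded representative.\<close>

lemma density_fun_gm:
  assumes u: "u \<in> gm_space \<rho> s r q" and r: "1 \<le> r" and q: "1 \<le> q"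
  shows "represents s (density_fun s u) u" "\<exists>B. \<forall>x. norm (density_fun s u x) \<le> B"
proof -
  obtain F :: "int^'n \<Rightarrow> real^'n \<Rightarrow> complex" where F: "represents s (\<lambda>x. \<integral>l. F l x \<partial>count_space UNIV) u"
    "\<exists>B. \<forall>x. norm (\<integral>l. F l x \<partial>count_space UNIV) \<le> B"
    using gm_decomposition[OF assms] by blast
  have "\<exists>F. bounded (range F) \<and> represents s F u"
    by (intro exI[of _ "\<lambda>x. \<integral>l. F l x \<partial>count_space UNIV"] conjI F(1)) (use F(2) in \<open>auto simp: bounded_iff\<close>)
  from someI_ex[OF this] show "represents s (density_fun s u) u" "\<exists>B. \<forall>x. norm (density_fun s u x) \<le> B"
    by (auto simp: density_fun_def bounded_iff)
qed

lemma two_p: "1 \<le> p \<Longrightarrow> 1 \<le> 2 * (p :: ennreal)"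
  by (metis mult_2 add_increasing2 zero_le)

text \<open>The outer projection is convolution with \<open>kern (\<sigma> k)\<close>. Expanding
  both densities gives a double series whose (l, m) term costs kM times the L^(2p) norms of the
  pieces and vanishes unless \<open>k - l - m \<in> J3\<close>.\<close>

lemma product_component:
  assumes f: "f \<in> gm_space \<rho> s (2 * p) q" and g: "g \<in> gm_space \<rho> s (2 * p) q" and p: "1 \<le> p" and q: "1 \<le> q"
  shows "Lp_norm s p (freq_box \<rho> k (pointwise_prod s f g)) \<le>
    ennreal kM * (\<Sum>j\<in>J3. \<integral>\<^sup>+l. Lp_norm s (2 * p) (freq_box \<rho> l f) * Lp_norm s (2 * p) (freq_box \<rho> (k - j - l) g) \<partial>count_space UNIV)"
proof -
  note p2 = two_p[OF p]
  define \<alpha> where "\<alpha> l = Lp_norm s (2 * p) (freq_box \<rho> l f)" for l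
  define \<beta> where "\<beta> l = Lp_norm s (2 * p) (freq_box \<rho> l g)" for l
  obtain F where F: "\<And>l. represents s (F l) (freq_box \<rho> l f)" "\<And>l y. ennreal (norm (F l y)) \<le> ennreal kM * \<alpha> l"
    and FS: "(\<integral>\<^sup>+l. ennreal kM * \<alpha> l \<partial>count_space UNIV) < \<infinity>" and Fr: "represents s (\<lambda>x. \<integral>l. F l x \<partial>count_space UNIV) f"
    using gm_decomposition[OF f p2 q] unfolding \<alpha>_def by blast
  obtain G where G: "\<And>l. represents s (G l) (freq_box \<rho> l g)" "\<And>l y. ennreal (norm (G l y)) \<le> ennreal kM * \<beta> l"
    and GS: "(\<integral>\<^sup>+l. ennreal kM * \<beta> l \<partial>count_space UNIV) < \<infinity>" and Gr: "represents s (\<lambda>x. \<integral>l. G l x \<partial>count_space UNIV) g"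
    using gm_decomposition[OF g p2 q] unfolding \<beta>_def by blast
  define D where "D = density_fun s f"
  define E where "E = density_fun s g"
  obtain BD where D: "represents s D f" "\<And>x. norm (D x) \<le> BD" using density_fun_gm[OF f p2 q] unfolding D_def by blast
  obtain BE where E: "represents s E g" "\<And>x. norm (E x) \<le> BE" using density_fun_gm[OF g p2 q] unfolding E_def by blast
  have mF [measurable]: "F l \<in> borel_measurable borel" for l using F(1)[of l] by (simp add: represents_def)
  have mG [measurable]: "G l \<in> borel_measurable borel" for l using G(1)[of l] by (simp add: represents_def)
  have mD [measurable]: "D \<in> borel_measurable borel" using D(1) by (simp add: represents_def)
  have mE [measurable]: "E \<in> borel_measurable borel" using E(1) by (simp add: represents_def)
  note [measurable] = kern_\<sigma>_measurable
  have bDE: "norm (D x * E x) \<le> BD * BE" for x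
    unfolding norm_mult using D(2)[of x] E(2)[of x] norm_ge_zero order_trans by (intro mult_mono) blast+
  define \<kappa> where "\<kappa> = kern (\<sigma> k)"
  have m\<kappa> [measurable]: "\<kappa> \<in> borel_measurable borel" unfolding \<kappa>_def by (rule kern_\<sigma>_measurable)
  have i\<kappa>: "integrable lborel (\<lambda>x. \<kappa> (y - x))" for y unfolding \<kappa>_def by (rule integrable_lborel_shift(4)[OF kern_\<sigma>_integrable])
  define H where "H = conv (\<lambda>x. D x * E x) \<kappa>"
  have rH: "represents s H (freq_box \<rho> k (pointwise_prod s f g))"
    unfolding H_def \<kappa>_def
    by (rule conv_\<sigma>_represents[OF _ bDE]) (auto simp: pointwise_prod_def regular_functional_def D_def[symmetric] E_def[symmetric])
  define c where "c l m = conv (\<lambda>x. F l x * G m x) \<kappa>" for l m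
  have mc [measurable]: "c l m \<in> borel_measurable borel" for l m unfolding c_def by (rule conv_measurable) measurable
  have AE_D: "AE x in lborel. D x = (\<integral>l. F l x \<partial>count_space UNIV)" by (rule represents_unique[OF D(1) Fr])
  have AE_E: "AE x in lborel. E x = (\<integral>l. G l x \<partial>count_space UNIV)" by (rule represents_unique[OF E(1) Gr])
  have i1: "integrable lborel (\<lambda>x. E x * \<kappa> (y - x))" for y by (rule integrable_bounded_mult[OF i\<kappa> mE E(2)])
  have Ffin: "ennreal kM * \<alpha> l < \<infinity>" for l
    by (rule le_less_trans[OF nn_integral_ge_point FS]) simp
  have Gfin: "ennreal kM * \<beta> l < \<infinity>" for l
    by (rule le_less_trans[OF nn_integral_ge_point GS]) simp
  have bF: "norm (F l x) \<le> enn2real (ennreal kM * \<alpha> l)" for l x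
    using F(2)[of l x] Ffin[of l] by (metis enn2real_ennreal enn2real_mono norm_ge_zero infinity_ennreal_def)
  have i2: "integrable lborel (\<lambda>x. F l x * \<kappa> (y - x))" for l y by (rule integrable_bounded_mult[OF i\<kappa> mF bF])
  have mSF [measurable]: "(\<lambda>x. \<integral>l. F l x \<partial>count_space UNIV) \<in> borel_measurable borel"
    by (rule integral_sum_swap(3)[OF mF F(2) FS i1])
  have mSG [measurable]: "(\<lambda>x. \<integral>l. G l x \<partial>count_space UNIV) \<in> borel_measurable borel"
    by (rule integral_sum_swap(3)[OF mG G(2) GS i1])
  \<comment> \<open>The two densities are expanded one after the other, the remaining factor and the
    kernel being absorbed into an integrable function each time.\<close>
  have Hy: "H y = (\<integral>l. (\<integral>m. c l m y \<partial>count_space UNIV) \<partial>count_space UNIV)" for y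
  proof -
    have "H y = (\<integral>x. D x * (E x * \<kappa> (y - x)) \<partial>lborel)" by (simp add: H_def conv_def mult.assoc)
    also have "\<dots> = (\<integral>x. (\<integral>l. F l x \<partial>count_space UNIV) * (E x * \<kappa> (y - x)) \<partial>lborel)"
      by (rule integral_cong_AE) (use AE_D in \<open>auto elim!: AE_mp\<close>)
    also have "\<dots> = (\<integral>l. (\<integral>x. F l x * (E x * \<kappa> (y - x)) \<partial>lborel) \<partial>count_space UNIV)"
      by (rule integral_sum_swap(1)[OF mF F(2) FS i1])
    also have "\<dots> = (\<integral>l. (\<integral>m. c l m y \<partial>count_space UNIV) \<partial>count_space UNIV)"
    proof (intro Bochner_Integration.integral_cong refl)
      fix l
      have "(\<integral>x. F l x * (E x * \<kappa> (y - x)) \<partial>lborel) = (\<integral>x. E x * (F l x * \<kappa> (y - x)) \<partial>lborel)"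
        by (simp add: mult_ac)
      also have "\<dots> = (\<integral>x. (\<integral>m. G m x \<partial>count_space UNIV) * (F l x * \<kappa> (y - x)) \<partial>lborel)"
        by (rule integral_cong_AE) (use AE_E in \<open>auto elim!: AE_mp\<close>)
      also have "\<dots> = (\<integral>m. (\<integral>x. G m x * (F l x * \<kappa> (y - x)) \<partial>lborel) \<partial>count_space UNIV)"
        by (rule integral_sum_swap(1)[OF mG G(2) GS i2])
      finally show "(\<integral>x. F l x * (E x * \<kappa> (y - x)) \<partial>lborel) = (\<integral>m. c l m y \<partial>count_space UNIV)"
        by (simp add: c_def conv_def mult_ac)
    qed
    finally show ?thesis .
  qed
  have Hle: "ennreal (norm (H y)) \<le> (\<integral>\<^sup>+l. (\<integral>\<^sup>+m. ennreal (norm (c l m y)) \<partial>count_space UNIV) \<partial>count_space UNIV)" for y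
    unfolding Hy by (rule order_trans[OF ennreal_norm_integral_le nn_integral_mono]) (rule ennreal_norm_integral_le)
  have c_le: "eLp lborel p (\<lambda>y. ennreal (norm (c l m y))) \<le> (if k - l - m \<in> J3 then ennreal kM * (\<alpha> l * \<beta> m) else 0)" for l m
  proof (cases "k - l - m \<in> J3")
    case True
    have "eLp lborel p (\<lambda>y. ennreal (norm (c l m y)))
       \<le> eLp lborel p (\<lambda>y. \<integral>\<^sup>+x. ennreal (norm (F l x * G m x)) * ennreal (norm (\<kappa> (y - x))) \<partial>lborel)"
    proof (rule eLp_mono)
      show "AE y in lborel. ennreal (norm (c l m y)) \<le> (\<integral>\<^sup>+x. ennreal (norm (F l x * G m x)) * ennreal (norm (\<kappa> (y - x))) \<partial>lborel)"
        unfolding c_def conv_def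
        by (intro AE_I2 order_trans[OF ennreal_norm_integral_le]) (simp add: norm_mult ennreal_mult)
    qed measurable
    also have "\<dots> \<le> ennreal kM * eLp lborel p (\<lambda>x. ennreal (norm (F l x * G m x)))"
      by (rule eLp_conv[where k = "\<lambda>x. ennreal (norm (\<kappa> x))", OF _ _ p _ kM_pos]) (auto simp: \<kappa>_def kM_\<sigma>)
    also have "eLp lborel p (\<lambda>x. ennreal (norm (F l x * G m x))) \<le> \<alpha> l * \<beta> m"
      unfolding norm_mult ennreal_mult[OF norm_ge_zero norm_ge_zero] \<alpha>_def \<beta>_def Lp_norm_eq[OF F(1)] Lp_norm_eq[OF G(1)]
      by (rule eLp_product[OF _ _ p]) measurable
    finally show ?thesis using True by (simp add: mult_left_mono)
  next
    case False
    \<comment> \<open>For the vanishing terms the pieces are taken as convolutions of the bounded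
      densities, almost everywhere equal to \<open>F l\<close> and \<open>G m\<close>, since
      \<open>spectral_vanish\<close> speaks of such convolutions.\<close>
    have rF: "represents s (conv D (kern (\<sigma> l))) (freq_box \<rho> l f)"
      by (rule conv_\<sigma>_represents[OF mD D(2)]) (use D(1) in \<open>simp add: represents_def regular_functional_def\<close>)
    have rG: "represents s (conv E (kern (\<sigma> m))) (freq_box \<rho> m g)"
      by (rule conv_\<sigma>_represents[OF mE E(2)]) (use E(1) in \<open>simp add: represents_def regular_functional_def\<close>)
    have [measurable]: "conv D (kern (\<sigma> l)) \<in> borel_measurable borel" "conv E (kern (\<sigma> m)) \<in> borel_measurable borel"
      by (intro conv_measurable mD mE kern_\<sigma>_measurable)+
    have "c l m y = 0" for y
    proof -
      have "c l m y = (\<integral>x. conv D (kern (\<sigma> l)) x * (conv E (kern (\<sigma> m)) x * kern (\<sigma> k) (y - x)) \<partial>lborel)"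
        unfolding c_def conv_def[of "\<lambda>x. F l x * G m x"] \<kappa>_def
      proof (rule integral_cong_AE)
        show "AE x in lborel. F l x * G m x * kern (\<sigma> k) (y - x) = conv D (kern (\<sigma> l)) x * (conv E (kern (\<sigma> m)) x * kern (\<sigma> k) (y - x))"
          using represents_unique[OF F(1) rF] represents_unique[OF G(1) rG] by eventually_elim simp
      qed measurable
      also have "\<dots> = 0" by (rule spectral_vanish[OF mD D(2) mE E(2) False])
      finally show ?thesis .
    qed
    then show ?thesis using False eLp_zero[OF p] by simp
  qed
  have "Lp_norm s p (freq_box \<rho> k (pointwise_prod s f g)) = eLp lborel p (\<lambda>y. ennreal (norm (H y)))"
    by (rule Lp_norm_eq[OF rH])
  also have "\<dots> \<le> eLp lborel p (\<lambda>y. \<integral>\<^sup>+l. (\<integral>\<^sup>+m. ennreal (norm (c l m y)) \<partial>count_space UNIV) \<partial>count_space UNIV)"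
    using rH by (intro eLp_mono AE_I2 Hle) (auto simp: represents_def)
  also have "\<dots> \<le> (\<integral>\<^sup>+l. eLp lborel p (\<lambda>y. \<integral>\<^sup>+m. ennreal (norm (c l m y)) \<partial>count_space UNIV) \<partial>count_space UNIV)"
    by (rule eLp_minkowski[OF _ p], rule nn_integral_count_space_measurable) measurable
  also have "\<dots> \<le> (\<integral>\<^sup>+l. (\<integral>\<^sup>+m. eLp lborel p (\<lambda>y. ennreal (norm (c l m y))) \<partial>count_space UNIV) \<partial>count_space UNIV)"
    by (intro nn_integral_mono eLp_minkowski[OF _ p]) measurable
  also have "\<dots> \<le> (\<integral>\<^sup>+l. (\<integral>\<^sup>+m. (if k - l - m \<in> J3 then ennreal kM * (\<alpha> l * \<beta> m) else 0) \<partial>count_space UNIV) \<partial>count_space UNIV)"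
    by (intro nn_integral_mono c_le)
  \<comment> \<open>Substitution m = k - l - j turns the condition on m into
    \<open>j \<in> J3\<close>, leaving a finite sum over j.\<close>
  also have "\<dots> = (\<integral>\<^sup>+l. (\<Sum>j\<in>J3. ennreal kM * (\<alpha> l * \<beta> (k - j - l))) \<partial>count_space UNIV)"
  proof (intro nn_integral_cong)
    fix l
    have "(\<integral>\<^sup>+m. (if k - l - m \<in> J3 then ennreal kM * (\<alpha> l * \<beta> m) else 0) \<partial>count_space UNIV)
       = (\<integral>\<^sup>+j. (if k - l - (k - l - j) \<in> J3 then ennreal kM * (\<alpha> l * \<beta> (k - l - j)) else 0) \<partial>count_space UNIV)"
      by (rule nn_integral_bij_count_space[where g = "\<lambda>j. k - l - j", symmetric])
         (rule bij_betwI[where g = "\<lambda>j. k - l - j"]; simp)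
    also have "\<dots> = (\<integral>\<^sup>+j. (if j \<in> J3 then ennreal kM * (\<alpha> l * \<beta> (k - l - j)) else 0) \<partial>count_space UNIV)"
      by simp
    also have "\<dots> = (\<Sum>j\<in>J3. (if j \<in> J3 then ennreal kM * (\<alpha> l * \<beta> (k - l - j)) else 0))"
      by (rule nn_integral_count_space'[OF finite_J3]) auto
    also have "\<dots> = (\<Sum>j\<in>J3. ennreal kM * (\<alpha> l * \<beta> (k - j - l)))"
    proof (intro sum.cong refl)
      fix j :: "int^'n" assume "j \<in> J3"
      moreover have "k - l - j = k - j - l" by simp
      ultimately show "(if j \<in> J3 then ennreal kM * (\<alpha> l * \<beta> (k - l - j)) else 0) = ennreal kM * (\<alpha> l * \<beta> (k - j - l))"
        by (simp only: if_True)
    qed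
    finally show "(\<integral>\<^sup>+m. (if k - l - m \<in> J3 then ennreal kM * (\<alpha> l * \<beta> m) else 0) \<partial>count_space UNIV)
       = (\<Sum>j\<in>J3. ennreal kM * (\<alpha> l * \<beta> (k - j - l)))" .
  qed
  also have "\<dots> = ennreal kM * (\<Sum>j\<in>J3. \<integral>\<^sup>+l. \<alpha> l * \<beta> (k - j - l) \<partial>count_space UNIV)"
    by (simp add: nn_integral_sum nn_integral_cmult sum_distrib_left)
  finally show ?thesis unfolding \<alpha>_def \<beta>_def .
qed

end

section \<open>Linear structure, embedding and the final estimate\<close>

section \<open>The algebra property\<close>

lemma elq_sum:
  assumes p: "1 \<le> p" and "finite J"
  shows "elq p (\<lambda>k. \<Sum>j\<in>J. f j k) \<le> (\<Sum>j\<in>J. elq p (f j))"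
  using assms(2)
proof induction
  case empty
  then show ?case by (simp add: eLp_zero[OF p])
next
  case (insert j J)
  have "elq p (\<lambda>k. f j k + (\<Sum>j\<in>J. f j k)) \<le> elq p (f j) + elq p (\<lambda>k. \<Sum>j\<in>J. f j k)"
    by (rule eLp_add[OF _ _ p]) auto
  also have "\<dots> \<le> elq p (f j) + (\<Sum>j\<in>J. elq p (f j))" by (intro add_left_mono insert.IH)
  finally show ?case using insert by simp
qed

lemma gs_dual_hD:
  assumes "u \<in> gs_dual_h s h" "\<phi> \<in> gs_space_h s h"
  shows "\<psi> \<in> gs_space_h s h \<Longrightarrow> u (\<lambda>x. \<phi> x + \<psi> x) = u \<phi> + u \<psi>"
    and "u (\<lambda>x. c * \<phi> x) = c * u \<phi>"
  using assms unfolding gs_dual_h_def by simp_all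

text \<open>The definition admits a negative real C, which \<open>ennreal\<close> sends to 0; a
  nonnegative constant makes sums and products of constants compatible with
  \<open>ennreal\<close>.\<close>

lemma gs_dual_h_bound:
  assumes "u \<in> gs_dual_h s h"
  shows "\<exists>C\<ge>0. \<forall>\<phi>\<in>gs_space_h s h. ennreal (norm (u \<phi>)) \<le> ennreal C * gs_norm s h \<phi>"
proof -
  have "\<exists>C. \<forall>\<phi>\<in>gs_space_h s h. ennreal (norm (u \<phi>)) \<le> ennreal C * gs_norm s h \<phi>"
    using assms unfolding gs_dual_h_def by simp
  then obtain C where "\<forall>\<phi>\<in>gs_space_h s h. ennreal (norm (u \<phi>)) \<le> ennreal C * gs_norm s h \<phi>" ..
  moreover have "ennreal C * gs_norm s h \<phi> \<le> ennreal (max 0 C) * gs_norm s h \<phi>" for \<phi> :: "real^'a \<Rightarrow> complex"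
    by (intro mult_right_mono ennreal_leI) auto
  ultimately show ?thesis by (intro exI[of _ "max 0 C"]) (auto intro: order_trans)
qed

lemma gs_dual_plus:
  fixes u v :: "'n::finite functional"
  assumes u: "u \<in> gs_dual s" and v: "v \<in> gs_dual s"
  shows "(\<lambda>\<phi>. u \<phi> + v \<phi>) \<in> gs_dual s"
  unfolding gs_dual_def
proof (intro INT_I)
  fix h :: real assume h: "h \<in> {0<..}"
  have uh: "u \<in> gs_dual_h s h" and vh: "v \<in> gs_dual_h s h" using u v h by (auto simp: gs_dual_def)
  obtain C1 where C1: "C1 \<ge> 0" "\<forall>\<phi>\<in>gs_space_h s h. ennreal (norm (u \<phi>)) \<le> ennreal C1 * gs_norm s h \<phi>"
    using gs_dual_h_bound[OF uh] by blast
  obtain C2 where C2: "C2 \<ge> 0" "\<forall>\<phi>\<in>gs_space_h s h. ennreal (norm (v \<phi>)) \<le> ennreal C2 * gs_norm s h \<phi>"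
    using gs_dual_h_bound[OF vh] by blast
  show "(\<lambda>\<phi>. u \<phi> + v \<phi>) \<in> gs_dual_h s h"
    unfolding gs_dual_h_def
  proof (intro CollectI conjI ballI allI exI[of _ "C1 + C2"])
    fix \<phi> :: "real^'n \<Rightarrow> complex" assume \<phi>: "\<phi> \<in> gs_space_h s h"
    have "ennreal (norm (u \<phi> + v \<phi>)) \<le> ennreal (norm (u \<phi>)) + ennreal (norm (v \<phi>))"
      by (simp add: ennreal_plus[symmetric] norm_triangle_ineq ennreal_leI del: ennreal_plus)
    also have "\<dots> \<le> ennreal C1 * gs_norm s h \<phi> + ennreal C2 * gs_norm s h \<phi>"
      using C1(2) C2(2) \<phi> by (intro add_mono) auto
    also have "\<dots> = ennreal (C1 + C2) * gs_norm s h \<phi>"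
      using C1(1) C2(1) by (simp add: distrib_right)
    finally show "ennreal (norm (u \<phi> + v \<phi>)) \<le> ennreal (C1 + C2) * gs_norm s h \<phi>" .
  qed (simp_all add: gs_dual_hD[OF uh] gs_dual_hD[OF vh] distrib_left)
qed

lemma gs_dual_scale:
  fixes u :: "'n::finite functional"
  assumes u: "u \<in> gs_dual s"
  shows "(\<lambda>\<phi>. c * u \<phi>) \<in> gs_dual s"
  unfolding gs_dual_def
proof (intro INT_I)
  fix h :: real assume h: "h \<in> {0<..}"
  have uh: "u \<in> gs_dual_h s h" using u h by (auto simp: gs_dual_def)
  obtain C1 where C1: "C1 \<ge> 0" "\<forall>\<phi>\<in>gs_space_h s h. ennreal (norm (u \<phi>)) \<le> ennreal C1 * gs_norm s h \<phi>"
    using gs_dual_h_bound[OF uh] by blast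
  show "(\<lambda>\<phi>. c * u \<phi>) \<in> gs_dual_h s h"
    unfolding gs_dual_h_def
  proof (intro CollectI conjI ballI allI exI[of _ "norm c * C1"])
    fix \<phi> :: "real^'n \<Rightarrow> complex" assume \<phi>: "\<phi> \<in> gs_space_h s h"
    have "ennreal (norm (c * u \<phi>)) = ennreal (norm c) * ennreal (norm (u \<phi>))"
      by (simp add: norm_mult ennreal_mult)
    also have "\<dots> \<le> ennreal (norm c) * (ennreal C1 * gs_norm s h \<phi>)"
      using C1(2) \<phi> by (intro mult_left_mono) auto
    also have "\<dots> = ennreal (norm c * C1) * gs_norm s h \<phi>"
      using C1(1) by (simp add: ennreal_mult mult.assoc)
    finally show "ennreal (norm (c * u \<phi>)) \<le> ennreal (norm c * C1) * gs_norm s h \<phi>" .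
  qed (simp_all add: gs_dual_hD[OF uh] distrib_left mult.left_commute)
qed

lemma represents_plus:
  assumes "represents s F u" "represents s G v"
  shows "represents s (\<lambda>x. F x + G x) (\<lambda>\<phi>. u \<phi> + v \<phi>)"
  using assms unfolding represents_def regular_functional_def by (auto simp: distrib_right)

lemma represents_scale:
  assumes "represents s F u"
  shows "represents s (\<lambda>x. c * F x) (\<lambda>\<phi>. c * u \<phi>)"
  using assms unfolding represents_def regular_functional_def by (auto simp: mult.assoc)

context freq_decomp
begin

lemma Lp_norm_plus:
  fixes u v :: "'n functional"
  assumes p: "1 \<le> p"
  shows "Lp_norm s p (\<lambda>\<phi>. u \<phi> + v \<phi>) \<le> Lp_norm s p u + Lp_norm s p v"
proof (cases "Lp_norm s p u < \<infinity> \<and> Lp_norm s p v < \<infinity>")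
  case True
  then obtain F G where F: "represents s F u" and G: "represents s G v"
    using Lp_norm_finite_represents by metis
  have [measurable]: "F \<in> borel_measurable borel" "G \<in> borel_measurable borel"
    using F G by (auto simp: represents_def)
  have "Lp_norm s p (\<lambda>\<phi>. u \<phi> + v \<phi>) = eLp lborel p (\<lambda>x. ennreal (norm (F x + G x)))"
    by (rule Lp_norm_eq[OF represents_plus[OF F G]])
  also have "\<dots> \<le> eLp lborel p (\<lambda>x. ennreal (norm (F x)) + ennreal (norm (G x)))"
    by (rule eLp_mono) (auto simp: ennreal_plus[symmetric] norm_triangle_ineq ennreal_leI simp del: ennreal_plus)
  also have "\<dots> \<le> eLp lborel p (\<lambda>x. ennreal (norm (F x))) + eLp lborel p (\<lambda>x. ennreal (norm (G x)))"
    by (rule eLp_add[OF _ _ p]) measurable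
  finally show ?thesis by (simp add: Lp_norm_eq[OF F] Lp_norm_eq[OF G])
next
  case False
  then show ?thesis by (auto simp: less_top[symmetric])
qed

lemma Lp_norm_scale:
  fixes u :: "'n functional"
  assumes p: "1 \<le> p" and fin: "Lp_norm s p u < \<infinity>"
  shows "Lp_norm s p (\<lambda>\<phi>. c * u \<phi>) \<le> ennreal (norm c) * Lp_norm s p u"
proof -
  obtain F where F: "represents s F u" using Lp_norm_finite_represents[OF fin] .
  have [measurable]: "F \<in> borel_measurable borel" using F by (auto simp: represents_def)
  have "Lp_norm s p (\<lambda>\<phi>. c * u \<phi>) = eLp lborel p (\<lambda>x. ennreal (norm c) * ennreal (norm (F x)))"
    unfolding Lp_norm_eq[OF represents_scale[OF F]] by (simp add: norm_mult ennreal_mult)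
  also have "\<dots> \<le> ennreal (norm c) * eLp lborel p (\<lambda>x. ennreal (norm (F x)))"
    by (rule eLp_cmult[OF _ p]) measurable
  finally show ?thesis by (simp add: Lp_norm_eq[OF F])
qed

lemma freq_box_plus: "freq_box \<rho> k (\<lambda>\<phi>. u \<phi> + v \<phi>) = (\<lambda>\<phi>. freq_box \<rho> k u \<phi> + freq_box \<rho> k v \<phi>)"
  and freq_box_scale: "freq_box \<rho> k (\<lambda>\<phi>. c * u \<phi>) = (\<lambda>\<phi>. c * freq_box \<rho> k u \<phi>)"
  and freq_box_zero: "freq_box \<rho> k (\<lambda>\<phi>. 0) = (\<lambda>\<phi>. 0)"
  by (simp_all add: freq_box_eq fun_eq_iff)

lemma gm_space_plus:
  assumes p: "1 \<le> p" and q: "1 \<le> q" and u: "u \<in> gm_space \<rho> s p q" and v: "v \<in> gm_space \<rho> s p q"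
  shows "(\<lambda>\<phi>. u \<phi> + v \<phi>) \<in> gm_space \<rho> s p q"
proof -
  have "gm_norm \<rho> s p q (\<lambda>\<phi>. u \<phi> + v \<phi>) \<le>
      elq q (\<lambda>k. ennreal (exp (wt k)) * Lp_norm s p (freq_box \<rho> k u) + ennreal (exp (wt k)) * Lp_norm s p (freq_box \<rho> k v))"
    unfolding gm_norm_eq[OF q] freq_box_plus distrib_left[symmetric]
    by (intro elq_mono mult_left_mono Lp_norm_plus p) auto
  also have "\<dots> \<le> gm_norm \<rho> s p q u + gm_norm \<rho> s p q v"
    unfolding gm_norm_eq[OF q] by (rule eLp_add[OF _ _ q]) auto
  also have "\<dots> < \<infinity>" using u v by (simp add: gm_space_def)
  finally show ?thesis using u v by (simp add: gm_space_def gs_dual_plus)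
qed

lemma gm_space_component_finite:
  assumes q: "1 \<le> q" and u: "u \<in> gm_space \<rho> s p q"
  shows "Lp_norm s p (freq_box \<rho> k u) < \<infinity>"
proof (rule le_less_trans[OF component_le_gm_norm[OF q]])
  show "w k * gm_norm \<rho> s p q u < \<infinity>" using u by (simp add: gm_space_def w_def ennreal_mult_less_top)
qed

lemma gm_space_scale:
  assumes p: "1 \<le> p" and q: "1 \<le> q" and u: "u \<in> gm_space \<rho> s p q"
  shows "(\<lambda>\<phi>. c * u \<phi>) \<in> gm_space \<rho> s p q"
proof -
  have "gm_norm \<rho> s p q (\<lambda>\<phi>. c * u \<phi>) \<le>
      elq q (\<lambda>k. ennreal (norm c) * (ennreal (exp (wt k)) * Lp_norm s p (freq_box \<rho> k u)))"
    unfolding gm_norm_eq[OF q] freq_box_scale mult.left_commute[of "ennreal (norm c)"]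
    by (intro elq_mono mult_left_mono Lp_norm_scale p gm_space_component_finite[OF q u]) auto
  also have "\<dots> \<le> ennreal (norm c) * gm_norm \<rho> s p q u"
    unfolding gm_norm_eq[OF q] by (rule eLp_cmult[OF _ q]) auto
  also have "\<dots> < \<infinity>" using u by (simp add: gm_space_def ennreal_mult_less_top)
  finally show ?thesis using u by (simp add: gm_space_def gs_dual_scale)
qed

lemma gm_space_zero:
  assumes p: "1 \<le> p" and q: "1 \<le> q"
  shows "(\<lambda>\<phi>. 0) \<in> gm_space \<rho> s p q"
proof -
  have "represents s (\<lambda>x :: real^'n. 0) (\<lambda>\<phi>. 0)" by (simp add: represents_def regular_functional_def)
  from Lp_norm_eq[OF this] have "Lp_norm s p (freq_box \<rho> k (\<lambda>\<phi>. 0)) = 0" for k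
    by (simp add: freq_box_zero eLp_zero[OF p])
  then have "gm_norm \<rho> s p q (\<lambda>\<phi>. 0) = 0" by (simp add: gm_norm_eq[OF q] eLp_zero[OF q])
  moreover have "(\<lambda>\<phi>. 0 :: complex) \<in> (gs_dual s :: 'n functional set)"
    by (auto simp: gs_dual_def gs_dual_h_def)
  ultimately show ?thesis by (simp add: gm_space_def)
qed

text \<open>Bernstein bounds D by kM A, hence |D|^(2P) \<le> (kM A)^P |D|^P. The constant 1 + kM
  avoids a square root, as its square dominates kM, and it covers p = \<infinity> too.\<close>

lemma Lp_norm_double:
  assumes p: "1 \<le> p"
  shows "Lp_norm s (2 * p) (freq_box \<rho> l u) \<le> ennreal (1 + kM) * Lp_norm s p (freq_box \<rho> l u)"
proof (cases "Lp_norm s p (freq_box \<rho> l u) < \<infinity>")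
  case False
  then have "ennreal (1 + kM) * Lp_norm s p (freq_box \<rho> l u) = \<top>"
    using kM_pos by (simp add: less_top[symmetric] ennreal_mult_top)
  then show ?thesis by simp
next
  case True
  define A where "A = Lp_norm s p (freq_box \<rho> l u)"
  obtain D where D: "represents s D (freq_box \<rho> l u)" and b: "\<And>y. ennreal (norm (D y)) \<le> ennreal kM * A"
    using bernstein[OF p True] unfolding A_def by blast
  have [measurable]: "D \<in> borel_measurable borel" using D by (simp add: represents_def)
  have A: "A = eLp lborel p (\<lambda>x. ennreal (norm (D x)))" unfolding A_def by (rule Lp_norm_eq[OF D])
  have kM1: "ennreal kM \<le> ennreal (1 + kM)" "1 \<le> ennreal (1 + kM)"
    using kM_pos ennreal_leI[of 1 "1 + kM"] by (auto intro: ennreal_leI)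
  show ?thesis
  proof (cases "p = \<infinity>")
    case inf: True
    have "2 * p = p" using inf by (simp add: ennreal_mult_top)
    then show ?thesis using mult_right_mono[OF kM1(2), of "Lp_norm s p (freq_box \<rho> l u)"] by simp
  next
    case fin: False
    define P where "P = enn2real p"
    have P: "1 \<le> P" using enn2real_ge_1[OF p fin] by (simp add: P_def)
    have p2: "2 * p \<noteq> \<infinity>" using fin by (simp add: ennreal_mult_eq_top_iff)
    have P2: "enn2real (2 * p) = 2 * P" by (simp add: enn2real_mult P_def)
    have "(\<integral>\<^sup>+x. ennreal_powr (ennreal (norm (D x))) (2 * P) \<partial>lborel)
       = (\<integral>\<^sup>+x. ennreal_powr (ennreal (norm (D x)) * ennreal (norm (D x))) P \<partial>lborel)"
      using P by (simp add: ennreal_powr_mult power2_eq_square[symmetric] ennreal_powr_two ennreal_powr_powr mult.commute)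
    also have "\<dots> \<le> (\<integral>\<^sup>+x. ennreal_powr (ennreal kM * A) P * ennreal_powr (ennreal (norm (D x))) P \<partial>lborel)"
      using P by (intro nn_integral_mono) (auto simp: ennreal_powr_mult[symmetric] intro!: ennreal_powr_mono mult_right_mono b)
    also have "\<dots> = ennreal_powr (ennreal kM * A) P * ennreal_powr A P"
      unfolding A P_def eLp_powr[OF p fin] by (rule nn_integral_cmult) measurable
    also have "\<dots> = ennreal_powr (ennreal kM * A * A) P" using P by (simp add: ennreal_powr_mult)
    also have "\<dots> \<le> ennreal_powr (ennreal (1 + kM) * A * (ennreal (1 + kM) * A)) P"
      using P kM1 mult_right_mono[OF kM1(2), of A] by (intro ennreal_powr_mono mult_mono) auto
    also have "\<dots> = ennreal_powr (ennreal (1 + kM) * A) (2 * P)"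
      by (simp only: power2_eq_square[symmetric] ennreal_powr_two ennreal_powr_powr)
    finally show ?thesis
      unfolding Lp_norm_eq[OF D, of "2 * p"] A_def[symmetric]
      by (simp only: eLp_le_iff[OF two_p[OF p] p2] P2)
  qed
qed

lemma gm_norm_double:
  assumes p: "1 \<le> p" and q: "1 \<le> q"
  shows "gm_norm \<rho> s (2 * p) q u \<le> ennreal (1 + kM) * gm_norm \<rho> s p q u"
proof -
  have "gm_norm \<rho> s (2 * p) q u \<le> elq q (\<lambda>k. ennreal (1 + kM) * (ennreal (exp (wt k)) * Lp_norm s p (freq_box \<rho> k u)))"
    unfolding gm_norm_eq[OF q] mult.left_commute[of "ennreal (1 + kM)"]
    by (intro elq_mono mult_left_mono Lp_norm_double p) auto
  also have "\<dots> \<le> ennreal (1 + kM) * gm_norm \<rho> s p q u"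
    unfolding gm_norm_eq[OF q] by (rule eLp_cmult[OF _ q]) auto
  finally show ?thesis .
qed

lemma gm_space_double:
  assumes p: "1 \<le> p" and q: "1 \<le> q" and u: "u \<in> gm_space \<rho> s p q"
  shows "u \<in> gm_space \<rho> s (2 * p) q"
proof -
  have "ennreal (1 + kM) * gm_norm \<rho> s p q u < \<infinity>" using u by (simp add: gm_space_def ennreal_mult_less_top)
  then show ?thesis using le_less_trans[OF gm_norm_double[OF p q]] u by (simp add: gm_space_def)
qed

text \<open>kM comes from the convolution with the outer kernel, 2 exp (wt j) from splitting off the
  shift j, and 2 Wtot from the two halves of \<open>exp_wt_add\<close>, each costing the sum of
  \<open>w\<close>. The summand 1 ensures positivity.\<close>

definition Cprod :: real where
  "Cprod = kM * ((\<Sum>j\<in>J3. 2 * exp (wt j)) * (2 * Wtot)) + 1"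

lemma Wtot_nonneg: "0 \<le> Wtot"
  by (simp add: Wtot_def)

lemma Cprod_pos: "0 < Cprod"
proof -
  have "0 \<le> kM * ((\<Sum>j\<in>J3. 2 * exp (wt j)) * (2 * Wtot))"
    using kM_pos Wtot_nonneg by (intro mult_nonneg_nonneg sum_nonneg) auto
  then show ?thesis unfolding Cprod_def by linarith
qed

text \<open>Each half of \<open>exp_wt_add\<close> puts \<open>w\<close> on one index. The sequence
  on that index is bounded termwise by its norm while \<open>w\<close> supplies summability, so an
  l^1 by l^q convolution with the other sequence remains, for every q.\<close>

lemma gm_norm_product:
  assumes f: "f \<in> gm_space \<rho> s (2 * p) q" and g: "g \<in> gm_space \<rho> s (2 * p) q" and p: "1 \<le> p" and q: "1 \<le> q"
  shows "gm_norm \<rho> s p q (pointwise_prod s f g) \<le> ennreal Cprod * gm_norm \<rho> s (2 * p) q f * gm_norm \<rho> s (2 * p) q g"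
proof -
  define \<alpha> where "\<alpha> l = Lp_norm s (2 * p) (freq_box \<rho> l f)" for l
  define \<beta> where "\<beta> l = Lp_norm s (2 * p) (freq_box \<rho> l g)" for l
  define A where "A l = ennreal (exp (wt l)) * \<alpha> l" for l
  define B where "B l = ennreal (exp (wt l)) * \<beta> l" for l
  define NA where "NA = gm_norm \<rho> s (2 * p) q f"
  define NB where "NB = gm_norm \<rho> s (2 * p) q g"
  have NA: "NA = elq q A" and NB: "NB = elq q B"
    by (simp_all add: NA_def NB_def gm_norm_eq[OF q] A_def[abs_def] B_def[abs_def] \<alpha>_def \<beta>_def)
  have AN: "A l \<le> NA" and BN: "B l \<le> NB" for l unfolding NA NB by (rule elq_point[OF q])+
  define X where "X j k = (\<integral>\<^sup>+l. w l * B (k - j - l) \<partial>count_space UNIV)" for j k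
  define Y where "Y j k = (\<integral>\<^sup>+l. w l * A (k - j - l) \<partial>count_space UNIV)" for j k
  define c where "c j = ennreal (2 * exp (wt j))" for j
  have W: "ennreal (exp (wt (j + (l + m)))) * (\<alpha> l * \<beta> m) \<le> c j * (NA * (w l * B m) + NB * (w m * A l))" for j l m
  proof -
    \<comment> \<open>The shift j is split off crudely; the gain is kept for the two summation
      indices.\<close>
    have "exp (wt (j + (l + m))) \<le> 2 * exp (wt j) * (exp (wt l) * exp (wt m) * (exp (- (\<delta> * wt l)) + exp (- (\<delta> * wt m))))"
      by (rule order_trans[OF exp_wt_sub]) (intro mult_left_mono exp_wt_add; simp)
    then have "ennreal (exp (wt (j + (l + m)))) \<le> c j * (ennreal (exp (wt l)) * ennreal (exp (wt m)) * (w l + w m))"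
      by (simp add: c_def w_def ennreal_mult[symmetric] ennreal_plus[symmetric] ennreal_leI del: ennreal_plus)
    then have "ennreal (exp (wt (j + (l + m)))) * (\<alpha> l * \<beta> m)
        \<le> c j * (ennreal (exp (wt l)) * ennreal (exp (wt m)) * (w l + w m)) * (\<alpha> l * \<beta> m)"
      by (rule mult_right_mono) simp
    also have "\<dots> = c j * (A l * (w l * B m) + B m * (w m * A l))"
      by (simp add: A_def B_def distrib_left distrib_right mult_ac)
    also have "\<dots> \<le> c j * (NA * (w l * B m) + NB * (w m * A l))"
      by (intro mult_left_mono add_mono mult_right_mono AN BN) auto
    finally show ?thesis .
  qed
  have comp: "ennreal (exp (wt k)) * Lp_norm s p (freq_box \<rho> k (pointwise_prod s f g))
      \<le> ennreal kM * (\<Sum>j\<in>J3. c j * (NA * X j k + NB * Y j k))" for k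
  proof -
    have "ennreal (exp (wt k)) * Lp_norm s p (freq_box \<rho> k (pointwise_prod s f g))
      \<le> ennreal (exp (wt k)) * (ennreal kM * (\<Sum>j\<in>J3. \<integral>\<^sup>+l. \<alpha> l * \<beta> (k - j - l) \<partial>count_space UNIV))"
      unfolding \<alpha>_def \<beta>_def by (intro mult_left_mono product_component[OF f g p q]) simp
    also have "\<dots> = ennreal kM * (\<Sum>j\<in>J3. \<integral>\<^sup>+l. ennreal (exp (wt k)) * (\<alpha> l * \<beta> (k - j - l)) \<partial>count_space UNIV)"
      by (simp add: nn_integral_cmult sum_distrib_left mult.left_commute[of "ennreal (exp (wt k))" "ennreal kM"])
    also have "\<dots> \<le> ennreal kM * (\<Sum>j\<in>J3. c j * (NA * X j k + NB * Y j k))"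
    proof (intro mult_left_mono sum_mono)
      fix j :: "int^'n"
      have "(\<integral>\<^sup>+l. ennreal (exp (wt k)) * (\<alpha> l * \<beta> (k - j - l)) \<partial>count_space UNIV)
         \<le> (\<integral>\<^sup>+l. c j * (NA * (w l * B (k - j - l)) + NB * (w (k - j - l) * A l)) \<partial>count_space UNIV)"
      proof (rule nn_integral_mono)
        fix l show "ennreal (exp (wt k)) * (\<alpha> l * \<beta> (k - j - l)) \<le> c j * (NA * (w l * B (k - j - l)) + NB * (w (k - j - l) * A l))"
          using W[of j l "k - j - l"] by simp
      qed
      also have "\<dots> = c j * (NA * X j k + NB * (\<integral>\<^sup>+l. w (k - j - l) * A l \<partial>count_space UNIV))"
        unfolding X_def by (simp add: nn_integral_cmult nn_integral_add)
      \<comment> \<open>Reflecting l to k - j - l gives the second half the shape required by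
        \<open>elq_young\<close>.\<close>
      also have "(\<integral>\<^sup>+l. w (k - j - l) * A l \<partial>count_space UNIV) = Y j k"
      proof -
        have "(\<integral>\<^sup>+l. (\<lambda>l. w (k - j - l) * A l) (k - j - l) \<partial>count_space UNIV) = (\<integral>\<^sup>+l. w (k - j - l) * A l \<partial>count_space UNIV)"
          by (rule nn_integral_bij_count_space[where g = "\<lambda>l. k - j - l"])
             (rule bij_betwI[where g = "\<lambda>l. k - j - l"]; simp)
        then show ?thesis by (simp add: Y_def)
      qed
      finally show "(\<integral>\<^sup>+l. ennreal (exp (wt k)) * (\<alpha> l * \<beta> (k - j - l)) \<partial>count_space UNIV) \<le> c j * (NA * X j k + NB * Y j k)" .
    qed simp
    finally show ?thesis .
  qed
  have XY: "elq q (X j) \<le> ennreal Wtot * NB" "elq q (Y j) \<le> ennreal Wtot * NA" for j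
    unfolding X_def[abs_def] Y_def[abs_def] NA NB w_summable[symmetric] by (rule elq_young[OF q])+
  have "gm_norm \<rho> s p q (pointwise_prod s f g) \<le> elq q (\<lambda>k. ennreal kM * (\<Sum>j\<in>J3. c j * (NA * X j k + NB * Y j k)))"
    unfolding gm_norm_eq[OF q] by (intro elq_mono comp)
  also have "\<dots> \<le> ennreal kM * elq q (\<lambda>k. \<Sum>j\<in>J3. c j * (NA * X j k + NB * Y j k))"
    by (rule eLp_cmult[OF _ q]) simp
  also have "\<dots> \<le> ennreal kM * (\<Sum>j\<in>J3. elq q (\<lambda>k. c j * (NA * X j k + NB * Y j k)))"
    by (intro mult_left_mono elq_sum q finite_J3) simp
  also have "\<dots> \<le> ennreal kM * (\<Sum>j\<in>J3. c j * (2 * ennreal Wtot * (NA * NB)))"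
  proof (intro mult_left_mono sum_mono)
    fix j
    have "elq q (\<lambda>k. c j * (NA * X j k + NB * Y j k)) \<le> c j * elq q (\<lambda>k. NA * X j k + NB * Y j k)"
      by (rule eLp_cmult[OF _ q]) simp
    also have "\<dots> \<le> c j * (elq q (\<lambda>k. NA * X j k) + elq q (\<lambda>k. NB * Y j k))"
      by (intro mult_left_mono eLp_add q) auto
    also have "\<dots> \<le> c j * (NA * elq q (X j) + NB * elq q (Y j))"
      by (intro mult_left_mono add_mono eLp_cmult q) auto
    also have "\<dots> \<le> c j * (NA * (ennreal Wtot * NB) + NB * (ennreal Wtot * NA))"
      by (intro mult_left_mono add_mono XY) auto
    also have "\<dots> = c j * (2 * ennreal Wtot * (NA * NB))" by (simp add: mult_2[symmetric] mult_ac)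
    finally show "elq q (\<lambda>k. c j * (NA * X j k + NB * Y j k)) \<le> c j * (2 * ennreal Wtot * (NA * NB))" .
  qed simp
  also have "\<dots> = ennreal (kM * ((\<Sum>j\<in>(J3 :: (int^'n) set). 2 * exp (wt j)) * (2 * Wtot))) * (NA * NB)"
  proof -
    have "(\<Sum>j\<in>J3. c j * (2 * ennreal Wtot * (NA * NB))) = (\<Sum>j\<in>J3. c j) * (2 * ennreal Wtot * (NA * NB))"
      by (rule sum_distrib_right[symmetric])
    also have "(\<Sum>j\<in>J3. c j) = ennreal (\<Sum>j\<in>(J3 :: (int^'n) set). 2 * exp (wt j))"
      unfolding c_def by (rule sum_ennreal) simp
    also have "2 * ennreal Wtot = ennreal (2 * Wtot)"
      using Wtot_nonneg by (simp add: ennreal_mult)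
    finally show ?thesis
      using kM_pos Wtot_nonneg by (simp add: ennreal_mult sum_nonneg mult.assoc)
  qed
  also have "\<dots> \<le> ennreal Cprod * (NA * NB)"
    unfolding Cprod_def by (intro mult_right_mono ennreal_leI) auto
  finally show ?thesis by (simp add: NA_def NB_def mult.assoc)
qed

lemma gm_space_product:
  assumes f: "f \<in> gm_space \<rho> s (2 * p) q" and g: "g \<in> gm_space \<rho> s (2 * p) q" and p: "1 \<le> p" and q: "1 \<le> q"
  shows "pointwise_prod s f g \<in> gm_space \<rho> s p q"
proof -
  note p2 = two_p[OF p]
  obtain BD where D: "\<And>x. norm (density_fun s f x) \<le> BD" using density_fun_gm(2)[OF f p2 q] by blast
  obtain BE where E: "\<And>x. norm (density_fun s g x) \<le> BE" using density_fun_gm(2)[OF g p2 q] by blast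
  have m: "density_fun s f \<in> borel_measurable borel" "density_fun s g \<in> borel_measurable borel"
    using density_fun_gm(1)[OF f p2 q] density_fun_gm(1)[OF g p2 q] by (auto simp: represents_def)
  have "norm (density_fun s f x * density_fun s g x) \<le> BD * BE" for x
    unfolding norm_mult using D[of x] E[of x] norm_ge_zero order_trans by (intro mult_mono) blast+
  then have "pointwise_prod s f g \<in> gs_dual s"
    unfolding pointwise_prod_def using m by (intro regular_functional_gs_dual) auto
  moreover have "ennreal Cprod * gm_norm \<rho> s (2 * p) q f * gm_norm \<rho> s (2 * p) q g < \<infinity>"
    using f g by (simp add: gm_space_def ennreal_mult_less_top)
  ultimately show ?thesis
    using le_less_trans[OF gm_norm_product[OF f g p q]] by (simp add: gm_space_def)
qed

text \<open>One embedding from exponent p into 2 p per factor, hence the square of 1 + kM.\<close>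

lemma gm_norm_algebra:
  assumes f: "f \<in> gm_space \<rho> s p q" and g: "g \<in> gm_space \<rho> s p q" and p: "1 \<le> p" and q: "1 \<le> q"
  shows "gm_norm \<rho> s p q (pointwise_prod s f g) \<le> ennreal (Cprod * (1 + kM)\<^sup>2) * gm_norm \<rho> s p q f * gm_norm \<rho> s p q g"
proof -
  have "gm_norm \<rho> s p q (pointwise_prod s f g) \<le> ennreal Cprod * gm_norm \<rho> s (2 * p) q f * gm_norm \<rho> s (2 * p) q g"
    by (rule gm_norm_product[OF gm_space_double[OF p q f] gm_space_double[OF p q g] p q])
  also have "\<dots> \<le> ennreal Cprod * (ennreal (1 + kM) * gm_norm \<rho> s p q f) * (ennreal (1 + kM) * gm_norm \<rho> s p q g)"
    by (intro mult_mono gm_norm_double p q) auto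
  also have "\<dots> = ennreal (Cprod * (1 + kM)\<^sup>2) * gm_norm \<rho> s p q f * gm_norm \<rho> s p q g"
    using kM_pos Cprod_pos by (simp add: ennreal_mult power2_eq_square mult_ac del: ennreal_plus)
  finally show ?thesis .
qed

end

text \<open>The constants are \<open>Cprod\<close> and \<open>Cprod * (1 + kM)\<^sup>2\<close>,
  built from \<rho> and s alone and hence the same for all f, g and even all p, q. The algebra
  property is rendered as a linear subspace closed under products, with a norm bound.\<close>

theorem theorem3p12:
  fixes \<rho> :: "real^'n::finite \<Rightarrow> real" and s :: real and p q :: ennreal
  assumes "1 \<le> p" and "1 \<le> q" and "1 < s" and "freq_uniform s \<rho>"
  shows "(\<exists>C::real. C > 0 \<and>
            (\<forall>f \<in> gm_space \<rho> s (2 * p) q. \<forall>g \<in> gm_space \<rho> s (2 * p) q.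
               pointwise_prod s f g \<in> gm_space \<rho> s p q \<and>
               gm_norm \<rho> s p q (pointwise_prod s f g)
                 \<le> ennreal C * gm_norm \<rho> s (2 * p) q f * gm_norm \<rho> s (2 * p) q g))
       \<and> ((\<lambda>\<phi>. 0) \<in> gm_space \<rho> s p q
          \<and> (\<forall>f \<in> gm_space \<rho> s p q. \<forall>g \<in> gm_space \<rho> s p q.
               (\<lambda>\<phi>. f \<phi> + g \<phi>) \<in> gm_space \<rho> s p q)
          \<and> (\<forall>c. \<forall>f \<in> gm_space \<rho> s p q. (\<lambda>\<phi>. c * f \<phi>) \<in> gm_space \<rho> s p q)
          \<and> (\<exists>C::real. C > 0 \<and>
               (\<forall>f \<in> gm_space \<rho> s p q. \<forall>g \<in> gm_space \<rho> s p q.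
                  pointwise_prod s f g \<in> gm_space \<rho> s p q \<and>
                  gm_norm \<rho> s p q (pointwise_prod s f g)
                    \<le> ennreal C * gm_norm \<rho> s p q f * gm_norm \<rho> s p q g)))"
proof -
  interpret freq_decomp \<rho> s by unfold_locales (use assms in auto)
  note pq = assms(1,2)
  have C2: "0 < Cprod * (1 + kM)\<^sup>2" using Cprod_pos kM_pos by (intro mult_pos_pos zero_less_power) auto
  show ?thesis
  proof (intro conjI ballI allI)
    show "\<exists>C::real. C > 0 \<and> (\<forall>f \<in> gm_space \<rho> s (2 * p) q. \<forall>g \<in> gm_space \<rho> s (2 * p) q.
        pointwise_prod s f g \<in> gm_space \<rho> s p q \<and> gm_norm \<rho> s p q (pointwise_prod s f g)
          \<le> ennreal C * gm_norm \<rho> s (2 * p) q f * gm_norm \<rho> s (2 * p) q g)"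
      using Cprod_pos gm_space_product[OF _ _ pq] gm_norm_product[OF _ _ pq] by blast
    show "\<exists>C::real. C > 0 \<and> (\<forall>f \<in> gm_space \<rho> s p q. \<forall>g \<in> gm_space \<rho> s p q.
        pointwise_prod s f g \<in> gm_space \<rho> s p q \<and> gm_norm \<rho> s p q (pointwise_prod s f g)
          \<le> ennreal C * gm_norm \<rho> s p q f * gm_norm \<rho> s p q g)"
      using C2 gm_space_product[OF gm_space_double[OF pq] gm_space_double[OF pq] pq] gm_norm_algebra[OF _ _ pq] by blast
  qed (use gm_space_zero[OF pq] gm_space_plus[OF pq] gm_space_scale[OF pq] in auto)
qed

end
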